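(* Let $1<p<\infty$ and let $m\in\mathbb N$ be such that $m<p\le m+1$. Then for every $H\in\mathcal S^p$ with $\|H\|_p\le 1$ there exist bounded symmetric polylinear forms $$\delta^{(1)}_H:\mathcal S^p\to\mathbb R,\quad \delta^{(2)}_H:\mathcal S^p\times\mathcal S^p\to\mathbb R,\quad\ldots,\quad \delta^{(m)}_H:\underbrace{\mathcal S^p\times\cdots\times\mathcal S^p}_{m\text{ times}}\to\mathbb R$$ such that $$\|H+V\|_p^p-\|H\|_p^p-\sum_{k=1}^m\delta^{(k)}_H(\underbrace{V,\ldots,V}_{k\text{ times}})=O(\|V\|_p^p),$$ where $V\in\mathcal S^p$ and $\|V\|_p\to 0$.
   Context: $\mathcal S^p$ is the Schatten-von Neumann class of compact operators on an arbitrary complex Hilbert space $\mathcal H$ with norm $\|X\|_p=(\operatorname{tr}|X|^p)^{1/p}$, regarded as a Banach space over the field of real numbers (so polylinear means multilinear over $\mathbb R$). *)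

theory Defs
  imports "HOL-Analysis.Analysis" "HOL-Library.Landau_Symbols" "HOL-Combinatorics.Permutations"
begin

section \<open>Complex Hilbert spaces\<close>

text \<open>The norm, metric and topology are those of the underlying real inner product space, whose
  inner product is the real part of the complex one. The complex inner product is linear in
  its first argument. The dimension is arbitrary; neither separability nor nontriviality is
  assumed.\<close>

class complex_hilbert_space = real_inner + complete_space +
  fixes scaleC :: "complex \<Rightarrow> 'a \<Rightarrow> 'a"
    and cinner :: "'a \<Rightarrow> 'a \<Rightarrow> complex"
  assumes scaleC_add_right: "scaleC c (x + y) = scaleC c x + scaleC c y"
    and scaleC_add_left: "scaleC (c + d) x = scaleC c x + scaleC d x"
    and scaleC_scaleC: "scaleC c (scaleC d x) = scaleC (c * d) x"
    and scaleC_of_real: "scaleC (complex_of_real r) x = scaleR r x"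
    and cinner_commute: "cinner x y = cnj (cinner y x)"
    and cinner_add_left: "cinner (x + y) z = cinner x z + cinner y z"
    and cinner_scaleC_left: "cinner (scaleC c x) y = c * cinner x y"
    and Re_cinner: "Re (cinner x y) = inner x y"

instantiation complex :: complex_hilbert_space
begin

definition scaleC_complex :: "complex \<Rightarrow> complex \<Rightarrow> complex"
  where "scaleC_complex c x = c * x"

definition cinner_complex :: "complex \<Rightarrow> complex \<Rightarrow> complex"
  where "cinner_complex x y = x * cnj y"

instance
  by standard
    (auto simp: scaleC_complex_def cinner_complex_def inner_complex_def algebra_simps
      scaleR_conv_of_real)

end

text \<open>Operators are elements of the real normed space \<open>'a \<Rightarrow>\<^sub>L 'a\<close> of bounded real-linear maps;
  complex linearity is the following additional requirement.\<close>

definition clinear_op :: "('a::complex_hilbert_space \<Rightarrow>\<^sub>L 'a) \<Rightarrow> bool"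
  where "clinear_op X \<longleftrightarrow> (\<forall>c x. X (scaleC c x) = scaleC c (X x))"

definition compact_op :: "('a::complex_hilbert_space \<Rightarrow>\<^sub>L 'a) \<Rightarrow> bool"
  where "compact_op X \<longleftrightarrow> clinear_op X \<and> compact (closure (blinfun_apply X ` cball 0 1))"

definition cadjoint :: "('a::complex_hilbert_space \<Rightarrow>\<^sub>L 'a) \<Rightarrow> ('a \<Rightarrow>\<^sub>L 'a)"
  where "cadjoint X = (THE Y :: 'a \<Rightarrow>\<^sub>L 'a. \<forall>x y. cinner (X x) y = cinner x (Y y))"

definition positive_op :: "('a::complex_hilbert_space \<Rightarrow>\<^sub>L 'a) \<Rightarrow> bool"
  where "positive_op A \<longleftrightarrow>
    clinear_op A \<and> (\<forall>x. cinner (A x) x \<in> \<real> \<and> Re (cinner (A x) x) \<ge> 0)"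

text \<open>The modulus \<open>|X| = (X\<^sup>* X)\<^sup>1\<^sup>/\<^sup>2\<close>, by uniqueness of the positive square root.\<close>

definition modulus_op :: "('a::complex_hilbert_space \<Rightarrow>\<^sub>L 'a) \<Rightarrow> ('a \<Rightarrow>\<^sub>L 'a)"
  where "modulus_op X = (THE A. positive_op A \<and> A o\<^sub>L A = cadjoint X o\<^sub>L X)"

text \<open>Functional calculus for a compact positive operator \<open>A\<close>: by the spectral theorem the
  eigenvectors of \<open>A\<close> span a dense subspace, so \<open>A\<^sup>p\<close> (for \<open>p > 0\<close>) is the unique bounded
  operator acting as the scalar \<open>l powr p\<close> on each eigenspace \<open>ker (A - l)\<close>, including \<open>ker A\<close>,
  where \<open>0 powr p = 0\<close>. It is meant only for compact positive \<open>A\<close>.\<close>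

definition powr_op :: "('a::complex_hilbert_space \<Rightarrow>\<^sub>L 'a) \<Rightarrow> real \<Rightarrow> ('a \<Rightarrow>\<^sub>L 'a)"
  where "powr_op A p = (THE B. clinear_op B \<and>
    (\<forall>l\<ge>0. \<forall>x. A x = scaleR l x \<longrightarrow> B x = scaleR (l powr p) x))"

definition orthonormal_basis :: "'a::complex_hilbert_space set \<Rightarrow> bool"
  where "orthonormal_basis E \<longleftrightarrow>
    (\<forall>e\<in>E. cinner e e = 1) \<and> (\<forall>e\<in>E. \<forall>f\<in>E. e \<noteq> f \<longrightarrow> cinner e f = 0) \<and>
    (\<forall>x. (\<forall>e\<in>E. cinner x e = 0) \<longrightarrow> x = 0)"

text \<open>The trace of a positive operator, possibly infinite; it does not depend on the basis.\<close>

definition trace_op :: "('a::complex_hilbert_space \<Rightarrow>\<^sub>L 'a) \<Rightarrow> ennreal"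
  where "trace_op A =
    (\<Sum>\<^sub>\<infinity>e\<in>(SOME E. orthonormal_basis E). ennreal (Re (cinner (A e) e)))"


section \<open>Schatten--von Neumann classes\<close>

definition schatten :: "real \<Rightarrow> ('a::complex_hilbert_space \<Rightarrow>\<^sub>L 'a) set"
  where "schatten p = {X. compact_op X \<and> trace_op (powr_op (modulus_op X) p) < \<infinity>}"

definition schatten_norm :: "real \<Rightarrow> ('a::complex_hilbert_space \<Rightarrow>\<^sub>L 'a) \<Rightarrow> real"
  where "schatten_norm p X = enn2real (trace_op (powr_op (modulus_op X) p)) powr (1 / p)"

definition schatten_at_0 :: "real \<Rightarrow> ('a::complex_hilbert_space \<Rightarrow>\<^sub>L 'a) filter"
  where "schatten_at_0 p =
    inf (principal (schatten p)) (filtercomap (schatten_norm p) (nhds 0))"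


section \<open>Polylinear forms\<close>

text \<open>The \<open>k\<close>-fold Cartesian power of the Schatten class is represented by lists of length \<open>k\<close>;
  the values of a form on other lists are irrelevant. Linearity is over the reals.\<close>

definition schatten_tuples :: "real \<Rightarrow> nat \<Rightarrow> ('a::complex_hilbert_space \<Rightarrow>\<^sub>L 'a) list set"
  where "schatten_tuples p k = {Xs. length Xs = k \<and> set Xs \<subseteq> schatten p}"

definition polylinear_form ::
    "real \<Rightarrow> nat \<Rightarrow> (('a::complex_hilbert_space \<Rightarrow>\<^sub>L 'a) list \<Rightarrow> real) \<Rightarrow> bool"
  where "polylinear_form p k d \<longleftrightarrow>
    (\<forall>Xs\<in>schatten_tuples p k. \<forall>i<k. \<forall>X\<in>schatten p. \<forall>Y\<in>schatten p. \<forall>c::real.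
      d (Xs[i := X + Y]) = d (Xs[i := X]) + d (Xs[i := Y]) \<and>
      d (Xs[i := c *\<^sub>R X]) = c * d (Xs[i := X]))"

definition symmetric_form ::
    "real \<Rightarrow> nat \<Rightarrow> (('a::complex_hilbert_space \<Rightarrow>\<^sub>L 'a) list \<Rightarrow> real) \<Rightarrow> bool"
  where "symmetric_form p k d \<longleftrightarrow>
    (\<forall>Xs\<in>schatten_tuples p k. \<forall>\<pi>. \<pi> permutes {..<k} \<longrightarrow> d (permute_list \<pi> Xs) = d Xs)"

definition bounded_form ::
    "real \<Rightarrow> nat \<Rightarrow> (('a::complex_hilbert_space \<Rightarrow>\<^sub>L 'a) list \<Rightarrow> real) \<Rightarrow> bool"
  where "bounded_form p k d \<longleftrightarrow>
    (\<exists>C. \<forall>Xs\<in>schatten_tuples p k. \<bar>d Xs\<bar> \<le> C * (\<Prod>i<k. schatten_norm p (Xs ! i)))"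

end

theory Submission
  imports Defs "HOL-Complex_Analysis.Cauchy_Integral_Theorem"
begin

text \<open>Let \<open>F(X) = \<parallel>X\<parallel>\<^sub>p\<^sup>p\<close>. The forms exist as soon as the difference of order \<open>m + 1\<close> of \<open>F\<close> along \<open>V\<close> is
  bounded by a multiple of \<open>F(V)\<close>, uniformly in the base point: polarization extends this bound to
  mixed differences, and the forms are recovered from the highest degree downwards as limits of
  \<open>2\<^sup>n\<^sup>k\<close> times the mixed difference of order \<open>k\<close> with increments \<open>2\<^sup>-\<^sup>n V\<^sub>i\<close>.

  Compression to finite-dimensional subspaces and the dilation of \<open>X\<close> to an off-diagonal block
  operator reduce the bound to self-adjoint operators of finite rank. For even \<open>p\<close> it is then
  immediate. Otherwise let \<open>2 k < p < 2 k + 2\<close>; up to a constant, \<open>F(X)\<close> is the integral of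
  \<open>t\<^sup>p\<^sup>-\<^sup>2\<^sup>k\<^sup>-\<^sup>1 tr (X\<^sup>2\<^sup>k\<^sup>+\<^sup>2 / (X\<^sup>2 + t\<^sup>2))\<close> over \<open>t > 0\<close>, and differences of this trace are those of the
  resolvents at \<open>\<i> t\<close> and \<open>- \<i> t\<close>. For non-integral \<open>p\<close> one splits \<open>V\<close> at the level \<open>t\<close> and uses that the
  large part has small rank and that Hoelder's inequality controls the small part.

  For odd \<open>p\<close> the integrand decays too slowly for absolute values. Passing to small increments, one
  has to bound the integral of \<open>tr ((C V)\<^sup>p C)\<close> with \<open>C = w / (w - H)\<close> along the imaginary axis. Split
  \<open>C\<close> into the parts \<open>C\<^sub>+\<close> and \<open>C\<^sub>-\<close> on the nonnegative and negative spectral subspaces of \<open>H\<close>. A factor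
  \<open>C\<^sub>+ A C\<^sub>-\<close> equals \<open>C\<^sub>+ N + N' C\<^sub>-\<close>, where \<open>N\<close> and \<open>N'\<close> arise from \<open>A\<close> by multipliers that are bounded on all
  Schatten classes with exponent strictly between \<open>1\<close> and infinity. This reduces words of mixed signs
  to words of a single sign, and for the latter the contour can be moved by Cauchy's theorem.\<close>

text \<open>Differences replace derivatives because every constant must be uniform in the base point
  and in the dimension; such an estimate survives compressions and limits, and no differentiability
  of the norm is presupposed. The critical case is odd \<open>p = m + 1\<close>. After the
  substitution t = exp u, Hoelder's inequality bounds the integrand by a quantity that stays
  constant as u tends to infinity, and the order of the difference cannot be raised, since only
  \<open>m\<close> forms are available. Cancellation between the two half-axes has to be used. It
  becomes visible only for an expression homogeneous of degree \<open>p\<close> in \<open>V\<close>,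
  with all resolvents at one point; cutting \<open>V\<close> into ever smaller steps preserves this
  main term and kills the error of degree \<open>p + 1\<close>. The multipliers are bounded first
  for exponents 2 k, k odd, by a positivity argument in the style of M. Riesz, and then for the
  others by duality and real interpolation. Since the exponents 1 and infinity are excluded, the
  bookkeeping of words must ensure that a multiplier only meets an operator measured with exponent p
  / j, 0 < j < p.\<close>

instance complex_hilbert_space \<subseteq> banach ..

section \<open>Scalar multiplication and the complex inner product\<close>

lemma scaleC_zero_left [simp]: "scaleC 0 (x::'a::complex_hilbert_space) = 0"
  using scaleC_of_real[of 0 x] by simp

lemma scaleC_zero_right [simp]: "scaleC c (0::'a::complex_hilbert_space) = 0"
  using scaleC_add_right[of c "0::'a" 0] by simp

lemma scaleC_one [simp]: "scaleC 1 (x::'a::complex_hilbert_space) = x"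
  using scaleC_of_real[of 1 x] by simp

lemma scaleC_minus_left: "scaleC (- c) (x::'a::complex_hilbert_space) = - scaleC c x"
  using scaleC_add_left[of c "- c" x] by (simp add: minus_unique)

lemma scaleC_minus_right: "scaleC c (- x::'a::complex_hilbert_space) = - scaleC c x"
  using scaleC_add_right[of c x "- x"] by (simp add: minus_unique)

lemma scaleC_diff_right: "scaleC c (x - y::'a::complex_hilbert_space) = scaleC c x - scaleC c y"
  using scaleC_add_right[of c x "- y"] by (simp add: scaleC_minus_right)

lemma scaleC_diff_left: "scaleC (c - d) (x::'a::complex_hilbert_space) = scaleC c x - scaleC d x"
  using scaleC_add_left[of c "- d" x] by (simp add: scaleC_minus_left)

lemma scaleC_scaleR: "scaleC c (r *\<^sub>R (x::'a::complex_hilbert_space)) = r *\<^sub>R scaleC c x"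
  by (simp add: scaleC_of_real[symmetric] scaleC_scaleC mult.commute)

lemma cinner_add_right: "cinner x (y + z::'a::complex_hilbert_space) = cinner x y + cinner x z"
  by (metis cinner_add_left cinner_commute complex_cnj_add)

lemma cinner_scaleC_right: "cinner x (scaleC c (y::'a::complex_hilbert_space)) = cnj c * cinner x y"
  by (metis cinner_commute cinner_scaleC_left complex_cnj_mult)

lemma cinner_zero_left [simp]: "cinner (0::'a::complex_hilbert_space) y = 0"
  using cinner_scaleC_left[of 0 "0::'a" y] by simp

lemma cinner_zero_right [simp]: "cinner y (0::'a::complex_hilbert_space) = 0"
  using cinner_scaleC_right[of y 0 "0::'a"] by simp

lemma cinner_minus_left: "cinner (- x::'a::complex_hilbert_space) y = - cinner x y"
  using cinner_scaleC_left[of "-1" x y] by (simp add: scaleC_minus_left)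

lemma cinner_minus_right: "cinner x (- y::'a::complex_hilbert_space) = - cinner x y"
  using cinner_scaleC_right[of x "-1" y] by (simp add: scaleC_minus_left)

lemma cinner_diff_left: "cinner (x - y::'a::complex_hilbert_space) z = cinner x z - cinner y z"
  using cinner_add_left[of x "- y" z] by (simp add: cinner_minus_left)

lemma cinner_diff_right: "cinner z (x - y::'a::complex_hilbert_space) = cinner z x - cinner z y"
  using cinner_add_right[of z x "- y"] by (simp add: cinner_minus_right)

lemma cinner_sum_left: "cinner (\<Sum>i\<in>I. f i) (y::'a::complex_hilbert_space) = (\<Sum>i\<in>I. cinner (f i) y)"
  by (induction I rule: infinite_finite_induct) (auto simp: cinner_add_left)

lemma cinner_sum_right: "cinner y (\<Sum>i\<in>I. (f i::'a::complex_hilbert_space)) = (\<Sum>i\<in>I. cinner y (f i))"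
  by (induction I rule: infinite_finite_induct) (auto simp: cinner_add_right)

lemma cinner_scaleR_left: "cinner (r *\<^sub>R x) (y::'a::complex_hilbert_space) = of_real r * cinner x y"
  by (metis cinner_scaleC_left scaleC_of_real)

lemma cinner_scaleR_right: "cinner x (r *\<^sub>R (y::'a::complex_hilbert_space)) = of_real r * cinner x y"
  by (metis cinner_scaleC_right complex_cnj_complex_of_real scaleC_of_real)

lemma cinner_self: "cinner x (x::'a::complex_hilbert_space) = of_real ((norm x)\<^sup>2)"
proof (rule complex_eqI)
  show "Re (cinner x x) = Re (of_real ((norm x)\<^sup>2))"
    by (simp add: Re_cinner power2_norm_eq_inner)
  have "cinner x x = cnj (cinner x x)" by (rule cinner_commute)
  then have "Im (cinner x x) = - Im (cinner x x)" by (metis cnj.simps(2))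
  then show "Im (cinner x x) = Im (of_real ((norm x)\<^sup>2))" by simp
qed

lemma cinner_self_eq_one_iff: "cinner x (x::'a::complex_hilbert_space) = 1 \<longleftrightarrow> norm x = 1"
proof -
  have "cinner x x = 1 \<longleftrightarrow> (norm x)\<^sup>2 = 1"
    unfolding cinner_self by (metis of_real_1 of_real_eq_iff)
  then show ?thesis by (simp add: power2_eq_1_iff) (metis norm_ge_zero not_one_le_zero neg_0_le_iff_le)
qed

lemma mult_cnj_eq: "z * cnj z = (complex_of_real (cmod z))\<^sup>2"
  by (metis complex_norm_square of_real_power)

lemma norm_scaleC: "norm (scaleC c (x::'a::complex_hilbert_space)) = cmod c * norm x"
proof -
  have "of_real ((norm (scaleC c x))\<^sup>2) = cinner (scaleC c x) (scaleC c x)" by (simp add: cinner_self)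
  also have "... = (c * cnj c) * cinner x x" by (simp add: cinner_scaleC_left cinner_scaleC_right)
  also have "... = complex_of_real ((cmod c * norm x)\<^sup>2)"
    by (simp add: cinner_self mult_cnj_eq power_mult_distrib)
  finally have "(norm (scaleC c x))\<^sup>2 = (cmod c * norm x)\<^sup>2" using of_real_eq_iff by blast
  then show ?thesis by (simp add: power2_eq_iff_nonneg)
qed

text \<open>A phase turns the complex inner product into its modulus, and the real Cauchy-Schwarz
  inequality applies to the rotated vector.\<close>

lemma cinner_norm_le: "cmod (cinner x (y::'a::complex_hilbert_space)) \<le> norm x * norm y"
proof -
  obtain c where c: "cmod c = 1" "c * cinner x y = of_real (cmod (cinner x y))"
  proof (cases "cinner x y = 0")
    case False
    define z where "z = cinner x y"
    have z: "z \<noteq> 0" using False by (simp add: z_def)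
    have "cnj z / of_real (cmod z) * z = of_real ((cmod z)\<^sup>2) / of_real (cmod z)"
      by (simp add: mult_cnj_eq[symmetric] mult.commute)
    also have "... = of_real (cmod z)" using z by (simp add: power2_eq_square)
    finally show ?thesis
      using that[of "cnj z / of_real (cmod z)"] z by (simp add: z_def norm_divide)
  qed (auto intro: that[of 1])
  have "cmod (cinner x y) = Re (cinner (scaleC c x) y)" by (simp add: cinner_scaleC_left c)
  also have "... = inner (scaleC c x) y" by (rule Re_cinner)
  also have "... \<le> norm (scaleC c x) * norm y" by (rule norm_cauchy_schwarz)
  finally show ?thesis by (simp add: norm_scaleC c)
qed

lemma bounded_linear_cinner_left: "bounded_linear (\<lambda>x::'a::complex_hilbert_space. cinner x y)"
  by (rule bounded_linear_intro[of _ "norm y"])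
    (simp_all add: cinner_add_left cinner_scaleR_left cinner_norm_le scaleR_conv_of_real)

lemma bounded_linear_cinner_right: "bounded_linear (\<lambda>y::'a::complex_hilbert_space. cinner x y)"
  by (rule bounded_linear_intro[of _ "norm x"])
    (simp_all add: cinner_add_right cinner_scaleR_right cinner_norm_le scaleR_conv_of_real mult.commute[of "norm x"],
      metis cinner_norm_le mult.commute)

lemma bounded_linear_scaleC: "bounded_linear (\<lambda>x::'a::complex_hilbert_space. scaleC c x)"
  by (rule bounded_linear_intro[of _ "cmod c"]) (simp_all add: scaleC_add_right scaleC_scaleR norm_scaleC)

lemma cinner_eq_zero_imp: "(\<And>y. cinner x (y::'a::complex_hilbert_space) = 0) \<Longrightarrow> x = 0"
  using cinner_self[of x] by (metis norm_eq_zero of_real_eq_0_iff power_eq_0_iff)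

lemma cinner_ext_right: "(\<And>x. cinner x (y::'a::complex_hilbert_space) = cinner x z) \<Longrightarrow> y = z"
  using cinner_eq_zero_imp[of "y - z"]
  by (metis cinner_commute cinner_diff_right complex_cnj_zero eq_iff_diff_eq_0)

subsection \<open>Orthonormal systems\<close>

definition onset :: "'a::complex_hilbert_space set \<Rightarrow> bool"
  where "onset E \<longleftrightarrow> (\<forall>e\<in>E. cinner e e = 1) \<and> (\<forall>e\<in>E. \<forall>f\<in>E. e \<noteq> f \<longrightarrow> cinner e f = 0)"

lemma onset_cinner: "onset E \<Longrightarrow> e \<in> E \<Longrightarrow> f \<in> E \<Longrightarrow> cinner e f = (if e = f then 1 else 0)"
  by (auto simp: onset_def)

lemma onset_norm: "onset E \<Longrightarrow> e \<in> E \<Longrightarrow> norm e = 1"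
  by (simp add: onset_def cinner_self_eq_one_iff)

lemma orthonormal_basis_onset: "orthonormal_basis E \<Longrightarrow> onset E"
  by (simp add: orthonormal_basis_def onset_def)

text \<open>Zorn's lemma inside a set \<open>S\<close> of admissible vectors. Taking everything for
  \<open>S\<close> extends an orthonormal set to a basis; taking the eigenvectors gives the spectral
  theorem.\<close>

lemma maximal_onset_exists:
  fixes S :: "'a::complex_hilbert_space set"
  assumes "onset E0" "E0 \<subseteq> S"
  obtains E where "onset E" "E0 \<subseteq> E" "E \<subseteq> S"
    "\<not> (\<exists>x\<in>S. norm x = 1 \<and> (\<forall>e\<in>E. cinner x e = 0))"
proof -
  let ?A = "{E. onset E \<and> E0 \<subseteq> E \<and> E \<subseteq> S}"
  have "\<exists>M\<in>?A. \<forall>X\<in>?A. M \<subseteq> X \<longrightarrow> X = M"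
  proof (rule subset_Zorn_nonempty)
    show "?A \<noteq> {}" using assms by auto
  next
    fix C assume C: "C \<noteq> {}" "subset.chain ?A C"
    have "onset (\<Union>C)"
      unfolding onset_def
    proof (intro conjI ballI impI)
      fix e assume "e \<in> \<Union>C"
      then show "cinner e e = 1" using C by (auto simp: subset.chain_def onset_def)
    next
      fix e f assume "e \<in> \<Union>C" "f \<in> \<Union>C" and ef: "e \<noteq> f"
      then obtain X Y where XY: "X \<in> C" "Y \<in> C" "e \<in> X" "f \<in> Y" by auto
      have "\<forall>x\<in>C. \<forall>y\<in>C. x \<subset> y \<or> x = y \<or> y \<subset> x \<or> y = x" using C(2) by (simp add: subset.chain_def)
      then have "X \<subset> Y \<or> X = Y \<or> Y \<subset> X" using XY(1,2) by metis
      then have "X \<subseteq> Y \<or> Y \<subseteq> X" by auto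
      then obtain Z where "Z \<in> C" "e \<in> Z" "f \<in> Z" using XY by auto
      then show "cinner e f = 0" using C ef by (auto simp: subset.chain_def onset_def)
    qed
    moreover obtain X where "X \<in> C" using C by blast
    then have "E0 \<subseteq> \<Union>C" using C unfolding subset.chain_def by blast
    moreover have "\<Union>C \<subseteq> S" using C by (auto simp: subset.chain_def)
    ultimately show "\<Union>C \<in> ?A" by simp
  qed
  then obtain E where EA: "E \<in> ?A" and mx: "\<forall>X\<in>?A. E \<subseteq> X \<longrightarrow> X = E" by (rule bexE)
  from EA have E: "onset E" "E0 \<subseteq> E" "E \<subseteq> S" by auto
  have max: "X = E" if "onset X" "E0 \<subseteq> X" "X \<subseteq> S" "E \<subseteq> X" for X using mx that by simp
  show thesis
  proof (rule that[OF E], rule notI)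
    assume "\<exists>x\<in>S. norm x = 1 \<and> (\<forall>e\<in>E. cinner x e = 0)"
    then obtain x where x: "x \<in> S" "norm x = 1" "\<And>e. e \<in> E \<Longrightarrow> cinner x e = 0" by blast
    have x1: "cinner x x = 1" using x(2) by (simp add: cinner_self_eq_one_iff)
    have x': "cinner e x = 0" if "e \<in> E" for e using x(3)[OF that] cinner_commute[of e x] by simp
    have "onset (insert x E)" using E(1) x(3) x' x1 by (auto simp: onset_def)
    then have "insert x E = E" using E x(1) by (intro max) auto
    then have "x \<in> E" by auto
    then show False using x(3)[of x] x1 by simp
  qed
qed

lemma onset_extends_to_basis:
  assumes "onset (E0 :: 'a::complex_hilbert_space set)"
  obtains E where "orthonormal_basis E" "E0 \<subseteq> E"
proof -
  obtain E where E: "onset E" "E0 \<subseteq> E" "E \<subseteq> UNIV"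
    and max: "\<not> (\<exists>x\<in>UNIV. norm x = 1 \<and> (\<forall>e\<in>E. cinner x e = 0))"
    by (rule maximal_onset_exists[OF assms subset_UNIV])
  have "x = 0" if "\<forall>e\<in>E. cinner x e = 0" for x
  proof (rule ccontr)
    assume "x \<noteq> 0"
    then have "norm ((1 / norm x) *\<^sub>R x) = 1" by simp
    moreover have "cinner ((1 / norm x) *\<^sub>R x) e = 0" if "e \<in> E" for e
      using \<open>\<forall>e\<in>E. cinner x e = 0\<close> that by (simp add: cinner_scaleR_left)
    ultimately show False using max by blast
  qed
  then have "orthonormal_basis E" using E(1) by (auto simp: orthonormal_basis_def onset_def)
  then show thesis using that E(2) by blast
qed

lemma orthonormal_basis_exists: "\<exists>E :: 'a::complex_hilbert_space set. orthonormal_basis E"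
  using onset_extends_to_basis[of "{}"] by (auto simp: onset_def)

lemma norm_sum_onset:
  assumes "onset E" "finite F" "F \<subseteq> E"
  shows "(norm (\<Sum>e\<in>F. scaleC (c e) e))\<^sup>2 = (\<Sum>e\<in>F. (cmod (c e))\<^sup>2)"
proof -
  have "complex_of_real ((norm (\<Sum>e\<in>F. scaleC (c e) e))\<^sup>2)
      = (\<Sum>e\<in>F. \<Sum>f\<in>F. c e * cnj (c f) * cinner e f)"
    unfolding cinner_self[symmetric]
    by (subst cinner_sum_left)
      (simp add: cinner_sum_right cinner_scaleC_left cinner_scaleC_right sum_distrib_left mult_ac)
  also have "... = (\<Sum>e\<in>F. \<Sum>f\<in>F. if e = f then c e * cnj (c f) else 0)"
    using assms by (intro sum.cong refl) (auto simp: onset_cinner subset_iff)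
  also have "... = (\<Sum>e\<in>F. c e * cnj (c e))" using assms(2) by simp
  also have "... = complex_of_real (\<Sum>e\<in>F. (cmod (c e))\<^sup>2)"
    by (simp add: mult_cnj_eq)
  finally show ?thesis using of_real_eq_iff by blast
qed

lemma bessel:
  assumes "onset E" "finite F" "F \<subseteq> E"
  shows "(\<Sum>e\<in>F. (cmod (cinner x e))\<^sup>2) \<le> (norm x)\<^sup>2"
proof -
  define y where "y = (\<Sum>e\<in>F. scaleC (cinner x e) e)"
  have xy: "cinner x y = of_real (\<Sum>e\<in>F. (cmod (cinner x e))\<^sup>2)"
    by (simp add: y_def cinner_sum_right cinner_scaleC_right mult_cnj_eq[symmetric] mult.commute)
  have ny: "(norm y)\<^sup>2 = (\<Sum>e\<in>F. (cmod (cinner x e))\<^sup>2)"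
    unfolding y_def by (rule norm_sum_onset[OF assms])
  have "(norm (x - y))\<^sup>2 = (norm x)\<^sup>2 - 2 * inner x y + (norm y)\<^sup>2"
    by (simp add: power2_norm_eq_inner inner_diff_left inner_diff_right inner_commute)
  moreover have "inner x y = (\<Sum>e\<in>F. (cmod (cinner x e))\<^sup>2)"
    unfolding Re_cinner[symmetric] xy by simp
  ultimately have "0 \<le> (norm x)\<^sup>2 - (norm y)\<^sup>2"
    using ny zero_le_power2[of "norm (x - y)"] by linarith
  then show ?thesis using ny by simp
qed

text \<open>The sum need not converge absolutely, so the filter of finite partial sums is shown to
  be Cauchy. Two partial sums are compared with one over a common superset; by Pythagoras the
  squared distance is a difference of partial sums of the scalar series.\<close>

lemma onset_summable:
  fixes E :: "'a::complex_hilbert_space set"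
  assumes E: "onset E" and c: "(\<lambda>e. (cmod (c e))\<^sup>2) summable_on E"
  shows "(\<lambda>e. scaleC (c e) e) summable_on E"
proof -
  let ?f = "\<lambda>e. scaleC (c e) e" and ?g = "\<lambda>e. (cmod (c e))\<^sup>2"
  obtain L where lim: "(sum ?g \<longlongrightarrow> L) (finite_subsets_at_top E)"
    using c unfolding has_sum_def summable_on_def by blast
  have diff: "(norm (sum ?f (F - F')))\<^sup>2 = sum ?g F - sum ?g F'" if "finite F" "F \<subseteq> E" "F' \<subseteq> F" for F F'
    using norm_sum_onset[OF E, of "F - F'" c] that by (simp add: sum_diff subset_eq finite_subset)
  have "\<exists>P. eventually P (finite_subsets_at_top E) \<and>
      (\<forall>F F'. P F \<and> P F' \<longrightarrow> dist (sum ?f F) (sum ?f F') < e)" if "e > 0" for e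
  proof -
    define d where "d = (e / 4)\<^sup>2"
    then have "d > 0" using that by simp
    define d2 where "d2 = d / 2"
    have "d2 > 0" using \<open>d > 0\<close> by (simp add: d2_def)
    define P where "P F \<longleftrightarrow> finite F \<and> F \<subseteq> E \<and> dist (sum ?g F) L < d2" for F
    have ev: "eventually P (finite_subsets_at_top E)"
      using lim \<open>d2 > 0\<close>
      by (auto simp add: P_def[abs_def] eventually_conj_iff eventually_finite_subsets_at_top_weakI tendsto_iff)
    obtain F0 where F0: "finite F0" "F0 \<subseteq> E" "\<And>F. finite F \<Longrightarrow> F0 \<subseteq> F \<Longrightarrow> F \<subseteq> E \<Longrightarrow> P F"
      using ev by (auto simp: eventually_finite_subsets_at_top)
    have "dist (sum ?f F1) (sum ?f F2) < e" if P: "P F1" "P F2" for F1 F2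
    proof -
      define F where "F = F0 \<union> F1 \<union> F2"
      have F: "finite F" "F \<subseteq> E" using F0(1,2) P by (auto simp: F_def P_def)
      have "F0 \<subseteq> F" unfolding F_def by blast
      then have F: "finite F" "F \<subseteq> E" "P F" using F F0(3) by blast+
      have *: "dist (sum ?f F) (sum ?f F') < e / 2" if "F' \<subseteq> F" "P F'" for F'
      proof -
        have "(norm (sum ?f F - sum ?f F'))\<^sup>2 = sum ?g F - sum ?g F'"
          using diff[OF F(1,2) that(1)] F(1) that(1) by (simp add: sum_diff)
        also have "... < d" using F(3) that(2) unfolding P_def dist_real_def d2_def by linarith
        finally have "(norm (sum ?f F - sum ?f F'))\<^sup>2 < (e / 4)\<^sup>2" by (simp add: d_def)
        then have "norm (sum ?f F - sum ?f F') < e / 4" by (rule power2_less_imp_less) (use \<open>e > 0\<close> in simp)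
        then show ?thesis using \<open>e > 0\<close> by (simp add: dist_norm)
      qed
      have "dist (sum ?f F1) (sum ?f F2) \<le> dist (sum ?f F) (sum ?f F1) + dist (sum ?f F) (sum ?f F2)"
        by (rule dist_triangle3)
      also have "... < e / 2 + e / 2" by (intro add_strict_mono *) (use P in \<open>auto simp: F_def\<close>)
      finally show ?thesis by simp
    qed
    then show ?thesis using ev by blast
  qed
  then have "cauchy_filter (filtermap (sum ?f) (finite_subsets_at_top E))"
    by (simp add: cauchy_filter_metric_filtermap)
  moreover have "complete (UNIV::'a set)"
    by (meson Cauchy_convergent UNIV_I complete_def convergent_def)
  ultimately obtain L' where "(sum ?f \<longlongrightarrow> L') (finite_subsets_at_top E)"
    using complete_uniform[where S=UNIV] by (force simp add: filterlim_def)
  then show ?thesis using summable_on_def has_sum_def by blast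
qed

lemma bessel_summable:
  assumes "onset E"
  shows "(\<lambda>e. (cmod (cinner x e))\<^sup>2) summable_on E"
  by (rule nonneg_bdd_above_summable_on) (auto intro!: bdd_aboveI2 bessel[OF assms])

lemma basis_expansion:
  assumes "orthonormal_basis E"
  shows "((\<lambda>e. scaleC (cinner x e) e) has_sum x) E"
proof -
  have E: "onset E" by (rule orthonormal_basis_onset[OF assms])
  obtain y where y: "((\<lambda>e. scaleC (cinner x e) e) has_sum y) E"
    using onset_summable[OF E bessel_summable[OF E]] by (auto simp: summable_on_def)
  have "cinner (x - y) f = 0" if f: "f \<in> E" for f
  proof -
    have "((\<lambda>e. cinner (scaleC (cinner x e) e) f) has_sum cinner y f) E"
      by (rule has_sum_bounded_linear[OF bounded_linear_cinner_left y])
    moreover have "((\<lambda>e. cinner (scaleC (cinner x e) e) f) has_sum cinner x f) E"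
    proof -
      have "cinner (scaleC (cinner x e) e) f = (if e = f then cinner x f else 0)" if "e \<in> E" for e
        using onset_cinner[OF E that f] by (simp add: cinner_scaleC_left)
      moreover have "((\<lambda>e. if e = f then cinner x f else 0) has_sum cinner x f) E"
        by (rule has_sum_finite_neutralI[of "{f}"]) (use f in auto)
      ultimately show ?thesis by (simp cong: has_sum_cong)
    qed
    ultimately show ?thesis by (simp add: cinner_diff_left has_sum_unique)
  qed
  then have "x - y = 0" using assms unfolding orthonormal_basis_def by blast
  then show ?thesis using y by simp
qed

lemma parseval_cinner:
  assumes "orthonormal_basis E"
  shows "((\<lambda>e. cinner x e * cinner e y) has_sum cinner x y) E"
  using has_sum_bounded_linear[OF bounded_linear_cinner_left[of y] basis_expansion[OF assms, of x]]
  by (simp add: cinner_scaleC_left)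

lemma parseval:
  assumes "orthonormal_basis E"
  shows "((\<lambda>e. (cmod (cinner x e))\<^sup>2) has_sum (norm x)\<^sup>2) E"
proof -
  have "((\<lambda>e. Re (cinner x e * cinner e x)) has_sum Re (cinner x x)) E"
    by (rule has_sum_Re[OF parseval_cinner[OF assms]])
  moreover have "Re (cinner x e * cinner e x) = (cmod (cinner x e))\<^sup>2" for e
    using cinner_commute[of e x] by (metis Re_complex_of_real complex_norm_square)
  ultimately show ?thesis by (simp add: cinner_self)
qed

lemma op_expansion:
  fixes X :: "'a::complex_hilbert_space \<Rightarrow>\<^sub>L 'a"
  assumes "orthonormal_basis E" "clinear_op X"
  shows "((\<lambda>e. scaleC (cinner x e) (X e)) has_sum X x) E"
  using has_sum_bounded_linear[OF blinfun.bounded_linear_right basis_expansion[OF assms(1), of x], of X] assms(2)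
  by (simp add: clinear_op_def)

lemma op_eqI_basis:
  fixes X Y :: "'a::complex_hilbert_space \<Rightarrow>\<^sub>L 'a"
  assumes "orthonormal_basis E" "clinear_op X" "clinear_op Y" "\<And>e. e \<in> E \<Longrightarrow> X e = Y e"
  shows "X = Y"
proof (rule blinfun_eqI)
  fix x
  have "((\<lambda>e. scaleC (cinner x e) (Y e)) has_sum X x) E"
    using op_expansion[OF assms(1,2), of x] assms(4) by (simp cong: has_sum_cong)
  then show "X x = Y x" using op_expansion[OF assms(1,3), of x] by (rule has_sum_unique)
qed

subsection \<open>Adjoints and diagonal operators\<close>

lemma clinear_op_sum: "clinear_op X \<Longrightarrow> X (\<Sum>i\<in>I. scaleC (c i) (v i)) = (\<Sum>i\<in>I. scaleC (c i) (X (v i)))"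
  by (simp add: blinfun.sum_right clinear_op_def)

text \<open>The value at \<open>y\<close> is assembled from its coefficients
  \<open>cinner y (X e)\<close>. Their square summability is self-improving: for a finite partial
  sum z the sum of squares equals both |z|^2 and <y, X z>, hence |z| is at most |y| |X|.\<close>

lemma adjoint_exists:
  fixes X :: "'a::complex_hilbert_space \<Rightarrow>\<^sub>L 'a"
  assumes X: "clinear_op X"
  shows "\<exists>Y :: 'a \<Rightarrow>\<^sub>L 'a. \<forall>x y. cinner (X x) y = cinner x (Y y)"
proof -
  obtain E :: "'a set" where E: "orthonormal_basis E" using orthonormal_basis_exists by blast
  have on: "onset E" by (rule orthonormal_basis_onset[OF E])
  have bd: "(\<Sum>e\<in>F. (cmod (cinner y (X e)))\<^sup>2) \<le> (norm y * norm X)\<^sup>2" if F: "finite F" "F \<subseteq> E" for F y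
  proof -
    let ?z = "\<Sum>e\<in>F. scaleC (cinner y (X e)) e" and ?S = "\<Sum>e\<in>F. (cmod (cinner y (X e)))\<^sup>2"
    have nz: "(norm ?z)\<^sup>2 = ?S" by (rule norm_sum_onset[OF on F])
    have "cinner y (X ?z) = of_real ?S"
      by (simp add: clinear_op_sum[OF X] cinner_sum_right cinner_scaleC_right mult_cnj_eq[symmetric] mult.commute)
    then have "cmod (cinner y (X ?z)) = \<bar>?S\<bar>" by (simp only: norm_of_real)
    then have "?S = cmod (cinner y (X ?z))" by (simp add: sum_nonneg)
    also have "... \<le> norm y * norm (X ?z)" by (rule cinner_norm_le)
    also have "... \<le> norm y * (norm X * norm ?z)" by (intro mult_left_mono norm_blinfun) auto
    finally have *: "(norm ?z)\<^sup>2 \<le> (norm y * norm X) * norm ?z" using nz by (simp add: mult.assoc)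
    have "norm ?z \<le> norm y * norm X"
    proof (cases "norm ?z = 0")
      case False
      then show ?thesis using * by (simp add: power2_eq_square)
    qed simp
    then have "(norm ?z)\<^sup>2 \<le> (norm y * norm X)\<^sup>2" by (intro power_mono) auto
    then show ?thesis using nz by simp
  qed
  have "\<exists>z. \<forall>x. cinner (X x) y = cinner x z" for y
  proof -
    have "(\<lambda>e. (cmod (cinner y (X e)))\<^sup>2) summable_on E"
      by (rule nonneg_bdd_above_summable_on) (auto intro!: bdd_aboveI2 bd)
    then obtain z where z: "((\<lambda>e. scaleC (cinner y (X e)) e) has_sum z) E"
      using onset_summable[OF on, of "\<lambda>e. cinner y (X e)"] unfolding summable_on_def by blast
    have "cinner (X x) y = cinner x z" for x
    proof -
      have "((\<lambda>e. cinner x (scaleC (cinner y (X e)) e)) has_sum cinner x z) E"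
        by (rule has_sum_bounded_linear[OF bounded_linear_cinner_right z])
      moreover have "cinner x (scaleC (cinner y (X e)) e) = cinner (scaleC (cinner x e) (X e)) y" for e
        using cinner_commute[of y "X e"] by (simp add: cinner_scaleC_left cinner_scaleC_right)
      moreover have "((\<lambda>e. cinner (scaleC (cinner x e) (X e)) y) has_sum cinner (X x) y) E"
        by (rule has_sum_bounded_linear[OF bounded_linear_cinner_left op_expansion[OF E X]])
      ultimately show ?thesis by (simp add: has_sum_unique)
    qed
    then show ?thesis by blast
  qed
  then obtain Y where Y: "\<And>x y. cinner (X x) y = cinner x (Y y)" by metis
  have "bounded_linear Y"
  proof (rule bounded_linear_intro[of _ "norm X"])
    fix x y and r :: real
    show "Y (x + y) = Y x + Y y"
      by (rule cinner_ext_right) (simp add: Y[symmetric] cinner_add_right)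
    show "Y (r *\<^sub>R x) = r *\<^sub>R Y x"
      by (rule cinner_ext_right) (simp add: Y[symmetric] cinner_scaleR_right)
    have "(norm (Y x))\<^sup>2 = cmod (cinner (Y x) (Y x))" by (simp add: cinner_self norm_power)
    also have "... = cmod (cinner (X (Y x)) x)" by (simp add: Y)
    also have "... \<le> norm (X (Y x)) * norm x" by (rule cinner_norm_le)
    also have "... \<le> (norm X * norm (Y x)) * norm x" by (intro mult_right_mono norm_blinfun) auto
    finally have *: "norm (Y x) * norm (Y x) \<le> (norm x * norm X) * norm (Y x)"
      by (simp add: power2_eq_square mult_ac)
    then show "norm (Y x) \<le> norm x * norm X"
      by (cases "norm (Y x) = 0") (simp_all add: mult_le_cancel_right)
  qed
  then show ?thesis using Y by (intro exI[of _ "Blinfun Y"]) (simp add: bounded_linear_Blinfun_apply)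
qed

lemma cinner_cadjoint:
  assumes "clinear_op X"
  shows "cinner (X x) y = cinner x (cadjoint X y)"
proof -
  obtain Y where Y: "\<forall>x y. cinner (X x) y = cinner x (blinfun_apply Y y)" using adjoint_exists[OF assms] by blast
  have "cadjoint X = Y"
    unfolding cadjoint_def
  proof (rule the_equality)
    fix Z assume Z: "\<forall>x y. cinner (X x) y = cinner x (blinfun_apply Z y)"
    show "Z = Y"
    proof (rule blinfun_eqI, rule cinner_ext_right)
      fix y x
      have "cinner x (Z y) = cinner (X x) y" using Z by simp
      also have "... = cinner x (Y y)" using Y by simp
      finally show "cinner x (Z y) = cinner x (Y y)" .
    qed
  qed (rule Y)
  then show ?thesis using Y by simp
qed

lemma cinner_cadjoint_left:
  assumes "clinear_op X"
  shows "cinner (cadjoint X x) y = cinner x (X y)"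
proof -
  have "cinner (cadjoint X x) y = cnj (cinner y (cadjoint X x))" by (rule cinner_commute)
  also have "... = cnj (cinner (X y) x)" by (simp add: cinner_cadjoint[OF assms])
  also have "... = cinner x (X y)" by (rule cinner_commute[symmetric])
  finally show ?thesis .
qed

lemma clinear_cadjoint:
  assumes "clinear_op X"
  shows "clinear_op (cadjoint X)"
  unfolding clinear_op_def
proof (intro allI, rule cinner_ext_right)
  fix c x y
  have "cinner y (cadjoint X (scaleC c x)) = cinner (X y) (scaleC c x)"
    by (rule cinner_cadjoint[OF assms, symmetric])
  also have "... = cinner y (scaleC c (cadjoint X x))"
    by (simp add: cinner_scaleC_right cinner_cadjoint[OF assms])
  finally show "cinner y (cadjoint X (scaleC c x)) = cinner y (scaleC c (cadjoint X x))" .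
qed

lemma cadjoint_eqI:
  assumes "clinear_op X" "\<And>x y. cinner (X x) y = cinner x (blinfun_apply Y y)"
  shows "cadjoint X = Y"
proof (rule blinfun_eqI, rule cinner_ext_right)
  fix y x
  have "cinner x (cadjoint X y) = cinner (X x) y" by (rule cinner_cadjoint[OF assms(1), symmetric])
  then show "cinner x (cadjoint X y) = cinner x (Y y)" using assms(2)[of x y] by (rule trans)
qed

lemma norm_cadjoint_le:
  assumes X: "clinear_op X"
  shows "norm (cadjoint X) \<le> norm X"
proof (rule norm_blinfun_bound)
  fix x
  let ?Y = "cadjoint X"
  have "(norm (?Y x))\<^sup>2 = cmod (cinner (?Y x) (?Y x))" by (simp add: cinner_self norm_power)
  also have "... = cmod (cinner (X (?Y x)) x)" by (simp add: cinner_cadjoint[OF X])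
  also have "... \<le> norm (X (?Y x)) * norm x" by (rule cinner_norm_le)
  also have "... \<le> (norm X * norm (?Y x)) * norm x" by (intro mult_right_mono norm_blinfun) auto
  finally have *: "norm (?Y x) * norm (?Y x) \<le> (norm X * norm x) * norm (?Y x)"
    by (simp add: power2_eq_square mult_ac)
  then show "norm (?Y x) \<le> norm X * norm x"
    by (cases "norm (?Y x) = 0") (simp_all add: mult_le_cancel_right)
qed simp

lemma clinear_op_compose: "clinear_op X \<Longrightarrow> clinear_op Y \<Longrightarrow> clinear_op (X o\<^sub>L Y)"
  by (simp add: clinear_op_def)

text \<open>Provides the modulus and its powers, which are diagonal in a singular basis. The last
  clause is the form in which positivity and the trace are read off.\<close>

lemma diagonal_op_exists:
  fixes E :: "'a::complex_hilbert_space set"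
  assumes E: "orthonormal_basis E" and mu: "\<And>e. e \<in> E \<Longrightarrow> \<bar>\<mu> e\<bar> \<le> C"
  obtains D :: "'a \<Rightarrow>\<^sub>L 'a" where "clinear_op D" "\<And>e. e \<in> E \<Longrightarrow> D e = \<mu> e *\<^sub>R e"
    "\<And>x e. e \<in> E \<Longrightarrow> cinner (D x) e = complex_of_real (\<mu> e) * cinner x e"
    "\<And>x. ((\<lambda>e. complex_of_real (\<mu> e * (cmod (cinner x e))\<^sup>2)) has_sum cinner (D x) x) E"
proof -
  let ?g = "\<lambda>x e. scaleC (complex_of_real (\<mu> e) * cinner x e) e"
  have on: "onset E" by (rule orthonormal_basis_onset[OF E])
  define K where "K = max C 0"
  have K: "\<bar>\<mu> e\<bar> \<le> K" "0 \<le> K" if "e \<in> E" for e using mu[OF that] by (auto simp: K_def)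
  have K0: "0 \<le> K" by (simp add: K_def)
  have sq: "(cmod (complex_of_real (\<mu> e) * cinner x e))\<^sup>2 \<le> K\<^sup>2 * (cmod (cinner x e))\<^sup>2" if "e \<in> E" for x e
    using K[OF that] by (auto simp: norm_mult power_mult_distrib intro!: mult_right_mono abs_le_square_iff[THEN iffD1])
  have "(\<lambda>e. ?g x e) summable_on E" for x
    by (rule onset_summable[OF on], rule summable_on_comparison_test[OF summable_on_cmult_right[OF bessel_summable[OF on]]])
      (use sq in auto)
  then obtain D where D: "\<And>x. ((\<lambda>e. ?g x e) has_sum D x) E"
    unfolding summable_on_def by metis
  have nD: "norm (D x) \<le> norm x * K" for x
  proof -
    have "((\<lambda>F. norm (\<Sum>e\<in>F. ?g x e)) \<longlongrightarrow> norm (D x)) (finite_subsets_at_top E)"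
      by (intro tendsto_norm) (use D[of x] in \<open>simp add: has_sum_def\<close>)
    moreover have "\<forall>\<^sub>F F in finite_subsets_at_top E. norm (\<Sum>e\<in>F. ?g x e) \<le> norm x * K"
    proof (rule eventually_finite_subsets_at_top_weakI)
      fix F assume F: "finite F" "F \<subseteq> E"
      have "(norm (\<Sum>e\<in>F. ?g x e))\<^sup>2 = (\<Sum>e\<in>F. (cmod (complex_of_real (\<mu> e) * cinner x e))\<^sup>2)"
        by (rule norm_sum_onset[OF on F])
      also have "... \<le> (\<Sum>e\<in>F. K\<^sup>2 * (cmod (cinner x e))\<^sup>2)" using F sq by (intro sum_mono) auto
      also have "... \<le> K\<^sup>2 * (norm x)\<^sup>2"
        unfolding sum_distrib_left[symmetric] by (intro mult_left_mono bessel[OF on F]) auto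
      also have "... = (norm x * K)\<^sup>2" by (simp add: power_mult_distrib)
      finally show "norm (\<Sum>e\<in>F. ?g x e) \<le> norm x * K"
        by (rule power2_le_imp_le) (simp add: K0)
    qed
    ultimately show ?thesis by (rule tendsto_upperbound) simp
  qed
  have "bounded_linear D"
  proof (rule bounded_linear_intro[OF _ _ nD])
    fix x y and r :: real
    have "((\<lambda>e. ?g x e + ?g y e) has_sum D x + D y) E"
      by (intro has_sum_add D)
    then show "D (x + y) = D x + D y"
      using D[of "x + y"] by (simp add: cinner_add_left distrib_left scaleC_add_left has_sum_unique)
    have "((\<lambda>e. r *\<^sub>R (?g x e)) has_sum r *\<^sub>R D x) E"
      by (rule has_sum_bounded_linear[OF bounded_linear_scaleR_right D])
    then show "D (r *\<^sub>R x) = r *\<^sub>R D x"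
      using D[of "r *\<^sub>R x"] by (simp add: cinner_scaleR_left scaleC_of_real[symmetric] cinner_scaleC_left scaleC_scaleC mult_ac has_sum_unique)
  qed
  then have ap: "blinfun_apply (Blinfun D) = D" by (rule bounded_linear_Blinfun_apply)
  show thesis
  proof (rule that[of "Blinfun D"], unfold ap)
    show "clinear_op (Blinfun D)"
      unfolding clinear_op_def ap
    proof (intro allI)
      fix c x
      have "((\<lambda>e. scaleC c (?g x e)) has_sum scaleC c (D x)) E"
        by (rule has_sum_bounded_linear[OF bounded_linear_scaleC D])
      then show "D (scaleC c x) = scaleC c (D x)"
        using D[of "scaleC c x"] by (simp add: cinner_scaleC_left scaleC_scaleC mult_ac has_sum_unique)
    qed
    show ce: "cinner (D x) f = complex_of_real (\<mu> f) * cinner x f" if f: "f \<in> E" for x f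
    proof -
      have "((\<lambda>e. cinner (?g x e) f) has_sum cinner (D x) f) E"
        by (rule has_sum_bounded_linear[OF bounded_linear_cinner_left D])
      moreover have "((\<lambda>e. cinner (?g x e) f) has_sum complex_of_real (\<mu> f) * cinner x f) E"
        by (rule has_sum_finite_neutralI[of "{f}"])
          (use f on in \<open>auto simp: cinner_scaleC_left onset_cinner\<close>)
      ultimately show ?thesis by (rule has_sum_unique)
    qed
    show "D f = \<mu> f *\<^sub>R f" if f: "f \<in> E" for f
    proof -
      have "((\<lambda>e. ?g f e) has_sum \<mu> f *\<^sub>R f) E"
        by (rule has_sum_finite_neutralI[of "{f}"])
          (use f on in \<open>auto simp: onset_cinner scaleC_of_real\<close>)
      then show ?thesis using D has_sum_unique by blast
    qed
    show "((\<lambda>e. complex_of_real (\<mu> e * (cmod (cinner x e))\<^sup>2)) has_sum cinner (D x) x) E" for x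
    proof -
      have "((\<lambda>e. cinner (?g x e) x) has_sum cinner (D x) x) E"
        by (rule has_sum_bounded_linear[OF bounded_linear_cinner_left D])
      moreover have "cinner (?g x e) x = complex_of_real (\<mu> e * (cmod (cinner x e))\<^sup>2)" for e
        using cinner_commute[of e x] by (simp add: cinner_scaleC_left mult_cnj_eq[symmetric] mult.assoc)
      ultimately show ?thesis by simp
    qed
  qed
qed

subsection \<open>The spectral theorem for compact symmetric operators\<close>

text \<open>A maximizing sequence of unit vectors for the norm of \<open>X\<close> is Cauchy by the parallelogram
  law as soon as its images converge.\<close>

lemma norm_attained:
  fixes X :: "'a::complex_hilbert_space \<Rightarrow>\<^sub>L 'a"
  assumes X: "compact_op X" and U: "closed U" "subspace U" and u: "u \<in> U" "u \<noteq> 0"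
  obtains v where "v \<in> U" "norm v = 1" "\<And>x. x \<in> U \<Longrightarrow> norm (X x) \<le> norm (X v) * norm x"
proof -
  define W where "W = {x \<in> U. norm x \<le> 1}"
  define s where "s = (SUP x\<in>W. norm (X x))"
  have bdd: "bdd_above ((\<lambda>x. norm (X x)) ` W)"
  proof (rule bdd_aboveI2[of _ _ "norm X"])
    fix x assume "x \<in> W"
    then show "norm (X x) \<le> norm X"
      using norm_blinfun[of X x] mult_left_mono[of "norm x" 1 "norm X"] by (simp add: W_def)
  qed
  have W0: "0 \<in> W" using U(2) by (simp add: W_def subspace_0)
  have s_up: "norm (X x) \<le> s" if "x \<in> W" for x
    unfolding s_def by (rule cSUP_upper[OF that bdd])
  have s0: "0 \<le> s" using s_up[OF W0] by simp
  have bound: "norm (X x) \<le> s * norm x" if "x \<in> U" for x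
  proof (cases "x = 0")
    case False
    then have "(1 / norm x) *\<^sub>R x \<in> W" using that U(2) by (simp add: W_def subspace_scale)
    from s_up[OF this] show ?thesis using False by (simp add: blinfun.scaleR_right field_simps)
  qed simp
  show thesis
  proof (cases "s = 0")
    case True
    show ?thesis
      by (rule that[of "(1 / norm u) *\<^sub>R u"]) (use u U(2) bound True in \<open>auto simp: subspace_scale\<close>)
  next
    case False
    then have sp: "s > 0" using s0 by simp
    have "\<exists>x\<in>W. s - s / Suc n < norm (X x)" for n
    proof -
      have "s - s / Suc n < s" using sp by simp
      then show ?thesis unfolding s_def using less_cSUP_iff[OF _ bdd] W0 by (metis empty_iff s_def)
    qed
    then obtain v where v: "\<And>n. v n \<in> W" "\<And>n. s - s / Suc n < norm (X (v n))" by metis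
    have lim: "(\<lambda>n. norm (X (v n))) \<longlonglongrightarrow> s"
    proof (rule tendsto_sandwich[of "\<lambda>n. s - s / Suc n" _ _ "\<lambda>_. s"])
      have "(\<lambda>n. s / real (Suc n)) \<longlonglongrightarrow> 0"
        using LIMSEQ_inverse_real_of_nat[THEN tendsto_mult_left, of s] by (simp add: divide_inverse)
      from tendsto_diff[OF tendsto_const[of s] this] show "(\<lambda>n. s - s / real (Suc n)) \<longlonglongrightarrow> s" by simp
    qed (use v s_up in \<open>auto intro!: always_eventually less_imp_le\<close>)
    have "seq_compact (closure (blinfun_apply X ` cball 0 1))"
      using X by (simp add: compact_op_def compact_imp_seq_compact)
    moreover have "X (v n) \<in> closure (blinfun_apply X ` cball 0 1)" for n
      using v(1)[of n] closure_subset by (force simp: W_def)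
    ultimately obtain l r where r: "strict_mono r" "((\<lambda>n. X (v n)) \<circ> r) \<longlonglongrightarrow> l"
      using seq_compactE[of "closure (blinfun_apply X ` cball 0 1)" "\<lambda>n. X (v n)"] by metis
    define w where "w = v \<circ> r"
    have w: "w n \<in> W" for n using v(1) by (simp add: w_def)
    have wl: "(\<lambda>n. X (w n)) \<longlonglongrightarrow> l" using r(2) by (simp add: w_def comp_def)
    have nl: "norm l = s"
    proof (rule LIMSEQ_unique)
      show "(\<lambda>n. norm (X (w n))) \<longlonglongrightarrow> norm l" by (rule tendsto_norm[OF wl])
      show "(\<lambda>n. norm (X (w n))) \<longlonglongrightarrow> s"
        using LIMSEQ_subseq_LIMSEQ[OF lim r(1)] by (simp add: w_def comp_def)
    qed
    have par: "(norm (w m - w n))\<^sup>2 \<le> 4 - (norm (X (w m) + X (w n)) / s)\<^sup>2" for m n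
    proof -
      have "w m + w n \<in> U" using w U(2) by (simp add: W_def subspace_add)
      from bound[OF this] have "norm (X (w m) + X (w n)) / s \<le> norm (w m + w n)"
        using sp by (simp add: blinfun.add_right divide_le_eq mult.commute)
      then have 1: "(norm (X (w m) + X (w n)) / s)\<^sup>2 \<le> (norm (w m + w n))\<^sup>2"
        using sp by (intro power_mono) auto
      have "(norm (w m - w n))\<^sup>2 + (norm (w m + w n))\<^sup>2 = 2 * (norm (w m))\<^sup>2 + 2 * (norm (w n))\<^sup>2"
        by (simp add: power2_norm_eq_inner inner_add_left inner_add_right inner_diff_left inner_diff_right)
      moreover have "(norm (w k))\<^sup>2 \<le> 1" for k using w[of k] by (simp add: W_def power_le_one)
      from this[of m] this[of n] have "2 * (norm (w m))\<^sup>2 + 2 * (norm (w n))\<^sup>2 \<le> 4" by linarith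
      ultimately show ?thesis using 1 by linarith
    qed
    have "Cauchy w"
      unfolding Cauchy_def
    proof (intro allI impI)
      fix e :: real assume e: "e > 0"
      \<comment> \<open>The cap at 1 keeps 2 - d nonnegative, so that squaring below preserves the
        inequality.\<close>
      define d where "d = min (e\<^sup>2 / 4) 1"
      have d: "d > 0" "d \<le> 1" "d \<le> e\<^sup>2 / 4" using e by (auto simp: d_def)
      obtain N where N: "\<And>n. n \<ge> N \<Longrightarrow> norm (X (w n) - l) < s * d / 2"
        using LIMSEQ_D[OF wl, of "s * d / 2"] sp d by auto
      have "dist (w m) (w n) < e" if "m \<ge> N" "n \<ge> N" for m n
      proof -
        have "norm (2 *\<^sub>R l) \<le> norm (X (w m) + X (w n)) + norm (X (w m) - l) + norm (X (w n) - l)"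
        proof -
          have "2 *\<^sub>R l = (X (w m) + X (w n)) - (X (w m) - l) - (X (w n) - l)" by (simp add: scaleR_2)
          then have "norm (2 *\<^sub>R l) \<le> norm ((X (w m) + X (w n)) - (X (w m) - l)) + norm (X (w n) - l)"
            by (simp only: norm_triangle_ineq4)
          moreover have "norm ((X (w m) + X (w n)) - (X (w m) - l)) \<le> norm (X (w m) + X (w n)) + norm (X (w m) - l)"
            by (rule norm_triangle_ineq4)
          ultimately show ?thesis by linarith
        qed
        then have "2 * s - s * d \<le> norm (X (w m) + X (w n))"
          using N[OF that(1)] N[OF that(2)] nl by simp
        then have "(2 * s - s * d) / s \<le> norm (X (w m) + X (w n)) / s" using sp by (intro divide_right_mono) auto
        moreover have "(2 * s - s * d) / s = 2 - d" using sp by (simp add: field_simps)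
        ultimately have "(2 - d)\<^sup>2 \<le> (norm (X (w m) + X (w n)) / s)\<^sup>2" using d by (intro power_mono) auto
        with par[of m n] have "(norm (w m - w n))\<^sup>2 \<le> 4 - (2 - d)\<^sup>2" by linarith
        also have "... < 4 * d" using d by (simp add: power2_eq_square algebra_simps)
        also have "... \<le> e\<^sup>2" using d by simp
        finally have "norm (w m - w n) < e" by (rule power2_less_imp_less) (use e in simp)
        then show ?thesis by (simp add: dist_norm)
      qed
      then show "\<exists>M. \<forall>m\<ge>M. \<forall>n\<ge>M. dist (w m) (w n) < e" by blast
    qed
    then obtain z where z: "w \<longlonglongrightarrow> z" using Cauchy_convergent by (auto simp: convergent_def)
    have zU: "z \<in> U" using closed_sequentially[OF U(1) _ z] w by (auto simp: W_def)
    have nz: "norm z \<le> 1"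
      by (rule tendsto_upperbound[OF tendsto_norm[OF z]]) (use w in \<open>auto simp: W_def\<close>)
    have "(\<lambda>n. X (w n)) \<longlonglongrightarrow> X z" by (rule blinfun.tendsto[OF tendsto_const z])
    then have Xz: "norm (X z) = s" using LIMSEQ_unique[OF wl] nl by metis
    have "s \<le> s * norm z" using bound[OF zU] Xz by simp
    then have "norm z = 1" using nz sp by auto
    then show ?thesis using that[OF zU] Xz bound by simp
  qed
qed

text \<open>At a unit vector v where |X v| is maximal, with value s, equality in Cauchy-Schwarz
  forces X (X v) = s^2 v. Then X v + s v is an eigenvector for s, unless it is zero, in which case v
  itself belongs to -s.\<close>

lemma eigenvector_exists:
  fixes X :: "'a::complex_hilbert_space \<Rightarrow>\<^sub>L 'a"
  assumes X: "compact_op X" and sym: "\<And>x y. cinner (X x) y = cinner x (X y)"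
    and U: "closed U" "subspace U" and inv: "\<And>x. x \<in> U \<Longrightarrow> X x \<in> U" and u: "u \<in> U" "u \<noteq> 0"
  obtains w k where "w \<in> U" "norm w = 1" "X w = k *\<^sub>R w"
proof -
  obtain v where v: "v \<in> U" "norm v = 1" and max: "\<And>x. x \<in> U \<Longrightarrow> norm (X x) \<le> norm (X v) * norm x"
    using norm_attained[OF X U u] by blast
  define s where "s = norm (X v)"
  have 1: "inner (X (X v)) v = s\<^sup>2"
    by (metis Re_cinner sym power2_norm_eq_inner s_def)
  have 2: "norm (X (X v)) \<le> s\<^sup>2"
    using max[OF inv[OF v(1)]] by (simp add: s_def power2_eq_square)
  have "(norm (X (X v) - s\<^sup>2 *\<^sub>R v))\<^sup>2 = (norm (X (X v)))\<^sup>2 - 2 * s\<^sup>2 * inner (X (X v)) v + (s\<^sup>2)\<^sup>2 * (norm v)\<^sup>2"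
    unfolding power2_norm_eq_inner inner_diff_left inner_diff_right inner_scaleR_left inner_scaleR_right
      inner_commute[of v "X (X v)"]
    by (simp add: algebra_simps power2_eq_square)
  also have "... = (norm (X (X v)))\<^sup>2 - (s\<^sup>2)\<^sup>2" using v(2) 1 by (simp add: power2_eq_square)
  also have "... \<le> 0" using power_mono[OF 2, of 2] by simp
  finally have XX: "X (X v) = s\<^sup>2 *\<^sub>R v" by simp
  define w where "w = X v + s *\<^sub>R v"
  have wU: "w \<in> U" using v(1) inv U(2) by (simp add: w_def subspace_add subspace_scale)
  have Xw: "X w = s *\<^sub>R w"
    by (simp add: w_def blinfun.add_right blinfun.scaleR_right XX scaleR_add_right power2_eq_square add.commute)
  show thesis
  proof (cases "w = 0")
    case True
    then have "X v = (- s) *\<^sub>R v" by (simp add: w_def add_eq_0_iff2)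
    then show ?thesis using that v by blast
  next
    case False
    show ?thesis
      by (rule that[of "(1 / norm w) *\<^sub>R w" s])
        (use False wU U(2) Xw in \<open>auto simp: subspace_scale blinfun.scaleR_right\<close>)
  qed
qed

text \<open>A maximal orthonormal set of eigenvectors misses nothing, because its orthogonal
  complement in \<open>U\<close> is closed and invariant and would contain another eigenvector.
  Admitting a subspace \<open>U\<close> allows, in \<open>eig_exists\<close>, a finite eigenbasis of
  a prescribed finite-dimensional space that includes vectors from the kernel.\<close>

lemma spectral_theorem:
  fixes X :: "'a::complex_hilbert_space \<Rightarrow>\<^sub>L 'a"
  assumes X: "compact_op X" and sym: "\<And>x y. cinner (X x) y = cinner x (X y)"
    and U: "closed U" "subspace U" and inv: "\<And>x. x \<in> U \<Longrightarrow> X x \<in> U"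
  obtains E where "onset E" "E \<subseteq> U" "\<And>e. e \<in> E \<Longrightarrow> \<exists>k::real. X e = k *\<^sub>R e"
    "\<And>x. x \<in> U \<Longrightarrow> (\<And>e. e \<in> E \<Longrightarrow> cinner x e = 0) \<Longrightarrow> x = 0"
proof -
  define S where "S = {x \<in> U. \<exists>k::real. X x = k *\<^sub>R x}"
  have on0: "onset ({}::'a set)" by (simp add: onset_def)
  obtain E where E: "onset E" "{} \<subseteq> E" "E \<subseteq> S"
    and max: "\<not> (\<exists>x\<in>S. norm x = 1 \<and> (\<forall>e\<in>E. cinner x e = 0))"
    by (rule maximal_onset_exists[OF on0 empty_subsetI[of S]])
  define V where "V = {x \<in> U. \<forall>e\<in>E. cinner x e = 0}"
  have V_eq: "V = U \<inter> (\<Inter>e\<in>E. (\<lambda>x. cinner x e) -` {0})" by (auto simp: V_def)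
  have "closed ((\<lambda>x. cinner x e) -` {0})" for e :: 'a
    by (intro continuous_closed_vimage closed_singleton)
      (simp add: linear_continuous_at[OF bounded_linear_cinner_left])
  then have Vc: "closed V" unfolding V_eq using U(1) by (intro closed_Int closed_INT) auto
  have Vs: "subspace V"
    using U(2) by (auto simp: V_def subspace_def cinner_add_left cinner_scaleR_left)
  have Vi: "X x \<in> V" if "x \<in> V" for x
  proof -
    have "cinner (X x) e = 0" if e: "e \<in> E" for e
    proof -
      obtain k :: real where "X e = k *\<^sub>R e" using E(3) e by (auto simp: S_def)
      then show ?thesis using \<open>x \<in> V\<close> e by (simp add: sym cinner_scaleR_right V_def)
    qed
    then show ?thesis using that inv by (simp add: V_def)
  qed
  show thesis
  proof (rule that[OF E(1)])
    show "E \<subseteq> U" "\<And>e. e \<in> E \<Longrightarrow> \<exists>k::real. X e = k *\<^sub>R e" using E(3) by (auto simp: S_def)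
    fix x assume "x \<in> U" and x: "\<And>e. e \<in> E \<Longrightarrow> cinner x e = 0"
    show "x = 0"
    proof (rule ccontr)
      assume "x \<noteq> 0"
      moreover have "x \<in> V" using \<open>x \<in> U\<close> x by (simp add: V_def)
      ultimately obtain w and k :: real where "w \<in> V" "norm w = 1" "X w = k *\<^sub>R w"
        using eigenvector_exists[OF X sym Vc Vs Vi] by blast
      then show False using max by (auto simp: V_def S_def)
    qed
  qed
qed

subsection \<open>Singular bases\<close>

text \<open>A full basis of eigenvectors of \<open>cadjoint X o\<^sub>L X\<close>, kernel included.
  Its vectors are mapped to mutually orthogonal vectors whose lengths are the singular values, so no
  separate list of singular values is kept.\<close>

definition sing_basis :: "('a::complex_hilbert_space \<Rightarrow>\<^sub>L 'a) \<Rightarrow> 'a set \<Rightarrow> bool"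
  where "sing_basis X E \<longleftrightarrow> orthonormal_basis E \<and> (\<forall>e\<in>E. cadjoint X (X e) = (norm (X e))\<^sup>2 *\<^sub>R e)"

lemma compact_closure_subset:
  fixes A C :: "'a::metric_space set"
  assumes "A \<subseteq> C" "compact C"
  shows "compact (closure A)"
proof -
  have "closure A \<subseteq> C" using assms by (simp add: closure_minimal compact_imp_closed)
  then have "closure A = C \<inter> closure A" by auto
  then show ?thesis using assms(2) by (metis closed_closure compact_Int_closed)
qed

lemma compact_op_compose_left:
  assumes "compact_op X" "clinear_op Y"
  shows "compact_op (Y o\<^sub>L X)"
proof -
  have "blinfun_apply (Y o\<^sub>L X) ` cball 0 1 \<subseteq> blinfun_apply Y ` closure (blinfun_apply X ` cball 0 1)"
    using closure_subset by fastforce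
  moreover have "compact (blinfun_apply Y ` closure (blinfun_apply X ` cball 0 1))"
    using assms(1) by (intro compact_continuous_image linear_continuous_on blinfun.bounded_linear_right)
      (simp add: compact_op_def)
  ultimately show ?thesis
    using assms compact_closure_subset by (auto simp: compact_op_def clinear_op_compose)
qed

lemma sing_basis_exists:
  assumes X: "compact_op X"
  shows "\<exists>E. sing_basis X E"
proof -
  have Xl: "clinear_op X" using X by (simp add: compact_op_def)
  define K where "K = cadjoint X o\<^sub>L X"
  have K: "compact_op K" unfolding K_def by (rule compact_op_compose_left[OF X clinear_cadjoint[OF Xl]])
  have Kc: "cinner (K x) y = cinner (X x) (X y)" for x y
    by (simp add: K_def cinner_cadjoint_left[OF Xl])
  have sym: "cinner (K x) y = cinner x (K y)" for x y
    unfolding Kc by (simp add: K_def cinner_cadjoint[OF Xl])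
  obtain E where E: "onset E" "\<And>e. e \<in> E \<Longrightarrow> \<exists>k::real. K e = k *\<^sub>R e"
    "\<And>x. (\<And>e. e \<in> E \<Longrightarrow> cinner x e = 0) \<Longrightarrow> x = 0"
    using spectral_theorem[OF K sym closed_UNIV subspace_UNIV] by (metis UNIV_I)
  have "orthonormal_basis E" using E(1,3) unfolding orthonormal_basis_def onset_def by blast
  moreover have "K e = (norm (X e))\<^sup>2 *\<^sub>R e" if e: "e \<in> E" for e
  proof -
    obtain k :: real where l: "K e = k *\<^sub>R e" using E(2)[OF e] by blast
    have "complex_of_real k = cinner (K e) e" using E(1) e by (simp add: l cinner_scaleR_left onset_def)
    also have "... = of_real ((norm (X e))\<^sup>2)" by (simp add: Kc cinner_self)
    finally have "k = (norm (X e))\<^sup>2" by (simp only: of_real_eq_iff)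
    then show ?thesis using l by simp
  qed
  ultimately show ?thesis by (auto simp: sing_basis_def K_def)
qed

lemma sing_basis_orthogonal:
  assumes "clinear_op X" "sing_basis X E" "e \<in> E" "f \<in> E"
  shows "cinner (X e) (X f) = (if e = f then of_real ((norm (X e))\<^sup>2) else 0)"
proof -
  have "cinner (X e) (X f) = cinner (cadjoint X (X e)) f" by (simp add: cinner_cadjoint_left[OF assms(1)])
  also have "... = of_real ((norm (X e))\<^sup>2) * cinner e f"
    using assms by (simp add: sing_basis_def cinner_scaleR_left)
  finally show ?thesis
    using assms onset_cinner[OF orthonormal_basis_onset, of E e f] by (simp add: sing_basis_def)
qed

text \<open>Only the quadratic form is assumed real; polarization at \<open>x + y\<close> and at
  \<open>scaleC \<i> x + y\<close> transfers this to the sesquilinear form.\<close>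

lemma positive_op_symmetric:
  assumes "positive_op A"
  shows "cinner (A x) y = cinner x (A y)"
proof -
  have real: "Im (cinner (A z) z) = 0" for z
    using assms by (auto simp: positive_op_def complex_is_Real_iff)
  have lin: "A (scaleC c z) = scaleC c (A z)" for c z using assms by (simp add: positive_op_def clinear_op_def)
  have im: "Im (cinner (A x) y) + Im (cinner (A y) x) = 0" for x y
    using real[of "x + y"] real[of x] real[of y]
    by (simp add: blinfun.add_right cinner_add_left cinner_add_right)
  have "Re (cinner (A x) y) - Re (cinner (A y) x) = 0"
    using im[of "scaleC \<i> x" y] by (simp add: lin cinner_scaleC_left cinner_scaleC_right)
  then have "cinner (A x) y = cnj (cinner (A y) x)"
    using im[of x y] by (intro complex_eqI) auto
  then show ?thesis by (metis cinner_commute)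
qed

section \<open>The trace of powers of the modulus\<close>

lemma has_sum_ennreal:
  assumes "(f has_sum S) A" "\<And>x. x \<in> A \<Longrightarrow> 0 \<le> f x"
  shows "((\<lambda>x. ennreal (f x)) has_sum ennreal S) A"
proof -
  have "((\<lambda>F. ennreal (sum f F)) \<longlongrightarrow> ennreal S) (finite_subsets_at_top A)"
    using assms(1) by (intro tendsto_ennrealI) (simp add: has_sum_def)
  moreover have "\<forall>\<^sub>F F in finite_subsets_at_top A. ennreal (sum f F) = (\<Sum>x\<in>F. ennreal (f x))"
    by (rule eventually_finite_subsets_at_top_weakI) (use assms(2) in \<open>auto simp: sum_ennreal subset_iff\<close>)
  ultimately show ?thesis unfolding has_sum_def by (rule Lim_transform_eventually)
qed

lemma infsum_swap_le_ennreal: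
  fixes f :: "'a \<Rightarrow> 'b \<Rightarrow> ennreal"
  shows "(\<Sum>\<^sub>\<infinity>x\<in>A. \<Sum>\<^sub>\<infinity>y\<in>B. f x y) \<le> (\<Sum>\<^sub>\<infinity>y\<in>B. \<Sum>\<^sub>\<infinity>x\<in>A. f x y)"
proof -
  have "(\<Sum>x\<in>F. \<Sum>\<^sub>\<infinity>y\<in>B. f x y) \<le> (\<Sum>\<^sub>\<infinity>y\<in>B. \<Sum>\<^sub>\<infinity>x\<in>A. f x y)" if F: "finite F" "F \<subseteq> A" for F
  proof -
    have "(\<Sum>x\<in>F. \<Sum>\<^sub>\<infinity>y\<in>B. f x y) = (\<Sum>\<^sub>\<infinity>y\<in>B. \<Sum>x\<in>F. f x y)"
      using F(1) by induction (simp_all add: infsum_add nonneg_summable_on_complete)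
    also have "... \<le> (\<Sum>\<^sub>\<infinity>y\<in>B. \<Sum>\<^sub>\<infinity>x\<in>A. f x y)"
    proof (rule infsum_mono)
      fix y
      have "infsum (\<lambda>x. f x y) F \<le> infsum (\<lambda>x. f x y) A"
        using F by (intro infsum_mono_neutral nonneg_summable_on_complete) auto
      then show "(\<Sum>x\<in>F. f x y) \<le> (\<Sum>\<^sub>\<infinity>x\<in>A. f x y)" using F by simp
    qed (simp_all add: nonneg_summable_on_complete)
    finally show ?thesis .
  qed
  then show ?thesis
    by (subst nonneg_infsum_complete) (auto intro!: SUP_least)
qed

lemma infsum_swap_ennreal:
  fixes f :: "'a \<Rightarrow> 'b \<Rightarrow> ennreal"
  shows "(\<Sum>\<^sub>\<infinity>x\<in>A. \<Sum>\<^sub>\<infinity>y\<in>B. f x y) = (\<Sum>\<^sub>\<infinity>y\<in>B. \<Sum>\<^sub>\<infinity>x\<in>A. f x y)"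
  by (intro antisym infsum_swap_le_ennreal)

text \<open>Resolves the definite descriptions behind \<open>modulus_op\<close> and
  \<open>powr_op\<close>: both operators are diagonal in \<open>E\<close>, and uniqueness is tested
  on \<open>E\<close>. The passage from the chosen trace basis to \<open>E\<close> is an exchange of
  sums of nonnegative terms followed by Parseval.\<close>

theorem trace_powr_modulus:
  fixes X :: "'a::complex_hilbert_space \<Rightarrow>\<^sub>L 'a"
  assumes X: "clinear_op X" and E: "sing_basis X E" and p: "p > 0"
  shows "trace_op (powr_op (modulus_op X) p) = (\<Sum>\<^sub>\<infinity>e\<in>E. ennreal (norm (X e) powr p))"
proof -
  let ?g = "\<lambda>f e. norm (X e) powr p * (cmod (cinner f e))\<^sup>2"
  have ob: "orthonormal_basis E" using E by (simp add: sing_basis_def)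
  have on: "onset E" by (rule orthonormal_basis_onset[OF ob])
  define K where "K = cadjoint X o\<^sub>L X"
  have Kl: "clinear_op K" by (simp add: K_def clinear_op_compose clinear_cadjoint X)
  have Ke: "K e = (norm (X e))\<^sup>2 *\<^sub>R e" if "e \<in> E" for e using E that by (simp add: K_def sing_basis_def)
  have sb: "norm (X e) \<le> norm X" if "e \<in> E" for e
    using norm_blinfun[of X e] onset_norm[OF on that] by simp
  obtain D where D: "clinear_op D" "\<And>e. e \<in> E \<Longrightarrow> D e = norm (X e) *\<^sub>R e"
    "\<And>x e. e \<in> E \<Longrightarrow> cinner (D x) e = complex_of_real (norm (X e)) * cinner x e"
    "\<And>x. ((\<lambda>e. complex_of_real (norm (X e) * (cmod (cinner x e))\<^sup>2)) has_sum cinner (D x) x) E"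
    using diagonal_op_exists[OF ob, of "\<lambda>e. norm (X e)" "norm X"] sb by auto
  have Dpos: "positive_op D"
    unfolding positive_op_def
  proof (intro conjI allI)
    show "clinear_op D" by (rule D(1))
    fix x
    have "((\<lambda>e. 0) has_sum Im (cinner (D x) x)) E"
      using has_sum_Im[OF D(4)[of x]] by simp
    then have "Im (cinner (D x) x) = 0" by (rule has_sum_unique) simp
    then show "cinner (D x) x \<in> \<real>" by (simp add: complex_is_Real_iff)
    show "0 \<le> Re (cinner (D x) x)"
      by (rule has_sum_nonneg[OF has_sum_Re[OF D(4)[of x]]]) simp
  qed
  have DD: "D o\<^sub>L D = K"
    by (rule op_eqI_basis[OF ob clinear_op_compose[OF D(1) D(1)] Kl])
      (simp add: D(2) blinfun.scaleR_right Ke power2_eq_square)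
  have mod: "modulus_op X = D"
    unfolding modulus_op_def K_def[symmetric]
  proof (rule the_equality)
    show "positive_op D \<and> D o\<^sub>L D = K" using Dpos DD by simp
    fix A assume A: "positive_op A \<and> A o\<^sub>L A = K"
    then have Al: "clinear_op A" by (simp add: positive_op_def)
    show "A = D"
    proof (rule op_eqI_basis[OF ob Al D(1)])
      fix e assume e: "e \<in> E"
      define s where "s = norm (X e)"
      have AA: "A (A e) = s\<^sup>2 *\<^sub>R e" using A Ke[OF e] unfolding s_def by (metis blinfun_apply_blinfun_compose)
      have Asym: "cinner (A x) y = cinner x (A y)" for x y using positive_op_symmetric A by blast
      have "A e = s *\<^sub>R e"
      proof (cases "s = 0")
        case True
        have "cinner (A e) (A e) = cinner (A (A e)) e" by (simp add: Asym)
        then have "cinner (A e) (A e) = 0" using AA True by simp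
        then have "A e = 0" by (simp add: cinner_self)
        then show ?thesis using True by simp
      next
        case False
        then have sp: "s > 0" by (simp add: s_def)
        \<comment> \<open>If nonzero, this would be an eigenvector of the positive operator
          \<open>A\<close> for the eigenvalue -s < 0.\<close>
        define w where "w = A e - s *\<^sub>R e"
        have "A w = (- s) *\<^sub>R w"
          by (simp add: w_def blinfun.diff_right blinfun.scaleR_right AA power2_eq_square algebra_simps)
        then have "Re (cinner (A w) w) = - s * (norm w)\<^sup>2" by (simp add: cinner_minus_left cinner_scaleR_left cinner_self)
        moreover have "0 \<le> Re (cinner (A w) w)" using A by (simp add: positive_op_def)
        ultimately have "s * (norm w)\<^sup>2 \<le> 0" by simp
        then have "w = 0" using sp by (simp add: mult_le_0_iff)
        then show ?thesis by (simp add: w_def)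
      qed
      then show "A e = D e" using D(2)[OF e] by (simp add: s_def)
    qed
  qed
  obtain B where B: "clinear_op B" "\<And>e. e \<in> E \<Longrightarrow> B e = (norm (X e) powr p) *\<^sub>R e"
    "\<And>x e. e \<in> E \<Longrightarrow> cinner (B x) e = complex_of_real (norm (X e) powr p) * cinner x e"
    "\<And>x. ((\<lambda>e. complex_of_real (norm (X e) powr p * (cmod (cinner x e))\<^sup>2)) has_sum cinner (B x) x) E"
  proof (rule diagonal_op_exists[OF ob, of "\<lambda>e. norm (X e) powr p" "norm X powr p"])
    fix e assume "e \<in> E"
    then show "\<bar>norm (X e) powr p\<bar> \<le> norm X powr p" using sb p by (simp add: powr_mono2)
  qed auto
  have pw: "powr_op D p = B"
    unfolding powr_op_def
  proof (rule the_equality, intro conjI allI impI)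
    show "clinear_op B" by (rule B(1))
    fix l :: real and x assume l: "l \<ge> 0" "D x = l *\<^sub>R x"
    have "cinner (B x - (l powr p) *\<^sub>R x) e = 0" if e: "e \<in> E" for e
    proof (cases "cinner x e = 0")
      case False
      have "complex_of_real (norm (X e)) * cinner x e = cinner (D x) e" by (simp only: D(3)[OF e])
      also have "... = complex_of_real l * cinner x e" by (simp add: l(2) cinner_scaleR_left)
      finally have "complex_of_real (norm (X e)) * cinner x e = complex_of_real l * cinner x e" .
      then have "norm (X e) = l" using False by auto
      then show ?thesis by (simp add: cinner_diff_left cinner_scaleR_left B(3)[OF e])
    qed (simp add: cinner_diff_left cinner_scaleR_left B(3)[OF e])
    then have "B x - (l powr p) *\<^sub>R x = 0" using ob unfolding orthonormal_basis_def by blast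
    then show "B x = (l powr p) *\<^sub>R x" by simp
  next
    fix B' assume B': "clinear_op B' \<and> (\<forall>l\<ge>0. \<forall>x. D x = l *\<^sub>R x \<longrightarrow> B' x = (l powr p) *\<^sub>R x)"
    then have B'l: "clinear_op B'" by simp
    show "B' = B"
    proof (rule op_eqI_basis[OF ob B'l B(1)])
      fix e assume e: "e \<in> E"
      then have "B' e = (norm (X e) powr p) *\<^sub>R e" using B' D(2)[OF e] norm_ge_zero by blast
      then show "B' e = B e" using B(2)[OF e] by simp
    qed
  qed
  define E0 :: "'a set" where "E0 = (SOME E. orthonormal_basis E)"
  have E0: "orthonormal_basis E0" unfolding E0_def by (rule someI_ex[OF orthonormal_basis_exists])
  have "trace_op B = (\<Sum>\<^sub>\<infinity>f\<in>E0. \<Sum>\<^sub>\<infinity>e\<in>E. ennreal (?g f e))"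
    unfolding trace_op_def E0_def[symmetric]
  proof (rule infsum_cong)
    fix f assume "f \<in> E0"
    have "((\<lambda>e. ?g f e) has_sum Re (cinner (B f) f)) E"
      using has_sum_Re[OF B(4)[of f]] by simp
    then show "ennreal (Re (cinner (B f) f)) = (\<Sum>\<^sub>\<infinity>e\<in>E. ennreal (?g f e))"
      by (intro infsumI[symmetric] has_sum_ennreal) auto
  qed
  also have "... = (\<Sum>\<^sub>\<infinity>e\<in>E. \<Sum>\<^sub>\<infinity>f\<in>E0. ennreal (?g f e))"
    by (rule infsum_swap_ennreal)
  also have "... = (\<Sum>\<^sub>\<infinity>e\<in>E. ennreal (norm (X e) powr p))"
  proof (rule infsum_cong)
    fix e assume e: "e \<in> E"
    have "cmod (cinner f e) = cmod (cinner e f)" for f by (metis cinner_commute complex_mod_cnj)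
    then have "((\<lambda>f. ?g f e) has_sum norm (X e) powr p * (norm e)\<^sup>2) E0"
      using has_sum_cmult_right[OF parseval[OF E0, of e]] by simp
    then have "((\<lambda>f. ?g f e) has_sum norm (X e) powr p) E0"
      using onset_norm[OF on e] by simp
    then show "(\<Sum>\<^sub>\<infinity>f\<in>E0. ennreal (?g f e)) = ennreal (norm (X e) powr p)"
      by (intro infsumI has_sum_ennreal) auto
  qed
  finally show ?thesis by (simp add: mod pw)
qed

text \<open>The functional F of the overview, which behaves better than the norm: it is a sum over
  singular values. An infinite trace is sent to 0, so values outside \<open>schatten p\<close> carry
  no information.\<close>

definition spow :: "real \<Rightarrow> ('a::complex_hilbert_space \<Rightarrow>\<^sub>L 'a) \<Rightarrow> real"
  where "spow p X = enn2real (trace_op (powr_op (modulus_op X) p))"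

lemma spow_nonneg [simp]: "0 \<le> spow p X"
  by (simp add: spow_def)

lemma schatten_norm_spow: "schatten_norm p X = spow p X powr (1 / p)"
  by (simp add: schatten_norm_def spow_def)

lemma schatten_norm_nonneg [simp]: "0 \<le> schatten_norm p X"
  by (simp add: schatten_norm_spow)

lemma schatten_norm_powr: "p > 0 \<Longrightarrow> schatten_norm p X powr p = spow p X"
  by (cases "spow p X = 0") (simp_all add: schatten_norm_spow powr_powr)

lemma spowI:
  assumes "compact_op X" "sing_basis X E" "p > 0" "((\<lambda>e. norm (X e) powr p) has_sum S) E"
  shows "X \<in> schatten p" "spow p X = S"
proof -
  have "trace_op (powr_op (modulus_op X) p) = ennreal S"
    using trace_powr_modulus[of X E p] assms has_sum_ennreal[OF assms(4)]
    by (simp add: compact_op_def infsumI)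
  moreover have "0 \<le> S" by (rule has_sum_nonneg[OF assms(4)]) simp
  ultimately show "X \<in> schatten p" "spow p X = S" using assms(1) by (auto simp: schatten_def spow_def)
qed

lemma spow_has_sum:
  assumes "X \<in> schatten p" "sing_basis X E" "p > 0"
  shows "((\<lambda>e. norm (X e) powr p) has_sum spow p X) E"
proof -
  have X: "compact_op X" using assms(1) by (simp add: schatten_def)
  have tr: "trace_op (powr_op (modulus_op X) p) = (\<Sum>\<^sub>\<infinity>e\<in>E. ennreal (norm (X e) powr p))"
    using trace_powr_modulus[of X E p] assms X by (simp add: compact_op_def)
  define T where "T = trace_op (powr_op (modulus_op X) p)"
  have T: "T < \<infinity>" using assms(1) by (simp add: schatten_def T_def)
  have "(\<lambda>e. norm (X e) powr p) summable_on E"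
  proof (rule nonneg_bdd_above_summable_on, simp, rule bdd_aboveI2)
    fix F assume F: "F \<in> {F. F \<subseteq> E \<and> finite F}"
    have "ennreal (\<Sum>e\<in>F. norm (X e) powr p) = (\<Sum>e\<in>F. ennreal (norm (X e) powr p))"
      by (simp add: sum_ennreal)
    also have "... \<le> T"
    proof -
      have "infsum (\<lambda>e. ennreal (norm (X e) powr p)) F \<le> infsum (\<lambda>e. ennreal (norm (X e) powr p)) E"
        using F by (intro infsum_mono_neutral nonneg_summable_on_complete) auto
      then show ?thesis using F by (simp add: T_def tr)
    qed
    finally have "enn2real (ennreal (\<Sum>e\<in>F. norm (X e) powr p)) \<le> enn2real T"
      using T by (intro enn2real_mono) (auto simp: less_top)
    then show "(\<Sum>e\<in>F. norm (X e) powr p) \<le> enn2real T" by (simp add: sum_nonneg)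
  qed
  then have *: "((\<lambda>e. norm (X e) powr p) has_sum (\<Sum>\<^sub>\<infinity>e\<in>E. norm (X e) powr p)) E" by simp
  then show ?thesis using spowI(2)[OF X assms(2,3) *] by simp
qed

subsection \<open>Bessel families and the variational description of the Schatten norm\<close>

text \<open>Equivalently, sending coefficients c i to the sum of the c i x i is a contraction.
  Unlike orthonormality this is preserved by contractions, which makes the ideal property of the
  Schatten class immediate.\<close>

definition bessel_fam :: "'i set \<Rightarrow> ('i \<Rightarrow> 'a::complex_hilbert_space) \<Rightarrow> bool"
  where "bessel_fam I x \<longleftrightarrow> finite I \<and> (\<forall>z. (\<Sum>i\<in>I. (cmod (cinner z (x i)))\<^sup>2) \<le> (norm z)\<^sup>2)"

definition on_fam :: "'i set \<Rightarrow> ('i \<Rightarrow> 'a::complex_hilbert_space) \<Rightarrow> bool"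
  where "on_fam I x \<longleftrightarrow> (\<forall>i\<in>I. \<forall>j\<in>I. cinner (x i) (x j) = (if i = j then 1 else 0))"

lemma cmod_cinner_commute: "cmod (cinner x y) = cmod (cinner y (x::'a::complex_hilbert_space))"
  by (metis cinner_commute complex_mod_cnj)

lemma on_fam_onset: "on_fam I x \<Longrightarrow> onset (x ` I)" and on_fam_inj: "on_fam I x \<Longrightarrow> inj_on x I"
proof -
  assume *: "on_fam I x"
  show inj: "inj_on x I"
  proof (rule inj_onI, rule ccontr)
    fix i j assume "i \<in> I" "j \<in> I" "x i = x j" "i \<noteq> j"
    moreover have "cinner (x i) (x i) = 1" "cinner (x i) (x j) = 0"
      using * \<open>i \<in> I\<close> \<open>j \<in> I\<close> \<open>i \<noteq> j\<close> unfolding on_fam_def by (metis (full_types))+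
    ultimately show False by simp
  qed
  show "onset (x ` I)" using * by (auto simp: on_fam_def onset_def)
qed

lemma on_fam_bessel:
  assumes "on_fam I x" "finite I"
  shows "bessel_fam I x"
proof -
  have "(\<Sum>i\<in>I. (cmod (cinner z (x i)))\<^sup>2) = (\<Sum>e\<in>x ` I. (cmod (cinner z e))\<^sup>2)" for z
    using on_fam_inj[OF assms(1)] by (simp add: sum.reindex)
  then show ?thesis
    using bessel[OF on_fam_onset[OF assms(1)], of "x ` I"] assms(2) by (simp add: bessel_fam_def)
qed

lemma cmod_cinner_self: "cmod (cinner x (x::'a::complex_hilbert_space)) = (norm x)\<^sup>2"
  by (simp add: cinner_self norm_power)

lemma bessel_fam_norm_le:
  assumes "bessel_fam I x" "i \<in> I"
  shows "norm (x i) \<le> 1"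
proof (cases "norm (x i) = 0")
  case False
  have "(cmod (cinner (x i) (x i)))\<^sup>2 \<le> (\<Sum>j\<in>I. (cmod (cinner (x i) (x j)))\<^sup>2)"
    by (rule member_le_sum[OF assms(2), of "\<lambda>j. (cmod (cinner (x i) (x j)))\<^sup>2"])
      (use assms(1) in \<open>auto simp: bessel_fam_def\<close>)
  also have "... \<le> (norm (x i))\<^sup>2" using assms(1) by (simp add: bessel_fam_def)
  finally have "(norm (x i))\<^sup>2 * (norm (x i))\<^sup>2 \<le> 1 * (norm (x i))\<^sup>2"
    by (simp add: cmod_cinner_self power2_eq_square)
  then have "(norm (x i))\<^sup>2 \<le> 1" using False by (subst (asm) mult_le_cancel_right) auto
  then show ?thesis by (simp add: power2_le_iff_abs_le[of 1 "norm (x i)", simplified] abs_square_le_1)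
qed simp

text \<open>The tangent of the convex function \<open>s powr p\<close> at \<open>c\<close> lies
  below its graph. It is affine in \<open>s\<close>, so it can be averaged with weights, and the
  point \<open>c\<close> may be chosen afterwards.\<close>

lemma Young_tangent:
  fixes p s c :: real
  assumes "p \<ge> 1" "s \<ge> 0" "c \<ge> 0"
  shows "p * c powr (p - 1) * s \<le> s powr p + (p - 1) * c powr p"
proof (cases "p = 1 \<or> c = 0")
  case False
  define q where "q = p / (p - 1)"
  have p: "p > 1" using False assms by auto
  have "s * c powr (p - 1) \<le> s powr p / p + (c powr (p - 1)) powr q / q"
    by (rule Youngs_inequality) (use p assms in \<open>auto simp: q_def field_simps\<close>)
  also have "(c powr (p - 1)) powr q = c powr p" using p by (simp add: powr_powr q_def)
  finally have "p * (s * c powr (p - 1)) \<le> p * (s powr p / p + c powr p / q)"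
    using p by (intro mult_left_mono) auto
  also have "... = s powr p + (p - 1) * c powr p" using p by (simp add: q_def field_simps)
  finally show ?thesis by (simp add: mult_ac)
next
  case True
  then show ?thesis using assms by auto
qed

lemma has_sum_sum_finite:
  fixes f :: "'i \<Rightarrow> 'b \<Rightarrow> 'c::topological_comm_monoid_add"
  assumes "finite I" "\<And>i. i \<in> I \<Longrightarrow> (f i has_sum S i) A"
  shows "((\<lambda>x. \<Sum>i\<in>I. f i x) has_sum (\<Sum>i\<in>I. S i)) A"
  using assms by (induction I rule: finite_induct) (auto intro!: has_sum_add)

text \<open>The matrix \<open>d i e = (|\<langle>x\<^sub>i, e\<rangle>|\<^sup>2 + |\<langle>u\<^sub>e, y\<^sub>i\<rangle>|\<^sup>2) / 2\<close> is doubly substochastic, so the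
  convexity of the \<open>p\<close>-th power, in the form of its tangent inequality, applies row by row.\<close>

lemma spow_bessel:
  fixes X :: "'a::complex_hilbert_space \<Rightarrow>\<^sub>L 'a"
  assumes X: "X \<in> schatten p" and p: "p \<ge> 1" and x: "bessel_fam I x" and y: "bessel_fam I y"
  shows "(\<Sum>i\<in>I. cmod (cinner (X (x i)) (y i)) powr p) \<le> spow p X"
proof -
  let ?c = "\<lambda>i. cmod (cinner (X (x i)) (y i))"
  have Xc: "compact_op X" using X by (simp add: schatten_def)
  have Xl: "clinear_op X" using Xc by (simp add: compact_op_def)
  obtain E where E: "sing_basis X E" using sing_basis_exists[OF Xc] by blast
  have ob: "orthonormal_basis E" using E by (simp add: sing_basis_def)
  have on: "onset E" by (rule orthonormal_basis_onset[OF ob])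
  define s where "s e = norm (X e)" for e
  \<comment> \<open>Division by zero gives \<open>u e = 0\<close> on the kernel; orthonormality
    holds on \<open>E1\<close>, the Bessel inequality on all of \<open>E\<close>.\<close>
  define u where "u e = (1 / s e) *\<^sub>R X e" for e
  have Xu: "X e = s e *\<^sub>R u e" for e by (cases "s e = 0") (simp_all add: u_def s_def)
  have nu: "norm (u e) \<le> 1" for e by (simp add: u_def s_def)
  define E1 where "E1 = {e \<in> E. s e \<noteq> 0}"
  have u0: "u e = 0" if "s e = 0" for e using that by (simp add: u_def)
  have onu: "on_fam E1 u"
    unfolding on_fam_def
    using sing_basis_orthogonal[OF Xl E]
    by (auto simp: E1_def u_def s_def cinner_scaleR_left cinner_scaleR_right power2_eq_square)
  define d where "d i e = ((cmod (cinner (x i) e))\<^sup>2 + (cmod (cinner (u e) (y i)))\<^sup>2) / 2" for i e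
  let ?D = "\<lambda>i. \<Sum>\<^sub>\<infinity>e\<in>E. d i e * s e powr p"
  have d0: "0 \<le> d i e" for i e by (simp add: d_def)
  have col: "(\<Sum>i\<in>I. d i e) \<le> 1" if e: "e \<in> E" for e
  proof -
    have "(\<Sum>i\<in>I. (cmod (cinner (x i) e))\<^sup>2) \<le> 1"
      using x onset_norm[OF on e] by (subst cmod_cinner_commute) (auto simp: bessel_fam_def dest: spec[of _ e])
    moreover have "(\<Sum>i\<in>I. (cmod (cinner (u e) (y i)))\<^sup>2) \<le> (norm (u e))\<^sup>2" using y by (simp add: bessel_fam_def)
    moreover have "(norm (u e))\<^sup>2 \<le> 1" using nu[of e] by (simp add: power_le_one)
    ultimately show ?thesis by (simp add: d_def sum_divide_distrib[symmetric] sum.distrib)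
  qed
  have usum: "(\<Sum>e\<in>F. (cmod (cinner (u e) z))\<^sup>2) \<le> (norm z)\<^sup>2" if F: "finite F" "F \<subseteq> E" for F z
  proof -
    have "(\<Sum>e\<in>F. (cmod (cinner (u e) z))\<^sup>2) = (\<Sum>e\<in>F \<inter> E1. (cmod (cinner (u e) z))\<^sup>2)"
      using F by (intro sum.mono_neutral_right) (auto simp: E1_def u0)
    also have "bessel_fam (F \<inter> E1) u"
      by (rule on_fam_bessel) (use onu F in \<open>auto simp: on_fam_def\<close>)
    then have "(\<Sum>e\<in>F \<inter> E1. (cmod (cinner (u e) z))\<^sup>2) \<le> (norm z)\<^sup>2"
      by (subst cmod_cinner_commute) (simp add: bessel_fam_def)
    finally show ?thesis .
  qed
  have row: "d i summable_on E \<and> infsum (d i) E \<le> 1" if i: "i \<in> I" for i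
  proof -
    have "(norm (x i))\<^sup>2 \<le> 1" "(norm (y i))\<^sup>2 \<le> 1"
      using bessel_fam_norm_le[OF x i] bessel_fam_norm_le[OF y i] by (simp_all add: power_le_one)
    then have b: "(\<Sum>e\<in>F. d i e) \<le> 1" if "finite F" "F \<subseteq> E" for F
      using bessel[OF on that, of "x i"] usum[OF that, of "y i"]
      by (simp add: d_def sum_divide_distrib[symmetric] sum.distrib)
    then have "d i summable_on E" using d0 by (intro nonneg_bdd_above_summable_on bdd_aboveI2) auto
    then show ?thesis using b by (auto intro: infsum_le_finite_sums)
  qed
  have sp: "((\<lambda>e. s e powr p) has_sum spow p X) E"
    unfolding s_def using spow_has_sum[OF X E] p by simp
  have d1: "d i e \<le> 1" if "i \<in> I" "e \<in> E" for i e
    using member_le_sum[OF that(1), of "\<lambda>i. d i e"] d0 col[OF that(2)] x by (auto simp: bessel_fam_def)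
  have ds: "(\<lambda>e. d i e * s e powr p) summable_on E" if "i \<in> I" for i
    by (rule summable_on_comparison_test[OF has_sum_imp_summable[OF sp]])
      (use d0 d1[OF that] in \<open>auto intro: mult_left_le_one_le\<close>)
  have main: "?c i powr p \<le> ?D i" if i: "i \<in> I" for i
  proof (cases "?c i = 0")
    case True
    then show ?thesis using d0 by (auto intro!: infsum_nonneg)
  next
    case False
    define c where "c = ?c i"
    \<comment> \<open>The tangent is taken at the very value \<open>c\<close> to be estimated: then
      K c = p c^p, and the surplus (p - 1) c^p cancels against the constant term.\<close>
    define K where "K = p * c powr (p - 1)"
    have c: "c > 0" using False by (simp add: c_def)
    have K: "K > 0" using c p by (simp add: K_def)
    define t where "t e = cmod (cinner (x i) e * cinner (X e) (y i))" for e
    define g where "g e = d i e * s e powr p + (p - 1) * c powr p * d i e" for e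
    have t_le: "K * t e \<le> g e" for e
    proof -
      have "t e = s e * (cmod (cinner (x i) e) * cmod (cinner (u e) (y i)))"
        by (simp add: t_def Xu cinner_scaleR_left norm_mult) (simp add: s_def)
      also have "... \<le> s e * d i e"
      proof (rule mult_left_mono)
        have "0 \<le> (cmod (cinner (x i) e) - cmod (cinner (u e) (y i)))\<^sup>2" by simp
        then show "cmod (cinner (x i) e) * cmod (cinner (u e) (y i)) \<le> d i e"
          by (simp add: d_def power2_eq_square algebra_simps)
      qed (simp add: s_def)
      finally have "K * t e \<le> (K * s e) * d i e" using K by (simp add: mult.assoc)
      also have "... \<le> (s e powr p + (p - 1) * c powr p) * d i e"
        unfolding K_def using c d0 by (intro mult_right_mono Young_tangent p) (auto simp: s_def)
      finally show ?thesis by (simp add: g_def algebra_simps)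
    qed
    have gs: "(g has_sum ?D i + (p - 1) * c powr p * infsum (d i) E) E"
      unfolding g_def by (intro has_sum_add has_sum_cmult_right has_sum_infsum ds[OF i]) (use row[OF i] in blast)
    have "(\<lambda>e. K * t e) summable_on E"
      by (rule summable_on_comparison_test[OF has_sum_imp_summable[OF gs] t_le]) (use K in \<open>simp add: t_def\<close>)
    then have Kt: "((\<lambda>e. K * t e) has_sum infsum (\<lambda>e. K * t e) E) E" by simp
    have "((\<lambda>e. (1 / K) * (K * t e)) has_sum (1 / K) * infsum (\<lambda>e. K * t e) E) E"
      by (rule has_sum_cmult_right[OF Kt])
    then have ts: "(t has_sum (1 / K) * infsum (\<lambda>e. K * t e) E) E" using K by simp
    have "((\<lambda>e. cinner (scaleC (cinner (x i) e) (X e)) (y i)) has_sum cinner (X (x i)) (y i)) E"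
      by (rule has_sum_bounded_linear[OF bounded_linear_cinner_left op_expansion[OF ob Xl]])
    then have "((\<lambda>e. cinner (x i) e * cinner (X e) (y i)) has_sum cinner (X (x i)) (y i)) E"
      by (simp add: cinner_scaleC_left)
    from norm_has_sum_bound[OF ts[unfolded t_def] this]
    have "c \<le> (1 / K) * infsum (\<lambda>e. K * t e) E" by (simp add: c_def t_def)
    then have "K * c \<le> infsum (\<lambda>e. K * t e) E" using K by (simp add: field_simps)
    also have "... \<le> ?D i + (p - 1) * c powr p * infsum (d i) E"
      by (rule has_sum_mono[OF Kt gs t_le])
    also have "... \<le> ?D i + (p - 1) * c powr p"
      using row[OF i] p by (intro add_left_mono mult_left_le) auto
    also have "K * c = p * c powr p" using c by (simp add: K_def powr_diff)
    finally show ?thesis by (simp add: c_def algebra_simps)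
  qed
  have fin: "finite I" using x by (simp add: bessel_fam_def)
  have "(\<Sum>i\<in>I. ?c i powr p) \<le> (\<Sum>i\<in>I. \<Sum>\<^sub>\<infinity>e\<in>E. d i e * s e powr p)"
    by (rule sum_mono[OF main])
  also have "... \<le> spow p X"
  proof (rule has_sum_mono[OF _ sp])
    show "((\<lambda>e. \<Sum>i\<in>I. d i e * s e powr p) has_sum (\<Sum>i\<in>I. \<Sum>\<^sub>\<infinity>e\<in>E. d i e * s e powr p)) E"
      by (rule has_sum_sum_finite[OF fin]) (simp add: ds)
    fix e assume "e \<in> E"
    then show "(\<Sum>i\<in>I. d i e * s e powr p) \<le> s e powr p"
      using col by (simp add: sum_distrib_right[symmetric] mult_left_le_one_le sum_nonneg d0)
  qed
  finally show ?thesis .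
qed

text \<open>Converse of \<open>spow_bessel\<close>: for e in a singular basis and u the normalized
  image of e, the tested sum consists of the powers of the singular values. The two results together
  describe the norm as a supremum, from which sums and products are estimated termwise.\<close>

lemma schattenI:
  fixes X :: "'a::complex_hilbert_space \<Rightarrow>\<^sub>L 'a"
  assumes X: "compact_op X" and p: "p > 0"
    and bound: "\<And>F u. finite F \<Longrightarrow> bessel_fam F (\<lambda>e. e) \<Longrightarrow> bessel_fam F u \<Longrightarrow>
      (\<Sum>e\<in>F. cmod (cinner (X e) (u e)) powr p) \<le> C"
  shows "X \<in> schatten p" "spow p X \<le> C"
proof -
  have Xl: "clinear_op X" using X by (simp add: compact_op_def)
  obtain E where E: "sing_basis X E" using sing_basis_exists[OF X] by blast
  have on: "onset E" using E orthonormal_basis_onset by (auto simp: sing_basis_def)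
  have b: "(\<Sum>e\<in>F. norm (X e) powr p) \<le> C" if F: "finite F" "F \<subseteq> E" for F
  proof -
    define F' where "F' = {e \<in> F. X e \<noteq> 0}"
    define u where "u e = (1 / norm (X e)) *\<^sub>R X e" for e
    have F': "finite F'" "F' \<subseteq> E" using F by (auto simp: F'_def)
    have "on_fam F' u"
      using sing_basis_orthogonal[OF Xl E] F'(2)
      by (auto simp: on_fam_def u_def F'_def cinner_scaleR_left cinner_scaleR_right power2_eq_square subset_iff)
    moreover have "on_fam F' (\<lambda>e. e)" using on F'(2) by (auto simp: on_fam_def onset_cinner subset_iff)
    ultimately have "(\<Sum>e\<in>F'. cmod (cinner (X e) (u e)) powr p) \<le> C"
      using F' by (intro bound on_fam_bessel)
    moreover have "cmod (cinner (X e) (u e)) = norm (X e)" for e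
      by (simp add: u_def cinner_scaleR_right cinner_self norm_mult norm_power power2_eq_square norm_divide)
    moreover have "(\<Sum>e\<in>F. norm (X e) powr p) = (\<Sum>e\<in>F'. norm (X e) powr p)"
      using F by (intro sum.mono_neutral_right) (auto simp: F'_def)
    ultimately show ?thesis by simp
  qed
  then have s: "(\<lambda>e. norm (X e) powr p) summable_on E"
    by (intro nonneg_bdd_above_summable_on bdd_aboveI2) auto
  then have hs: "((\<lambda>e. norm (X e) powr p) has_sum (\<Sum>\<^sub>\<infinity>e\<in>E. norm (X e) powr p)) E" by simp
  show "X \<in> schatten p" by (rule spowI(1)[OF X E p hs])
  have "(\<Sum>\<^sub>\<infinity>e\<in>E. norm (X e) powr p) \<le> C" by (rule infsum_le_finite_sums[OF s b])
  then show "spow p X \<le> C" by (simp add: spowI(2)[OF X E p hs])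
qed

subsection \<open>The Schatten class as a two-sided ideal\<close>

lemma compact_op_add:
  assumes "compact_op X" "compact_op Y"
  shows "compact_op (X + Y)"
proof -
  let ?A = "closure (blinfun_apply X ` cball 0 1)" and ?B = "closure (blinfun_apply Y ` cball 0 1)"
  have sub: "blinfun_apply (X + Y) ` cball 0 1 \<subseteq> {x + y |x y. x \<in> ?A \<and> y \<in> ?B}"
  proof
    fix z assume "z \<in> blinfun_apply (X + Y) ` cball 0 1"
    then obtain w where w: "w \<in> cball 0 1" "z = X w + Y w" by (auto simp: blinfun.add_left)
    have "X w \<in> ?A" "Y w \<in> ?B" using w(1) by (auto intro!: closure_subset[THEN subsetD])
    then show "z \<in> {x + y |x y. x \<in> ?A \<and> y \<in> ?B}" using w(2) by blast
  qed
  have "compact {x + y |x y. x \<in> ?A \<and> y \<in> ?B}"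
    using assms by (intro compact_sums) (auto simp: compact_op_def)
  then have "compact (closure (blinfun_apply (X + Y) ` cball 0 1))"
    using sub by (rule compact_closure_subset[rotated])
  then show ?thesis
    using assms by (auto simp: compact_op_def clinear_op_def blinfun.add_left scaleC_add_right)
qed

lemma compact_op_scaleR:
  assumes "compact_op X"
  shows "compact_op (c *\<^sub>R X)"
proof -
  have "blinfun_apply (c *\<^sub>R X) ` cball 0 1 \<subseteq> (\<lambda>x. c *\<^sub>R x) ` closure (blinfun_apply X ` cball 0 1)"
    using closure_subset by (fastforce simp: blinfun.scaleR_left)
  moreover have "compact ((\<lambda>x. c *\<^sub>R x) ` closure (blinfun_apply X ` cball 0 1))"
    using assms by (intro compact_scaling) (simp add: compact_op_def)
  ultimately show ?thesis
    using assms compact_closure_subset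
    by (auto simp: compact_op_def clinear_op_def blinfun.scaleR_left scaleC_scaleR)
qed

lemma compact_op_compose_right:
  assumes "compact_op X" "clinear_op Y"
  shows "compact_op (X o\<^sub>L Y)"
proof -
  have "blinfun_apply (X o\<^sub>L Y) ` cball 0 1 \<subseteq> (\<lambda>x. norm Y *\<^sub>R x) ` closure (blinfun_apply X ` cball 0 1)"
  proof
    fix z assume "z \<in> blinfun_apply (X o\<^sub>L Y) ` cball 0 1"
    then obtain w where w: "norm w \<le> 1" "z = X (Y w)" by auto
    define v where "v = (1 / norm Y) *\<^sub>R Y w"
    have "norm (Y w) \<le> norm Y" using norm_blinfun[of Y w] mult_left_mono[OF w(1), of "norm Y"] by simp
    then have v: "norm v \<le> 1" "Y w = norm Y *\<^sub>R v"
      by (auto simp: v_def divide_le_eq_1)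
    then have "X v \<in> closure (blinfun_apply X ` cball 0 1)" using closure_subset by force
    then show "z \<in> (\<lambda>x. norm Y *\<^sub>R x) ` closure (blinfun_apply X ` cball 0 1)"
      using v(2) w(2) by (auto simp: blinfun.scaleR_right)
  qed
  moreover have "compact ((\<lambda>x. norm Y *\<^sub>R x) ` closure (blinfun_apply X ` cball 0 1))"
    using assms by (intro compact_scaling) (simp add: compact_op_def)
  ultimately show ?thesis
    using assms compact_closure_subset by (auto simp: compact_op_def clinear_op_compose)
qed

text \<open>The constant \<open>2 powr p\<close> is crude but sufficient: it makes the class a
  subspace and serves as the quasi-triangle inequality in \<open>power_functional\<close>.\<close>

lemma schatten_add:
  assumes X: "X \<in> schatten p" and Y: "Y \<in> schatten p" and p: "p \<ge> 1"
  shows "X + Y \<in> schatten p" "spow p (X + Y) \<le> 2 powr p * (spow p X + spow p Y)"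
proof -
  have c: "compact_op (X + Y)" using X Y by (intro compact_op_add) (auto simp: schatten_def)
  have b: "(\<Sum>e\<in>F. cmod (cinner ((X + Y) e) (u e)) powr p) \<le> 2 powr p * (spow p X + spow p Y)"
    if "bessel_fam F (\<lambda>e. e)" "bessel_fam F u" for F u
  proof -
    have pw: "cmod (a + b) powr p \<le> 2 powr p * (cmod a powr p + cmod b powr p)" for a b :: complex
    proof -
      define m where "m = max (cmod a) (cmod b)"
      have "cmod (a + b) \<le> 2 * m" using norm_triangle_ineq[of a b] by (auto simp: m_def)
      then have "cmod (a + b) powr p \<le> (2 * m) powr p" using p by (intro powr_mono2) auto
      also have "... = 2 powr p * m powr p" by (rule powr_mult)
      also have "m powr p \<le> cmod a powr p + cmod b powr p" by (auto simp: m_def max_def)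
      finally show ?thesis by simp
    qed
    have "(\<Sum>e\<in>F. cmod (cinner ((X + Y) e) (u e)) powr p)
        \<le> (\<Sum>e\<in>F. 2 powr p * (cmod (cinner (X e) (u e)) powr p + cmod (cinner (Y e) (u e)) powr p))"
      by (intro sum_mono) (use pw in \<open>simp add: blinfun.add_left cinner_add_left\<close>)
    also have "... = 2 powr p * ((\<Sum>e\<in>F. cmod (cinner (X e) (u e)) powr p) + (\<Sum>e\<in>F. cmod (cinner (Y e) (u e)) powr p))"
      by (simp add: sum_distrib_left[symmetric] sum.distrib)
    also have "... \<le> 2 powr p * (spow p X + spow p Y)"
      by (intro mult_left_mono add_mono spow_bessel[OF X p that] spow_bessel[OF Y p that]) auto
    finally show ?thesis .
  qed
  have p0: "p > 0" using p by simp
  show "X + Y \<in> schatten p" "spow p (X + Y) \<le> 2 powr p * (spow p X + spow p Y)"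
    using schattenI[OF c p0 b] by auto
qed

lemma schatten_scaleR:
  assumes X: "X \<in> schatten p" and p: "p > 0"
  shows "c *\<^sub>R X \<in> schatten p" "spow p (c *\<^sub>R X) = \<bar>c\<bar> powr p * spow p X"
proof -
  have Xc: "compact_op X" using X by (simp add: schatten_def)
  then have Xl: "clinear_op X" by (simp add: compact_op_def)
  obtain E where E: "sing_basis X E" using sing_basis_exists[OF Xc] by blast
  have cl: "clinear_op (c *\<^sub>R X)" using compact_op_scaleR[OF Xc] by (simp add: compact_op_def)
  have "cadjoint (c *\<^sub>R X) = c *\<^sub>R cadjoint X"
    by (rule cadjoint_eqI[OF cl])
      (simp add: blinfun.scaleR_left cinner_scaleR_left cinner_scaleR_right cinner_cadjoint[OF Xl])
  then have E': "sing_basis (c *\<^sub>R X) E"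
    using E by (simp add: sing_basis_def blinfun.scaleR_left blinfun.scaleR_right power_mult_distrib power2_eq_square)
  have "((\<lambda>e. \<bar>c\<bar> powr p * norm (X e) powr p) has_sum \<bar>c\<bar> powr p * spow p X) E"
    by (rule has_sum_cmult_right[OF spow_has_sum[OF X E p]])
  then have hs: "((\<lambda>e. norm ((c *\<^sub>R X) e) powr p) has_sum \<bar>c\<bar> powr p * spow p X) E"
    by (simp add: blinfun.scaleR_left powr_mult)
  show "c *\<^sub>R X \<in> schatten p" "spow p (c *\<^sub>R X) = \<bar>c\<bar> powr p * spow p X"
    using spowI[OF compact_op_scaleR[OF Xc] E' p hs] by auto
qed

lemma bessel_fam_op:
  assumes x: "bessel_fam I x" and A: "clinear_op A"
  obtains y where "bessel_fam I y" "\<And>i. A (x i) = norm A *\<^sub>R y i"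
proof -
  define y where "y i = (1 / norm A) *\<^sub>R A (x i)" for i
  have 1: "A (x i) = norm A *\<^sub>R y i" for i by (cases "norm A = 0") (simp_all add: y_def)
  have "(\<Sum>i\<in>I. (cmod (cinner z (y i)))\<^sup>2) \<le> (norm z)\<^sup>2" for z
  proof -
    define w where "w = (1 / norm A) *\<^sub>R cadjoint A z"
    have zw: "cinner z (y i) = cinner w (x i)" for i
      by (simp add: y_def w_def cinner_scaleR_left cinner_scaleR_right cinner_cadjoint_left[OF A])
    have "norm (cadjoint A z) \<le> norm A * norm z"
      by (rule order_trans[OF norm_blinfun]) (intro mult_right_mono norm_cadjoint_le A norm_ge_zero)
    then have "norm w \<le> norm z" by (cases "norm A = 0") (auto simp: w_def field_simps)
    then have "(norm w)\<^sup>2 \<le> (norm z)\<^sup>2" by (simp add: power_mono)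
    then show ?thesis using x unfolding zw bessel_fam_def by (meson order_trans)
  qed
  then show thesis using that[of y] 1 x by (auto simp: bessel_fam_def)
qed

text \<open>The factors \<open>B\<close> and \<open>cadjoint A\<close> are moved to the test
  families, which stay Bessel after division by the norms.\<close>

lemma schatten_ideal:
  assumes X: "X \<in> schatten p" and p: "p \<ge> 1" and A: "clinear_op A" and B: "clinear_op B"
  shows "A o\<^sub>L X o\<^sub>L B \<in> schatten p" "spow p (A o\<^sub>L X o\<^sub>L B) \<le> (norm A * norm B) powr p * spow p X"
proof -
  have Xc: "compact_op X" using X by (simp add: schatten_def)
  have c: "compact_op (A o\<^sub>L X o\<^sub>L B)" by (intro compact_op_compose_right compact_op_compose_left Xc A B)
  have b: "(\<Sum>e\<in>F. cmod (cinner ((A o\<^sub>L X o\<^sub>L B) e) (u e)) powr p) \<le> (norm A * norm B) powr p * spow p X"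
    if e: "bessel_fam F (\<lambda>e. e)" and u: "bessel_fam F u" for F u
  proof -
    obtain x where x: "bessel_fam F x" "\<And>e. B e = norm B *\<^sub>R x e" using bessel_fam_op[OF e B] by blast
    obtain y where y: "bessel_fam F y" "\<And>e. cadjoint A (u e) = norm (cadjoint A) *\<^sub>R y e"
      using bessel_fam_op[OF u clinear_cadjoint[OF A]] by blast
    have "cmod (cinner ((A o\<^sub>L X o\<^sub>L B) e) (u e)) powr p
        \<le> (norm A * norm B) powr p * cmod (cinner (X (x e)) (y e)) powr p" for e
    proof -
      have "cinner ((A o\<^sub>L X o\<^sub>L B) e) (u e) = of_real (norm B * norm (cadjoint A)) * cinner (X (x e)) (y e)"
        by (simp add: cinner_cadjoint[OF A] x(2) y(2) blinfun.scaleR_right cinner_scaleR_left cinner_scaleR_right)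
      then have "cmod (cinner ((A o\<^sub>L X o\<^sub>L B) e) (u e)) = (norm B * norm (cadjoint A)) * cmod (cinner (X (x e)) (y e))"
        by (simp add: norm_mult)
      also have "... \<le> (norm A * norm B) * cmod (cinner (X (x e)) (y e))"
        using norm_cadjoint_le[OF A] by (intro mult_right_mono) (auto simp: mult.commute[of "norm A"] intro: mult_left_mono)
      finally show ?thesis
        using p by (subst powr_mult[symmetric]) (auto intro: powr_mono2)
    qed
    then have "(\<Sum>e\<in>F. cmod (cinner ((A o\<^sub>L X o\<^sub>L B) e) (u e)) powr p)
        \<le> (norm A * norm B) powr p * (\<Sum>e\<in>F. cmod (cinner (X (x e)) (y e)) powr p)"
      unfolding sum_distrib_left by (intro sum_mono)
    also have "... \<le> (norm A * norm B) powr p * spow p X"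
      by (intro mult_left_mono spow_bessel[OF X p x(1) y(1)]) simp
    finally show ?thesis .
  qed
  have p0: "p > 0" using p by simp
  show "A o\<^sub>L X o\<^sub>L B \<in> schatten p" "spow p (A o\<^sub>L X o\<^sub>L B) \<le> (norm A * norm B) powr p * spow p X"
    using schattenI[OF c p0 b] by auto
qed

subsection \<open>The algebra of complex-linear operators\<close>

text \<open>Complex-linear operators get a type of their own so that composition is the
  multiplication of a ring and noncommutative identities become ring identities.\<close>

typedef (overloaded) 'a cop = "{X :: 'a::complex_hilbert_space \<Rightarrow>\<^sub>L 'a. clinear_op X}"
  morphisms bl Cop
  by (rule exI[of _ 0]) (simp add: clinear_op_def)

setup_lifting type_definition_cop

lemma clinear_bl [simp]: "clinear_op (bl X)" using bl by simp

abbreviation ap :: "'a::complex_hilbert_space cop \<Rightarrow> 'a \<Rightarrow> 'a" where "ap X \<equiv> blinfun_apply (bl X)"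

instantiation cop :: (complex_hilbert_space) real_normed_vector
begin

lift_definition zero_cop :: "'a cop" is 0 by (simp add: clinear_op_def)
lift_definition plus_cop :: "'a cop \<Rightarrow> 'a cop \<Rightarrow> 'a cop" is "(+)"
  by (simp add: clinear_op_def blinfun.add_left scaleC_add_right)
lift_definition minus_cop :: "'a cop \<Rightarrow> 'a cop \<Rightarrow> 'a cop" is "(-)"
  by (simp add: clinear_op_def blinfun.diff_left scaleC_diff_right)
lift_definition uminus_cop :: "'a cop \<Rightarrow> 'a cop" is "uminus"
  by (simp add: clinear_op_def blinfun.minus_left scaleC_minus_right)
lift_definition scaleR_cop :: "real \<Rightarrow> 'a cop \<Rightarrow> 'a cop" is "scaleR"
  by (simp add: clinear_op_def blinfun.scaleR_left scaleC_scaleR)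
lift_definition norm_cop :: "'a cop \<Rightarrow> real" is norm .
definition dist_cop :: "'a cop \<Rightarrow> 'a cop \<Rightarrow> real" where "dist_cop X Y = norm (X - Y)"
definition sgn_cop :: "'a cop \<Rightarrow> 'a cop" where "sgn_cop X = inverse (norm X) *\<^sub>R X"
definition uniformity_cop :: "('a cop \<times> 'a cop) filter"
  where "uniformity_cop = (INF e\<in>{0<..}. principal {(x, y). dist x y < e})"
definition open_cop :: "'a cop set \<Rightarrow> bool"
  where "open_cop U = (\<forall>x\<in>U. eventually (\<lambda>(x', y). x' = x \<longrightarrow> y \<in> U) uniformity)"

instance
proof
  fix X Y :: "'a cop" and a b :: real
  show "a *\<^sub>R (X + Y) = a *\<^sub>R X + a *\<^sub>R Y" "(a + b) *\<^sub>R X = a *\<^sub>R X + b *\<^sub>R X"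
    by (transfer, simp add: scaleR_add_right scaleR_add_left)+
qed (unfold dist_cop_def sgn_cop_def uniformity_cop_def open_cop_def,
  (simp | (transfer; simp add: algebra_simps norm_triangle_ineq))+)

end

text \<open>The unit is added as a monoid only: on the zero space \<open>1 = 0\<close>, so the unit
  cannot be asserted to have norm 1. The bound \<open>norm_one_le\<close> takes its place.\<close>

instantiation cop :: (complex_hilbert_space) "{real_normed_algebra, monoid_mult}"
begin

lift_definition times_cop :: "'a cop \<Rightarrow> 'a cop \<Rightarrow> 'a cop" is "(o\<^sub>L)"
  by (rule clinear_op_compose)
lift_definition one_cop :: "'a cop" is id_blinfun by (simp add: clinear_op_def)

instance
  by standard
    (transfer; auto intro!: blinfun_eqI norm_blinfun_compose
      simp: blinfun.add_left blinfun.add_right blinfun.scaleR_left blinfun.scaleR_right)+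

end

lift_definition adj :: "'a::complex_hilbert_space cop \<Rightarrow> 'a cop" is cadjoint by (rule clinear_cadjoint)

lift_definition cs :: "complex \<Rightarrow> 'a::complex_hilbert_space cop" is "\<lambda>c. Blinfun (scaleC c)"
  by (simp add: clinear_op_def bounded_linear_Blinfun_apply bounded_linear_scaleC scaleC_scaleC mult.commute)

lemma bounded_linear_rank_one: "bounded_linear (\<lambda>x::'a::complex_hilbert_space. scaleC (cinner x v) u)"
proof (rule bounded_linear_intro[of _ "norm v * norm u"])
  fix x y :: 'a and r :: real
  show "scaleC (cinner (x + y) v) u = scaleC (cinner x v) u + scaleC (cinner y v) u"
    by (simp add: cinner_add_left scaleC_add_left)
  show "scaleC (cinner (r *\<^sub>R x) v) u = r *\<^sub>R scaleC (cinner x v) u"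
    by (simp add: scaleC_of_real[symmetric] cinner_scaleC_left scaleC_scaleC)
  show "norm (scaleC (cinner x v) u) \<le> norm x * (norm v * norm u)"
    using mult_right_mono[OF cinner_norm_le[of x v], of "norm u"] by (simp add: norm_scaleC mult.assoc)
qed

lift_definition rk :: "'a::complex_hilbert_space \<Rightarrow> 'a \<Rightarrow> 'a cop" is "\<lambda>u v. Blinfun (\<lambda>x. scaleC (cinner x v) u)"
  by (simp add: clinear_op_def bounded_linear_Blinfun_apply bounded_linear_rank_one cinner_scaleC_left scaleC_scaleC)

lemma ap_simps [simp]:
  "ap 0 x = 0" "ap 1 x = x" "ap (X + Y) x = ap X x + ap Y x" "ap (X - Y) x = ap X x - ap Y x"
  "ap (- X) x = - ap X x" "ap (r *\<^sub>R X) x = r *\<^sub>R ap X x" "ap (X * Y) x = ap X (ap Y x)"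
  "ap (cs c) x = scaleC c x"
  by (transfer; simp add: blinfun.add_left blinfun.diff_left blinfun.minus_left blinfun.scaleR_left
      bounded_linear_Blinfun_apply bounded_linear_scaleC)+

lemma ap_rk [simp]: "ap (rk u v) x = scaleC (cinner x v) u"
  by transfer (simp add: bounded_linear_Blinfun_apply bounded_linear_rank_one)

lemma ap_scaleC [simp]: "ap X (scaleC c x) = scaleC c (ap X x)"
  using clinear_bl[of X] by (simp add: clinear_op_def)

lemma ap_add [simp]: "ap X (x + y) = ap X x + ap X y" by (rule blinfun.add_right)
lemma ap_diff [simp]: "ap X (x - y) = ap X x - ap X y" by (rule blinfun.diff_right)

lemma ap_sum [simp]: "ap (\<Sum>i\<in>I. X i) x = (\<Sum>i\<in>I. ap (X i) x)"
  by (induction I rule: infinite_finite_induct) auto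

lemma ap_sum_right [simp]: "ap X (\<Sum>i\<in>I. x i) = (\<Sum>i\<in>I. ap X (x i))"
  by (rule blinfun.sum_right)

lemma cop_eqI: "(\<And>x. ap X x = ap Y x) \<Longrightarrow> X = Y"
  by transfer (rule blinfun_eqI)

lemma cinner_adj: "cinner (ap X x) y = cinner x (ap (adj X) y)"
  by transfer (rule cinner_cadjoint)

lemma cinner_adj_left: "cinner (ap (adj X) x) y = cinner x (ap X y)"
  by transfer (rule cinner_cadjoint_left)

lemma adj_eqI: "(\<And>x y. cinner (ap X x) y = cinner x (ap Y y)) \<Longrightarrow> adj X = Y"
  by transfer (rule cadjoint_eqI)

lemma adj_adj [simp]: "adj (adj X) = X"
  by (rule adj_eqI) (rule cinner_adj_left)

lemma adj_simps:
  "adj 0 = 0" "adj 1 = 1" "adj (X + Y) = adj X + adj Y" "adj (X - Y) = adj X - adj Y" "adj (- X) = - adj X"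
  "adj (r *\<^sub>R X) = r *\<^sub>R adj X" "adj (X * Y) = adj Y * adj X" "adj (cs c) = cs (cnj c)" "adj (rk u v) = rk v u"
  by (rule adj_eqI; simp add: cinner_add_left cinner_add_right cinner_diff_left cinner_diff_right cinner_minus_left
      cinner_minus_right cinner_scaleR_left cinner_scaleR_right cinner_scaleC_left cinner_scaleC_right
      cinner_adj flip: cinner_commute)+

lemma adj_sum: "adj (\<Sum>i\<in>I. X i) = (\<Sum>i\<in>I. adj (X i))"
  by (induction I rule: infinite_finite_induct) (auto simp: adj_simps)

lemma norm_ap: "norm (ap X x) \<le> norm X * norm x"
  by transfer (rule norm_blinfun)

lemma norm_copI: "0 \<le> b \<Longrightarrow> (\<And>x. norm (ap X x) \<le> b * norm x) \<Longrightarrow> norm X \<le> b"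
  by transfer (rule norm_blinfun_bound)

lemma norm_one_le: "norm (1 :: 'a::complex_hilbert_space cop) \<le> 1"
  by (rule norm_copI) simp_all

lemma cs_simps: "cs 0 = 0" "cs 1 = 1" "cs (c + d) = cs c + cs d" "cs (c - d) = cs c - cs d" "cs (- c) = - cs c"
  "cs (c * d) = cs c * cs d" "cs (of_real r) = r *\<^sub>R 1"
  by (rule cop_eqI; simp add: scaleC_add_left scaleC_diff_left scaleC_minus_left scaleC_scaleC scaleC_of_real mult.commute)+

lemma cs_commute: "cs c * X = X * cs c"
  by (rule cop_eqI) simp

lemma cs_of_real_mult: "cs (of_real r) * X = r *\<^sub>R X"
  by (rule cop_eqI) (simp add: scaleC_of_real)

lemma rk_mult: "rk u v * rk x y = cs (cinner x v) * rk u y" "X * rk u v = rk (ap X u) v" "rk u v * X = rk u (ap (adj X) v)"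
  by (rule cop_eqI; simp add: cinner_scaleC_left scaleC_scaleC mult.commute cinner_adj)+

lemma rk_zero [simp]: "rk 0 v = 0" "rk u 0 = 0"
  by (rule cop_eqI; simp)+

subsection \<open>Finite-rank operators and the trace\<close>

definition fr :: "'a::complex_hilbert_space cop \<Rightarrow> bool"
  where "fr X \<longleftrightarrow> (\<exists>(n::nat) u v. X = (\<Sum>i<n. rk (u i) (v i)))"

lemma fr_rk [simp]: "fr (rk u v)"
  unfolding fr_def by (intro exI[of _ "1::nat"] exI[of _ "\<lambda>_. u"] exI[of _ "\<lambda>_. v"]) simp

lemma fr_zero [simp]: "fr 0"
  unfolding fr_def by (intro exI[of _ "0::nat"]) simp

lemma fr_add [intro]:
  assumes "fr X" "fr Y"
  shows "fr (X + Y)"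
proof -
  obtain n u v where X: "X = (\<Sum>i<n::nat. rk (u i) (v i))" using assms(1) by (auto simp: fr_def)
  obtain k w z where Y: "Y = (\<Sum>i<k::nat. rk (w i) (z i))" using assms(2) by (auto simp: fr_def)
  define u' v' where "u' i = (if i < n then u i else w (i - n))" and "v' i = (if i < n then v i else z (i - n))" for i
  have "(\<Sum>i<n + k. rk (u' i) (v' i)) = (\<Sum>i<n. rk (u' i) (v' i)) + (\<Sum>i=n..<n+k. rk (u' i) (v' i))"
    using sum.atLeastLessThan_concat[of 0 n "n + k" "\<lambda>i. rk (u' i) (v' i)"] by (simp add: atLeast0LessThan)
  also have "(\<Sum>i=n..<n+k. rk (u' i) (v' i)) = (\<Sum>i<k. rk (u' (i + n)) (v' (i + n)))"
    using sum.shift_bounds_nat_ivl[of "\<lambda>i. rk (u' i) (v' i)" 0 n k] by (simp add: atLeast0LessThan add.commute)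
  finally have "X + Y = (\<Sum>i<n + k. rk (u' i) (v' i))"
    by (simp add: X Y u'_def v'_def)
  then show ?thesis unfolding fr_def by blast
qed

lemma fr_mult_left [intro]: "fr X \<Longrightarrow> fr (Y * X)"
  unfolding fr_def by (force simp: sum_distrib_left rk_mult)

lemma fr_mult_right [intro]: "fr X \<Longrightarrow> fr (X * Y)"
  unfolding fr_def by (force simp: sum_distrib_right rk_mult)

lemma fr_scaleR [intro]: "fr X \<Longrightarrow> fr (r *\<^sub>R X)"
  using fr_mult_left[of X "cs (of_real r)"] by (simp add: cs_of_real_mult)

lemma fr_minus [intro]: "fr X \<Longrightarrow> fr (- X)"
  using fr_scaleR[of X "-1"] by simp

lemma fr_diff [intro]: "fr X \<Longrightarrow> fr Y \<Longrightarrow> fr (X - Y)"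
  using fr_add[of X "- Y"] fr_minus[of Y] by simp

lemma fr_sum [intro]: "(\<And>i. i \<in> I \<Longrightarrow> fr (X i)) \<Longrightarrow> fr (\<Sum>i\<in>I. X i)"
  by (induction I rule: infinite_finite_induct) auto

lemma fr_adj [intro]: "fr X \<Longrightarrow> fr (adj X)"
  unfolding fr_def by (force simp: adj_sum adj_simps)

lemma compact_op_rk: "compact_op (bl (rk u v))"
proof -
  have "ap (rk u v) ` cball 0 1 \<subseteq> (\<lambda>c. scaleC c u) ` cball 0 (norm v)"
  proof
    fix y assume "y \<in> ap (rk u v) ` cball 0 1"
    then obtain x where x: "norm x \<le> 1" "y = scaleC (cinner x v) u" by auto
    have "cmod (cinner x v) \<le> norm x * norm v" by (rule cinner_norm_le)
    also have "... \<le> 1 * norm v" by (intro mult_right_mono x) simp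
    finally show "y \<in> (\<lambda>c. scaleC c u) ` cball 0 (norm v)" using x(2) by auto
  qed
  moreover have "compact ((\<lambda>c. scaleC c u) ` cball 0 (norm v))"
  proof (intro compact_continuous_image compact_cball linear_continuous_on)
    show "bounded_linear (\<lambda>c. scaleC c u)"
      by (rule bounded_linear_intro[of _ "norm u"])
        (auto simp: scaleC_add_left norm_scaleC scaleR_conv_of_real scaleC_scaleC[symmetric] scaleC_of_real)
  qed
  ultimately show ?thesis unfolding compact_op_def by (auto intro: compact_closure_subset)
qed

lemma compact_op_fr:
  assumes "fr X"
  shows "compact_op (bl X)"
proof -
  have "compact_op (bl (\<Sum>i<n. rk (u i) (v i)))" for n :: nat and u v :: "nat \<Rightarrow> 'a"
  proof (induction n)
    case 0
    have "bl (0::'a cop) = 0" by transfer simp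
    then show ?case using compact_op_scaleR[OF compact_op_rk, of 0] by simp
  next
    case (Suc n)
    have "bl (X + Y) = bl X + bl Y" for X Y :: "'a cop" by transfer simp
    then show ?case using compact_op_add[OF Suc compact_op_rk] by simp
  qed
  then show ?thesis using assms by (auto simp: fr_def)
qed

text \<open>Meant for finite-rank operators. There the sum converges and equals the sum of the
  \<open>cinner (u i) (v i)\<close> for every representation by rank-one operators, hence is
  independent of the basis.\<close>

definition tr :: "'a::complex_hilbert_space cop \<Rightarrow> complex"
  where "tr X = (\<Sum>\<^sub>\<infinity>e\<in>(SOME E. orthonormal_basis E). cinner (ap X e) e)"

lemma fr_has_sum:
  assumes "fr X"
  shows "((\<lambda>e. cinner (ap X e) e) has_sum tr X) (SOME E. orthonormal_basis E)"
    and "X = (\<Sum>i<n::nat. rk (u i) (v i)) \<Longrightarrow> tr X = (\<Sum>i<n. cinner (u i) (v i))"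
proof -
  define E :: "'a set" where "E = (SOME E. orthonormal_basis E)"
  have E: "orthonormal_basis E" unfolding E_def by (rule someI_ex[OF orthonormal_basis_exists])
  have *: "((\<lambda>e. cinner (ap (\<Sum>i<n. rk (u i) (v i)) e) e) has_sum (\<Sum>i<n. cinner (u i) (v i))) E"
    for n :: nat and u v :: "nat \<Rightarrow> 'a"
  proof -
    have "((\<lambda>e. \<Sum>i<n. cinner (u i) e * cinner e (v i)) has_sum (\<Sum>i<n. cinner (u i) (v i))) E"
      by (intro has_sum_sum_finite parseval_cinner[OF E]) simp
    then show ?thesis by (simp add: cinner_sum_left cinner_scaleC_left mult.commute)
  qed
  show "((\<lambda>e. cinner (ap X e) e) has_sum tr X) (SOME E. orthonormal_basis E)"
  proof -
    obtain n u v where X: "X = (\<Sum>i<n::nat. rk (u i) (v i))" using assms by (auto simp: fr_def)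
    show ?thesis unfolding X tr_def E_def[symmetric] by (rule has_sum_infsum[OF has_sum_imp_summable[OF *]])
  qed
  show "X = (\<Sum>i<n::nat. rk (u i) (v i)) \<Longrightarrow> tr X = (\<Sum>i<n. cinner (u i) (v i))"
    using *[of u v n] unfolding tr_def E_def[symmetric] by (auto simp: infsumI)
qed

lemma tr_rk [simp]: "tr (rk u v) = cinner u v"
  using fr_has_sum(2)[OF fr_rk, of u v "\<lambda>_. u" "\<lambda>_. v" "Suc 0"] by (simp add: lessThan_Suc)

lemma tr_add: "fr X \<Longrightarrow> fr Y \<Longrightarrow> tr (X + Y) = tr X + tr Y"
proof -
  assume "fr X" "fr Y"
  from has_sum_add[OF fr_has_sum(1)[OF this(1)] fr_has_sum(1)[OF this(2)]] show ?thesis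
    unfolding tr_def[of "X + Y"] by (simp add: cinner_add_left infsumI)
qed

lemma tr_cs: "fr X \<Longrightarrow> tr (cs c * X) = c * tr X"
proof -
  assume "fr X"
  from has_sum_cmult_right[OF fr_has_sum(1)[OF this], of c] show ?thesis
    unfolding tr_def[of "cs c * X"] by (simp add: cinner_scaleC_left infsumI)
qed

lemma tr_scaleR: "fr X \<Longrightarrow> tr (r *\<^sub>R X) = of_real r * tr X"
  using tr_cs[of X "of_real r"] by (simp add: cs_of_real_mult)

lemma tr_minus: "fr X \<Longrightarrow> tr (- X) = - tr X"
  using tr_scaleR[of X "-1"] by simp

lemma tr_diff: "fr X \<Longrightarrow> fr Y \<Longrightarrow> tr (X - Y) = tr X - tr Y"
  using tr_add[of X "- Y"] by (simp add: tr_minus fr_minus)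

lemma tr_zero [simp]: "tr 0 = 0"
  using tr_rk[of 0 0] by simp

lemma tr_sum: "(\<And>i. i \<in> I \<Longrightarrow> fr (X i)) \<Longrightarrow> tr (\<Sum>i\<in>I. X i) = (\<Sum>i\<in>I. tr (X i))"
  by (induction I rule: infinite_finite_induct) (auto simp: tr_add fr_sum)

lemma tr_rk_mult: "tr (rk u v * Y) = cinner (ap Y u) v"
  by (simp add: rk_mult cinner_adj)

lemma tr_commute:
  assumes "fr X"
  shows "tr (X * Y) = tr (Y * X)"
proof -
  obtain n u v where X: "X = (\<Sum>i<n::nat. rk (u i) (v i))" using assms by (auto simp: fr_def)
  show ?thesis
    unfolding X sum_distrib_left sum_distrib_right
    by (subst (1 2) tr_sum) (auto simp: tr_rk_mult rk_mult(2))
qed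

subsection \<open>Orthogonal projections and singular value decompositions\<close>

definition proj :: "'a::complex_hilbert_space set \<Rightarrow> 'a cop"
  where "proj B = (\<Sum>b\<in>B. rk b b)"

lemma fr_proj [simp]: "fr (proj B)"
  unfolding proj_def by (rule fr_sum) simp

lemma adj_proj [simp]: "adj (proj B) = proj B"
  by (simp add: proj_def adj_sum adj_simps)

lemma ap_proj: "ap (proj B) x = (\<Sum>b\<in>B. scaleC (cinner x b) b)"
  by (simp add: proj_def)

lemma ap_proj_mem:
  assumes "onset B" "finite B" "b \<in> B"
  shows "ap (proj B) b = b"
proof -
  have "ap (proj B) b = (\<Sum>c\<in>B. if c = b then b else 0)"
    unfolding ap_proj by (intro sum.cong refl) (use assms in \<open>auto simp: onset_cinner\<close>)
  then show ?thesis using assms by simp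
qed

lemma proj_idem:
  assumes "onset B" "finite B"
  shows "proj B * proj B = proj B"
proof (rule cop_eqI)
  fix x
  have "ap (proj B * proj B) x = (\<Sum>b\<in>B. scaleC (cinner x b) (ap (proj B) b))"
    by (simp add: ap_proj[of B x])
  also have "... = (\<Sum>b\<in>B. scaleC (cinner x b) b)" by (intro sum.cong refl) (simp add: ap_proj_mem[OF assms])
  finally show "ap (proj B * proj B) x = ap (proj B) x" by (simp add: ap_proj)
qed

lemma norm_proj_le:
  assumes "onset B" "finite B"
  shows "norm (proj B) \<le> 1"
proof (rule norm_copI)
  fix x
  have "(norm (ap (proj B) x))\<^sup>2 \<le> (norm x)\<^sup>2"
    unfolding ap_proj using norm_sum_onset[OF assms(1,2) subset_refl] bessel[OF assms(1,2) subset_refl] by simp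
  then have "norm (ap (proj B) x) \<le> norm x" by (rule power2_le_imp_le) simp
  then show "norm (ap (proj B) x) \<le> 1 * norm x" by simp
qed simp

text \<open>The result is a finite projection fixing prescribed vectors. The bound on
  \<open>card B\<close> later converts a number of rank-one terms into a bound for a trace.\<close>

lemma gram_schmidt:
  fixes W :: "'a::complex_hilbert_space set"
  assumes "finite W"
  obtains B where "onset B" "finite B" "card B \<le> card W" "\<And>w. w \<in> W \<Longrightarrow> ap (proj B) w = w"
  using assms
proof (induction W arbitrary: thesis rule: finite_induct)
  case empty
  show ?case by (rule empty[of "{}"]) (auto simp: onset_def)
next
  case (insert w W)
  obtain B where B: "onset B" "finite B" "card B \<le> card W" "\<And>w. w \<in> W \<Longrightarrow> ap (proj B) w = w"
    using insert.IH by blast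
  define z where "z = w - ap (proj B) w"
  show ?case
  proof (cases "z = 0")
    case True
    show ?thesis
      by (rule insert.prems[of B]) (use B insert.hyps True in \<open>auto simp: z_def\<close>)
  next
    case False
    define y where "y = (1 / norm z) *\<^sub>R z"
    have Pz: "ap (proj B) z = 0"
      using proj_idem[OF B(1,2)] unfolding z_def by (metis ap_diff ap_simps(7) diff_self)
    have zb: "cinner z b = 0" if "b \<in> B" for b
    proof -
      have "cinner z b = cinner z (ap (proj B) b)" using ap_proj_mem[OF B(1,2) that] by simp
      also have "... = cinner (ap (proj B) z) b" by (simp add: cinner_adj)
      finally show ?thesis by (simp add: Pz)
    qed
    have yb: "cinner y b = 0" "cinner b y = 0" if "b \<in> B" for b
      using zb[OF that] cinner_commute[of b z] by (simp_all add: y_def cinner_scaleR_left cinner_scaleR_right)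
    have yy: "cinner y y = 1" using False by (simp add: cinner_self_eq_one_iff y_def)
    have yB: "y \<notin> B" using yb yy by force
    have on: "onset (insert y B)" using B(1) yb yy by (auto simp: onset_def)
    have P': "ap (proj (insert y B)) x = ap (proj B) x + scaleC (cinner x y) y" for x
      using B(2) yB by (simp add: ap_proj add.commute)
    show ?thesis
    proof (rule insert.prems[OF on])
      show "card (insert y B) \<le> card (insert w W)" using B insert.hyps yB by simp
      fix x assume "x \<in> insert w W"
      moreover have "ap (proj (insert y B)) w = w"
      proof -
        have "cinner w z = cinner z z"
          using cinner_adj[of "proj B" w z] Pz by (simp add: z_def cinner_diff_left)
        then have "cinner w y = complex_of_real (norm z)"
          using False by (simp add: y_def cinner_scaleR_right cinner_self power2_eq_square)
        then have "scaleC (cinner w y) y = z"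
          using False by (simp add: scaleC_of_real y_def)
        then show ?thesis by (simp add: P' z_def)
      qed
      moreover have "ap (proj (insert y B)) x = x" if "x \<in> W"
      proof -
        have "cinner x y = cinner (ap (proj B) x) y" using B(4)[OF that] by simp
        also have "... = cinner x (ap (proj B) y)" by (simp add: cinner_adj)
        also have "... = 0" using Pz by (simp add: y_def blinfun.scaleR_right)
        finally show ?thesis using B(4)[OF that] by (simp add: P')
      qed
      ultimately show "ap (proj (insert y B)) x = x" by blast
    qed (use B in simp)
  qed
qed

lemma fr_range_proj:
  assumes "fr X"
  obtains B where "onset B" "finite B" "proj B * X = X"
proof -
  obtain n u v where X: "X = (\<Sum>i<n::nat. rk (u i) (v i))" using assms by (auto simp: fr_def)
  obtain B where B: "onset B" "finite B" "\<And>w. w \<in> u ` {..<n} \<Longrightarrow> ap (proj B) w = w"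
    using gram_schmidt[of "u ` {..<n}"] by (metis finite_imageI finite_lessThan)
  have "proj B * X = X" using B(3) by (simp add: X sum_distrib_left rk_mult)
  then show thesis using that B by blast
qed

text \<open>Double counting of |<e, b>|^2: summed over b it gives 1 for each e, summed over e at
  most 1 for each b.\<close>

lemma finite_onset_in_range:
  assumes B: "onset B" "finite B" and E: "onset E" "\<And>e. e \<in> E \<Longrightarrow> ap (proj B) e = e"
  shows "finite E"
proof -
  have "card F \<le> card B" if F: "finite F" "F \<subseteq> E" for F
  proof -
    have "real (card F) = (\<Sum>e\<in>F. (norm (ap (proj B) e))\<^sup>2)"
      using E F onset_norm[OF E(1)] by (simp add: subset_iff)
    also have "... = (\<Sum>e\<in>F. \<Sum>b\<in>B. (cmod (cinner e b))\<^sup>2)"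
      by (simp add: ap_proj norm_sum_onset[OF B subset_refl])
    also have "... = (\<Sum>b\<in>B. \<Sum>e\<in>F. (cmod (cinner b e))\<^sup>2)"
      by (subst sum.swap, subst cmod_cinner_commute) simp
    also have "... \<le> (\<Sum>b\<in>B. (norm b)\<^sup>2)" by (intro sum_mono bessel[OF E(1) F])
    also have "... = real (card B)" using onset_norm[OF B(1)] by simp
    finally show ?thesis by simp
  qed
  then show ?thesis using finite_if_finite_subsets_card_bdd[of E "card B"] by blast
qed

text \<open>The values are continued by 0 beyond \<open>n\<close>, so that Abel summation has no
  boundary term; zeros before \<open>n\<close> are allowed, so that powers of the values keep the
  same families of vectors.\<close>

definition svd :: "nat \<Rightarrow> (nat \<Rightarrow> real) \<Rightarrow> (nat \<Rightarrow> 'a::complex_hilbert_space) \<Rightarrow> (nat \<Rightarrow> 'a) \<Rightarrow> 'a cop \<Rightarrow> bool"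
  where "svd n s u v X \<longleftrightarrow> on_fam {..<n} u \<and> on_fam {..<n} v \<and> antimono s \<and> (\<forall>i. 0 \<le> s i) \<and>
    (\<forall>i\<ge>n. s i = 0) \<and> X = (\<Sum>i<n. s i *\<^sub>R rk (u i) (v i))"

abbreviation spw :: "real \<Rightarrow> 'a::complex_hilbert_space cop \<Rightarrow> real" where "spw p X \<equiv> spow p (bl X)"
abbreviation sn :: "real \<Rightarrow> 'a::complex_hilbert_space cop \<Rightarrow> real" where "sn p X \<equiv> schatten_norm p (bl X)"

lemma bl_mult: "bl (X * Y) = bl X o\<^sub>L bl Y" by transfer simp
lemma bl_add: "bl (X + Y) = bl X + bl Y" by transfer simp
lemma bl_scaleR: "bl (r *\<^sub>R X) = r *\<^sub>R bl X" by transfer simp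
lemma bl_adj: "bl (adj X) = cadjoint (bl X)" by transfer simp

text \<open>Extending \<open>v\<close> to a basis gives a singular basis. The index set is arbitrary
  and unordered, which covers eigenvalue expansions and the doubled index set of the dilation as
  well.\<close>

lemma spw_on_fam:
  fixes X :: "'a::complex_hilbert_space cop"
  assumes u: "on_fam I u" and v: "on_fam I v" and fin: "finite I" and s: "\<And>i. i \<in> I \<Longrightarrow> 0 \<le> s i"
    and X: "X = (\<Sum>i\<in>I. s i *\<^sub>R rk (u i) (v i))" and p: "p > 0"
  shows "bl X \<in> schatten p" "spw p X = (\<Sum>i\<in>I. s i powr p)"
proof -
  have frX: "fr X" unfolding X by (intro fr_sum fr_scaleR fr_rk)
  obtain E where E: "orthonormal_basis E" "v ` I \<subseteq> E" using onset_extends_to_basis[OF on_fam_onset[OF v]] by blast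
  have on: "onset E" by (rule orthonormal_basis_onset[OF E(1)])
  have Xv: "ap X (v j) = s j *\<^sub>R u j" if j: "j \<in> I" for j
  proof -
    have "ap X (v j) = (\<Sum>i\<in>I. if i = j then s j *\<^sub>R u j else 0)"
      unfolding X ap_sum by (intro sum.cong refl) (use v j in \<open>auto simp: on_fam_def\<close>)
    then show ?thesis using fin j by simp
  qed
  have X0: "ap X e = 0" if "e \<in> E" "e \<notin> v ` I" for e
  proof -
    have "cinner e (v i) = 0" if "i \<in> I" for i
    proof -
      have "e \<noteq> v i" "v i \<in> E" using \<open>e \<notin> v ` I\<close> that E(2) by auto
      then show ?thesis using onset_cinner[OF on \<open>e \<in> E\<close>, of "v i"] by simp
    qed
    then show ?thesis by (simp add: X)
  qed
  have aX: "adj X = (\<Sum>i\<in>I. s i *\<^sub>R rk (v i) (u i))" by (simp add: X adj_sum adj_simps)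
  have aXu: "ap (adj X) (u j) = s j *\<^sub>R v j" if j: "j \<in> I" for j
  proof -
    have "ap (adj X) (u j) = (\<Sum>i\<in>I. if i = j then s j *\<^sub>R v j else 0)"
      unfolding aX ap_sum by (intro sum.cong refl) (use u j in \<open>auto simp: on_fam_def\<close>)
    then show ?thesis using fin j by simp
  qed
  have nu: "norm (u j) = 1" if "j \<in> I" for j
    using u that by (auto simp: on_fam_def cinner_self_eq_one_iff[symmetric])
  have nX: "norm (ap X (v j)) = s j" if "j \<in> I" for j using Xv[OF that] nu[OF that] s[OF that] by simp
  have sb: "sing_basis (bl X) E"
    unfolding sing_basis_def bl_adj[symmetric]
  proof (intro conjI ballI E(1))
    fix e assume e: "e \<in> E"
    show "ap (adj X) (ap X e) = (norm (ap X e))\<^sup>2 *\<^sub>R e"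
    proof (cases "e \<in> v ` I")
      case True
      then obtain j where j: "j \<in> I" "e = v j" by auto
      then show ?thesis using Xv[OF j(1)] aXu[OF j(1)] nX[OF j(1)] by (simp add: blinfun.scaleR_right power2_eq_square)
    qed (use X0[OF e] in simp)
  qed
  have "((\<lambda>e. norm (ap X e) powr p) has_sum (\<Sum>e\<in>v ` I. norm (ap X e) powr p)) E"
    by (rule has_sum_finite_neutralI) (use fin E(2) X0 in auto)
  moreover have "(\<Sum>e\<in>v ` I. norm (ap X e) powr p) = (\<Sum>i\<in>I. s i powr p)"
    using on_fam_inj[OF v] nX by (simp add: sum.reindex)
  ultimately have hs: "((\<lambda>e. norm (ap X e) powr p) has_sum (\<Sum>i\<in>I. s i powr p)) E" by simp
  show "bl X \<in> schatten p" "spw p X = (\<Sum>i\<in>I. s i powr p)"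
    using spowI[OF compact_op_fr[OF frX] sb p hs] by auto
qed

lemma svd_exists:
  assumes "fr X"
  obtains n s u v where "svd n s u v X"
proof -
  obtain E where E: "sing_basis (bl X) E" using sing_basis_exists[OF compact_op_fr[OF assms]] by blast
  have ob: "orthonormal_basis E" using E by (simp add: sing_basis_def)
  have on: "onset E" by (rule orthonormal_basis_onset[OF ob])
  define G where "G = {e \<in> E. ap X e \<noteq> 0}"
  define w where "w e = (1 / norm (ap X e)) *\<^sub>R ap X e" for e
  have onw: "on_fam G w"
    unfolding on_fam_def using sing_basis_orthogonal[OF clinear_bl E]
    by (auto simp: G_def w_def cinner_scaleR_left cinner_scaleR_right power2_eq_square)
  obtain B where B: "onset B" "finite B" "proj B * X = X" using fr_range_proj[OF assms] by blast
  have "finite (w ` G)"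
  proof (rule finite_onset_in_range[OF B(1,2) on_fam_onset[OF onw]])
    fix y assume "y \<in> w ` G"
    then obtain e where "y = w e" by auto
    then show "ap (proj B) y = y" using B(3) by (metis w_def ap_simps(7) blinfun.scaleR_right)
  qed
  then have finG: "finite G" using on_fam_inj[OF onw] by (rule finite_imageD)
  define xs where "xs = rev (sort_key (\<lambda>e. norm (ap X e)) (SOME l. set l = G \<and> distinct l))"
  have l: "set (SOME l. set l = G \<and> distinct l) = G" "distinct (SOME l. set l = G \<and> distinct l)"
    using someI_ex[OF finite_distinct_list[OF finG]] by auto
  have xs: "set xs = G" "distinct xs" using l by (simp_all add: xs_def)
  have srt: "sorted_wrt (\<lambda>x y. norm (ap X y) \<le> norm (ap X x)) xs"
    unfolding xs_def sorted_wrt_rev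
    using sorted_sort_key[of "\<lambda>e. norm (ap X e)"] unfolding sorted_map by simp
  define n where "n = length xs"
  define v where "v i = xs ! i" for i
  define u where "u i = w (v i)" for i
  define s where "s i = (if i < n then norm (ap X (v i)) else 0)" for i
  have vG: "v i \<in> G" if "i < n" for i using that xs(1) by (auto simp: v_def n_def)
  have bij: "bij_betw v {..<n} G"
    unfolding v_def n_def using xs by (metis bij_betw_nth)
  have inj: "v i = v j \<longleftrightarrow> i = j" if "i < n" "j < n" for i j
    using that xs(2) by (simp add: v_def n_def nth_eq_iff_index_eq)
  have "svd n s u v X"
    unfolding svd_def
  proof (intro conjI allI impI)
    show "on_fam {..<n} u" using onw vG inj by (auto simp: on_fam_def u_def)
    show "on_fam {..<n} v" using on vG inj by (auto simp: on_fam_def onset_cinner G_def)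
    show "antimono s"
    proof (rule antimonoI)
      fix i j :: nat assume "i \<le> j"
      then show "s j \<le> s i"
        using sorted_wrt_nth_less[OF srt, of i j] by (cases "i = j") (auto simp: s_def v_def n_def)
    qed
    show "0 \<le> s i" for i by (simp add: s_def)
    show "s i = 0" if "n \<le> i" for i using that by (simp add: s_def)
    show "X = (\<Sum>i<n. s i *\<^sub>R rk (u i) (v i))"
    proof -
      have sx: "s i *\<^sub>R u i = ap X (v i)" if "i < n" for i using vG[OF that] that by (simp add: s_def u_def w_def G_def)
      have "(\<Sum>i<n. s i *\<^sub>R rk (u i) (v i)) = (\<Sum>i<n. rk (ap X (v i)) (v i))"
      proof (intro sum.cong refl)
        fix i assume "i \<in> {..<n}"
        then show "s i *\<^sub>R rk (u i) (v i) = rk (ap X (v i)) (v i)"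
          by (intro cop_eqI) (simp add: sx[symmetric] scaleC_scaleR)
      qed
      also have "... = (\<Sum>e\<in>G. rk (ap X e) e)" by (rule sum.reindex_bij_betw[OF bij, of "\<lambda>e. rk (ap X e) e"])
      also have "... = X"
      proof -
        have "bl (\<Sum>e\<in>G. rk (ap X e) e) = bl X"
        proof (rule op_eqI_basis[OF ob clinear_bl clinear_bl])
          fix f assume f: "f \<in> E"
          have "ap (\<Sum>e\<in>G. rk (ap X e) e) f = (\<Sum>e\<in>G. if e = f then ap X f else 0)"
            unfolding ap_sum by (intro sum.cong refl) (use f on in \<open>auto simp: onset_cinner G_def\<close>)
          then show "ap (\<Sum>e\<in>G. rk (ap X e) e) f = ap X f" using finG f by (auto simp: G_def)
        qed
        then show ?thesis by (simp add: bl_inject)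
      qed
      finally show ?thesis by simp
    qed
  qed
  then show thesis by (rule that)
qed

lemma svd_spw:
  assumes "svd n s u v X" "p > 0"
  shows "spw p X = (\<Sum>i<n. s i powr p)" "bl X \<in> schatten p"
  using spw_on_fam[of "{..<n}" u v s X p] assms by (auto simp: svd_def)

lemma fr_schatten: "fr X \<Longrightarrow> p > 0 \<Longrightarrow> bl X \<in> schatten p"
  using svd_exists svd_spw by metis

subsection \<open>Hoelder inequalities\<close>

lemma norm_sum_on_fam:
  assumes "on_fam I u" "finite I"
  shows "(norm (\<Sum>i\<in>I. scaleC (c i) (u i)))\<^sup>2 = (\<Sum>i\<in>I. (cmod (c i))\<^sup>2)"
proof -
  have inj: "inj_on u I" by (rule on_fam_inj[OF assms(1)])
  have "(norm (\<Sum>e\<in>u ` I. scaleC (c (the_inv_into I u e)) e))\<^sup>2 = (\<Sum>e\<in>u ` I. (cmod (c (the_inv_into I u e)))\<^sup>2)"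
    by (rule norm_sum_onset[OF on_fam_onset[OF assms(1)]]) (use assms(2) in auto)
  then show ?thesis using inj by (simp add: sum.reindex the_inv_into_f_f)
qed

lemma norm_partial_isometry_le:
  assumes "on_fam I u" "on_fam I v" "finite I"
  shows "norm (\<Sum>i\<in>I. rk (u i) (v i)) \<le> 1"
proof (rule norm_copI)
  fix x
  have "(norm (ap (\<Sum>i\<in>I. rk (u i) (v i)) x))\<^sup>2 = (\<Sum>i\<in>I. (cmod (cinner x (v i)))\<^sup>2)"
    by (simp add: norm_sum_on_fam[OF assms(1,3)])
  also have "... \<le> (norm x)\<^sup>2" using on_fam_bessel[OF assms(2,3)] by (simp add: bessel_fam_def)
  finally have "norm (ap (\<Sum>i\<in>I. rk (u i) (v i)) x) \<le> norm x" by (rule power2_le_imp_le) simp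
  then show "norm (ap (\<Sum>i\<in>I. rk (u i) (v i)) x) \<le> 1 * norm x" by simp
qed simp

text \<open>Stands for a contraction of rank at most \<open>k\<close>. The rank enters only through
  the trace against bounded operators, and in this form products inherit it with the minimum of the
  ranks.\<close>

definition rank_bd :: "nat \<Rightarrow> 'a::complex_hilbert_space cop \<Rightarrow> bool"
  where "rank_bd k Z \<longleftrightarrow> fr Z \<and> norm Z \<le> 1 \<and> (\<forall>Q. cmod (tr (Z * Q)) \<le> real k * norm Q)"

lemma rank_bd_partial_isometry:
  assumes "on_fam {..<k} u" "on_fam {..<k} v"
  shows "rank_bd k (\<Sum>i<k. rk (u i) (v i))"
  unfolding rank_bd_def
proof (intro conjI allI)
  show "fr (\<Sum>i<k. rk (u i) (v i))" by (intro fr_sum) simp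
  show "norm (\<Sum>i<k. rk (u i) (v i)) \<le> 1" by (rule norm_partial_isometry_le) (use assms in auto)
  fix Q :: "'a cop"
  have n: "norm (u i) = 1" "norm (v i) = 1" if "i < k" for i
    using assms that by (auto simp: on_fam_def cinner_self_eq_one_iff[symmetric])
  have "cmod (tr ((\<Sum>i<k. rk (u i) (v i)) * Q)) = cmod (\<Sum>i<k. cinner (ap Q (u i)) (v i))"
    unfolding sum_distrib_right by (subst tr_sum) (auto simp: tr_rk_mult)
  also have "... \<le> (\<Sum>i<k. norm Q)"
  proof (rule sum_norm_le)
    fix i assume "i \<in> {..<k}"
    then have i: "i < k" by simp
    have "cmod (cinner (ap Q (u i)) (v i)) \<le> norm (ap Q (u i)) * norm (v i)" by (rule cinner_norm_le)
    also have "... \<le> norm Q" using norm_ap[of Q "u i"] n[OF i] by simp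
    finally show "cmod (cinner (ap Q (u i)) (v i)) \<le> norm Q" .
  qed
  finally show "cmod (tr ((\<Sum>i<k. rk (u i) (v i)) * Q)) \<le> real k * norm Q" by simp
qed

lemma rank_bd_mult:
  assumes Z: "rank_bd k Z" and W: "rank_bd j W"
  shows "rank_bd (min k j) (Z * W)"
  unfolding rank_bd_def
proof (intro conjI allI)
  show "fr (Z * W)" using Z by (auto simp: rank_bd_def)
  show "norm (Z * W) \<le> 1"
    using norm_mult_ineq[of Z W] mult_mono[of "norm Z" 1 "norm W" 1] Z W by (auto simp: rank_bd_def)
  fix Q :: "'a cop"
  have "cmod (tr (Z * (W * Q))) \<le> real k * norm (W * Q)" using Z by (simp add: rank_bd_def)
  also have "... \<le> real k * norm Q"
    using norm_mult_ineq[of W Q] mult_right_mono[of "norm W" 1 "norm Q"] W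
    by (intro mult_left_mono) (auto simp: rank_bd_def)
  finally have 1: "cmod (tr (Z * W * Q)) \<le> real k * norm Q" by (simp add: mult.assoc)
  have "tr (Z * W * Q) = tr (W * (Q * Z))"
    using tr_commute[of Z "W * Q"] Z by (simp add: rank_bd_def mult.assoc)
  also have "cmod ... \<le> real j * norm (Q * Z)" using W by (simp add: rank_bd_def)
  also have "... \<le> real j * norm Q"
    using norm_mult_ineq[of Q Z] mult_left_mono[of "norm Z" 1 "norm Q"] Z
    by (intro mult_left_mono) (auto simp: rank_bd_def)
  finally show "cmod (tr (Z * W * Q)) \<le> real (min k j) * norm Q" using 1 by (simp add: min_def)
qed

lemma abel_summation:
  fixes s :: "nat \<Rightarrow> real" and r :: "nat \<Rightarrow> 'b::real_vector"
  shows "(\<Sum>j<n. (s j - s (Suc j)) *\<^sub>R (\<Sum>i<Suc j. r i)) = (\<Sum>i<n. s i *\<^sub>R r i) - s n *\<^sub>R (\<Sum>i<n. r i)"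
  by (induction n) (simp_all add: algebra_simps)

text \<open>Writing each factor as a positive combination of partial isometries (layer cake), the trace
  of a product of partial isometries is at most the smallest of their ranks.\<close>

lemma trace_prod_singular_values:
  assumes "list_all2 (\<lambda>A s. \<exists>n u v. svd n s u v A) As ss" "rank_bd k Z"
  shows "cmod (tr (Z * prod_list As)) \<le> (\<Sum>t<k. prod_list (map (\<lambda>s. s t) ss))"
  using assms
proof (induction arbitrary: k Z rule: list_all2_induct)
  case Nil
  have "cmod (tr (Z * 1)) \<le> real k * norm (1 :: 'a cop)" using Nil unfolding rank_bd_def by blast
  also have "... \<le> real k" using norm_one_le mult_left_mono[of "norm (1 :: 'a cop)" 1 "real k"] by simp
  finally show ?case by simp
next
  case (Cons A As s ss)
  obtain n u v where svd: "svd n s u v A" using Cons.hyps(1) by blast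
  define W where "W j = (\<Sum>i<j. rk (u i) (v i))" for j
  define d where "d j = s j - s (Suc j)" for j
  have d0: "0 \<le> d j" for j using svd by (auto simp: svd_def d_def antimono_def)
  have W: "rank_bd j (W j)" if "j \<le> n" for j
    unfolding W_def by (rule rank_bd_partial_isometry) (use svd that in \<open>auto simp: svd_def on_fam_def\<close>)
  have A: "A = (\<Sum>j<n. d j *\<^sub>R W (Suc j))"
    using abel_summation[of s "\<lambda>i. rk (u i) (v i)" n] svd by (simp add: svd_def d_def W_def)
  define x where "x t = prod_list (map (\<lambda>s. s t) ss)" for t
  have bnd: "cmod (tr (Z * W (Suc j) * prod_list As)) \<le> (\<Sum>i<Suc j. if i < k then x i else 0)" if "j < n" for j
  proof -
    have "rank_bd (min k (Suc j)) (Z * W (Suc j))" by (intro rank_bd_mult Cons.prems W) (use that in auto)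
    from Cons.IH[OF this] have "cmod (tr (Z * W (Suc j) * prod_list As)) \<le> (\<Sum>t<min k (Suc j). x t)"
      by (simp add: x_def)
    also have "(\<Sum>t<min k (Suc j). x t) = (\<Sum>i\<in>{i. i < Suc j \<and> i < k}. x i)" by (rule sum.cong) auto
    also have "... = (\<Sum>i<Suc j. if i < k then x i else 0)"
      by (subst sum.inter_filter[symmetric]) (auto intro: sum.cong)
    finally show ?thesis .
  qed
  have frZ: "fr Z" using Cons.prems by (simp add: rank_bd_def)
  have "tr (Z * prod_list (A # As)) = (\<Sum>j<n. of_real (d j) * tr (Z * W (Suc j) * prod_list As))"
  proof -
    have "Z * prod_list (A # As) = (\<Sum>j<n. d j *\<^sub>R (Z * W (Suc j) * prod_list As))"
      by (simp add: A sum_distrib_left sum_distrib_right mult.assoc)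
    then show ?thesis using frZ by (simp add: tr_sum tr_scaleR fr_scaleR fr_mult_right)
  qed
  also have "cmod ... \<le> (\<Sum>j<n. d j *\<^sub>R (\<Sum>i<Suc j. if i < k then x i else 0))"
  proof (rule sum_norm_le)
    fix j assume "j \<in> {..<n}"
    then show "cmod (of_real (d j) * tr (Z * W (Suc j) * prod_list As))
        \<le> d j *\<^sub>R (\<Sum>i<Suc j. if i < k then x i else 0)"
      using mult_left_mono[OF bnd d0, of j] d0[of j] by (simp only: norm_mult norm_of_real real_scaleR_def) simp
  qed
  also have "... = (\<Sum>i<n. s i *\<^sub>R (if i < k then x i else 0))"
    unfolding d_def abel_summation using svd by (simp add: svd_def)
  also have "... = (\<Sum>i<k. s i * x i)"
  proof -
    have "(\<Sum>i<n. s i *\<^sub>R (if i < k then x i else 0)) = (\<Sum>i\<in>{..<n} \<inter> {..<k}. s i * x i)"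
      by (subst sum.inter_restrict) (auto intro: sum.cong)
    also have "... = (\<Sum>i<k. s i * x i)"
      by (rule sum.mono_neutral_left) (use svd in \<open>auto simp: svd_def\<close>, metis not_less)
    finally show ?thesis .
  qed
  finally show ?case by (simp add: x_def)
qed

lemma rank_bd_proj:
  assumes "onset B" "finite B"
  shows "rank_bd (card B) (proj B)"
proof -
  obtain f where f: "bij_betw f {..<card B} B" using ex_bij_betw_nat_finite[OF assms(2)] by (auto simp: atLeast0LessThan)
  have "on_fam {..<card B} f"
    unfolding on_fam_def
  proof (intro ballI)
    fix i j assume ij: "i \<in> {..<card B}" "j \<in> {..<card B}"
    then have "f i \<in> B" "f j \<in> B" "f i = f j \<longleftrightarrow> i = j"
      using f by (auto simp: bij_betw_def inj_on_eq_iff)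
    then show "cinner (f i) (f j) = (if i = j then 1 else 0)" by (simp add: onset_cinner[OF assms(1)])
  qed
  from rank_bd_partial_isometry[OF this this] show ?thesis
    unfolding proj_def using sum.reindex_bij_betw[OF f, of "\<lambda>b. rk b b"] by simp
qed

lemma sn_powr: "p > 0 \<Longrightarrow> sn p X powr p = spw p X"
  by (rule schatten_norm_powr)

lemma spw_scaleR:
  assumes "fr X" "p > 0"
  shows "spw p (c *\<^sub>R X) = \<bar>c\<bar> powr p * spw p X"
  using schatten_scaleR(2)[OF fr_schatten[OF assms] assms(2)] by (simp add: bl_scaleR)

lemma spw_zero: "p > 0 \<Longrightarrow> spw p 0 = 0"
  using spw_scaleR[of 0 p 0] by simp

lemma sn_scaleR: "fr X \<Longrightarrow> p > 0 \<Longrightarrow> sn p (c *\<^sub>R X) = \<bar>c\<bar> * sn p X"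
  by (cases "c = 0") (auto simp: schatten_norm_spow spw_scaleR powr_mult powr_powr spw_zero)

lemma sn_zero [simp]: "p > 0 \<Longrightarrow> sn p 0 = 0"
  using sn_scaleR[of 0 p 0] by simp

lemma sn_eq_zeroD:
  assumes "fr X" "p > 0" "sn p X = 0"
  shows "X = 0"
proof -
  obtain n s u v where svd: "svd n s u v X" by (rule svd_exists[OF assms(1)])
  have "spw p X = 0" using assms by (metis powr_eq_0_iff sn_powr)
  then have "(\<Sum>i<n. s i powr p) = 0" using svd_spw(1)[OF svd assms(2)] by simp
  then have "s i = 0" if "i < n" for i using that svd by (subst (asm) sum_nonneg_eq_0_iff) (auto simp: svd_def)
  then show ?thesis using svd by (simp add: svd_def)
qed

lemma sn_ideal:
  assumes "fr X" "p \<ge> 1"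
  shows "sn p (A * X * B) \<le> norm A * norm B * sn p X"
proof -
  have "spw p (A * X * B) \<le> (norm (bl A) * norm (bl B)) powr p * spw p X"
    unfolding bl_mult by (rule schatten_ideal) (use assms in \<open>auto intro: fr_schatten\<close>)
  moreover have "norm (bl A) = norm A" "norm (bl B) = norm B" by (transfer, simp)+
  ultimately have "spw p (A * X * B) powr (1 / p) \<le> ((norm A * norm B) powr p * spw p X) powr (1 / p)"
    using assms by (intro powr_mono2) auto
  also have "... = norm A * norm B * sn p X"
    using assms by (simp add: powr_mult powr_powr schatten_norm_spow)
  finally show ?thesis by (simp add: schatten_norm_spow)
qed

lemma sn_ideal_left:
  fixes A X :: "'a::complex_hilbert_space cop"
  assumes "fr X" "p \<ge> 1"
  shows "sn p (A * X) \<le> norm A * sn p X"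
proof -
  have "sn p (A * X * 1) \<le> norm A * norm (1 :: 'a cop) * sn p X" by (rule sn_ideal[OF assms])
  also have "... \<le> norm A * 1 * sn p X" by (intro mult_right_mono mult_left_mono norm_one_le) auto
  finally show ?thesis by simp
qed

lemma sn_ideal_right:
  fixes B X :: "'a::complex_hilbert_space cop"
  assumes "fr X" "p \<ge> 1"
  shows "sn p (X * B) \<le> norm B * sn p X"
proof -
  have "sn p (1 * X * B) \<le> norm (1 :: 'a cop) * norm B * sn p X" by (rule sn_ideal[OF assms])
  also have "... \<le> 1 * norm B * sn p X" by (intro mult_right_mono norm_one_le) auto
  finally show ?thesis by simp
qed

lemma sn_adj:
  assumes "fr X" "p > 0"
  shows "sn p (adj X) = sn p X"
proof -
  obtain n s u v where svd: "svd n s u v X" by (rule svd_exists[OF assms(1)])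
  then have X: "X = (\<Sum>i<n. s i *\<^sub>R rk (u i) (v i))" by (simp add: svd_def)
  have "adj X = (\<Sum>i<n. s i *\<^sub>R rk (v i) (u i))" by (simp add: X adj_sum adj_simps)
  then have "spw p (adj X) = (\<Sum>i<n. s i powr p)"
    by (intro spw_on_fam(2)) (use svd assms(2) in \<open>auto simp: svd_def\<close>)
  then show ?thesis using svd_spw(1)[OF svd assms(2)] by (simp add: schatten_norm_spow)
qed

lemma trace_le_sn1:
  assumes "fr X"
  shows "cmod (tr X) \<le> sn 1 X"
proof -
  obtain n s u v where svd: "svd n s u v X" by (rule svd_exists[OF assms(1)])
  then have X: "X = (\<Sum>i<n. s i *\<^sub>R rk (u i) (v i))" by (simp add: svd_def)
  have "tr X = (\<Sum>i<n. of_real (s i) * cinner (u i) (v i))"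
    unfolding X by (subst tr_sum) (auto simp: tr_scaleR fr_scaleR)
  also have "cmod ... \<le> (\<Sum>i<n. s i)"
  proof (rule sum_norm_le)
    fix i assume "i \<in> {..<n}"
    then have "norm (u i) = 1" "norm (v i) = 1" "0 \<le> s i"
      using svd by (auto simp: svd_def on_fam_def cinner_self_eq_one_iff[symmetric])
    then show "cmod (of_real (s i) * cinner (u i) (v i)) \<le> s i"
      using mult_left_mono[OF cinner_norm_le[of "u i" "v i"], of "s i"] by (simp add: norm_mult)
  qed
  also have "... = spw 1 X" using svd_spw(1)[OF svd, of 1] svd by (simp add: svd_def)
  finally show ?thesis by (simp add: schatten_norm_spow)
qed

text \<open>The extremal operator for the trace pairing: in terms of the polar decomposition X = U
  |X| it is |X|^(r - 1) times the adjoint of U. Its singular values are the powers s^(r - 1), still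
  in decreasing order.\<close>

lemma dual_operator:
  assumes svd: "svd n s u v X" and r: "r \<ge> 1"
  defines "Z \<equiv> \<Sum>i<n. (s i powr (r - 1)) *\<^sub>R rk (v i) (u i)"
  shows "fr Z" "tr (X * Z) = of_real (spw r X)"
    "svd n (\<lambda>i. if i < n then s i powr (r - 1) else 0) v u Z"
proof -
  show "fr Z" unfolding Z_def by (intro fr_sum fr_scaleR) simp
  have on: "on_fam {..<n} u" "on_fam {..<n} v" and s0: "\<And>i. 0 \<le> s i"
    and X: "X = (\<Sum>i<n. s i *\<^sub>R rk (u i) (v i))" using svd by (auto simp: svd_def)
  have cu: "cinner (u i) (u j) = (if i = j then 1 else 0)" if "i < n" "j < n" for i j
    using on(1) that by (simp add: on_fam_def)
  have nv: "cinner (v i) (v j) = (if i = j then 1 else 0)" if "i < n" "j < n" for i j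
    using on(2) that by (simp add: on_fam_def)
  have "X * Z = (\<Sum>i<n. \<Sum>j<n. (s i * s j powr (r - 1)) *\<^sub>R (cs (cinner (v j) (v i)) * rk (u i) (u j)))"
    unfolding X Z_def sum_distrib_right sum_distrib_left[of "_ *\<^sub>R _"]
    by (simp add: rk_mult(1) mult.commute)
  also have "... = (\<Sum>i<n. \<Sum>j<n. if j = i then (s i * s i powr (r - 1)) *\<^sub>R rk (u i) (u i) else 0)"
    by (intro sum.cong refl) (auto simp: nv cs_simps)
  also have "... = (\<Sum>i<n. (s i powr r) *\<^sub>R rk (u i) (u i))"
    using s0 by (auto intro!: sum.cong simp: powr_mult_base)
  finally have "tr (X * Z) = (\<Sum>i<n. of_real (s i powr r) * cinner (u i) (u i))"
    by (simp add: tr_sum tr_scaleR fr_scaleR)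
  also have "... = of_real (\<Sum>i<n. s i powr r)" by (simp add: cu)
  finally show "tr (X * Z) = of_real (spw r X)" using svd_spw(1)[OF svd, of r] r by simp
  show "svd n (\<lambda>i. if i < n then s i powr (r - 1) else 0) v u Z"
    unfolding svd_def
  proof (intro conjI allI impI)
    show "antimono (\<lambda>i. if i < n then s i powr (r - 1) else 0)"
      using svd r by (auto simp: antimono_def svd_def intro!: powr_mono2)
  qed (use on in \<open>auto simp: Z_def intro!: sum.cong\<close>)
qed

text \<open>Pairing \<open>X * Y\<close> with its extremal operator reduces everything to singular
  values: the sum of s^r is at most the sum of s^(r - 1) x y. The tangent inequality absorbs s^(r -
  1) into the left side, and Young's inequality separates x from y.\<close>

lemma sn_mult_normalized:
  assumes X: "fr X" "sn a X \<le> 1" and Y: "fr Y" "sn b Y \<le> 1"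
    and r: "a > 0" "b > 0" "1 / a + 1 / b = 1 / r" "r \<ge> 1"
  shows "sn r (X * Y) \<le> 1"
proof -
  obtain n x u v where sx: "svd n x u v X" by (rule svd_exists[OF X(1)])
  obtain n' y u' v' where sy: "svd n' y u' v' Y" by (rule svd_exists[OF Y(1)])
  obtain N s w z where ss: "svd N s w z (X * Y)" by (rule svd_exists[OF fr_mult_right[OF X(1), of Y]])
  note D = dual_operator[OF ss r(4)]
  define Z where "Z = (\<Sum>i<N. (s i powr (r - 1)) *\<^sub>R rk (z i) (w i))"
  define S where "S = spw r (X * Y)"
  \<comment> \<open>This projection does not change the product; it supplies the initial finite rank
    for \<open>trace_prod_singular_values\<close>.\<close>
  obtain B where B: "onset B" "finite B" "proj B * X = X" using fr_range_proj[OF X(1)] by blast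
  define k where "k = card B"
  have s0: "0 \<le> s i" "0 \<le> x i" "0 \<le> y i" for i using ss sx sy by (auto simp: svd_def)
  have sums: "(\<Sum>t<k. \<sigma> t powr q) \<le> spw q A" if A: "svd m \<sigma> f g A" and q: "q > 0" for \<sigma> q m f g and A :: "'a cop"
  proof -
    have "(\<Sum>t<k. \<sigma> t powr q) = (\<Sum>t\<in>{..<k} \<inter> {..<m}. \<sigma> t powr q)"
      by (rule sum.mono_neutral_right) (use A in \<open>auto simp: svd_def intro: leI\<close>)
    also have "... \<le> (\<Sum>t<m. \<sigma> t powr q)" by (rule sum_mono2) auto
    finally show ?thesis using svd_spw(1)[OF A q] by simp
  qed
  have "S = cmod (tr (proj B * prod_list [X, Y, Z]))"
    using D(2) by (simp add: S_def Z_def mult.assoc[symmetric] B(3))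
  also have "... \<le> (\<Sum>t<k. prod_list (map (\<lambda>s. s t) [x, y, \<lambda>i. if i < N then s i powr (r - 1) else 0]))"
    unfolding k_def
    by (rule trace_prod_singular_values[OF _ rank_bd_proj[OF B(1,2)]])
      (use sx sy D(3) in \<open>auto simp: Z_def\<close>)
  also have "... \<le> (\<Sum>t<k. s t powr (r - 1) * (x t * y t))"
    by (intro sum_mono) (use s0 in auto)
  finally have S1: "S \<le> (\<Sum>t<k. s t powr (r - 1) * (x t * y t))" .
  have "r * S \<le> (\<Sum>t<k. r * s t powr (r - 1) * (x t * y t))"
    using mult_left_mono[OF S1, of r] r by (simp add: sum_distrib_left mult.assoc)
  also have "... \<le> (\<Sum>t<k. (x t * y t) powr r + (r - 1) * s t powr r)"
    by (intro sum_mono Young_tangent r) (use s0 in auto)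
  also have "... = (\<Sum>t<k. (x t * y t) powr r) + (r - 1) * (\<Sum>t<k. s t powr r)"
    by (simp add: sum.distrib sum_distrib_left)
  also have "... \<le> (\<Sum>t<k. (x t * y t) powr r) + (r - 1) * S"
    unfolding S_def using sums[OF ss, of r] r by (intro add_left_mono mult_left_mono) auto
  finally have "S \<le> (\<Sum>t<k. (x t * y t) powr r)" by (simp add: algebra_simps)
  also have "... \<le> (\<Sum>t<k. r / a * x t powr a + r / b * y t powr b)"
  proof (rule sum_mono)
    fix t
    have ab: "r / a + r / b = 1"
    proof -
      have "r / a + r / b = r * (1 / a + 1 / b)" by (simp add: distrib_left)
      also have "... = 1" unfolding r(3) using r(4) by simp
      finally show ?thesis .
    qed
    show "(x t * y t) powr r \<le> r / a * x t powr a + r / b * y t powr b"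
    proof (cases "x t = 0 \<or> y t = 0")
      case False
      then have "(x t powr a) powr (r / a) * (y t powr b) powr (r / b) \<le> r / a * x t powr a + r / b * y t powr b"
        using r ab s0[of t] by (intro Youngs_inequality_0) auto
      then show ?thesis using r s0[of t] by (simp add: powr_powr powr_mult)
    qed (use r s0[of t] in auto)
  qed
  also have "... = r / a * (\<Sum>t<k. x t powr a) + r / b * (\<Sum>t<k. y t powr b)"
    by (simp add: sum.distrib sum_distrib_left)
  also have "... \<le> r / a * 1 + r / b * 1"
  proof (intro add_mono mult_left_mono)
    have 1: "q > 0 \<Longrightarrow> sn q A \<le> 1 \<Longrightarrow> spw q A \<le> 1" for q and A :: "'a cop"
      using sn_powr[of q A] powr_mono2[of q "sn q A" 1] by simp
    show "(\<Sum>t<k. x t powr a) \<le> 1" using sums[OF sx r(1)] 1[OF r(1) X(2)] by simp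
    show "(\<Sum>t<k. y t powr b) \<le> 1" using sums[OF sy r(2)] 1[OF r(2) Y(2)] by simp
  qed (use r in auto)
  also have "... = r * (1 / a + 1 / b)" by (simp add: distrib_left)
  also have "... = 1" unfolding r(3) using r(4) by simp
  finally have "spw r (X * Y) \<le> 1" by (simp add: S_def)
  then show ?thesis using powr_mono2[of "1 / r" "spw r (X * Y)" 1] r by (simp add: schatten_norm_spow)
qed

theorem sn_mult:
  assumes X: "fr X" and Y: "fr Y"
    and r: "a > 0" "b > 0" "1 / a + 1 / b = 1 / r" "r \<ge> 1"
  shows "sn r (X * Y) \<le> sn a X * sn b Y"
proof (cases "sn a X = 0 \<or> sn b Y = 0")
  case True
  then have "X = 0 \<or> Y = 0" using sn_eq_zeroD X Y r by blast
  then show ?thesis using r by auto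
next
  case False
  define x y where "x = sn a X" and "y = sn b Y"
  have xy: "x > 0" "y > 0" using False schatten_norm_nonneg[of a "bl X"] schatten_norm_nonneg[of b "bl Y"]
    unfolding x_def y_def by linarith+
  have "sn r ((1 / x) *\<^sub>R X * ((1 / y) *\<^sub>R Y)) \<le> 1"
    by (rule sn_mult_normalized[OF _ _ _ _ r])
      (use X Y xy r in \<open>auto simp: sn_scaleR x_def[symmetric] y_def[symmetric]\<close>)
  then have "sn r ((1 / (x * y)) *\<^sub>R (X * Y)) \<le> 1" by (simp add: mult.commute)
  then have "1 / (x * y) * sn r (X * Y) \<le> 1" using xy r X by (subst (asm) sn_scaleR) auto
  then show ?thesis using xy by (simp add: x_def[symmetric] y_def[symmetric] field_simps)
qed

lemma trace_hoelder:
  assumes "fr X" "fr Y" "a > 0" "b > 0" "1 / a + 1 / b = 1"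
  shows "cmod (tr (X * Y)) \<le> sn a X * sn b Y"
  using trace_le_sn1[OF fr_mult_right[OF assms(1), of Y]] sn_mult[OF assms(1-4), of 1] assms(5) by simp

section \<open>Duality, the triangle inequality and traces of products\<close>

lemma conjugate_exponent:
  fixes r :: real
  assumes "r > 1"
  shows "r / (r - 1) > 0" "1 / r + 1 / (r / (r - 1)) = 1" "r / (r - 1) > 1"
  using assms by (auto simp: field_simps)

lemma dual_exists:
  assumes X: "fr X" and r: "r > 1"
  obtains Z where "fr Z" "tr (X * Z) = of_real (spw r X)" "spw (r / (r - 1)) Z = spw r X"
proof -
  obtain n s u v where svd: "svd n s u v X" by (rule svd_exists[OF X])
  have r1: "r \<ge> 1" using r by simp
  note D = dual_operator[OF svd r1]
  have "spw (r / (r - 1)) (\<Sum>i<n. (s i powr (r - 1)) *\<^sub>R rk (v i) (u i)) = (\<Sum>i<n. (if i < n then s i powr (r - 1) else 0) powr (r / (r - 1)))"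
    by (rule svd_spw(1)[OF D(3) conjugate_exponent(1)[OF r]])
  also have "... = (\<Sum>i<n. s i powr r)" using r by (intro sum.cong) (auto simp: powr_powr)
  also have "... = spw r X" using svd_spw(1)[OF svd, of r] r by simp
  finally show thesis using that D(1,2) by blast
qed

lemma sn_le_dual:
  assumes X: "fr X" and r: "r > 1" and C: "C \<ge> 0"
    and bd: "\<And>Z. fr Z \<Longrightarrow> cmod (tr (X * Z)) \<le> C * sn (r / (r - 1)) Z"
  shows "sn r X \<le> C"
proof (cases "spw r X = 0")
  case True
  then show ?thesis using C by (simp add: schatten_norm_spow)
next
  case False
  define S where "S = spw r X"
  have S: "S > 0" using False spow_nonneg[of r "bl X"] unfolding S_def by linarith
  obtain Z where Z: "fr Z" "tr (X * Z) = of_real S" "spw (r / (r - 1)) Z = S"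
    using dual_exists[OF X r] unfolding S_def by blast
  have "S = cmod (tr (X * Z))" using Z(2) S by simp
  also have "... \<le> C * S powr (1 - 1 / r)"
    using bd[OF Z(1)] Z(3) r by (simp add: schatten_norm_spow diff_divide_distrib)
  also have "S powr (1 - 1 / r) = S / S powr (1 / r)" using S by (simp add: powr_diff)
  finally have "S powr (1 / r) \<le> C" using S by (simp add: field_simps)
  then show ?thesis by (simp add: schatten_norm_spow S_def)
qed

lemma sn_triangle:
  assumes "fr X" "fr Y" "r > 1"
  shows "sn r (X + Y) \<le> sn r X + sn r Y"
proof (rule sn_le_dual[OF fr_add[OF assms(1,2)] assms(3)])
  fix Z :: "'a cop" assume Z: "fr Z"
  note c = conjugate_exponent[OF assms(3)]
  have "cmod (tr ((X + Y) * Z)) \<le> cmod (tr (X * Z)) + cmod (tr (Y * Z))"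
    using assms by (simp add: distrib_right tr_add fr_mult_right norm_triangle_ineq)
  also have "... \<le> sn r X * sn (r / (r - 1)) Z + sn r Y * sn (r / (r - 1)) Z"
    using assms c Z by (intro add_mono trace_hoelder) auto
  finally show "cmod (tr ((X + Y) * Z)) \<le> (sn r X + sn r Y) * sn (r / (r - 1)) Z" by (simp add: distrib_right)
qed simp

text \<open>Each factor carries the reciprocal \<open>t\<close> of its exponent, because reciprocals
  add up.\<close>

lemma sn_prod_list:
  assumes "xs \<noteq> []" "\<And>A t. (A, t) \<in> set xs \<Longrightarrow> fr A \<and> t > 0" "sum_list (map snd xs) \<le> 1"
  shows "fr (prod_list (map fst xs))"
    "sn (1 / sum_list (map snd xs)) (prod_list (map fst xs)) \<le> prod_list (map (\<lambda>(A, t). sn (1 / t) A) xs)"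
proof -
  have "fr (prod_list (map fst xs)) \<and> sum_list (map snd xs) > 0 \<and>
    sn (1 / sum_list (map snd xs)) (prod_list (map fst xs)) \<le> prod_list (map (\<lambda>(A, t). sn (1 / t) A) xs)"
    using assms
  proof (induction xs)
    case (Cons x xs)
    obtain A t where x: "x = (A, t)" by (cases x)
    have At: "fr A" "t > 0" using Cons.prems(2)[of A t] x by auto
    show ?case
    proof (cases "xs = []")
      case True
      then show ?thesis using At by (simp add: x)
    next
      case False
      define T where "T = sum_list (map snd xs)"
      define P where "P = prod_list (map fst xs)"
      have tT: "t + T \<le> 1" using Cons.prems(3) by (simp add: x T_def)
      have IH: "fr P" "T > 0" "sn (1 / T) P \<le> prod_list (map (\<lambda>(A, t). sn (1 / t) A) xs)"
        using Cons.IH[OF False] Cons.prems(2) tT At(2) by (auto simp: T_def P_def)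
      have "sn (1 / (t + T)) (A * P) \<le> sn (1 / t) A * sn (1 / T) P"
        by (rule sn_mult) (use At IH tT in auto)
      also have "... \<le> sn (1 / t) A * prod_list (map (\<lambda>(A, t). sn (1 / t) A) xs)"
        by (intro mult_left_mono IH(3)) simp
      finally show ?thesis using At IH by (auto simp: x T_def P_def)
    qed
  qed simp
  then show "fr (prod_list (map fst xs))"
    "sn (1 / sum_list (map snd xs)) (prod_list (map fst xs)) \<le> prod_list (map (\<lambda>(A, t). sn (1 / t) A) xs)"
    by auto
qed

lemma trace_prod_list:
  assumes "xs \<noteq> []" "\<And>A t. (A, t) \<in> set xs \<Longrightarrow> fr A \<and> t > 0" "sum_list (map snd xs) = 1"
  shows "cmod (tr (prod_list (map fst xs))) \<le> prod_list (map (\<lambda>(A, t). sn (1 / t) A) xs)"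
proof -
  have "fr (prod_list (map fst xs))" using sn_prod_list(1)[OF assms(1,2)] assms(3) by simp
  from trace_le_sn1[OF this] show ?thesis using sn_prod_list(2)[OF assms(1,2)] assms(3) by simp
qed

lemma trace_prod_list_same:
  assumes k: "k \<ge> 1" "length As = k" and fr: "\<And>A. A \<in> set As \<Longrightarrow> fr A"
  shows "cmod (tr (prod_list As)) \<le> prod_list (map (sn (real k)) As)"
proof -
  let ?xs = "map (\<lambda>A. (A, 1 / real k)) As"
  have "cmod (tr (prod_list (map fst ?xs))) \<le> prod_list (map (\<lambda>(A, t). sn (1 / t) A) ?xs)"
    by (rule trace_prod_list) (use assms in \<open>auto simp: comp_def sum_list_triv\<close>)
  then show ?thesis by (simp add: comp_def)
qed

lemma spw_eq_power: "k \<ge> 1 \<Longrightarrow> spw (real k) X = sn (real k) X ^ k"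
  using sn_powr[of "real k" X] by (simp add: powr_realpow')

text \<open>For an even exponent the norm is the trace of a polynomial and thus accessible to
  algebra; this is the starting point of the multiplier estimate.\<close>

lemma trace_gram_power:
  assumes X: "fr X" and k: "k \<ge> 1"
  shows "tr ((adj X * X) ^ k) = of_real (spw (2 * real k) X)"
proof -
  obtain n s u v where svd: "svd n s u v X" by (rule svd_exists[OF X])
  have on: "on_fam {..<n} u" "on_fam {..<n} v" and s0: "\<And>i. 0 \<le> s i"
    and Xe: "X = (\<Sum>i<n. s i *\<^sub>R rk (u i) (v i))" using svd by (auto simp: svd_def)
  have cu: "cinner (u i) (u j) = (if i = j then 1 else 0)" if "i < n" "j < n" for i j
    using on(1) that by (simp add: on_fam_def)
  have nv: "cinner (v i) (v j) = (if i = j then 1 else 0)" if "i < n" "j < n" for i j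
    using on(2) that by (simp add: on_fam_def)
  have gram: "adj X * X = (\<Sum>i<n. ((s i)\<^sup>2) *\<^sub>R rk (v i) (v i))"
  proof -
    have "adj X * X = (\<Sum>i<n. \<Sum>j<n. (s i * s j) *\<^sub>R (cs (cinner (u j) (u i)) * rk (v i) (v j)))"
      unfolding Xe adj_sum adj_simps sum_distrib_right sum_distrib_left[of "_ *\<^sub>R _"]
      by (simp add: rk_mult(1) mult.commute)
    also have "... = (\<Sum>i<n. \<Sum>j<n. if j = i then ((s i)\<^sup>2) *\<^sub>R rk (v i) (v i) else 0)"
      by (intro sum.cong refl) (auto simp: cu cs_simps power2_eq_square)
    finally show ?thesis by simp
  qed
  have pow: "(adj X * X) ^ Suc m = (\<Sum>i<n. ((s i) ^ (2 * Suc m)) *\<^sub>R rk (v i) (v i))" for m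
  proof (induction m)
    case 0
    show ?case using gram by (simp add: power2_eq_square)
  next
    case (Suc m)
    have "(adj X * X) ^ Suc (Suc m) = (\<Sum>i<n. \<Sum>j<n. ((s i)\<^sup>2 * s j ^ (2 * Suc m)) *\<^sub>R (cs (cinner (v j) (v i)) * rk (v i) (v j)))"
      unfolding power_Suc[of _ "Suc m"] Suc.IH unfolding gram sum_distrib_right sum_distrib_left[of "_ *\<^sub>R _"]
      by (simp add: rk_mult(1) mult.commute)
    also have "... = (\<Sum>i<n. \<Sum>j<n. if j = i then (s i ^ (2 * Suc (Suc m))) *\<^sub>R rk (v i) (v i) else 0)"
      by (intro sum.cong refl) (auto simp: nv cs_simps power2_eq_square)
    finally show ?case by simp
  qed
  obtain m where m: "k = Suc m" using k by (cases k) auto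
  have "tr ((adj X * X) ^ k) = (\<Sum>i<n. of_real (s i ^ (2 * k)) * cinner (v i) (v i))"
    unfolding m pow by (subst tr_sum) (auto simp: tr_scaleR fr_scaleR)
  also have "... = of_real (\<Sum>i<n. s i ^ (2 * k))" by (simp add: nv)
  also have "(\<Sum>i<n. s i ^ (2 * k)) = (\<Sum>i<n. s i powr (2 * real k))"
  proof (intro sum.cong refl)
    fix i
    show "s i ^ (2 * k) = s i powr (2 * real k)"
      using powr_realpow'[OF s0[of i], of "2 * k"] k by simp
  qed
  also have "... = spw (2 * real k) X" using svd_spw(1)[OF svd, of "2 * real k"] k by simp
  finally show ?thesis .
qed

lemma fr_power: "fr X \<Longrightarrow> k \<ge> 1 \<Longrightarrow> fr (X ^ k)"
  by (cases k) auto

lemma power_diff_noncomm: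
  fixes x y :: "'a::{ring, monoid_mult}"
  shows "x ^ k - y ^ k = (\<Sum>i<k. y ^ i * (x - y) * x ^ (k - 1 - i))"
proof (induction k)
  case (Suc k)
  have "x ^ Suc k - y ^ Suc k = (x ^ k - y ^ k) * x + y ^ k * (x - y)"
    by (simp add: algebra_simps power_commutes)
  also have "(x ^ k - y ^ k) * x = (\<Sum>i<k. y ^ i * (x - y) * x ^ (Suc k - 1 - i))"
    unfolding Suc sum_distrib_right
  proof (intro sum.cong refl)
    fix i assume "i \<in> {..<k}"
    then have "Suc k - 1 - i = Suc (k - 1 - i)" by auto
    then show "y ^ i * (x - y) * x ^ (k - 1 - i) * x = y ^ i * (x - y) * x ^ (Suc k - 1 - i)"
      by (simp add: mult.assoc power_commutes)
  qed
  finally show ?case by simp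
qed simp

lemma minus_power_noncomm: "(- x) ^ k = (if even k then x ^ k else - (x ^ k :: 'a::{ring, monoid_mult}))"
  by (induction k) auto

subsection \<open>Matrices with respect to an orthonormal family\<close>

definition mx :: "nat \<Rightarrow> (nat \<Rightarrow> 'a::complex_hilbert_space) \<Rightarrow> (nat \<Rightarrow> nat \<Rightarrow> complex) \<Rightarrow> 'a cop"
  where "mx n e a = (\<Sum>i<n. \<Sum>j<n. cs (a i j) * rk (e i) (e j))"

definition dg :: "nat \<Rightarrow> (nat \<Rightarrow> 'a::complex_hilbert_space) \<Rightarrow> (nat \<Rightarrow> complex) \<Rightarrow> 'a cop"
  where "dg n e d = mx n e (\<lambda>i j. if i = j then d i else 0)"

definition cf :: "(nat \<Rightarrow> 'a::complex_hilbert_space) \<Rightarrow> 'a cop \<Rightarrow> nat \<Rightarrow> nat \<Rightarrow> complex"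
  where "cf e A i j = cinner (ap A (e j)) (e i)"

lemma fr_mx [simp]: "fr (mx n e a)"
  unfolding mx_def by (intro fr_sum fr_mult_left fr_rk)

lemma fr_dg [simp]: "fr (dg n e d)"
  by (simp add: dg_def)

lemma mx_cong: "(\<And>i j. i < n \<Longrightarrow> j < n \<Longrightarrow> a i j = b i j) \<Longrightarrow> mx n e a = mx n e b"
  unfolding mx_def by (intro sum.cong refl) auto

lemma mx_add: "mx n e a + mx n e b = mx n e (\<lambda>i j. a i j + b i j)"
  by (simp add: mx_def sum.distrib[symmetric] cs_simps distrib_right)

lemma mx_scaleR: "r *\<^sub>R mx n e a = mx n e (\<lambda>i j. of_real r * a i j)"
proof -
  have "r *\<^sub>R (cs c * X) = cs (of_real r * c) * X" for c and X :: "'a cop"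
    by (simp only: cs_simps(6) mult.assoc cs_of_real_mult mult_scaleR_left)
  then show ?thesis by (simp add: mx_def scaleR_sum_right)
qed

lemma adj_mx: "adj (mx n e a) = mx n e (\<lambda>i j. cnj (a j i))"
proof -
  have "adj (mx n e a) = (\<Sum>i<n. \<Sum>j<n. cs (cnj (a i j)) * rk (e j) (e i))"
    by (simp add: mx_def adj_sum adj_simps cs_commute)
  then show ?thesis unfolding mx_def by (subst sum.swap)
qed

lemma mx_mult:
  assumes e: "on_fam {..<n} e"
  shows "mx n e a * mx n e b = mx n e (\<lambda>i j. \<Sum>k<n. a i k * b k j)"
proof -
  have "(cs (a i k) * rk (e i) (e k)) * mx n e b = (\<Sum>j<n. cs (a i k * b k j) * rk (e i) (e j))"
    if "i < n" "k < n" for i k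
  proof -
    have "(cs (a i k) * rk (e i) (e k)) * mx n e b
        = (\<Sum>k'<n. \<Sum>j<n. if k' = k then cs (a i k * b k j) * rk (e i) (e j) else 0)"
      unfolding mx_def sum_distrib_left
    proof (intro sum.cong refl)
      fix k' j assume "k' \<in> {..<n}" "j \<in> {..<n}"
      have "rk (e i) (e k) * (cs (b k' j) * rk (e k') (e j)) = cs (b k' j) * rk (e i) (e k) * rk (e k') (e j)"
        using cs_commute[of "b k' j" "rk (e i) (e k)"] by (simp only: mult.assoc[symmetric])
      then have "(cs (a i k) * rk (e i) (e k)) * (cs (b k' j) * rk (e k') (e j))
          = cs (a i k) * (cs (b k' j) * rk (e i) (e k)) * rk (e k') (e j)"
        by (simp only: mult.assoc)
      also have "... = cs (a i k * b k' j) * (cs (cinner (e k') (e k)) * rk (e i) (e j))"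
        by (simp add: cs_simps mult.assoc rk_mult(1))
      finally show "(cs (a i k) * rk (e i) (e k)) * (cs (b k' j) * rk (e k') (e j))
          = (if k' = k then cs (a i k * b k j) * rk (e i) (e j) else 0)"
        using e that \<open>k' \<in> {..<n}\<close> by (auto simp: on_fam_def cs_simps)
    qed
    also have "... = (\<Sum>j<n. \<Sum>k'<n. if k' = k then cs (a i k * b k j) * rk (e i) (e j) else 0)"
      by (rule sum.swap)
    finally show ?thesis using that by simp
  qed
  then have "mx n e a * mx n e b = (\<Sum>i<n. \<Sum>k<n. \<Sum>j<n. cs (a i k * b k j) * rk (e i) (e j))"
    unfolding mx_def[of n e a] sum_distrib_right by (intro sum.cong refl) auto
  also have "... = (\<Sum>i<n. \<Sum>j<n. \<Sum>k<n. cs (a i k * b k j) * rk (e i) (e j))"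
    by (intro sum.cong refl sum.swap)
  also have "... = mx n e (\<lambda>i j. \<Sum>k<n. a i k * b k j)"
  proof -
    have "(cs (sum f S) :: 'a cop) = (\<Sum>k\<in>S. cs (f k))" for f :: "nat \<Rightarrow> complex" and S
      by (induction S rule: infinite_finite_induct) (auto simp: cs_simps)
    then show ?thesis by (simp add: mx_def sum_distrib_right)
  qed
  finally show ?thesis .
qed

lemma dg_mult_mx: "on_fam {..<n} e \<Longrightarrow> dg n e d * mx n e a = mx n e (\<lambda>i j. d i * a i j)"
  unfolding dg_def by (subst mx_mult, assumption, rule mx_cong) (simp add: if_distrib[of "\<lambda>x. x * _"] cong: if_cong)

lemma mx_mult_dg: "on_fam {..<n} e \<Longrightarrow> mx n e a * dg n e d = mx n e (\<lambda>i j. a i j * d j)"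
  unfolding dg_def by (subst mx_mult, assumption, rule mx_cong) (simp add: if_distrib[of "\<lambda>x. _ * x"] cong: if_cong)

lemma dg_mult_dg: "on_fam {..<n} e \<Longrightarrow> dg n e c * dg n e d = dg n e (\<lambda>i. c i * d i)"
  unfolding dg_def[of n e d] by (subst dg_mult_mx) (auto simp: dg_def intro: mx_cong)

lemma dg_eq: "dg n e d = (\<Sum>i<n. cs (d i) * rk (e i) (e i))"
  unfolding dg_def mx_def
proof (intro sum.cong refl)
  fix i assume "i \<in> {..<n}"
  have "(\<Sum>j<n. cs (if i = j then d i else 0) * rk (e i) (e j)) = (\<Sum>j<n. if j = i then cs (d i) * rk (e i) (e i) else 0)"
    by (intro sum.cong refl) (auto simp: cs_simps)
  then show "(\<Sum>j<n. cs (if i = j then d i else 0) * rk (e i) (e j)) = cs (d i) * rk (e i) (e i)"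
    using \<open>i \<in> {..<n}\<close> by simp
qed

lemma dg_mult_op_dg: "dg n e c * A * dg n e d = mx n e (\<lambda>i j. c i * cf e A i j * d j)"
proof -
  have "dg n e c * A * dg n e d = (\<Sum>i<n. \<Sum>j<n. (cs (c i) * rk (e i) (e i)) * A * (cs (d j) * rk (e j) (e j)))"
    unfolding dg_eq sum_distrib_right by (simp add: sum_distrib_left)
  also have "... = mx n e (\<lambda>i j. c i * cf e A i j * d j)"
    unfolding mx_def
  proof (intro sum.cong refl)
    fix i j
    have "rk (e i) (e i) * A * cs (d j) = cs (d j) * (rk (e i) (e i) * A)" by (rule cs_commute[symmetric])
    then have "(cs (c i) * rk (e i) (e i)) * A * (cs (d j) * rk (e j) (e j))
        = cs (c i) * cs (d j) * (rk (e i) (e i) * (A * rk (e j) (e j)))"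
      by (simp only: mult.assoc) (simp only: mult.assoc[symmetric])
    also have "rk (e i) (e i) * (A * rk (e j) (e j)) = cs (cf e A i j) * rk (e i) (e j)"
      by (simp add: rk_mult(2)[of A] rk_mult(1) cf_def)
    finally show "(cs (c i) * rk (e i) (e i)) * A * (cs (d j) * rk (e j) (e j))
        = cs (c i * cf e A i j * d j) * rk (e i) (e j)"
      by (simp add: mult.assoc[symmetric] cs_simps(6)[symmetric]) (simp add: mult_ac)
  qed
  finally show ?thesis .
qed

lemma norm_dg_le:
  assumes e: "on_fam {..<n} e" and d: "\<And>i. i < n \<Longrightarrow> cmod (d i) \<le> C" and C: "0 \<le> C"
  shows "norm (dg n e d) \<le> C"
proof (rule norm_copI[OF C])
  fix x
  have "ap (dg n e d) x = (\<Sum>i<n. scaleC (d i * cinner x (e i)) (e i))"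
    by (simp add: dg_eq scaleC_scaleC mult.commute)
  then have "(norm (ap (dg n e d) x))\<^sup>2 = (\<Sum>i<n. (cmod (d i * cinner x (e i)))\<^sup>2)"
    by (simp add: norm_sum_on_fam[OF e])
  also have "... \<le> (\<Sum>i<n. C\<^sup>2 * (cmod (cinner x (e i)))\<^sup>2)"
    by (intro sum_mono) (use d in \<open>auto simp: norm_mult power_mult_distrib intro!: mult_right_mono power_mono\<close>)
  also have "... \<le> C\<^sup>2 * (norm x)\<^sup>2"
    unfolding sum_distrib_left[symmetric]
    by (intro mult_left_mono) (use on_fam_bessel[OF e] in \<open>auto simp: bessel_fam_def\<close>)
  also have "... = (C * norm x)\<^sup>2" by (simp add: power_mult_distrib)
  finally show "norm (ap (dg n e d) x) \<le> C * norm x" by (rule power2_le_imp_le) (simp add: C)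
qed

lemma cf_add: "cf e (A + B) i j = cf e A i j + cf e B i j" by (simp add: cf_def cinner_add_left)
lemma cf_scaleR: "cf e (r *\<^sub>R A) i j = of_real r * cf e A i j" by (simp add: cf_def cinner_scaleR_left)
lemma cf_adj: "cf e (adj A) i j = cnj (cf e A j i)"
  unfolding cf_def by (metis cinner_adj_left cinner_commute)

subsection \<open>The Sylvester multipliers\<close>

text \<open>For eigenvalues \<open>x = l i \<ge> 0\<close> and \<open>- z = l j < 0\<close> the multipliers are \<open>x / (x + z)\<close> and
  \<open>z / (x + z)\<close>.\<close>

definition syl1 :: "nat \<Rightarrow> (nat \<Rightarrow> 'a::complex_hilbert_space) \<Rightarrow> (nat \<Rightarrow> real) \<Rightarrow> 'a cop \<Rightarrow> 'a cop"
  where "syl1 n e l A = mx n e (\<lambda>i j. if 0 \<le> l i \<and> l j < 0 then of_real (l i / (l i - l j)) * cf e A i j else 0)"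

definition syl2 :: "nat \<Rightarrow> (nat \<Rightarrow> 'a::complex_hilbert_space) \<Rightarrow> (nat \<Rightarrow> real) \<Rightarrow> 'a cop \<Rightarrow> 'a cop"
  where "syl2 n e l A = mx n e (\<lambda>i j. if 0 \<le> l i \<and> l j < 0 then of_real (- l j / (l i - l j)) * cf e A i j else 0)"

definition pospr :: "nat \<Rightarrow> (nat \<Rightarrow> 'a::complex_hilbert_space) \<Rightarrow> (nat \<Rightarrow> real) \<Rightarrow> 'a cop"
  where "pospr n e l = dg n e (\<lambda>i. if 0 \<le> l i then 1 else 0)"

definition negpr :: "nat \<Rightarrow> (nat \<Rightarrow> 'a::complex_hilbert_space) \<Rightarrow> (nat \<Rightarrow> real) \<Rightarrow> 'a cop"
  where "negpr n e l = dg n e (\<lambda>i. if l i < 0 then 1 else 0)"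

lemma fr_syl [simp]: "fr (syl1 n e l A)" "fr (syl2 n e l A)"
  by (simp_all add: syl1_def syl2_def)

lemma syl_add: "syl1 n e l A + syl2 n e l A = pospr n e l * A * negpr n e l"
  unfolding syl1_def syl2_def pospr_def negpr_def dg_mult_op_dg mx_add
proof (rule mx_cong)
  fix i j
  have "0 \<le> l i \<Longrightarrow> l j < 0 \<Longrightarrow>
      complex_of_real (l i / (l i - l j)) * c + complex_of_real (- l j / (l i - l j)) * c = c" for c
  proof -
    assume "0 \<le> l i" "l j < 0"
    then have "l i / (l i - l j) + - l j / (l i - l j) = 1" by (simp add: diff_divide_distrib[symmetric])
    then show ?thesis by (metis distrib_right of_real_add of_real_1 mult_1)
  qed
  then show "(if 0 \<le> l i \<and> l j < 0 then complex_of_real (l i / (l i - l j)) * cf e A i j else 0) +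
      (if 0 \<le> l i \<and> l j < 0 then complex_of_real (- l j / (l i - l j)) * cf e A i j else 0)
      = (if 0 \<le> l i then 1 else 0) * cf e A i j * (if l j < 0 then 1 else 0)" by auto
qed

text \<open>\<open>N\<^sup>* M\<close> is similar to the positive operator \<open>K\<^sup>* K\<close>, so all its powers have positive trace.\<close>

lemma syl_trace_nonneg:
  assumes e: "on_fam {..<n} e" and k: "k \<ge> 1"
  shows "\<exists>r\<ge>0. tr ((adj (syl2 n e l A) * syl1 n e l A) ^ k) = complex_of_real r"
proof -
  \<comment> \<open>The geometric mean sqrt (x z) / (x + z) of the two multipliers. In the product
    the weights in x cancel, and those in z depend on one index only and are collected in
    \<open>D\<close> and \<open>D'\<close>.\<close>
  define K where "K = mx n e (\<lambda>i j. if 0 \<le> l i \<and> l j < 0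
    then of_real (sqrt (l i) * sqrt (- l j) / (l i - l j)) * cf e A i j else 0)"
  define D where "D = dg n e (\<lambda>i. if l i < 0 then of_real (sqrt (- l i)) else 0)"
  define D' where "D' = dg n e (\<lambda>i. if l i < 0 then of_real (1 / sqrt (- l i)) else 0)"
  define Q where "Q = adj K * K"
  have eq: "adj (syl2 n e l A) * syl1 n e l A = D * Q * D'"
    unfolding Q_def K_def D_def D'_def syl1_def syl2_def adj_mx mx_mult[OF e] dg_mult_mx[OF e] mx_mult_dg[OF e]
  proof (rule mx_cong)
    fix i j
    show "(\<Sum>k<n. cnj (if 0 \<le> l k \<and> l i < 0 then complex_of_real (- l i / (l k - l i)) * cf e A k i else 0) *
          (if 0 \<le> l k \<and> l j < 0 then complex_of_real (l k / (l k - l j)) * cf e A k j else 0)) =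
      (if l i < 0 then complex_of_real (sqrt (- l i)) else 0) *
      (\<Sum>k<n. cnj (if 0 \<le> l k \<and> l i < 0 then complex_of_real (sqrt (l k) * sqrt (- l i) / (l k - l i)) * cf e A k i else 0) *
          (if 0 \<le> l k \<and> l j < 0 then complex_of_real (sqrt (l k) * sqrt (- l j) / (l k - l j)) * cf e A k j else 0)) *
      (if l j < 0 then complex_of_real (1 / sqrt (- l j)) else 0)"
    proof (cases "l i < 0 \<and> l j < 0")
      case True
      have "complex_of_real (- l i / (l k - l i)) * c * (complex_of_real (l k / (l k - l j)) * d) =
        complex_of_real (sqrt (- l i)) * (complex_of_real (sqrt (l k) * sqrt (- l i) / (l k - l i)) * c *
          (complex_of_real (sqrt (l k) * sqrt (- l j) / (l k - l j)) * d)) * complex_of_real (1 / sqrt (- l j))"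
        if "0 \<le> l k" for k c d
      proof -
        define \<alpha> \<beta> \<kappa> where "\<alpha> = sqrt (- l i)" and "\<beta> = sqrt (- l j)" and "\<kappa> = sqrt (l k)"
        have sq: "\<alpha> * \<alpha> = - l i" "\<kappa> * \<kappa> = l k" "\<beta> \<noteq> 0"
          using that True by (auto simp: \<alpha>_def \<beta>_def \<kappa>_def)
        have "- l i / (l k - l i) * (l k / (l k - l j)) = (\<alpha> * \<alpha>) / (l k - l i) * ((\<kappa> * \<kappa>) / (l k - l j))"
          by (simp only: sq)
        also have "... = \<alpha> * (\<kappa> * \<alpha> / (l k - l i)) * (\<kappa> * \<beta> / (l k - l j)) * (1 / \<beta>)"
          using sq(3) by (simp add: mult_ac)
        finally have r: "- l i / (l k - l i) * (l k / (l k - l j)) =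
          sqrt (- l i) * (sqrt (l k) * sqrt (- l i) / (l k - l i)) * (sqrt (l k) * sqrt (- l j) / (l k - l j)) * (1 / sqrt (- l j))"
          by (simp only: \<alpha>_def \<beta>_def \<kappa>_def)
        show ?thesis using arg_cong[OF r, of complex_of_real] unfolding of_real_mult by (simp only: mult_ac)
      qed
      then show ?thesis
        using True unfolding sum_distrib_left sum_distrib_right
        by (intro sum.cong refl) auto
    qed auto
  qed
  have D'D: "D' * D = negpr n e l"
    unfolding D_def D'_def dg_mult_dg[OF e] negpr_def
    by (rule arg_cong[of _ _ "dg n e"]) (auto simp: fun_eq_iff simp flip: of_real_mult)
  have KE: "K * negpr n e l = K"
    unfolding K_def negpr_def mx_mult_dg[OF e] by (rule mx_cong) auto
  have QE: "Q * negpr n e l = Q" by (simp add: Q_def mult.assoc KE)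
  have pow: "(D * Q * D') ^ Suc m = D * Q ^ Suc m * D'" for m
  proof (induction m)
    case (Suc m)
    have "(D * Q * D') ^ Suc (Suc m) = (D * Q * D') * (D * Q ^ Suc m * D')" using Suc by simp
    also have "... = D * (Q * (D' * D)) * Q ^ Suc m * D'" by (simp only: mult.assoc)
    also have "... = D * Q ^ Suc (Suc m) * D'" by (simp add: D'D QE mult.assoc)
    finally show ?case .
  qed simp
  obtain m where m: "k = Suc m" using k by (cases k) auto
  have "tr ((adj (syl2 n e l A) * syl1 n e l A) ^ k) = tr (D * (Q ^ k * D'))"
    unfolding eq m pow by (simp only: mult.assoc)
  also have "... = tr (Q ^ k * (D' * D))"
    using tr_commute[of D "Q ^ k * D'"] by (simp add: D_def mult.assoc)
  also have "... = tr (Q ^ k)" by (simp add: D'D m power_Suc2 mult.assoc QE del: power_Suc)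
  also have "... = of_real (spw (2 * real k) K)" unfolding Q_def by (rule trace_gram_power) (use k in \<open>auto simp: K_def\<close>)
  finally show ?thesis using spow_nonneg by blast
qed

lemma norm_pospr_le: "on_fam {..<n} e \<Longrightarrow> norm (pospr n e l) \<le> 1"
  and norm_negpr_le: "on_fam {..<n} e \<Longrightarrow> norm (negpr n e l) \<le> 1"
  by (auto simp: pospr_def negpr_def intro!: norm_dg_le)

lemma sn_corner_le:
  assumes "on_fam {..<n} e" "fr A" "p \<ge> 1"
  shows "sn p (pospr n e l * A * negpr n e l) \<le> sn p A"
proof -
  have "sn p (pospr n e l * A * negpr n e l) \<le> norm (pospr n e l) * norm (negpr n e l) * sn p A"
    by (rule sn_ideal[OF assms(2,3)])
  also have "... \<le> 1 * 1 * sn p A"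
    using norm_pospr_le[OF assms(1)] norm_negpr_le[OF assms(1)] by (intro mult_right_mono mult_mono) auto
  finally show ?thesis by simp
qed

text \<open>Put x = \<open>adj N * N\<close> and y = \<open>- (adj N * M)\<close>; then x - y =
  \<open>adj N * A0\<close> no longer contains the multipliers in its second factor. For odd
  \<open>k\<close> the trace of y^k is nonpositive, while that of x^k is the 2k-th power of the norm
  of \<open>N\<close>, which is therefore at most |tr (x^k - y^k)|. Each term of the telescoped
  difference contains x - y once, and this trades one norm of \<open>N\<close> for a norm of
  \<open>A\<close>.\<close>

theorem sn_syl2_even:
  assumes e: "on_fam {..<n} e" and A: "fr A" and k: "odd k"
  shows "sn (2 * real k) (syl2 n e l A) \<le> 1 / (2 powr (1 / real k) - 1) * sn (2 * real k) A"
proof -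
  have k1: "k \<ge> 1" using k by (cases k) auto
  define q where "q = 2 * real k"
  have q: "q \<ge> 2" "q > 0" using k1 by (auto simp: q_def)
  define N M A0 where "N = syl2 n e l A" and "M = syl1 n e l A" and "A0 = pospr n e l * A * negpr n e l"
  have A0: "A0 = M + N" unfolding A0_def M_def N_def by (simp add: syl_add[symmetric])
  have fr: "fr N" "fr M" "fr A0" using A by (auto simp: N_def M_def A0_def)
  define a g \<nu> where "a = sn q A" and "g = sn q M" and "\<nu> = sn q N"
  have nn: "0 \<le> a" "0 \<le> g" "0 \<le> \<nu>" by (simp_all add: a_def g_def \<nu>_def)
  have A0a: "sn q A0 \<le> a" unfolding A0_def a_def using sn_corner_le[OF e A] q by simp
  have "M = A0 + (-1) *\<^sub>R N" by (simp add: A0)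
  then have "g \<le> sn q A0 + sn q ((-1) *\<^sub>R N)"
    unfolding g_def by (metis fr(1,3) fr_scaleR q(1) sn_triangle less_le_trans one_less_numeral_iff semiring_norm(76))
  also have "sn q ((-1) *\<^sub>R N) = \<nu>" unfolding \<nu>_def by (subst sn_scaleR[OF fr(1) q(2)]) simp
  finally have g_le: "g \<le> \<nu> + a" using A0a by linarith
  define x where "x = adj N * N"
  define y where "y = - (adj N * M)"
  have xy: "x - y = adj N * A0" by (simp add: x_def y_def A0 distrib_left)
  have snk: "sn (real k) (adj N * B) \<le> \<nu> * sn q B" if "fr B" for B
  proof -
    have "sn (real k) (adj N * B) \<le> sn q (adj N) * sn q B"
      by (rule sn_mult) (use fr that q k1 in \<open>auto simp: q_def\<close>)
    then show ?thesis using sn_adj[OF fr(1), of q] q by (simp add: \<nu>_def)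
  qed
  have snx: "sn (real k) x \<le> \<nu> * \<nu>" unfolding x_def using snk[OF fr(1)] by (simp add: \<nu>_def)
  have sny: "sn (real k) y \<le> \<nu> * g"
  proof -
    have "y = (-1) *\<^sub>R (adj N * M)" by (simp add: y_def)
    then have "sn (real k) y = sn (real k) (adj N * M)" using fr k1 by (simp only: sn_scaleR fr_mult_left)
    then show ?thesis using snk[OF fr(2)] by (simp add: g_def)
  qed
  have snxy: "sn (real k) (x - y) \<le> \<nu> * a"
    unfolding xy using snk[OF fr(3)] mult_left_mono[OF A0a nn(3)] by linarith
  have frxy: "fr x" "fr y" using fr by (auto simp: x_def y_def)
  have "tr (x ^ k) - tr (y ^ k) = (\<Sum>i<k. tr (y ^ i * (x - y) * x ^ (k - 1 - i)))"
  proof -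
    have f: "fr (y ^ i * (x - y) * x ^ (k - 1 - i))" for i using frxy by auto
    have "tr (x ^ k) - tr (y ^ k) = tr (x ^ k - y ^ k)" using frxy k1 by (simp add: tr_diff fr_power)
    then show ?thesis unfolding power_diff_noncomm[of x k y] using f by (simp add: tr_sum)
  qed
  moreover have "cmod (tr (y ^ i * (x - y) * x ^ (k - 1 - i))) \<le> (\<nu> * g) ^ i * (\<nu> * a) * (\<nu> * \<nu>) ^ (k - 1 - i)"
    if "i < k" for i
  proof -
    let ?As = "replicate i y @ [x - y] @ replicate (k - 1 - i) x"
    have "cmod (tr (prod_list ?As)) \<le> prod_list (map (sn (real k)) ?As)"
      by (rule trace_prod_list_same) (use that k1 frxy in auto)
    also have "prod_list ?As = y ^ i * (x - y) * x ^ (k - 1 - i)"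
      by (simp add: prod_list_replicate mult.assoc)
    also have "prod_list (map (sn (real k)) ?As) = sn (real k) y ^ i * sn (real k) (x - y) * sn (real k) x ^ (k - 1 - i)"
      by (simp add: prod_list_replicate mult.assoc)
    also have "... \<le> (\<nu> * g) ^ i * (\<nu> * a) * (\<nu> * \<nu>) ^ (k - 1 - i)"
      by (intro mult_mono power_mono snx sny snxy) (use nn in auto)
    finally show ?thesis .
  qed
  ultimately have 1: "cmod (tr (x ^ k) - tr (y ^ k)) \<le> (\<Sum>i<k. (\<nu> * g) ^ i * (\<nu> * a) * (\<nu> * \<nu>) ^ (k - 1 - i))"
    by (auto intro: sum_norm_le)
  obtain r where r: "r \<ge> 0" "tr ((adj N * M) ^ k) = complex_of_real r"
    using syl_trace_nonneg[OF e k1] unfolding N_def M_def by blast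
  have "tr (y ^ k) = - of_real r"
    using k r(2) fr k1 unfolding y_def by (simp add: minus_power_noncomm tr_minus fr_power fr_mult_left)
  moreover have "tr (x ^ k) = of_real (\<nu> ^ (2 * k))"
  proof -
    have "tr (x ^ k) = of_real (spw q N)" unfolding x_def q_def by (rule trace_gram_power[OF fr(1) k1])
    also have "spw q N = \<nu> ^ (2 * k)" using spw_eq_power[of "2 * k" N] k1 by (simp add: q_def \<nu>_def)
    finally show ?thesis .
  qed
  ultimately have "cmod (tr (x ^ k) - tr (y ^ k)) = \<nu> ^ (2 * k) + r"
    using r(1) nn by (simp flip: of_real_power of_real_add)
  with 1 have "\<nu> ^ (2 * k) \<le> (\<Sum>i<k. (\<nu> * g) ^ i * (\<nu> * a) * (\<nu> * \<nu>) ^ (k - 1 - i))" using r by linarith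
  also have "... \<le> (\<Sum>i<k. \<nu> ^ k * ((\<nu> + a) ^ i * a * \<nu> ^ (k - 1 - i)))"
  proof (rule sum_mono)
    fix i assume "i \<in> {..<k}"
    then have ik: "i + (k - 1 - i) + 1 = k" by auto
    have "(\<nu> * g) ^ i * (\<nu> * a) * (\<nu> * \<nu>) ^ (k - 1 - i) = \<nu> ^ (i + (k - 1 - i) + 1) * (g ^ i * a * \<nu> ^ (k - 1 - i))"
      by (simp only: power_mult_distrib power_add power_one_right mult_ac)
    also have "... \<le> \<nu> ^ k * ((\<nu> + a) ^ i * a * \<nu> ^ (k - 1 - i))"
      unfolding ik by (intro mult_left_mono mult_right_mono power_mono g_le) (use nn in auto)
    finally show "(\<nu> * g) ^ i * (\<nu> * a) * (\<nu> * \<nu>) ^ (k - 1 - i) \<le> \<nu> ^ k * ((\<nu> + a) ^ i * a * \<nu> ^ (k - 1 - i))" .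
  qed
  also have "... = \<nu> ^ k * ((\<nu> + a) ^ k - \<nu> ^ k)"
  proof -
    have "(\<nu> + a) ^ k - \<nu> ^ k = - (\<nu> ^ k - (\<nu> + a) ^ k)" by simp
    also have "... = (\<Sum>i<k. (\<nu> + a) ^ i * a * \<nu> ^ (k - 1 - i))"
      unfolding power_diff_noncomm[of \<nu> k "\<nu> + a"] by (simp add: sum_negf)
    finally show ?thesis by (simp add: sum_distrib_left)
  qed
  finally have main: "\<nu> ^ k * \<nu> ^ k \<le> \<nu> ^ k * ((\<nu> + a) ^ k - \<nu> ^ k)" by (simp add: mult_2 power_add)
  \<comment> \<open>After division by \<nu>^k the estimate reads 2 \<nu>^k \<le> (\<nu> + a)^k;
    \<open>c\<close> is the k-th root of 2.\<close>
  define c where "c = 2 powr (1 / real k)"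
  have c1: "c > 1" using k1 by (simp add: c_def)
  have ck: "c ^ k = 2" using k1 by (simp add: c_def powr_realpow[symmetric] powr_powr)
  have "\<nu> * c \<le> \<nu> + a"
  proof (cases "\<nu> = 0")
    case False
    then have "\<nu> ^ k > 0" using nn by simp
    then have "\<nu> ^ k \<le> (\<nu> + a) ^ k - \<nu> ^ k" using main by simp
    then have "(\<nu> * c) ^ k \<le> (\<nu> + a) ^ k" by (simp add: power_mult_distrib ck)
    then show ?thesis using nn k1 power_mono_iff[of "\<nu> * c" "\<nu> + a" k] c1 by simp
  qed (use nn in simp)
  then have "\<nu> * (c - 1) \<le> a" by (simp add: algebra_simps)
  then have "\<nu> \<le> 1 / (c - 1) * a" using c1 by (simp add: field_simps)
  then show ?thesis by (simp add: \<nu>_def a_def N_def q_def c_def)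
qed

subsection \<open>Real interpolation\<close>

text \<open>Comparison with the integral of x^(-g); the increments of x^(1 - g) are estimated from
  below by the weighted inequality of arithmetic and geometric means.\<close>

lemma sum_powr_below:
  assumes "0 \<le> g" "g < (1::real)"
  shows "(\<Sum>b<N. real (Suc b) powr (- g)) \<le> real N powr (1 - g) / (1 - g)"
proof (induction N)
  case (Suc N)
  have step: "(1 - g) * real (Suc N) powr (- g) \<le> real (Suc N) powr (1 - g) - real N powr (1 - g)"
  proof (cases "N = 0")
    case False
    define b where "b = real (Suc N)"
    have b: "b > 1" using False by (simp add: b_def)
    have "((b - 1) / b) powr (1 - g) * 1 powr g \<le> (1 - g) * ((b - 1) / b) + g * 1"
      by (rule Youngs_inequality_0) (use assms b in auto)
    also have "... = 1 - (1 - g) / b" using b by (simp add: field_simps)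
    finally have "b powr (1 - g) * ((b - 1) / b) powr (1 - g) \<le> b powr (1 - g) * (1 - (1 - g) / b)"
      by (intro mult_left_mono) auto
    also have "b powr (1 - g) * ((b - 1) / b) powr (1 - g) = (b - 1) powr (1 - g)"
      using b by (simp add: powr_divide)
    also have "b powr (1 - g) * (1 - (1 - g) / b) = b powr (1 - g) - (1 - g) * (b powr (1 - g) / b)"
      by (simp add: algebra_simps)
    also have "b powr (1 - g) / b = b powr (- g)" using b by (simp add: powr_diff powr_minus field_simps)
    finally show ?thesis by (simp add: b_def)
  qed (use assms in simp)
  have "(\<Sum>b<Suc N. real (Suc b) powr (- g)) \<le> real N powr (1 - g) / (1 - g) + real (Suc N) powr (- g)"
    using Suc by simp
  also have "real (Suc N) powr (- g) \<le> (real (Suc N) powr (1 - g) - real N powr (1 - g)) / (1 - g)"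
    using step assms by (simp add: pos_le_divide_eq mult.commute)
  finally show ?case by (simp add: diff_divide_distrib)
qed simp

lemma sum_powr_above:
  assumes h: "h > (0::real)" and a: "a \<ge> 1"
  shows "(\<Sum>b=a..<N. real (Suc b) powr (- 1 - h)) \<le> real a powr (- h) / h"
proof -
  have "(\<Sum>b=a..<a+d. real (Suc b) powr (- 1 - h)) \<le> (real a powr (- h) - real (a + d) powr (- h)) / h" for d
  proof (induction d)
    case (Suc d)
    define b where "b = real (Suc (a + d))"
    have b: "b > 1" using a by (simp add: b_def)
    define y where "y = (b - 1) / b"
    have y: "y > 0" using b by (simp add: y_def)
    have "h * b powr (- 1 - h) \<le> (b - 1) powr (- h) - b powr (- h)"
    proof -
      have "ln y \<le> y - 1" by (rule ln_le_minus_one[OF y])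
      also have "y - 1 = - 1 / b" using b by (simp add: y_def field_simps)
      finally have "h * (1 / b) \<le> - h * ln y" using h mult_left_mono[of "1 / b" "- ln y" h] by simp
      then have "1 + h / b \<le> exp (- h * ln y)" using exp_ge_add_one_self[of "- h * ln y"] by simp
      then have "1 + h / b \<le> y powr (- h)" using y by (simp add: powr_def)
      then have "b powr (- h) * (1 + h / b) \<le> b powr (- h) * y powr (- h)" by (intro mult_left_mono) auto
      also have "b powr (- h) * y powr (- h) = (b - 1) powr (- h)"
        using b by (simp add: y_def powr_divide)
      finally have 1: "b powr (- h) + h * (b powr (- h) / b) \<le> (b - 1) powr (- h)" by (simp add: algebra_simps)
      have 2: "b powr (- 1 - h) = b powr (- h) / b"
      proof -
        have "- 1 - h = - h - 1" by simp
        then have "b powr (- 1 - h) = b powr (- h - 1)" by metis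
        also have "... = b powr (- h) / b powr 1" by (rule powr_diff)
        finally show ?thesis using b by simp
      qed
      from 1 show ?thesis unfolding 2 by linarith
    qed
    then have "b powr (- 1 - h) \<le> ((b - 1) powr (- h) - b powr (- h)) / h"
      using h by (simp add: pos_le_divide_eq mult.commute)
    moreover have "b - 1 = real (a + d)" by (simp add: b_def)
    ultimately have "real (Suc (a + d)) powr (- 1 - h) \<le> (real (a + d) powr (- h) - real (a + Suc d) powr (- h)) / h"
      by (simp add: b_def)
    then show ?case using Suc by (simp add: diff_divide_distrib)
  qed simp
  from order_trans[OF this divide_right_mono[of _ "real a powr (- h)" h]]
  have *: "(\<Sum>b=a..<a+d. real (Suc b) powr (- 1 - h)) \<le> real a powr (- h) / h" for d
    using h by simp
  show ?thesis
  proof (cases "a \<le> N")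
    case True
    then show ?thesis using *[of "N - a"] by simp
  qed (use h in simp)
qed

text \<open>Homogeneous of degree -1. It is made so that its sum over a < J, b < L dominates max(J,
  L)^t min(J, L)^(1 - t), the bound for partial isometries of ranks J and L; the sum over layers
  then becomes a bilinear form in the singular values.\<close>

definition kern :: "real \<Rightarrow> nat \<Rightarrow> nat \<Rightarrow> real"
  where "kern t a b = real (Suc (max a b)) powr (t - 1) * real (Suc (min a b)) powr (- t)"

lemma kern_nonneg [simp]: "0 \<le> kern t a b"
  by (simp add: kern_def)

lemma kern_commute: "kern t a b = kern t b a"
  by (simp add: kern_def max.commute min.commute)

text \<open>Power weights for Schur's test. The part b \<le> a is controlled because t + x < 1, the
  part b > a because x > t.\<close>

lemma schur_test_sum:
  assumes t: "0 \<le> t" "t < x" "x < 1 - t"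
  shows "(\<Sum>b<N. kern t a b * (real (Suc a) / real (Suc b)) powr x) \<le> 1 / (1 - t - x) + 1 / (x - t)"
proof -
  define f where "f b = kern t a b * (real (Suc a) / real (Suc b)) powr x" for b
  define A where "A = real (Suc a)"
  have A: "A > 0" by (simp add: A_def)
  have "(\<Sum>b<N. f b) \<le> (\<Sum>b\<in>{..<Suc a} \<union> {Suc a..<N}. f b)"
    by (rule sum_mono2) (auto simp: f_def)
  also have "... = (\<Sum>b<Suc a. f b) + (\<Sum>b=Suc a..<N. f b)" by (rule sum.union_disjoint) auto
  also have "(\<Sum>b<Suc a. f b) = (\<Sum>b<Suc a. A powr (t + x - 1) * real (Suc b) powr (- (t + x)))"
  proof (intro sum.cong refl)
    fix b assume "b \<in> {..<Suc a}"
    then have "max a b = a" "min a b = b" by auto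
    then have "f b = (A powr (t - 1) * A powr x) * (real (Suc b) powr (- t) * real (Suc b) powr (- x))"
      by (simp add: f_def kern_def A_def powr_divide powr_minus_divide)
    then show "f b = A powr (t + x - 1) * real (Suc b) powr (- (t + x))"
      by (simp add: powr_add[symmetric] algebra_simps)
  qed
  also have "... \<le> A powr (t + x - 1) * (A powr (1 - (t + x)) / (1 - (t + x)))"
    unfolding sum_distrib_left[symmetric]
    using sum_powr_below[of "t + x" "Suc a"] t by (intro mult_left_mono) (auto simp: A_def)
  also have "... = 1 / (1 - t - x)" using A by (simp add: powr_add[symmetric])
  also have "(\<Sum>b=Suc a..<N. f b) = (\<Sum>b=Suc a..<N. A powr (x - t) * real (Suc b) powr (- 1 - (x - t)))"
  proof (intro sum.cong refl)
    fix b assume "b \<in> {Suc a..<N}"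
    then have "max a b = b" "min a b = a" by auto
    then have "f b = (real (Suc b) powr (t - 1) * real (Suc b) powr (- x)) * (A powr (- t) * A powr x)"
      by (simp add: f_def kern_def A_def powr_divide powr_minus_divide)
    then show "f b = A powr (x - t) * real (Suc b) powr (- 1 - (x - t))"
      by (simp add: powr_add[symmetric] algebra_simps)
  qed
  also have "... \<le> A powr (x - t) * (A powr (- (x - t)) / (x - t))"
    unfolding sum_distrib_left[symmetric]
    using sum_powr_above[of "x - t" "Suc a" N] t by (intro mult_left_mono) (auto simp: A_def)
  also have "... = 1 / (x - t)" using A by (simp add: powr_add[symmetric])
  finally show ?thesis by (simp add: f_def)
qed

text \<open>Both exponents in the kernel are nonpositive, so none of the J L terms is smaller than
  the value at the corner.\<close>

lemma kern_sum_lower: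
  assumes t: "0 \<le> t" "t \<le> 1" and J: "1 \<le> J" "1 \<le> L"
  shows "real (max J L) powr t * real (min J L) powr (1 - t) \<le> (\<Sum>a<J. \<Sum>b<L. kern t a b)"
proof -
  define M m where "M = real (max J L)" and "m = real (min J L)"
  have Mm: "M \<ge> 1" "m \<ge> 1" "M * m = real J * real L" using J by (auto simp: M_def m_def max_def min_def)
  have "M powr t * m powr (1 - t) = (M * m) * (M powr (t - 1) * m powr (- t))"
    using Mm by (simp add: powr_diff powr_minus field_simps)
  also have "... = (\<Sum>a<J. \<Sum>b<L. M powr (t - 1) * m powr (- t))" by (simp add: Mm(3))
  also have "... \<le> (\<Sum>a<J. \<Sum>b<L. kern t a b)"
  proof (intro sum_mono)
    fix a b assume "a \<in> {..<J}" "b \<in> {..<L}"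
    then have "real (Suc (max a b)) \<le> M" "real (Suc (min a b)) \<le> m" by (auto simp: M_def m_def)
    then show "M powr (t - 1) * m powr (- t) \<le> kern t a b"
      unfolding kern_def using t by (intro mult_mono powr_mono2') auto
  qed
  finally show ?thesis by (simp add: M_def m_def)
qed

lemma svd_layers:
  assumes "svd n s u v A"
  shows "A = (\<Sum>j<n. (s j - s (Suc j)) *\<^sub>R (\<Sum>i<Suc j. rk (u i) (v i)))"
    "\<And>j. 0 \<le> s j - s (Suc j)"
    "\<And>x :: nat \<Rightarrow> real. (\<Sum>j<n. (s j - s (Suc j)) * (\<Sum>i<Suc j. x i)) = (\<Sum>i<n. s i * x i)"
    "\<And>j q. j \<le> n \<Longrightarrow> q > 0 \<Longrightarrow> sn q (\<Sum>i<j. rk (u i) (v i)) = real j powr (1 / q)"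
proof -
  show "A = (\<Sum>j<n. (s j - s (Suc j)) *\<^sub>R (\<Sum>i<Suc j. rk (u i) (v i)))"
    unfolding abel_summation using assms by (simp add: svd_def)
  show "0 \<le> s j - s (Suc j)" for j using assms by (auto simp: svd_def antimono_def)
  show "(\<Sum>j<n. (s j - s (Suc j)) * (\<Sum>i<Suc j. x i)) = (\<Sum>i<n. s i * x i)" for x :: "nat \<Rightarrow> real"
    using abel_summation[of s x n] assms by (simp add: svd_def)
  show "sn q (\<Sum>i<j. rk (u i) (v i)) = real j powr (1 / q)" if "j \<le> n" "q > 0" for j q
    using spw_on_fam(2)[of "{..<j}" u v "\<lambda>_. 1" "\<Sum>i<j. rk (u i) (v i)" q] assms that
    by (auto simp: svd_def on_fam_def schatten_norm_spow)
qed

text \<open>Layer cake decomposition of both arguments reduces the interpolation of a bilinear form to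
  partial isometries; the resulting kernel is bounded by Schur's test.\<close>

lemma interpolation_normalized:
  fixes \<Phi> :: "'a::complex_hilbert_space cop \<Rightarrow> 'a cop \<Rightarrow> complex"
  assumes add: "\<And>A B Z. fr A \<Longrightarrow> fr B \<Longrightarrow> fr Z \<Longrightarrow> \<Phi> (A + B) Z = \<Phi> A Z + \<Phi> B Z"
      "\<And>A B Z. fr A \<Longrightarrow> fr B \<Longrightarrow> fr Z \<Longrightarrow> \<Phi> Z (A + B) = \<Phi> Z A + \<Phi> Z B"
    and sc: "\<And>c A Z. fr A \<Longrightarrow> fr Z \<Longrightarrow> \<Phi> (c *\<^sub>R A) Z = of_real c * \<Phi> A Z"
      "\<And>c A Z. fr A \<Longrightarrow> fr Z \<Longrightarrow> \<Phi> Z (c *\<^sub>R A) = of_real c * \<Phi> Z A"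
    and bd: "\<And>A B. fr A \<Longrightarrow> fr B \<Longrightarrow> cmod (\<Phi> A B) \<le> C * sn q A * sn q' B"
      "\<And>A B. fr A \<Longrightarrow> fr B \<Longrightarrow> cmod (\<Phi> A B) \<le> C * sn q' A * sn q B"
    and q: "q > 1" "1 / q + 1 / q' = 1" and C: "C \<ge> 0"
    and r: "r > 1" "1 / q < 1 / r" "1 / r < 1 - 1 / q"
    and A: "fr A" "sn r A \<le> 1" and B: "fr B" "sn (r / (r - 1)) B \<le> 1"
  shows "cmod (\<Phi> A B) \<le> C * (1 / (1 - 1 / q - 1 / r) + 1 / (1 / r - 1 / q))"
proof -
  define t where "t = 1 / q"
  let ?S = "1 / (1 - t - 1 / r) + 1 / (1 / r - t)"
  let ?K = "\<lambda>j l. \<Sum>a<Suc j. \<Sum>b<Suc l. kern t a b"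
  define r' where "r' = r / (r - 1)"
  have t: "0 < t" "t < 1 / r" "1 / r < 1 - t" "t < 1" using q r by (auto simp: t_def)
  have t2: "1 / q' = 1 - t" using q by (simp add: t_def)
  have q'0: "q' > 0" using t2 t(4) by (metis diff_gt_0_iff_gt zero_less_divide_1_iff)
  have r'1: "r' > 1" "1 / r + 1 / r' = 1" "r' > 0" using conjugate_exponent[OF r(1)] by (auto simp: r'_def)
  obtain n s u v where sA: "svd n s u v A" by (rule svd_exists[OF A(1)])
  obtain n' s' u' v' where sB: "svd n' s' u' v' B" by (rule svd_exists[OF B(1)])
  note LA = svd_layers[OF sA] and LB = svd_layers[OF sB]
  define W where "W j = (\<Sum>i<j. rk (u i) (v i))" for j
  define W' where "W' j = (\<Sum>i<j. rk (u' i) (v' i))" for j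
  define d where "d j = s j - s (Suc j)" for j
  define d' where "d' j = s' j - s' (Suc j)" for j
  have frW: "fr (W j)" "fr (W' j)" for j by (auto simp: W_def W'_def intro!: fr_sum)
  have d0: "0 \<le> d j" "0 \<le> d' j" for j using LA(2) LB(2) by (simp_all add: d_def d'_def)
  have s0: "0 \<le> s j" "0 \<le> s' j" for j using sA sB by (auto simp: svd_def)
  have suml: "\<Phi> (\<Sum>j\<in>I. c j *\<^sub>R X j) Z = (\<Sum>j\<in>I. of_real (c j) * \<Phi> (X j) Z)"
    if "\<And>j. fr (X j)" "fr Z" for c :: "nat \<Rightarrow> real" and X Z and I
  proof (induction I rule: infinite_finite_induct)
    case (insert j I)
    then show ?case using that by (simp add: add(1) sc(1) fr_sum fr_scaleR)
  qed (use sc(1)[of 0 Z 0] that in auto)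
  have sumr: "\<Phi> Z (\<Sum>j\<in>I. c j *\<^sub>R X j) = (\<Sum>j\<in>I. of_real (c j) * \<Phi> Z (X j))"
    if "\<And>j. fr (X j)" "fr Z" for c :: "nat \<Rightarrow> real" and X Z and I
  proof (induction I rule: infinite_finite_induct)
    case (insert j I)
    then show ?case using that by (simp add: add(2) sc(2) fr_sum fr_scaleR)
  qed (use sc(2)[of 0 Z 0] that in auto)
  have pair: "cmod (\<Phi> (W (Suc j)) (W' (Suc l))) \<le> C * ?K j l" if "j < n" "l < n'" for j l
  proof -
    have n1: "sn q (W (Suc j)) = real (Suc j) powr t" "sn q' (W (Suc j)) = real (Suc j) powr (1 - t)"
      using LA(4)[of "Suc j" q] LA(4)[of "Suc j" q'] that q q'0 t2 by (simp_all add: W_def t_def)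
    have n2: "sn q (W' (Suc l)) = real (Suc l) powr t" "sn q' (W' (Suc l)) = real (Suc l) powr (1 - t)"
      using LB(4)[of "Suc l" q] LB(4)[of "Suc l" q'] that q q'0 t2 by (simp_all add: W'_def t_def)
    \<comment> \<open>Of the two hypotheses the one is used that gives the larger rank the exponent
      \<open>t\<close>.\<close>
    have "cmod (\<Phi> (W (Suc j)) (W' (Suc l))) \<le> C * (real (max (Suc j) (Suc l)) powr t * real (min (Suc j) (Suc l)) powr (1 - t))"
      using bd(1)[OF frW(1)[of "Suc j"] frW(2)[of "Suc l"]] bd(2)[OF frW(1)[of "Suc j"] frW(2)[of "Suc l"]]
      unfolding n1 n2 by (cases "j \<le> l") (simp_all add: max_def min_def mult_ac)
    also have "... \<le> C * ?K j l"
      using t C by (intro mult_left_mono kern_sum_lower) auto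
    finally show ?thesis .
  qed
  have "\<Phi> A B = (\<Sum>j<n. of_real (d j) * (\<Sum>l<n'. of_real (d' l) * \<Phi> (W (Suc j)) (W' (Suc l))))"
  proof -
    have "\<Phi> A B = \<Phi> (\<Sum>j<n. d j *\<^sub>R W (Suc j)) B" unfolding d_def W_def by (simp only: LA(1)[symmetric])
    also have "... = (\<Sum>j<n. of_real (d j) * \<Phi> (W (Suc j)) B)" by (rule suml) (simp_all add: frW B)
    also have "... = (\<Sum>j<n. of_real (d j) * \<Phi> (W (Suc j)) (\<Sum>l<n'. d' l *\<^sub>R W' (Suc l)))"
      unfolding d'_def W'_def by (simp only: LB(1)[symmetric])
    also have "... = (\<Sum>j<n. of_real (d j) * (\<Sum>l<n'. of_real (d' l) * \<Phi> (W (Suc j)) (W' (Suc l))))"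
      by (subst sumr) (simp_all add: frW)
    finally show ?thesis .
  qed
  also have "cmod ... \<le> (\<Sum>j<n. d j * (\<Sum>l<n'. d' l * (C * ?K j l)))"
  proof (rule sum_norm_le)
    fix j assume j: "j \<in> {..<n}"
    have "cmod (\<Sum>l<n'. of_real (d' l) * \<Phi> (W (Suc j)) (W' (Suc l))) \<le> (\<Sum>l<n'. d' l * (C * ?K j l))"
    proof (rule sum_norm_le)
      fix l assume "l \<in> {..<n'}"
      then show "cmod (of_real (d' l) * \<Phi> (W (Suc j)) (W' (Suc l))) \<le> d' l * (C * ?K j l)"
        using mult_left_mono[OF pair d0(2)[of l], of j] j d0(2)[of l] by (simp only: norm_mult norm_of_real) simp
    qed
    from mult_left_mono[OF this d0(1)[of j]]
    show "cmod (of_real (d j) * (\<Sum>l<n'. of_real (d' l) * \<Phi> (W (Suc j)) (W' (Suc l))))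
        \<le> d j * (\<Sum>l<n'. d' l * (C * ?K j l))"
      using d0(1)[of j] by (simp only: norm_mult norm_of_real abs_of_nonneg)
  qed
  also have "... = C * (\<Sum>a<n. s a * (\<Sum>b<n'. s' b * kern t a b))"
  proof -
    have "(\<Sum>l<n'. d' l * (C * ?K j l)) = C * (\<Sum>a<Suc j. \<Sum>b<n'. s' b * kern t a b)" for j
    proof -
      define X where "X l = (\<Sum>b<Suc l. \<Sum>a<Suc j. kern t a b)" for l
      have X: "?K j l = X l" for l unfolding X_def by (rule sum.swap)
      have "(\<Sum>l<n'. d' l * (C * X l)) = C * (\<Sum>l<n'. d' l * X l)" by (simp add: sum_distrib_left mult_ac)
      then have "(\<Sum>l<n'. d' l * (C * ?K j l))
          = C * (\<Sum>l<n'. d' l * (\<Sum>b<Suc l. \<Sum>a<Suc j. kern t a b))"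
        by (simp only: X) (simp only: X_def)
      also have "(\<Sum>l<n'. d' l * (\<Sum>b<Suc l. \<Sum>a<Suc j. kern t a b)) = (\<Sum>b<n'. s' b * (\<Sum>a<Suc j. kern t a b))"
        unfolding d'_def by (rule LB(3))
      also have "... = (\<Sum>a<Suc j. \<Sum>b<n'. s' b * kern t a b)"
        unfolding sum_distrib_left by (rule sum.swap)
      finally show ?thesis .
    qed
    then have "(\<Sum>j<n. d j * (\<Sum>l<n'. d' l * (C * ?K j l)))
        = C * (\<Sum>j<n. d j * (\<Sum>a<Suc j. \<Sum>b<n'. s' b * kern t a b))"
      by (simp only: sum_distrib_left[of C] mult.left_commute[of C])
    also have "(\<Sum>j<n. d j * (\<Sum>a<Suc j. \<Sum>b<n'. s' b * kern t a b)) = (\<Sum>a<n. s a * (\<Sum>b<n'. s' b * kern t a b))"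
      unfolding d_def by (rule LA(3))
    finally show ?thesis .
  qed
  also have "... \<le> C * ?S"
  proof (rule mult_left_mono[OF _ C])
    define R where "R a b = real (Suc a) / real (Suc b)" for a b
    have R: "R a b > 0" "R b a = 1 / R a b" for a b by (auto simp: R_def)
    have "s a * s' b \<le> s a powr r / r * R a b powr (1 / r') + s' b powr r' / r' * R b a powr (1 / r)" for a b
    proof -
      \<comment> \<open>Inserted and divided out before Young's inequality; its powers
        \<open>r\<close> and \<open>r'\<close> produce exactly the weights of Schur's test.\<close>
      define z where "z = R a b powr (1 / (r * r'))"
      have z: "z > 0" using R(1)[of a b] by (simp add: z_def)
      have "(s a * z) * (s' b / z) \<le> (s a * z) powr r / r + (s' b / z) powr r' / r'"
        by (rule Youngs_inequality) (use r r'1 s0 z in auto)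
      also have "(s a * z) powr r = s a powr r * R a b powr (1 / r')"
        using r r'1 by (simp add: powr_mult z_def powr_powr)
      also have "(s' b / z) powr r' = s' b powr r' * R b a powr (1 / r)"
        unfolding R(2)[where a = a and b = b] using r r'1 by (simp add: powr_divide z_def powr_powr)
      finally show ?thesis using z by simp
    qed
    then have "(\<Sum>a<n. s a * (\<Sum>b<n'. s' b * kern t a b)) \<le> (\<Sum>a<n. \<Sum>b<n'.
        (s a powr r / r * R a b powr (1 / r') + s' b powr r' / r' * R b a powr (1 / r)) * kern t a b)"
      unfolding sum_distrib_left mult.assoc[symmetric] by (intro sum_mono mult_right_mono) auto
    also have "... = (\<Sum>a<n. s a powr r / r * (\<Sum>b<n'. kern t a b * R a b powr (1 / r')))
        + (\<Sum>b<n'. s' b powr r' / r' * (\<Sum>a<n. kern t b a * R b a powr (1 / r)))"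
    proof -
      have "(\<Sum>a<n. \<Sum>b<n'. s' b powr r' / r' * R b a powr (1 / r) * kern t a b)
          = (\<Sum>b<n'. s' b powr r' / r' * (\<Sum>a<n. kern t b a * R b a powr (1 / r)))"
        unfolding sum_distrib_left
        by (subst sum.swap, intro sum.cong refl, subst kern_commute) (simp add: mult_ac)
      moreover have "(\<Sum>a<n. \<Sum>b<n'. s a powr r / r * R a b powr (1 / r') * kern t a b)
          = (\<Sum>a<n. s a powr r / r * (\<Sum>b<n'. kern t a b * R a b powr (1 / r')))"
        unfolding sum_distrib_left by (intro sum.cong refl) (simp only: mult_ac)
      ultimately show ?thesis by (simp only: distrib_right sum.distrib)
    qed
    also have "... \<le> (\<Sum>a<n. s a powr r / r * ?S)
        + (\<Sum>b<n'. s' b powr r' / r' * ?S)"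
    proof (intro add_mono sum_mono mult_left_mono)
      have "1 / r' = 1 - 1 / r" using r'1 by simp
      then have "1 / (1 - t - 1 / r') + 1 / (1 / r' - t) = ?S"
        by simp
      then show "(\<Sum>b<n'. kern t a b * R a b powr (1 / r')) \<le> ?S" for a
        using schur_test_sum[of t "1 / r'" a n'] t \<open>1 / r' = 1 - 1 / r\<close>
        by (simp only: R_def)
      show "(\<Sum>a<n. kern t b a * R b a powr (1 / r)) \<le> ?S" for b
        using schur_test_sum[of t "1 / r" b n] t by (simp add: R_def)
    qed (use r r'1 in auto)
    also have "... = (spw r A / r + spw r' B / r') * ?S"
      using svd_spw(1)[OF sA, of r] svd_spw(1)[OF sB, of r'] r r'1
      by (simp add: sum_distrib_right sum_divide_distrib distrib_right)
    also have "... \<le> 1 * ?S"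
    proof (rule mult_right_mono)
      have "spw r A \<le> 1" "spw r' B \<le> 1"
        using sn_powr[of r A] sn_powr[of r' B] powr_mono2[of r "sn r A" 1] powr_mono2[of r' "sn r' B" 1] A B r r'1
        by (simp_all add: r'_def)
      then have "spw r A / r + spw r' B / r' \<le> 1 / r + 1 / r'"
        using r r'1 by (intro add_mono divide_right_mono) auto
      then show "spw r A / r + spw r' B / r' \<le> 1" using r'1 by simp
    qed (use t in simp)
    finally show "(\<Sum>a<n. s a * (\<Sum>b<n'. s' b * kern t a b)) \<le> ?S" by simp
  qed
  finally show ?thesis by (simp add: t_def)
qed

theorem interpolation:
  fixes \<Phi> :: "'a::complex_hilbert_space cop \<Rightarrow> 'a cop \<Rightarrow> complex"
  assumes add: "\<And>A B Z. fr A \<Longrightarrow> fr B \<Longrightarrow> fr Z \<Longrightarrow> \<Phi> (A + B) Z = \<Phi> A Z + \<Phi> B Z"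
      "\<And>A B Z. fr A \<Longrightarrow> fr B \<Longrightarrow> fr Z \<Longrightarrow> \<Phi> Z (A + B) = \<Phi> Z A + \<Phi> Z B"
    and sc: "\<And>c A Z. fr A \<Longrightarrow> fr Z \<Longrightarrow> \<Phi> (c *\<^sub>R A) Z = of_real c * \<Phi> A Z"
      "\<And>c A Z. fr A \<Longrightarrow> fr Z \<Longrightarrow> \<Phi> Z (c *\<^sub>R A) = of_real c * \<Phi> Z A"
    and bd: "\<And>A B. fr A \<Longrightarrow> fr B \<Longrightarrow> cmod (\<Phi> A B) \<le> C * sn q A * sn q' B"
      "\<And>A B. fr A \<Longrightarrow> fr B \<Longrightarrow> cmod (\<Phi> A B) \<le> C * sn q' A * sn q B"
    and q: "q > 1" "1 / q + 1 / q' = 1" and C: "C \<ge> 0"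
    and r: "r > 1" "1 / q < 1 / r" "1 / r < 1 - 1 / q"
    and A: "fr A" and B: "fr B"
  shows "cmod (\<Phi> A B) \<le> C * (1 / (1 - 1 / q - 1 / r) + 1 / (1 / r - 1 / q)) * sn r A * sn (r / (r - 1)) B"
proof (cases "sn r A = 0 \<or> sn (r / (r - 1)) B = 0")
  case True
  have "r / (r - 1) > 0" "r > 0" using conjugate_exponent(1)[OF r(1)] r(1) by auto
  then have "A = 0 \<or> B = 0" using True sn_eq_zeroD A B by blast
  then have "\<Phi> A B = 0" using sc(1)[of 0 B 0] sc(2)[of 0 A 0] A B by auto
  then show ?thesis using True by auto
next
  case False
  define x y where "x = sn r A" and "y = sn (r / (r - 1)) B"
  have xy: "x > 0" "y > 0"
    using False schatten_norm_nonneg[of r "bl A"] schatten_norm_nonneg[of "r / (r - 1)" "bl B"]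
    unfolding x_def y_def by linarith+
  have r': "r / (r - 1) > 0" "r > 0" using conjugate_exponent(1)[OF r(1)] r(1) by auto
  have "sn r ((1 / x) *\<^sub>R A) \<le> 1" "sn (r / (r - 1)) ((1 / y) *\<^sub>R B) \<le> 1"
    using xy r' by (simp_all add: sn_scaleR A B x_def[symmetric] y_def[symmetric])
  then have "cmod (\<Phi> ((1 / x) *\<^sub>R A) ((1 / y) *\<^sub>R B)) \<le> C * (1 / (1 - 1 / q - 1 / r) + 1 / (1 / r - 1 / q))"
    using A B by (intro interpolation_normalized[OF add sc bd q C r]) auto
  also have "\<Phi> ((1 / x) *\<^sub>R A) ((1 / y) *\<^sub>R B) = of_real (1 / (x * y)) * \<Phi> A B"
    using A B by (simp add: sc fr_scaleR)
  finally have "cmod (\<Phi> A B) / (x * y) \<le> C * (1 / (1 - 1 / q - 1 / r) + 1 / (1 / r - 1 / q))"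
    using xy by (simp add: norm_mult norm_divide)
  then have "cmod (\<Phi> A B) \<le> C * (1 / (1 - 1 / q - 1 / r) + 1 / (1 / r - 1 / q)) * (x * y)"
    using xy by (subst (asm) pos_divide_le_eq) auto
  then show ?thesis by (simp add: x_def y_def mult.assoc)
qed

subsection \<open>Boundedness of the Sylvester multipliers\<close>

lemma tr_mx_mult: "tr (mx n e a * B) = (\<Sum>i<n. \<Sum>j<n. a i j * cf e B j i)"
  unfolding mx_def sum_distrib_right
  by (simp add: tr_sum fr_sum fr_mult_left fr_mult_right mult.assoc tr_cs tr_rk_mult cf_def)

text \<open>The multiplier is real, hence symmetric for the trace pairing; the adjoints bring
  \<open>B\<close> into the corner on which \<open>syl1\<close> acts. A bound for one exponent thus
  yields one for the conjugate exponent.\<close>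

lemma syl1_dual:
  assumes "fr A"
  shows "tr (syl1 n e l A * B) = tr (A * adj (syl1 n e l (adj B)))"
proof -
  have "tr (A * adj (syl1 n e l (adj B))) = tr (adj (syl1 n e l (adj B)) * A)"
    by (rule tr_commute[OF assms])
  also have "... = (\<Sum>j<n. \<Sum>i<n. (if 0 \<le> l i \<and> l j < 0 then of_real (l i / (l i - l j)) * cf e B j i else 0) * cf e A i j)"
    unfolding syl1_def adj_mx tr_mx_mult by (intro sum.cong refl) (simp add: cf_adj)
  also have "... = (\<Sum>i<n. \<Sum>j<n. (if 0 \<le> l i \<and> l j < 0 then of_real (l i / (l i - l j)) * cf e B j i else 0) * cf e A i j)"
    by (rule sum.swap)
  also have "... = tr (syl1 n e l A * B)"
    unfolding syl1_def tr_mx_mult by (intro sum.cong refl) auto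
  finally show ?thesis by simp
qed

lemma syl1_add: "syl1 n e l (A + B) = syl1 n e l A + syl1 n e l B"
  unfolding syl1_def mx_add by (rule mx_cong) (simp add: cf_add distrib_left)

lemma syl1_scaleR: "syl1 n e l (c *\<^sub>R A) = c *\<^sub>R syl1 n e l A"
  unfolding syl1_def mx_scaleR by (rule mx_cong) (simp add: cf_scaleR)

lemma sn_syl1_even:
  assumes e: "on_fam {..<n} e" and A: "fr A" and k: "odd k"
  shows "sn (2 * real k) (syl1 n e l A) \<le> (1 + 1 / (2 powr (1 / real k) - 1)) * sn (2 * real k) A"
proof -
  have k1: "k \<ge> 1" using k by (cases k) auto
  define q where "q = 2 * real k"
  have q: "q > 1" "q \<ge> 1" "q > 0" using k1 by (auto simp: q_def)
  have "syl1 n e l A = pospr n e l * A * negpr n e l + (-1) *\<^sub>R syl2 n e l A"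
    by (simp add: syl_add[symmetric])
  then have "sn q (syl1 n e l A) \<le> sn q (pospr n e l * A * negpr n e l) + sn q ((-1) *\<^sub>R syl2 n e l A)"
    using A sn_triangle[of "pospr n e l * A * negpr n e l" "(-1) *\<^sub>R syl2 n e l A" q] q
    by (simp add: fr_mult_left fr_mult_right fr_minus)
  also have "sn q ((-1) *\<^sub>R syl2 n e l A) = sn q (syl2 n e l A)" by (subst sn_scaleR) (use q in auto)
  also have "sn q (pospr n e l * A * negpr n e l) \<le> sn q A" by (rule sn_corner_le[OF e A q(2)])
  also have "sn q (syl2 n e l A) \<le> 1 / (2 powr (1 / real k) - 1) * sn q A"
    unfolding q_def by (rule sn_syl2_even[OF e A k])
  finally show ?thesis by (simp add: q_def distrib_right)
qed

theorem sn_syl1_bound: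
  assumes r: "r > (1::real)"
  shows "\<exists>C\<ge>0. \<forall>n (e :: nat \<Rightarrow> 'a::complex_hilbert_space) l A.
    on_fam {..<n} e \<longrightarrow> fr A \<longrightarrow> sn r (syl1 n e l A) \<le> C * sn r A"
proof -
  define r' where "r' = r / (r - 1)"
  have r': "r' > 1" "1 / r + 1 / r' = 1" using conjugate_exponent[OF r] by (auto simp: r'_def)
  \<comment> \<open>Makes q = 2 k, \<open>k\<close> odd, exceed both \<open>r\<close> and
    \<open>r'\<close>, so that \<open>r\<close> lies strictly between \<open>q\<close> and its
    conjugate.\<close>
  define N where "N = nat \<lceil>r + r'\<rceil>"
  define k where "k = 2 * N + 1"
  have k: "odd k" by (simp add: k_def)
  define q where "q = 2 * real k"
  have "real N \<ge> r + r'" unfolding N_def by linarith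
  then have q: "q > r" "q > r'" "q > 1" using r r' by (auto simp: q_def k_def)
  define C where "C = 1 + 1 / (2 powr (1 / real k) - 1)"
  have "k \<ge> 1" by (simp add: k_def)
  then have "2 powr (1 / real k) > 1" by simp
  then have C: "C \<ge> 0" by (simp add: C_def)
  have iq: "1 / q < 1 / r" "1 / r < 1 - 1 / q"
  proof -
    show "1 / q < 1 / r" using q r by (simp add: frac_less2)
    have "1 / q < 1 / r'" using q r' by (simp add: frac_less2)
    then show "1 / r < 1 - 1 / q" using r'(2) by linarith
  qed
  define K where "K = C * (1 / (1 - 1 / q - 1 / r) + 1 / (1 / r - 1 / q))"
  have K: "K \<ge> 0" unfolding K_def using C iq by (intro mult_nonneg_nonneg add_nonneg_nonneg) auto
  note cq = conjugate_exponent[OF q(3)]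
  have "sn r (syl1 n e l A) \<le> K * sn r A"
    if e: "on_fam {..<n} e" and A: "fr A" for n and e :: "nat \<Rightarrow> 'a" and l A
  proof (rule sn_le_dual[OF fr_syl(1) r])
    show "0 \<le> K * sn r A" using K by simp
    fix Z :: "'a cop" assume Z: "fr Z"
    have b: "sn q (syl1 n e l X) \<le> C * sn q X" if "fr X" for X
      unfolding q_def C_def by (rule sn_syl1_even[OF e that k])
    have "cmod (tr (syl1 n e l A * Z)) \<le> C * (1 / (1 - 1 / q - 1 / r) + 1 / (1 / r - 1 / q)) * sn r A * sn (r / (r - 1)) Z"
    proof (rule interpolation[where \<Phi> = "\<lambda>X Y. tr (syl1 n e l X * Y)" and q' = "q / (q - 1)", OF _ _ _ _ _ _ q(3) cq(2) C r iq A Z])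
      fix X Y :: "'a cop" assume XY: "fr X" "fr Y"
      have "cmod (tr (syl1 n e l X * Y)) \<le> sn q (syl1 n e l X) * sn (q / (q - 1)) Y"
        using q(3) cq XY by (intro trace_hoelder) auto
      also have "... \<le> C * sn q X * sn (q / (q - 1)) Y" by (intro mult_right_mono b XY) simp
      finally show "cmod (tr (syl1 n e l X * Y)) \<le> C * sn q X * sn (q / (q - 1)) Y" .
      have "cmod (tr (syl1 n e l X * Y)) \<le> sn (q / (q - 1)) X * sn q (adj (syl1 n e l (adj Y)))"
        unfolding syl1_dual[OF XY(1)] using q(3) cq XY by (intro trace_hoelder) auto
      also have "sn (q / (q - 1)) X * sn q (adj (syl1 n e l (adj Y))) \<le> sn (q / (q - 1)) X * (C * sn q Y)"
        using b[of "adj Y"] XY q(3) by (intro mult_left_mono) (simp_all add: sn_adj fr_adj)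
      finally show "cmod (tr (syl1 n e l X * Y)) \<le> C * sn (q / (q - 1)) X * sn q Y"
        by (simp add: mult_ac)
    qed (simp_all add: syl1_add syl1_scaleR distrib_left distrib_right tr_add tr_scaleR fr_mult_left fr_mult_right)
    then show "cmod (tr (syl1 n e l A * Z)) \<le> K * sn r A * sn (r / (r - 1)) Z" by (simp add: K_def)
  qed
  then show ?thesis using K by blast
qed

theorem sn_syl2_bound:
  assumes r: "r > (1::real)"
  shows "\<exists>C\<ge>0. \<forall>n (e :: nat \<Rightarrow> 'a::complex_hilbert_space) l A.
    on_fam {..<n} e \<longrightarrow> fr A \<longrightarrow> sn r (syl2 n e l A) \<le> C * sn r A"
proof -
  obtain C where C: "C \<ge> 0" "\<And>n (e :: nat \<Rightarrow> 'a) l A. on_fam {..<n} e \<Longrightarrow> fr A \<Longrightarrow> sn r (syl1 n e l A) \<le> C * sn r A"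
    using sn_syl1_bound[OF r] by metis
  have "sn r (syl2 n e l A) \<le> (1 + C) * sn r A" if e: "on_fam {..<n} e" and A: "fr A" for n and e :: "nat \<Rightarrow> 'a" and l A
  proof -
    have "syl2 n e l A = pospr n e l * A * negpr n e l + (-1) *\<^sub>R syl1 n e l A"
      by (simp add: syl_add[symmetric])
    then have "sn r (syl2 n e l A) \<le> sn r (pospr n e l * A * negpr n e l) + sn r ((-1) *\<^sub>R syl1 n e l A)"
      using A sn_triangle[of "pospr n e l * A * negpr n e l" "(-1) *\<^sub>R syl1 n e l A" r] r
      by (simp add: fr_mult_left fr_mult_right fr_minus)
    also have "sn r ((-1) *\<^sub>R syl1 n e l A) = sn r (syl1 n e l A)" by (subst sn_scaleR) (use r in auto)
    also have "sn r (pospr n e l * A * negpr n e l) \<le> sn r A" by (rule sn_corner_le[OF e A]) (use r in simp)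
    also have "sn r (syl1 n e l A) \<le> C * sn r A" by (rule C(2)[OF e A])
    finally show ?thesis by (simp add: distrib_right)
  qed
  then show ?thesis using C(1) by (intro exI[of _ "1 + C"]) auto
qed

subsection \<open>Integration over the imaginary axis\<close>

text \<open>The integral of g(w) dw / w up the imaginary axis over exp a < |w| < exp b. With w =
  \<i> exp u and w = -\<i> exp u one has dw / w = du on both halves, and the minus sign is the
  orientation of the lower one.\<close>

definition ctr :: "(complex \<Rightarrow> complex) \<Rightarrow> real \<Rightarrow> real \<Rightarrow> complex"
  where "ctr g a b = integral {a..b} (\<lambda>u. g (\<i> * of_real (exp u)) - g (- \<i> * of_real (exp u)))"

abbreviation offR :: "complex set" where "offR \<equiv> {w. Im w \<noteq> 0}"

lemma ctr_integrable:
  fixes g :: "complex \<Rightarrow> complex"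
  assumes "continuous_on offR g"
  shows "(\<lambda>u. g (\<i> * of_real (exp u))) integrable_on {a..b}" "(\<lambda>u. g (- \<i> * of_real (exp u))) integrable_on {a..b}"
proof -
  have "continuous_on {a..b} (\<lambda>u. g (\<i> * of_real (exp u)))"
    by (rule continuous_on_compose2[OF assms]) (auto intro!: continuous_intros)
  then show "(\<lambda>u. g (\<i> * of_real (exp u))) integrable_on {a..b}" by (rule integrable_continuous_interval)
  have "continuous_on {a..b} (\<lambda>u. g (- \<i> * of_real (exp u)))"
    by (rule continuous_on_compose2[OF assms]) (auto intro!: continuous_intros)
  then show "(\<lambda>u. g (- \<i> * of_real (exp u))) integrable_on {a..b}" by (rule integrable_continuous_interval)
qed

lemma ctr_add:
  assumes "continuous_on offR g" "continuous_on offR h"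
  shows "ctr (\<lambda>w. g w + h w) a b = ctr g a b + ctr h a b"
  unfolding ctr_def using ctr_integrable[OF assms(1), of a b] ctr_integrable[OF assms(2), of a b]
  by (subst integral_add[symmetric]) (auto intro!: integrable_diff integral_cong)

lemma ctr_cong:
  assumes "\<And>w. Im w \<noteq> 0 \<Longrightarrow> g w = h w"
  shows "ctr g a b = ctr h a b"
  unfolding ctr_def by (rule integral_cong) (simp add: assms)

lemma ctr_uminus: "ctr (\<lambda>w. g (- w)) a b = - ctr g a b"
  unfolding ctr_def by (subst integral_neg[symmetric]) (rule integral_cong, simp)

text \<open>In the coordinate z = log w the form dw / w is dz, and the two half-axes are the edges
  of a strip of width pi. By Cauchy's theorem the integral reduces to the two crosscuts, which
  correspond to half circles of radii exp a and exp b in the left half-plane. Each costs pi B,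
  whatever a and b are.\<close>

lemma ctr_bound_left:
  assumes hol: "g holomorphic_on {w. Im w \<noteq> 0 \<or> Re w < 0}"
    and bd: "\<And>w. Re w \<le> 0 \<Longrightarrow> w \<noteq> 0 \<Longrightarrow> cmod (g w) \<le> B" and ab: "a \<le> b"
  shows "cmod (ctr g a b) \<le> 2 * pi * B"
proof -
  define S where "S = {z. 0 < Im z \<and> Im z < 2 * pi}"
  define T where "T = {z. pi / 2 \<le> Im z \<and> Im z \<le> 3 * pi / 2}"
  have cS: "convex S"
    unfolding S_def Collect_conj_eq by (intro convex_Int convex_halfspace_Im_gt convex_halfspace_Im_lt)
  have oS: "open S"
    unfolding S_def Collect_conj_eq by (intro open_Int open_halfspace_Im_gt open_halfspace_Im_lt)
  have cT: "convex T"
    unfolding T_def Collect_conj_eq by (intro convex_Int convex_halfspace_Im_ge convex_halfspace_Im_le)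
  have TS: "T \<subseteq> S"
  proof
    fix z assume "z \<in> T"
    then have "pi / 2 \<le> Im z" "Im z \<le> 3 * pi / 2" by (auto simp: T_def)
    then show "z \<in> S" unfolding S_def mem_Collect_eq using pi_gt_zero by linarith
  qed
  have expS: "exp ` S \<subseteq> {w. Im w \<noteq> 0 \<or> Re w < 0}"
  proof (clarsimp simp: S_def)
    fix z assume z: "0 < Im z" "Im z < 2 * pi" and s: "Im (exp z) = 0"
    have "sin (Im z) = 0" using s by (simp add: Im_exp)
    then have "Im z = pi"
      using z sin_zero_pi_iff[of "Im z - pi"] by (simp add: sin_diff)
    then show "Re (exp z) < 0" by (simp add: Re_exp)
  qed
  have "(g \<circ> exp) holomorphic_on S"
    by (rule holomorphic_on_compose_gen[OF holomorphic_on_exp hol expS])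
  then obtain \<Gamma> where \<Gamma>: "\<And>z. z \<in> S \<Longrightarrow> (\<Gamma> has_field_derivative g (exp z)) (at z)"
    using holomorphic_convex_primitive'[OF cS oS, of "g \<circ> exp"] at_within_open[OF _ oS] by (metis comp_apply)
  have bdT: "cmod (\<Gamma> x - \<Gamma> y) \<le> B * cmod (x - y)" if "x \<in> T" "y \<in> T" for x y
  proof (rule field_differentiable_bound[OF cT])
    show "(\<Gamma> has_field_derivative g (exp z)) (at z within T)" if "z \<in> T" for z
      using \<Gamma> that TS by (meson has_field_derivative_at_within subsetD)
    show "cmod (g (exp z)) \<le> B" if "z \<in> T" for z
    proof (rule bd)
      have "cos (Im z) \<le> 0"
      proof -
        have "cos (Im z) = - cos (Im z - pi)" by (simp add: cos_diff)
        moreover have "0 \<le> cos (Im z - pi)" using that by (intro cos_ge_zero) (auto simp: T_def)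
        ultimately show ?thesis by simp
      qed
      then show "Re (exp z) \<le> 0" by (simp add: Re_exp mult_nonneg_nonpos)
    qed simp
  qed (use that in auto)
  define p1 where "p1 u = complex_of_real u + \<i> * of_real (pi / 2)" for u
  define p2 where "p2 u = complex_of_real u + \<i> * of_real (3 * pi / 2)" for u
  have pT: "p1 u \<in> T" "p2 u \<in> T" for u using pi_gt_zero by (auto simp: p1_def p2_def T_def)
  have e1: "exp (p1 u) = \<i> * of_real (exp u)" for u
    by (simp add: p1_def exp_add exp_of_real complex_eq_iff Re_exp Im_exp)
  have e2: "exp (p2 u) = - \<i> * of_real (exp u)" for u
  proof -
    have "cos (3 * pi / 2) = 0" "sin (3 * pi / 2) = -1"
      using cos_3over2_pi sin_3over2_pi by (simp_all add: mult.commute)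
    then show ?thesis by (simp add: p2_def exp_add exp_of_real complex_eq_iff Re_exp Im_exp)
  qed
  have d1: "((\<lambda>u. \<Gamma> (p1 u)) has_vector_derivative g (\<i> * of_real (exp u))) (at u within {a..b})" for u
  proof -
    have "(p1 has_vector_derivative 1) (at u within {a..b})"
      unfolding p1_def by (auto intro!: derivative_eq_intros)
    from field_vector_diff_chain_within[OF this has_field_derivative_at_within[OF \<Gamma>]]
    show ?thesis using pT(1)[of u] TS e1[of u] by (auto simp: o_def)
  qed
  have d2: "((\<lambda>u. \<Gamma> (p2 u)) has_vector_derivative g (- \<i> * of_real (exp u))) (at u within {a..b})" for u
  proof -
    have "(p2 has_vector_derivative 1) (at u within {a..b})"
      unfolding p2_def by (auto intro!: derivative_eq_intros)
    from field_vector_diff_chain_within[OF this has_field_derivative_at_within[OF \<Gamma>]]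
    show ?thesis using pT(2)[of u] TS e2[of u] by (auto simp: o_def)
  qed
  have "((\<lambda>u. g (\<i> * of_real (exp u)) - g (- \<i> * of_real (exp u))) has_integral
      (\<Gamma> (p1 b) - \<Gamma> (p1 a)) - (\<Gamma> (p2 b) - \<Gamma> (p2 a))) {a..b}"
    by (intro has_integral_diff fundamental_theorem_of_calculus[OF ab] d1 d2)
  then have "ctr g a b = (\<Gamma> (p1 b) - \<Gamma> (p2 b)) - (\<Gamma> (p1 a) - \<Gamma> (p2 a))"
    unfolding ctr_def by (simp add: integral_unique algebra_simps)
  then have "cmod (ctr g a b) \<le> cmod (\<Gamma> (p1 b) - \<Gamma> (p2 b)) + cmod (\<Gamma> (p1 a) - \<Gamma> (p2 a))"
    by (simp add: norm_triangle_ineq4)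
  also have "... \<le> B * cmod (p1 b - p2 b) + B * cmod (p1 a - p2 a)"
    by (intro add_mono bdT pT)
  finally have fin: "cmod (ctr g a b) \<le> B * cmod (p1 b - p2 b) + B * cmod (p1 a - p2 a)" .
  have pp: "cmod (p1 u - p2 u) = pi" for u
  proof -
    have "p1 u - p2 u = - (\<i> * of_real pi)" by (simp add: p1_def p2_def algebra_simps complex_eq_iff)
    then show ?thesis by (simp add: norm_mult)
  qed
  from fin show ?thesis unfolding pp by (simp add: mult_ac)
qed

lemma ctr_bound_right:
  assumes hol: "g holomorphic_on {w. Im w \<noteq> 0 \<or> 0 < Re w}"
    and bd: "\<And>w. 0 \<le> Re w \<Longrightarrow> w \<noteq> 0 \<Longrightarrow> cmod (g w) \<le> B" and ab: "a \<le> b"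
  shows "cmod (ctr g a b) \<le> 2 * pi * B"
proof -
  have "(g \<circ> uminus) holomorphic_on {w. Im w \<noteq> 0 \<or> Re w < 0}"
    by (rule holomorphic_on_compose_gen[OF _ hol]) (auto intro!: holomorphic_intros)
  then have "(\<lambda>w. g (- w)) holomorphic_on {w. Im w \<noteq> 0 \<or> Re w < 0}" by (simp add: o_def)
  from ctr_bound_left[OF this _ ab, of B] show ?thesis using bd by (simp add: ctr_uminus)
qed

subsection \<open>Words\<close>

text \<open>A letter \<open>(\<sigma>, A, j)\<close> stands for \<open>C\<^sub>\<sigma> A\<close>, where \<open>C = w / (w - H)\<close> and \<open>C\<^sub>\<sigma>\<close> is its compression to
  the negative (\<open>\<sigma> = True\<close>) or nonnegative spectral subspace of \<open>H\<close>. The operator \<open>A\<close> is measured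
  in the Schatten norm with exponent \<open>p / j\<close>, which means the operator norm for \<open>j = 0\<close>.\<close>

type_synonym 'a letter = "bool \<times> 'a cop \<times> nat"

definition csg :: "nat \<Rightarrow> (nat \<Rightarrow> 'a::complex_hilbert_space) \<Rightarrow> (nat \<Rightarrow> real) \<Rightarrow> complex \<Rightarrow> bool \<Rightarrow> 'a cop"
  where "csg n e l w \<sigma> = dg n e (\<lambda>i. if (l i < 0) = \<sigma> then w / (w - of_real (l i)) else 0)"

definition wprod :: "nat \<Rightarrow> (nat \<Rightarrow> 'a::complex_hilbert_space) \<Rightarrow> (nat \<Rightarrow> real) \<Rightarrow> complex \<Rightarrow> 'a letter list \<Rightarrow> 'a cop"
  where "wprod n e l w ws = prod_list (map (\<lambda>(\<sigma>, A, j). csg n e l w \<sigma> * A) ws)"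

definition nj :: "nat \<Rightarrow> nat \<Rightarrow> 'a::complex_hilbert_space cop \<Rightarrow> real"
  where "nj p j A = (if j = 0 then norm A else sn (real p / real j) A)"

definition wnorm :: "nat \<Rightarrow> 'a::complex_hilbert_space letter list \<Rightarrow> real"
  where "wnorm p ws = prod_list (map (\<lambda>(\<sigma>, A, j). nj p j A) ws)"

definition wdeg :: "'a letter list \<Rightarrow> nat"
  where "wdeg ws = sum_list (map (\<lambda>(\<sigma>, A, j). j) ws)"

definition wfr :: "'a::complex_hilbert_space letter list \<Rightarrow> bool"
  where "wfr ws \<longleftrightarrow> (\<forall>(\<sigma>, A, j)\<in>set ws. fr A)"

lemma word_simps [simp]:
  "wprod n e l w [] = 1" "wprod n e l w ((\<sigma>, A, j) # ws) = csg n e l w \<sigma> * A * wprod n e l w ws"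
  "wprod n e l w (ws @ vs) = wprod n e l w ws * wprod n e l w vs"
  "wnorm p [] = 1" "wnorm p ((\<sigma>, A, j) # ws) = nj p j A * wnorm p ws" "wnorm p (ws @ vs) = wnorm p ws * wnorm p vs"
  "wdeg [] = 0" "wdeg ((\<sigma>, A, j) # ws) = j + wdeg ws" "wdeg (ws @ vs) = wdeg ws + wdeg vs"
  "wfr []" "wfr ((\<sigma>, A, j) # ws) \<longleftrightarrow> fr A \<and> wfr ws" "wfr (ws @ vs) \<longleftrightarrow> wfr ws \<and> wfr vs"
  by (auto simp: wprod_def wnorm_def wdeg_def wfr_def ball_Un)

lemma nj_nonneg [simp]: "0 \<le> nj p j A"
  by (simp add: nj_def)

lemma wnorm_nonneg [simp]: "0 \<le> wnorm p ws"
  by (induction ws) auto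

lemma fr_wprod: "wfr ws \<Longrightarrow> ws \<noteq> [] \<Longrightarrow> fr (wprod n e l w ws)"
  by (cases ws) (auto simp: fr_mult_left fr_mult_right)

lemma nj_mult:
  assumes "fr A" "fr B" "i + j \<le> p"
  shows "nj p (i + j) (A * B) \<le> nj p i A * nj p j B"
proof -
  consider "i = 0" "j = 0" | "i = 0" "j > 0" | "i > 0" "j = 0" | "i > 0" "j > 0" by auto
  then show ?thesis
  proof cases
    case 1
    then show ?thesis by (simp add: nj_def norm_mult_ineq)
  next
    case 2
    then show ?thesis using assms by (auto simp: nj_def intro!: sn_ideal_left)
  next
    case 3
    then have "sn (real p / real i) (A * B) \<le> norm B * sn (real p / real i) A"
      using assms by (intro sn_ideal_right) auto
    then show ?thesis using 3 by (simp add: nj_def mult.commute)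
  next
    case 4
    have "sn (real p / real (i + j)) (A * B) \<le> sn (real p / real i) A * sn (real p / real j) B"
    proof (rule sn_mult)
      show "1 / (real p / real i) + 1 / (real p / real j) = 1 / (real p / real (i + j))"
        by (simp add: add_divide_distrib)
      have "real (i + j) \<le> real p" using assms(3) by (simp only: of_nat_le_iff)
      then show "1 \<le> real p / real (i + j)" using 4 by (simp add: field_simps)
    qed (use assms 4 in auto)
    then show ?thesis using 4 by (simp add: nj_def)
  qed
qed

lemma nj_contraction:
  assumes "fr A" "norm C \<le> 1" "j \<le> p"
  shows "nj p j (C * A) \<le> nj p j A"
proof (cases "j = 0")
  case True
  have "norm (C * A) \<le> norm C * norm A" by (rule norm_mult_ineq)
  also have "... \<le> 1 * norm A" by (intro mult_right_mono assms) simp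
  finally show ?thesis using True by (simp add: nj_def)
next
  case False
  have "sn (real p / real j) (C * A) \<le> norm C * sn (real p / real j) A"
    by (rule sn_ideal_left) (use assms False in auto)
  also have "... \<le> 1 * sn (real p / real j) A" by (intro mult_right_mono assms) simp
  finally show ?thesis using False by (simp add: nj_def)
qed

lemma nj_wprod:
  assumes "wfr ws" "wdeg ws \<le> p" "ws \<noteq> []" "\<And>\<sigma> A j. (\<sigma>, A, j) \<in> set ws \<Longrightarrow> norm (csg n e l w \<sigma>) \<le> 1"
  shows "nj p (wdeg ws) (wprod n e l w ws) \<le> wnorm p ws"
  using assms
proof (induction ws)
  case (Cons x ws)
  obtain \<sigma> A j where x: "x = (\<sigma>, A, j)" by (cases x)
  have A: "fr A" "wfr ws" "j \<le> p" "wdeg ws \<le> p" "j + wdeg ws \<le> p" "norm (csg n e l w \<sigma>) \<le> 1"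
    using Cons.prems by (auto simp: x)
  have 1: "nj p j (csg n e l w \<sigma> * A) \<le> nj p j A" by (rule nj_contraction) (use A in auto)
  show ?case
  proof (cases "ws = []")
    case False
    have IH: "nj p (wdeg ws) (wprod n e l w ws) \<le> wnorm p ws"
      by (rule Cons.IH) (use A False Cons.prems in auto)
    have "nj p (j + wdeg ws) (csg n e l w \<sigma> * A * wprod n e l w ws)
        \<le> nj p j (csg n e l w \<sigma> * A) * nj p (wdeg ws) (wprod n e l w ws)"
      by (rule nj_mult) (use A fr_wprod False in auto)
    also have "... \<le> nj p j A * wnorm p ws" by (intro mult_mono 1 IH) auto
    finally show ?thesis by (simp add: x)
  qed (use 1 in \<open>simp add: x\<close>)
qed simp

lemma trace_wprod:
  assumes "wfr ws" "wdeg ws = p" "p \<ge> 1" "ws \<noteq> []" "\<And>\<sigma> A j. (\<sigma>, A, j) \<in> set ws \<Longrightarrow> norm (csg n e l w \<sigma>) \<le> 1"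
  shows "cmod (tr (wprod n e l w ws)) \<le> wnorm p ws"
proof -
  have "cmod (tr (wprod n e l w ws)) \<le> sn 1 (wprod n e l w ws)"
    by (rule trace_le_sn1) (rule fr_wprod[OF assms(1,4)])
  also have "... = nj p (wdeg ws) (wprod n e l w ws)" using assms by (simp add: nj_def)
  also have "... \<le> wnorm p ws" by (rule nj_wprod) (use assms in auto)
  finally show ?thesis .
qed

lemma norm_csg_le:
  assumes e: "on_fam {..<n} e" and w: "w \<noteq> 0" "if \<sigma> then 0 \<le> Re w else Re w \<le> 0"
  shows "norm (csg n e l w \<sigma>) \<le> 1"
  unfolding csg_def
proof (rule norm_dg_le[OF e])
  fix i
  show "cmod (if (l i < 0) = \<sigma> then w / (w - complex_of_real (l i)) else 0) \<le> 1"
  proof (cases "(l i < 0) = \<sigma>")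
    case True
    have "(cmod w)\<^sup>2 \<le> (cmod (w - of_real (l i)))\<^sup>2"
    proof -
      have "(cmod (w - of_real (l i)))\<^sup>2 = (cmod w)\<^sup>2 - 2 * (l i * Re w) + (l i)\<^sup>2"
        by (simp only: cmod_power2) (simp add: power2_eq_square algebra_simps)
      moreover have "l i * Re w \<le> 0"
        using True w(2) by (cases \<sigma>) (auto simp: mult_nonpos_nonneg mult_nonneg_nonpos)
      moreover have "0 \<le> (l i)\<^sup>2" by simp
      ultimately show ?thesis by linarith
    qed
    then have "cmod w \<le> cmod (w - of_real (l i))" by (rule power2_le_imp_le) simp
    then show ?thesis using True w(1) by (auto simp: norm_divide divide_le_eq_1)
  qed simp
qed simp

text \<open>Each \<open>csg\<close> is a sum of eigenprojections with scalar coefficients; expanding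
  the letters one at a time leaves only products of these coefficients. The operator
  \<open>Z\<close> collects what has been expanded.\<close>

lemma holomorphic_word:
  assumes "wfr ws" "fr Z" "\<And>\<sigma> A j i. (\<sigma>, A, j) \<in> set ws \<Longrightarrow> i < n \<Longrightarrow> (l i < 0) = \<sigma> \<Longrightarrow> of_real (l i) \<notin> S"
  shows "(\<lambda>w. tr (Z * wprod n e l w ws)) holomorphic_on S"
  using assms
proof (induction ws arbitrary: Z)
  case (Cons x ws)
  obtain \<sigma> A j where x: "x = (\<sigma>, A, j)" by (cases x)
  have A: "fr A" "wfr ws" using Cons.prems by (auto simp: x)
  have eq: "tr (Z * wprod n e l w (x # ws)) =
      (\<Sum>i<n. (if (l i < 0) = \<sigma> then w / (w - of_real (l i)) else 0) * tr (Z * (rk (e i) (e i) * A) * wprod n e l w ws))" for w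
  proof -
    have "Z * wprod n e l w (x # ws) = (\<Sum>i<n. cs (if (l i < 0) = \<sigma> then w / (w - of_real (l i)) else 0) *
        (Z * (rk (e i) (e i) * A) * wprod n e l w ws))"
      unfolding x word_simps csg_def dg_eq sum_distrib_left sum_distrib_right
    proof (intro sum.cong refl)
      fix i
      show "Z * (cs c * rk (e i) (e i) * A * W) = cs c * (Z * (rk (e i) (e i) * A) * W)" for c and W :: "'a cop"
        using cs_commute[of c Z] by (metis mult.assoc)
    qed
    then show ?thesis using Cons.prems(2) by (simp add: tr_sum tr_cs fr_mult_left fr_mult_right)
  qed
  show ?case
    unfolding eq
  proof (intro holomorphic_on_sum holomorphic_on_mult)
    fix i assume i: "i \<in> {..<n}"
    show "(\<lambda>w. if (l i < 0) = \<sigma> then w / (w - complex_of_real (l i)) else 0) holomorphic_on S"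
    proof (cases "(l i < 0) = \<sigma>")
      case True
      then have "of_real (l i) \<notin> S" using Cons.prems(3)[of \<sigma> A j i] i x by auto
      then show ?thesis using True by (auto intro!: holomorphic_intros)
    qed simp
    show "(\<lambda>w. tr (Z * (rk (e i) (e i) * A) * wprod n e l w ws)) holomorphic_on S"
      by (rule Cons.IH) (use A Cons.prems in auto)
  qed
qed simp

lemma holomorphic_trace_word:
  assumes e: "on_fam {..<n} e" and ws: "wfr ws" "ws \<noteq> []"
    "\<And>\<sigma> A j i. (\<sigma>, A, j) \<in> set ws \<Longrightarrow> i < n \<Longrightarrow> (l i < 0) = \<sigma> \<Longrightarrow> of_real (l i) \<notin> S"
  shows "(\<lambda>w. tr (wprod n e l w ws)) holomorphic_on S"
proof -
  \<comment> \<open>The identity need not have finite rank; the projection onto the span of the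
    \<open>e i\<close> replaces it as initial \<open>Z\<close>.\<close>
  have one: "dg n e (\<lambda>_. 1) * csg n e l w \<sigma> = csg n e l w \<sigma>" for w \<sigma>
    unfolding csg_def dg_mult_dg[OF e] by simp
  have "dg n e (\<lambda>_. 1) * wprod n e l w ws = wprod n e l w ws" for w
    using ws(2) by (cases ws) (auto simp: mult.assoc[symmetric] one)
  moreover have "(\<lambda>w. tr (dg n e (\<lambda>_. 1) * wprod n e l w ws)) holomorphic_on S"
    by (rule holomorphic_word[OF ws(1) fr_dg ws(3)])
  ultimately show ?thesis by simp
qed

lemma ctr_pure_word:
  assumes e: "on_fam {..<n} e" and ws: "wfr ws" "wdeg ws = p" "p \<ge> 1" "ws \<noteq> []"
    and pure: "\<And>\<sigma>' A j. (\<sigma>', A, j) \<in> set ws \<Longrightarrow> \<sigma>' = \<sigma>" and ab: "a \<le> b"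
  shows "cmod (ctr (\<lambda>w. tr (wprod n e l w ws)) a b) \<le> 2 * pi * wnorm p ws"
proof (cases \<sigma>)
  case True
  show ?thesis
  proof (rule ctr_bound_right[OF _ _ ab])
    show "(\<lambda>w. tr (wprod n e l w ws)) holomorphic_on {w. Im w \<noteq> 0 \<or> 0 < Re w}"
      by (rule holomorphic_trace_word[OF e ws(1,4)]) (use pure True in \<open>force\<close>)
    fix w assume "0 \<le> Re w" "w \<noteq> 0"
    then show "cmod (tr (wprod n e l w ws)) \<le> wnorm p ws"
      using pure True by (intro trace_wprod ws norm_csg_le[OF e]) auto
  qed
next
  case False
  show ?thesis
  proof (rule ctr_bound_left[OF _ _ ab])
    show "(\<lambda>w. tr (wprod n e l w ws)) holomorphic_on {w. Im w \<noteq> 0 \<or> Re w < 0}"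
      by (rule holomorphic_trace_word[OF e ws(1,4)]) (use pure False in \<open>force\<close>)
    fix w assume "Re w \<le> 0" "w \<noteq> 0"
    then show "cmod (tr (wprod n e l w ws)) \<le> wnorm p ws"
      using pure False by (intro trace_wprod ws norm_csg_le[OF e]) auto
  qed
qed

text \<open>Each use of this identity removes one factor \<open>C\<close> from a word with mixed signs.\<close>

lemma csg_reduction:
  assumes w: "Im w \<noteq> 0" and e: "on_fam {..<n} e"
  shows "csg n e l w False * A * csg n e l w True
    = csg n e l w False * syl1 n e l A + syl2 n e l A * csg n e l w True"
  unfolding csg_def dg_mult_op_dg syl1_def syl2_def dg_mult_mx[OF e] mx_mult_dg[OF e] mx_add
proof (rule mx_cong)
  fix i j
  define x y where "x = complex_of_real (l i)" and "y = complex_of_real (l j)"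
  have wx: "w - x \<noteq> 0" "w - y \<noteq> 0" using w by (auto simp: x_def y_def complex_eq_iff)
  have *: "w / (w - x) * c * (w / (w - y)) = w / (w - x) * (x / (x - y) * c) + (- y) / (x - y) * c * (w / (w - y))"
    if "x \<noteq> y" for c
  proof -
    have xy: "x - y \<noteq> 0" using that by simp
    have "w * w * (x - y) = w * x * (w - y) - y * w * (w - x)" by (simp add: algebra_simps)
    then have "w * w * (x - y) / ((w - x) * (w - y) * (x - y)) = (w * x * (w - y) - y * w * (w - x)) / ((w - x) * (w - y) * (x - y))"
      by simp
    also have "... = w / (w - x) * (x / (x - y)) + (- y) / (x - y) * (w / (w - y))"
      using wx xy by (simp add: diff_divide_distrib mult_ac)
    also have "w * w * (x - y) / ((w - x) * (w - y) * (x - y)) = w / (w - x) * (w / (w - y))" using xy by simp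
    finally have eq: "w / (w - x) * (w / (w - y)) = w / (w - x) * (x / (x - y)) + (- y) / (x - y) * (w / (w - y))" .
    have "w / (w - x) * c * (w / (w - y)) = c * (w / (w - x) * (w / (w - y)))" by (simp only: mult_ac)
    also have "... = w / (w - x) * (x / (x - y) * c) + (- y) / (x - y) * c * (w / (w - y))"
      unfolding eq by (simp only: distrib_left mult_ac)
    finally show ?thesis .
  qed
  show "(if (l i < 0) = False then w / (w - complex_of_real (l i)) else 0) * cf e A i j *
        (if (l j < 0) = True then w / (w - complex_of_real (l j)) else 0) =
      (if (l i < 0) = False then w / (w - complex_of_real (l i)) else 0) *
        (if 0 \<le> l i \<and> l j < 0 then complex_of_real (l i / (l i - l j)) * cf e A i j else 0) +
      (if 0 \<le> l i \<and> l j < 0 then complex_of_real (- l j / (l i - l j)) * cf e A i j else 0) *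
        (if (l j < 0) = True then w / (w - complex_of_real (l j)) else 0)"
  proof (cases "0 \<le> l i \<and> l j < 0")
    case True
    then have "x \<noteq> y" by (auto simp: x_def y_def)
    from *[OF this] show ?thesis using True by (simp add: x_def y_def)
  qed auto
qed

text \<open>A letter with \<open>j = 0\<close> is measured in the operator norm, where no bound for
  the multipliers is available. It must therefore not stand before a change of sign: its sign is
  that of the next letter, and at the end \<open>s\<close> plays the part of the next letter, namely
  the first one when the word is read cyclically.\<close>

fun wok :: "'a letter list \<Rightarrow> bool \<Rightarrow> bool"
  where "wok [] s = True"
  | "wok ((\<sigma>, A, j) # ws) s = ((j = 0 \<longrightarrow> \<sigma> = (case ws of [] \<Rightarrow> s | x # _ \<Rightarrow> fst x)) \<and> wok ws s)"

text \<open>Under the trace the factor \<open>syl2\<close> left at the front of a word moves to its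
  end and is absorbed there by the last letter.\<close>

fun addlast :: "'a::complex_hilbert_space cop \<Rightarrow> nat \<Rightarrow> 'a letter list \<Rightarrow> 'a letter list"
  where "addlast N k [] = []"
  | "addlast N k [(\<sigma>, A, j)] = [(\<sigma>, A * N, j + k)]"
  | "addlast N k (x # y # ws) = x # addlast N k (y # ws)"

lemma wok_append: "vs \<noteq> [] \<Longrightarrow> wok (ws @ vs) s \<longleftrightarrow> wok ws (fst (hd vs)) \<and> wok vs s"
proof (induction ws)
  case (Cons x ws)
  then show ?case by (cases x; cases ws; cases vs) auto
qed simp

lemma addlast_props:
  assumes "ws \<noteq> []"
  shows "wprod n e l w (addlast N k ws) = wprod n e l w ws * N" "wdeg (addlast N k ws) = wdeg ws + k"
    "length (addlast N k ws) = length ws" "wfr ws \<Longrightarrow> wfr (addlast N k ws)"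
    "k > 0 \<Longrightarrow> wok ws s \<Longrightarrow> wok (addlast N k ws) s'" "fst (hd (addlast N k ws)) = fst (hd ws)" "addlast N k ws \<noteq> []"
    "wfr ws \<Longrightarrow> fr N \<Longrightarrow> wdeg ws + k \<le> p \<Longrightarrow> wnorm p (addlast N k ws) \<le> wnorm p ws * nj p k N"
  using assms
proof (induction N k ws rule: addlast.induct)
  case (3 N k x y ws)
  obtain \<sigma> A j where x: "x = (\<sigma>, A, j)" by (cases x)
  obtain \<sigma>' A' j' where y: "y = (\<sigma>', A', j')" by (cases y)
  { case 1 then show ?case using 3 by (simp add: x mult.assoc) }
  { case 2 then show ?case using 3 by (simp add: x) }
  { case 3 then show ?case using "3.IH"(3) by simp }
  { case 4 then show ?case using "3.IH"(4) by (simp add: x) }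
  { case 5
    have "addlast N k (y # ws) \<noteq> []" "fst (hd (addlast N k (y # ws))) = \<sigma>'" using "3.IH"(6,7) by (auto simp: y)
    then show ?case using 5 "3.IH"(5) by (auto simp: x y split: list.splits) }
  { case 6 then show ?case by simp }
  { case 7 then show ?case by simp }
  { case 8
    then have "wnorm p (addlast N k (y # ws)) \<le> wnorm p (y # ws) * nj p k N" using "3.IH"(8) by (simp add: x)
    then show ?case by (simp add: x mult.assoc mult_left_mono) }
qed (auto simp: mult.assoc intro: nj_mult)

text \<open>If all degrees vanished, the sign \<open>True\<close> would propagate to the end and
  contradict \<open>False\<close>. This ensures that the letter treated by
  \<open>csg_reduction\<close> has degree less than \<open>p\<close>.\<close>

lemma wok_exists_pos:
  fixes A :: "'a::complex_hilbert_space cop"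
  assumes "wok ((True, A, j) # ws) False"
  shows "wdeg ((True, A, j) # ws) > 0"
  using assms
proof (induction ws arbitrary: A j)
  case (Cons y ws)
  obtain \<sigma>' A' j' where y: "y = (\<sigma>', A', j')" by (cases y)
  show ?case
  proof (cases "j = 0")
    case True
    then have "\<sigma>'" using Cons.prems by (simp add: y)
    then have "0 < wdeg ((True, A', j') # ws)" using Cons.prems by (intro Cons.IH) (simp add: y)
    moreover have "y = (True, A', j')" using \<open>\<sigma>'\<close> by (simp add: y)
    moreover have "wdeg ((True, A, j) # (True, A', j') # ws) = j + wdeg ((True, A', j') # ws)"
      by (rule word_simps(8))
    ultimately show ?thesis by simp
  qed simp
qed auto

text \<open>Read cyclically, a word with both signs has a change from \<open>False\<close> to
  \<open>True\<close>, the order required by \<open>csg_reduction\<close>; the trace permits the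
  rotation.\<close>

lemma mixed_rotation:
  assumes "\<exists>x\<in>set ws. fst x" "\<exists>x\<in>set ws. \<not> fst x"
  obtains xs ys A j B k rest where "ws = xs @ ys" "ys @ xs = (False, A, j) # (True, B, k) # rest"
proof -
  obtain x where x: "x \<in> set ws" "fst x" using assms(1) by blast
  obtain as bs where ws: "ws = as @ x # bs" using x(1) by (meson split_list)
  define zs where "zs = bs @ as"
  have "\<exists>y\<in>set zs. \<not> fst y" using assms(2) x(2) by (auto simp: zs_def ws)
  then obtain cs y ds where zs: "zs = cs @ y # ds" "\<not> fst y" "\<forall>z\<in>set ds. fst z"
    using split_list_last_prop[of zs "\<lambda>y. \<not> fst y"] by auto
  obtain A j where y: "y = (False, A, j)" using zs(2) by (cases y) auto
  have hd: "fst (hd (ds @ [x]))" using zs(3) x(2) by (cases ds) auto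
  obtain B k rest where rest: "ds @ x # cs = (True, B, k) # rest"
  proof (cases ds)
    case Nil
    then show ?thesis using that[of _ _ cs] x(2) by (cases x) auto
  next
    case (Cons d ds')
    then show ?thesis using that[of _ _ "ds' @ x # cs"] hd by (cases d) auto
  qed
  have "\<exists>xs ys. ws = xs @ ys \<and> ys @ xs = y # ds @ x # cs"
  proof -
    from zs(1) have "bs @ as = cs @ y # ds" by (simp add: zs_def)
    then obtain us where "cs = bs @ us \<and> as = us @ y # ds \<or> bs = cs @ us \<and> us @ as = y # ds"
      unfolding append_eq_append_conv2 by metis
    then show ?thesis
    proof (elim disjE conjE)
      assume 1: "cs = bs @ us" "as = us @ y # ds"
      then have "ws = us @ (y # ds @ x # bs)" "(y # ds @ x # bs) @ us = y # ds @ x # cs" by (simp_all add: ws)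
      then show ?thesis by blast
    next
      assume 2: "bs = cs @ us" "us @ as = y # ds"
      then have "ws = (as @ x # cs) @ us" "us @ (as @ x # cs) = y # ds @ x # cs" by (simp_all add: ws)
      then show ?thesis by blast
    qed
  qed
  then show thesis using that rest y by auto
qed

abbreviation wctr :: "nat \<Rightarrow> (nat \<Rightarrow> 'a::complex_hilbert_space) \<Rightarrow> (nat \<Rightarrow> real) \<Rightarrow> 'a letter list \<Rightarrow> real \<Rightarrow> real \<Rightarrow> complex"
  where "wctr n e l ws a b \<equiv> ctr (\<lambda>w. tr (wprod n e l w ws)) a b"

text \<open>Induction on the length. A word of one sign is settled by the contour. Otherwise
  \<open>csg_reduction\<close> at a change of sign produces two words of the same degree with one
  letter less, and the merged letter has positive degree, so that \<open>wok\<close>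
  persists.\<close>

theorem ctr_word_bound:
  assumes p: "p \<ge> 2" and N: "N \<ge> 1"
  shows "\<exists>K\<ge>0. \<forall>n (e :: nat \<Rightarrow> 'a::complex_hilbert_space) l ws a b. on_fam {..<n} e \<longrightarrow> length ws = N \<longrightarrow> wfr ws \<longrightarrow>
    wdeg ws = p \<longrightarrow> wok ws (fst (hd ws)) \<longrightarrow> a \<le> b \<longrightarrow> cmod (wctr n e l ws a b) \<le> K * wnorm p ws"
  using N
proof (induction N)
  case (Suc N)
  have "\<exists>C\<ge>0. \<forall>n (e :: nat \<Rightarrow> 'a) l A. on_fam {..<n} e \<longrightarrow> fr A \<longrightarrow>
      nj p j (syl1 n e l A) \<le> C * nj p j A \<and> nj p j (syl2 n e l A) \<le> C * nj p j A" if j: "j \<in> {1..<p}" for j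
  proof -
    have r: "real p / real j > 1" using j by simp
    obtain C1 C2 where C: "C1 \<ge> 0" "C2 \<ge> 0"
      "\<And>n (e :: nat \<Rightarrow> 'a) l A. on_fam {..<n} e \<Longrightarrow> fr A \<Longrightarrow> sn (real p / real j) (syl1 n e l A) \<le> C1 * sn (real p / real j) A"
      "\<And>n (e :: nat \<Rightarrow> 'a) l A. on_fam {..<n} e \<Longrightarrow> fr A \<Longrightarrow> sn (real p / real j) (syl2 n e l A) \<le> C2 * sn (real p / real j) A"
      using sn_syl1_bound[OF r] sn_syl2_bound[OF r] by metis
    have "C1 * s \<le> (C1 + C2) * s" "C2 * s \<le> (C1 + C2) * s" if "s \<ge> 0" for s
      using that C by (auto intro!: mult_right_mono)
    then have "\<forall>n (e :: nat \<Rightarrow> 'a) l A. on_fam {..<n} e \<longrightarrow> fr A \<longrightarrow>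
      nj p j (syl1 n e l A) \<le> (C1 + C2) * nj p j A \<and> nj p j (syl2 n e l A) \<le> (C1 + C2) * nj p j A"
      using C(3,4) j order_trans[OF C(3)] order_trans[OF C(4)] unfolding nj_def by simp
    then show ?thesis using C(1,2) by (intro exI[of _ "C1 + C2"]) auto
  qed
  then obtain Cj where Cj: "\<And>j. j \<in> {1..<p} \<Longrightarrow> Cj j \<ge> 0"
    "\<And>j n (e :: nat \<Rightarrow> 'a) l A. j \<in> {1..<p} \<Longrightarrow> on_fam {..<n} e \<Longrightarrow> fr A \<Longrightarrow>
      nj p j (syl1 n e l A) \<le> Cj j * nj p j A \<and> nj p j (syl2 n e l A) \<le> Cj j * nj p j A" by metis
  \<comment> \<open>One constant for the finitely many exponents p / j that can occur.\<close>
  define C where "C = (\<Sum>j\<in>{1..<p}. Cj j)"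
  have C0: "C \<ge> 0" unfolding C_def by (intro sum_nonneg Cj(1))
  have C: "nj p j (syl1 n e l A) \<le> C * nj p j A" "nj p j (syl2 n e l A) \<le> C * nj p j A"
    if "j \<in> {1..<p}" "on_fam {..<n} e" "fr A" for j n and e :: "nat \<Rightarrow> 'a" and l A
  proof -
    have "Cj j \<le> C" unfolding C_def by (rule member_le_sum[OF that(1)]) (use Cj(1) in auto)
    then have "Cj j * nj p j A \<le> C * nj p j A" by (intro mult_right_mono) auto
    then show "nj p j (syl1 n e l A) \<le> C * nj p j A" "nj p j (syl2 n e l A) \<le> C * nj p j A"
      using Cj(2)[OF that, of l] by linarith+
  qed
  obtain K where K0: "K \<ge> 0" and K: "N \<ge> 1 \<Longrightarrow> on_fam {..<n} e \<Longrightarrow> length ws = N \<Longrightarrow> wfr ws \<Longrightarrow>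
    wdeg ws = p \<Longrightarrow> wok ws (fst (hd ws)) \<Longrightarrow> a \<le> b \<Longrightarrow> cmod (wctr n e l ws a b) \<le> K * wnorm p ws"
    for n and e :: "nat \<Rightarrow> 'a" and l ws a b
  proof (cases "N \<ge> 1")
    case True
    then show ?thesis using Suc.IH that by metis
  qed (use that[of 0] in auto)
  \<comment> \<open>2 pi for words of one sign; \<open>K * C\<close> for each of the two shorter
    words.\<close>
  define K' where "K' = 2 * pi + 2 * (K * C)"
  have KC: "K * C \<ge> 0" using K0 C0 by simp
  have "cmod (wctr n e l ws a b) \<le> K' * wnorm p ws"
    if e: "on_fam {..<n} e" and ws: "length ws = Suc N" "wfr ws" "wdeg ws = p" "wok ws (fst (hd ws))" and ab: "a \<le> b"
    for n and e :: "nat \<Rightarrow> 'a" and l ws a b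
  proof (cases "(\<exists>x\<in>set ws. fst x) \<and> (\<exists>x\<in>set ws. \<not> fst x)")
    case False
    then obtain \<sigma> where \<sigma>: "\<And>\<sigma>' A j. (\<sigma>', A, j) \<in> set ws \<Longrightarrow> \<sigma>' = \<sigma>" by (metis (full_types) fst_conv)
    have "cmod (wctr n e l ws a b) \<le> 2 * pi * wnorm p ws"
      by (rule ctr_pure_word[OF e _ _ _ _ \<sigma> ab]) (use ws p in auto)
    also have "... \<le> K' * wnorm p ws" using KC by (intro mult_right_mono) (auto simp: K'_def)
    finally show ?thesis .
  next
    case True
    then obtain xs ys A j B k rest where rot: "ws = xs @ ys" "ys @ xs = (False, A, j) # (True, B, k) # rest"
      using mixed_rotation[of ws] by metis
    define vs where "vs = (False, A, j) # (True, B, k) # rest"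
    have vs: "wfr vs" "wdeg vs = p" "wnorm p vs = wnorm p ws" "length vs = Suc N"
      unfolding vs_def rot(2)[symmetric] using ws by (auto simp: rot(1) mult.commute)
    have okv: "wok vs False"
    proof (cases "xs = [] \<or> ys = []")
      case True
      then have "ws = vs" using rot by (auto simp: vs_def)
      then show ?thesis using ws(4) by (simp add: vs_def)
    next
      case False
      then have "wok xs (fst (hd ys))" "wok ys (fst (hd xs))"
        using ws(4) unfolding rot(1) by (simp_all add: wok_append)
      then have "wok (ys @ xs) (fst (hd ys))" using False by (simp add: wok_append)
      moreover have "fst (hd ys) = False" using False rot(2) by (cases ys) auto
      ultimately show ?thesis by (simp add: vs_def rot(2))
    qed
    have trot: "tr (wprod n e l w ws) = tr (wprod n e l w vs)" for w
    proof (cases "xs = []")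
      case True
      then show ?thesis using rot by (simp add: vs_def)
    next
      case False
      then have "fr (wprod n e l w xs)" using ws(2) rot(1) by (intro fr_wprod) auto
      then show ?thesis unfolding vs_def rot(2)[symmetric] rot(1) word_simps by (rule tr_commute)
    qed
    \<comment> \<open>The sign changes after this letter, so \<open>wok\<close> excludes degree 0;
      the remaining letters have positive total degree, so j < p. Hence 1 < p / j < infinity, the
      range of the multiplier bounds.\<close>
    have j0: "j > 0" using okv by (auto simp: vs_def)
    have "wok ((True, B, k) # rest) False" using okv by (auto simp: vs_def)
    from wok_exists_pos[OF this] have jp: "j \<in> {1..<p}" using j0 vs(2) by (auto simp: vs_def)
    have frs: "fr A" "fr B" "wfr rest" using vs(1) by (auto simp: vs_def)
    define v1 where "v1 = (False, syl1 n e l A * B, j + k) # rest"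
    define v2 where "v2 = addlast (syl2 n e l A) j ((True, B, k) # rest)"
    have N1: "N \<ge> 1" "length v1 = N" "length v2 = N"
      using vs(4) by (auto simp: v1_def v2_def vs_def addlast_props(3))
    have split: "tr (wprod n e l w vs) = tr (wprod n e l w v1) + tr (wprod n e l w v2)" if w: "Im w \<noteq> 0" for w
    proof -
      define R where "R = wprod n e l w ((True, B, k) # rest)"
      have frR: "fr R" unfolding R_def by (rule fr_wprod) (use frs in auto)
      have "wprod n e l w vs = csg n e l w False * A * csg n e l w True * (B * wprod n e l w rest)"
        by (simp add: vs_def mult.assoc)
      also have "... = wprod n e l w v1 + syl2 n e l A * R"
        unfolding csg_reduction[OF w e] by (simp add: v1_def R_def distrib_right mult.assoc)
      finally have "tr (wprod n e l w vs) = tr (wprod n e l w v1) + tr (syl2 n e l A * R)"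
        using frs by (simp add: tr_add v1_def fr_mult_left fr_mult_right)
      also have "tr (syl2 n e l A * R) = tr (wprod n e l w v2)"
        unfolding v2_def addlast_props(1)[OF list.distinct(2)] R_def[symmetric] by (rule tr_commute) simp
      finally show ?thesis .
    qed
    have v1: "wfr v1" "wdeg v1 = p" "wok v1 (fst (hd v1))"
      using vs(1,2) okv j0 by (auto simp: v1_def vs_def)
    have v2: "wfr v2" "wdeg v2 = p" "wok v2 (fst (hd v2))"
    proof -
      show "wfr v2" unfolding v2_def by (rule addlast_props(4)) (use frs in auto)
      show "wdeg v2 = p" unfolding v2_def using vs(2) by (subst addlast_props(2)) (auto simp: vs_def)
      show "wok v2 (fst (hd v2))" unfolding v2_def
        by (rule addlast_props(5)[where s = False]) (use okv j0 in \<open>auto simp: vs_def\<close>)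
    qed
    have n1: "wnorm p v1 \<le> C * wnorm p vs"
    proof -
      have "nj p (j + k) (syl1 n e l A * B) \<le> nj p j (syl1 n e l A) * nj p k B"
        by (rule nj_mult) (use frs vs(2) in \<open>auto simp: vs_def\<close>)
      also have "... \<le> C * nj p j A * nj p k B" by (intro mult_right_mono C[OF jp e frs(1)]) simp
      finally have "nj p (j + k) (syl1 n e l A * B) \<le> C * nj p j A * nj p k B" .
      from mult_right_mono[OF this, of "wnorm p rest"] show ?thesis
        by (simp add: v1_def vs_def mult.assoc)
    qed
    have n2: "wnorm p v2 \<le> C * wnorm p vs"
    proof -
      have "wnorm p v2 \<le> wnorm p ((True, B, k) # rest) * nj p j (syl2 n e l A)"
        unfolding v2_def by (rule addlast_props(8)) (use frs vs(2) in \<open>auto simp: vs_def\<close>)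
      also have "... \<le> wnorm p ((True, B, k) # rest) * (C * nj p j A)"
        by (intro mult_left_mono C(2)[OF jp e frs(1)]) simp
      finally show ?thesis by (simp add: vs_def mult_ac)
    qed
    have cont: "continuous_on offR (\<lambda>w. tr (wprod n e l w v))" if "wfr v" "v \<noteq> []" for v
      by (intro holomorphic_on_imp_continuous_on holomorphic_trace_word[OF e that]) auto
    have "wctr n e l ws a b = ctr (\<lambda>w. tr (wprod n e l w v1) + tr (wprod n e l w v2)) a b"
      by (rule ctr_cong) (simp add: trot split)
    also have "... = wctr n e l v1 a b + wctr n e l v2 a b"
      by (intro ctr_add cont v1 v2) (auto simp: v1_def v2_def addlast_props(7))
    also have "cmod ... \<le> K * wnorm p v1 + K * wnorm p v2"
      by (rule order_trans[OF norm_triangle_ineq]) (intro add_mono K N1 e v1 v2 ab)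
    also have "... \<le> K * (C * wnorm p vs) + K * (C * wnorm p vs)" by (intro add_mono mult_left_mono n1 n2 K0)
    also have "... = 2 * (K * C) * wnorm p ws" by (simp add: vs(3))
    also have "... \<le> K' * wnorm p ws" by (intro mult_right_mono) (auto simp: K'_def)
    finally show ?thesis .
  qed
  then show ?case using KC by (intro exI[of _ K']) (auto simp: K'_def)
qed simp

subsection \<open>Difference operators\<close>

definition dif :: "'v::ab_group_add \<Rightarrow> ('v \<Rightarrow> 'w::ab_group_add) \<Rightarrow> 'v \<Rightarrow> 'w"
  where "dif V f = (\<lambda>X. f (X + V) - f X)"

abbreviation difn :: "nat \<Rightarrow> 'v::ab_group_add \<Rightarrow> ('v \<Rightarrow> 'w::ab_group_add) \<Rightarrow> 'v \<Rightarrow> 'w"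
  where "difn k V \<equiv> (dif V ^^ k)"

lemma difn_Suc: "difn (Suc k) V f X = difn k V f (X + V) - difn k V f X"
  by (simp add: dif_def)

text \<open>The set \<open>S\<close> is present because identities between operator functions hold
  only for self-adjoint or finite-rank arguments, a class stable under adding
  \<open>V\<close>.\<close>

lemma difn_cong_on:
  assumes "\<And>X. X \<in> S \<Longrightarrow> f X = g X" "\<And>X. X \<in> S \<Longrightarrow> X + V \<in> S" "X \<in> S"
  shows "difn k V f X = difn k V g X"
  using assms(3) by (induction k arbitrary: X) (simp_all add: assms(1,2) dif_def)

lemma difn_additive:
  assumes S: "\<And>X. X \<in> S \<Longrightarrow> X + V \<in> S" and f: "\<And>X. X \<in> S \<Longrightarrow> f X \<in> T"
    and T: "\<And>x y. x \<in> T \<Longrightarrow> y \<in> T \<Longrightarrow> x - y \<in> T" and g: "\<And>x y. x \<in> T \<Longrightarrow> y \<in> T \<Longrightarrow> g (x - y) = g x - g y"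
    and X: "X \<in> S"
  shows "difn k V f X \<in> T \<and> difn k V (\<lambda>X. g (f X)) X = g (difn k V f X)"
  using X by (induction k arbitrary: X) (simp_all add: f dif_def T g S)

lemma difn_add: "difn k V (\<lambda>X. f X + g X) X = difn k V f X + difn k V g X"
  by (induction k arbitrary: X) (simp_all add: dif_def)

lemma difn_sum: "difn k V (\<lambda>X. \<Sum>i\<in>I. f i X) X = (\<Sum>i\<in>I. difn k V (f i) X)"
  by (induction k arbitrary: X) (simp_all add: dif_def sum_subtractf)

lemma difn_linear:
  assumes "\<And>x y. g (x - y) = g x - g y"
  shows "difn k V (\<lambda>X. g (f X)) X = g (difn k V f X)"
  by (induction k arbitrary: X) (simp_all add: dif_def assms)

text \<open>Leibniz rule with a factor whose second difference vanishes. The sum of equal terms is a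
  multiple by \<open>Suc n\<close>, written without scalars.\<close>

lemma difn_times_linear:
  fixes a :: "'v::ring \<Rightarrow> 'v"
  shows "difn (Suc n) V (\<lambda>X. X * a X) X = X * difn (Suc n) V a X + (\<Sum>i<Suc n. V * difn n V a (X + V))"
proof (induction n arbitrary: X)
  case 0
  then show ?case by (simp add: dif_def algebra_simps)
next
  case (Suc n)
  have "difn (Suc (Suc n)) V (\<lambda>X. X * a X) X
      = difn (Suc n) V (\<lambda>X. X * a X) (X + V) - difn (Suc n) V (\<lambda>X. X * a X) X" by (rule difn_Suc)
  also have "... = X * (difn (Suc n) V a (X + V) - difn (Suc n) V a X) + V * difn (Suc n) V a (X + V)
      + (\<Sum>i<Suc n. V * (difn n V a (X + V + V) - difn n V a (X + V)))"
    unfolding Suc by (simp add: algebra_simps sum_subtractf)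
  also have "difn n V a (X + V + V) - difn n V a (X + V) = difn (Suc n) V a (X + V)" by (rule difn_Suc[symmetric])
  also have "difn (Suc n) V a (X + V) - difn (Suc n) V a X = difn (Suc (Suc n)) V a X" by (rule difn_Suc[symmetric])
  finally show ?case by (simp only: sum.lessThan_Suc[of _ "Suc n"] add_ac)
qed


lemma difn_const: "k > 0 \<Longrightarrow> difn k V (\<lambda>_. c) X = 0"
proof (cases k)
  case (Suc n)
  have "difn (Suc n) V (\<lambda>_. c) X = 0" by (induction n arbitrary: X) (simp_all add: dif_def)
  then show ?thesis by (simp add: Suc)
qed simp

lemma difn_power_zero:
  fixes V :: "'v::{ring, monoid_mult}"
  assumes "i < n"
  shows "difn n V (\<lambda>X. X ^ i) X = 0"
  using assms
proof (induction i arbitrary: n X)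
  case 0
  then show ?case by (simp add: difn_const)
next
  case (Suc i)
  then obtain m where n: "n = Suc m" "i < m" by (cases n) auto
  have "difn n V (\<lambda>X. X * X ^ i) X = 0"
    unfolding n(1) difn_times_linear using Suc.IH[of "Suc m"] Suc.IH[of m] n(2) by simp
  then show ?case by simp
qed

lemma difn_power_same:
  fixes V :: "'a::complex_hilbert_space cop"
  shows "difn i V (\<lambda>X. X ^ i) X = fact i *\<^sub>R V ^ i"
proof (induction i arbitrary: X)
  case (Suc i)
  have "difn (Suc i) V (\<lambda>X. X * X ^ i) X = (\<Sum>j<Suc i. V * (fact i *\<^sub>R V ^ i))"
    unfolding difn_times_linear Suc using difn_power_zero[of i "Suc i" V X] by simp
  also have "... = (real (Suc i) * fact i) *\<^sub>R V ^ Suc i"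
    by (simp only: sum_constant_scaleR card_lessThan scaleR_scaleR mult_scaleR_right power_Suc)
  finally show ?case by (simp only: fact_Suc power_Suc of_nat_mult of_nat_fact)
qed simp

lemma difn_integral:
  fixes f :: "'v::ab_group_add \<Rightarrow> real \<Rightarrow> 'w::euclidean_space"
  assumes S: "\<And>X. X \<in> S \<Longrightarrow> X + V \<in> S" and f: "\<And>X. X \<in> S \<Longrightarrow> f X integrable_on A" and X: "X \<in> S"
  shows "(\<lambda>u. difn k V (\<lambda>X. f X u) X) integrable_on A \<and>
    difn k V (\<lambda>X. integral A (f X)) X = integral A (\<lambda>u. difn k V (\<lambda>X. f X u) X)"
  using X
proof (induction k arbitrary: X)
  case (Suc k)
  have 1: "X + V \<in> S" by (rule S[OF Suc.prems])
  show ?case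
    unfolding difn_Suc using Suc.IH[OF 1] Suc.IH[OF Suc.prems] by (simp add: integrable_diff integral_diff)
qed (simp add: f)

lemma difn_tendsto:
  fixes f :: "'i \<Rightarrow> 'v::ab_group_add \<Rightarrow> 'w::real_normed_vector"
  assumes S: "\<And>X. X \<in> S \<Longrightarrow> X + V \<in> S" and f: "\<And>X. X \<in> S \<Longrightarrow> ((\<lambda>a. f a X) \<longlongrightarrow> g X) F" and X: "X \<in> S"
  shows "((\<lambda>a. difn k V (f a) X) \<longlongrightarrow> difn k V g X) F"
  using X by (induction k arbitrary: X) (auto simp: dif_def S f intro!: tendsto_diff)

subsection \<open>Functional calculus for self-adjoint operators of finite rank\<close>

definition sa :: "'a::complex_hilbert_space cop \<Rightarrow> bool"
  where "sa X \<longleftrightarrow> fr X \<and> adj X = X"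

lemma sa_add: "sa X \<Longrightarrow> sa Y \<Longrightarrow> sa (X + Y)"
  by (auto simp: sa_def adj_simps)

lemma sa_scaleR: "sa X \<Longrightarrow> sa (r *\<^sub>R X)"
  by (auto simp: sa_def adj_simps)

definition eig :: "nat \<Rightarrow> (nat \<Rightarrow> 'a::complex_hilbert_space) \<Rightarrow> (nat \<Rightarrow> real) \<Rightarrow> 'a cop \<Rightarrow> bool"
  where "eig n e l X \<longleftrightarrow> on_fam {..<n} e \<and> X = (\<Sum>i<n. l i *\<^sub>R rk (e i) (e i))"

text \<open>The eigenvectors span the whole range of \<open>proj B\<close>, kernel vectors included.
  If \<open>B\<close> also carries the range of another self-adjoint operator, that operator acts
  within the same span.\<close>

lemma eig_exists:
  fixes X :: "'a::complex_hilbert_space cop"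
  assumes X: "sa X" and B: "onset B" "finite B" "proj B * X = X"
  obtains n e l where "eig n e l X" "dg n e (\<lambda>_. 1) = proj B"
proof -
  have frX: "fr X" and aX: "adj X = X" using X by (auto simp: sa_def)
  define U where "U = {x. ap (proj B) x = x}"
  have cont: "continuous_on UNIV (\<lambda>x. ap (proj B) x - x)"
    by (intro continuous_on_diff linear_continuous_on[OF blinfun.bounded_linear_right] continuous_on_id)
  have U_eq: "U = (\<lambda>x. ap (proj B) x - x) -` {0}" by (auto simp: U_def)
  have U: "closed U" "subspace U"
    unfolding U_eq using continuous_closed_vimage[OF closed_singleton[of "0::'a"], of "\<lambda>x. ap (proj B) x - x"] cont
    by (auto simp: continuous_on_eq_continuous_at subspace_def algebra_simps blinfun.scaleR_right)
  have inv: "ap X x \<in> U" if "x \<in> U" for x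
    unfolding U_def using arg_cong[OF B(3), of "\<lambda>Y. ap Y x"] by simp
  have sym: "cinner (ap X x) y = cinner x (ap X y)" for x y using cinner_adj[of X x y] aX by simp
  obtain E where E: "onset E" "E \<subseteq> U" "\<And>e. e \<in> E \<Longrightarrow> \<exists>k::real. ap X e = k *\<^sub>R e"
    and max: "\<And>x. x \<in> U \<Longrightarrow> (\<And>e. e \<in> E \<Longrightarrow> cinner x e = 0) \<Longrightarrow> x = 0"
    using spectral_theorem[OF compact_op_fr[OF frX] sym U inv] by metis
  have finE: "finite E" by (rule finite_onset_in_range[OF B(1,2) E(1)]) (use E(2) in \<open>auto simp: U_def\<close>)
  have PE: "proj E = proj B"
  proof (rule cop_eqI)
    fix x
    have PU: "ap (proj B) x \<in> U" using arg_cong[OF proj_idem[OF B(1,2)], of "\<lambda>Y. ap Y x"] by (simp add: U_def)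
    have EU: "ap (proj E) x \<in> U"
      unfolding ap_proj
    proof (intro subspace_sum[OF U(2)])
      fix e assume "e \<in> E"
      then have "ap (proj B) e = e" using E(2) by (auto simp: U_def)
      then show "scaleC (cinner x e) e \<in> U" by (simp add: U_def)
    qed
    have "ap (proj B) x - ap (proj E) x = 0"
    proof (rule max)
      show "ap (proj B) x - ap (proj E) x \<in> U" using PU EU U(2) by (simp add: subspace_diff)
      fix e assume e: "e \<in> E"
      have "cinner (ap (proj B) x) e = cinner x e" using E(2) e by (auto simp: cinner_adj U_def)
      moreover have "cinner (ap (proj E) x) e = cinner x e" using ap_proj_mem[OF E(1) finE e] by (simp add: cinner_adj)
      ultimately show "cinner (ap (proj B) x - ap (proj E) x) e = 0" by (simp add: cinner_diff_left)
    qed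
    then show "ap (proj E) x = ap (proj B) x" by simp
  qed
  obtain k :: "'a \<Rightarrow> real" where k: "\<And>e. e \<in> E \<Longrightarrow> ap X e = k e *\<^sub>R e" using E(3) by metis
  obtain f where f: "bij_betw f {..<card E} E" using ex_bij_betw_nat_finite[OF finE] by (auto simp: atLeast0LessThan)
  have on: "on_fam {..<card E} f"
    unfolding on_fam_def
  proof (intro ballI)
    fix i j assume ij: "i \<in> {..<card E}" "j \<in> {..<card E}"
    then have "f i \<in> E" "f j \<in> E" "f i = f j \<longleftrightarrow> i = j"
      using f by (auto simp: bij_betw_def inj_on_eq_iff)
    then show "cinner (f i) (f j) = (if i = j then 1 else 0)" by (simp add: onset_cinner[OF E(1)])
  qed
  have "X = adj (proj B * X)" using B(3) aX by simp
  also have "... = X * proj E" by (simp add: adj_simps aX PE)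
  also have "... = (\<Sum>e\<in>E. k e *\<^sub>R rk e e)"
    unfolding proj_def sum_distrib_left
    by (intro sum.cong refl cop_eqI) (simp add: rk_mult(2) k scaleC_scaleR)
  also have "... = (\<Sum>i<card E. k (f i) *\<^sub>R rk (f i) (f i))"
    by (rule sum.reindex_bij_betw[OF f, symmetric])
  finally have "eig (card E) f (\<lambda>i. k (f i)) X" using on by (simp add: eig_def)
  moreover have "dg (card E) f (\<lambda>_. 1) = proj B"
    by (subst PE[symmetric], unfold proj_def dg_eq) (use sum.reindex_bij_betw[OF f, of "\<lambda>b. rk b b"] in \<open>simp add: cs_simps\<close>)
  ultimately show thesis using that by blast
qed

lemma eig_exists': "sa X \<Longrightarrow> \<exists>n e l. eig n e l X"
  using fr_range_proj[of X] eig_exists[of X] by (metis sa_def)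

lemma eig_spw:
  assumes "eig n e l X" "p > 0"
  shows "spw p X = (\<Sum>i<n. \<bar>l i\<bar> powr p)"
proof (rule spw_on_fam(2))
  let ?u = "\<lambda>i. (if l i < 0 then -1 else 1) *\<^sub>R e i"
  show "on_fam {..<n} ?u"
    using assms(1) by (auto simp: eig_def on_fam_def cinner_minus_left cinner_minus_right)
  show "on_fam {..<n} e" using assms(1) by (simp add: eig_def)
  have "l i *\<^sub>R rk (e i) (e i) = \<bar>l i\<bar> *\<^sub>R rk (?u i) (e i)" for i
    by (rule cop_eqI) (simp add: scaleC_minus_right)
  then show "X = (\<Sum>i<n. \<bar>l i\<bar> *\<^sub>R rk (?u i) (e i))" using assms(1) by (simp add: eig_def)
qed (use assms in auto)

text \<open>The vectors \<open>e i\<close> need not span the space; on their complement the operator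
  is 0, so the function contributes \<open>\<phi> 0\<close> there. Splitting this scalar off leaves
  a finite-rank part.\<close>

definition fcal :: "nat \<Rightarrow> (nat \<Rightarrow> 'a::complex_hilbert_space) \<Rightarrow> (nat \<Rightarrow> real) \<Rightarrow> (real \<Rightarrow> complex) \<Rightarrow> 'a cop"
  where "fcal n e l \<phi> = cs (\<phi> 0) + dg n e (\<lambda>i. \<phi> (l i) - \<phi> 0)"

lemma dg_add: "dg n e c + dg n e d = dg n e (\<lambda>i. c i + d i)"
  by (simp add: dg_eq cs_simps distrib_right sum.distrib)

lemma cs_mult_dg: "cs z * dg n e d = dg n e (\<lambda>i. z * d i)"
  by (simp add: dg_eq sum_distrib_left cs_simps mult.assoc)

lemma fcal_add: "fcal n e l \<phi> + fcal n e l \<psi> = fcal n e l (\<lambda>x. \<phi> x + \<psi> x)"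
proof -
  have "fcal n e l \<phi> + fcal n e l \<psi> = cs (\<phi> 0 + \<psi> 0) + (dg n e (\<lambda>i. \<phi> (l i) - \<phi> 0) + dg n e (\<lambda>i. \<psi> (l i) - \<psi> 0))"
    by (simp add: fcal_def cs_simps)
  then show ?thesis unfolding dg_add by (simp add: fcal_def algebra_simps)
qed

lemma fcal_cs: "fcal n e l (\<lambda>_. c) = cs c"
  by (simp add: fcal_def dg_eq cs_simps)

lemma fcal_mult:
  assumes "on_fam {..<n} e"
  shows "fcal n e l \<phi> * fcal n e l \<psi> = fcal n e l (\<lambda>x. \<phi> x * \<psi> x)"
proof -
  let ?a = "\<lambda>i. \<phi> (l i) - \<phi> 0" and ?b = "\<lambda>i. \<psi> (l i) - \<psi> 0"
  have "fcal n e l \<phi> * fcal n e l \<psi> = cs (\<phi> 0 * \<psi> 0) + (cs (\<phi> 0) * dg n e ?b + cs (\<psi> 0) * dg n e ?a + dg n e ?a * dg n e ?b)"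
    unfolding fcal_def distrib_left distrib_right cs_commute[of "\<psi> 0" "dg n e ?a"] by (simp add: cs_simps)
  also have "... = cs (\<phi> 0 * \<psi> 0) + dg n e (\<lambda>i. \<phi> 0 * ?b i + \<psi> 0 * ?a i + ?a i * ?b i)"
    unfolding cs_mult_dg dg_mult_dg[OF assms] dg_add ..
  also have "(\<lambda>i. \<phi> 0 * ?b i + \<psi> 0 * ?a i + ?a i * ?b i) = (\<lambda>i. \<phi> (l i) * \<psi> (l i) - \<phi> 0 * \<psi> 0)"
    by (simp add: algebra_simps)
  finally show ?thesis by (simp add: fcal_def)
qed

lemma fcal_id: "eig n e l X \<Longrightarrow> fcal n e l (\<lambda>x. of_real x) = X"
  by (simp add: fcal_def eig_def dg_eq cs_simps)

lemma fcal_power: "eig n e l X \<Longrightarrow> fcal n e l (\<lambda>x. of_real x ^ k) = X ^ k"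
proof (induction k)
  case (Suc k)
  then have "fcal n e l (\<lambda>x. of_real x * of_real x ^ k) = X * X ^ k"
    by (subst fcal_mult[symmetric]) (auto simp: eig_def fcal_id)
  then show ?case by simp
qed (simp add: fcal_cs cs_simps)

lemma fcal_cmult: "fcal n e l (\<lambda>x. c * \<phi> x) = cs c * fcal n e l \<phi>"
  unfolding fcal_def distrib_left cs_mult_dg by (simp add: cs_simps algebra_simps)

lemma fcal_sum: "fcal n e l (\<lambda>x. \<Sum>i\<in>I. f i x) = (\<Sum>i\<in>I. fcal n e l (f i))"
  by (induction I rule: infinite_finite_induct) (simp_all add: fcal_add[symmetric] fcal_cs cs_simps)

lemma tr_fcal:
  assumes "on_fam {..<n} e" "\<phi> 0 = 0"
  shows "fr (fcal n e l \<phi>)" "tr (fcal n e l \<phi>) = (\<Sum>i<n. \<phi> (l i))"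
proof -
  have f: "fcal n e l \<phi> = dg n e (\<lambda>i. \<phi> (l i))" using assms(2) by (simp add: fcal_def cs_simps)
  show "fr (fcal n e l \<phi>)" by (simp add: f)
  have "cinner (e i) (e i) = 1" if "i < n" for i using assms(1) that by (simp add: on_fam_def)
  then show "tr (fcal n e l \<phi>) = (\<Sum>i<n. \<phi> (l i))"
    unfolding f dg_eq by (subst tr_sum) (auto simp: tr_cs fr_mult_left)
qed

section \<open>Resolvents on the imaginary axis and their differences\<close>

definition rsv :: "real \<Rightarrow> 'a::complex_hilbert_space cop \<Rightarrow> 'a cop"
  where "rsv t X = (SOME R. (X - cs (\<i> * of_real t)) * R = 1 \<and> R * (X - cs (\<i> * of_real t)) = 1)"

text \<open>A two-sided inverse is unique, so \<open>rsv\<close> does not depend on an eigenbasis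
  and yet equals the functional calculus in each of them.\<close>

lemma rsv_eq_fcal:
  assumes "eig n e l X" "t \<noteq> 0"
  shows "rsv t X = fcal n e l (\<lambda>x. 1 / (of_real x - \<i> * of_real t))"
    "(X - cs (\<i> * of_real t)) * rsv t X = 1" "rsv t X * (X - cs (\<i> * of_real t)) = 1"
proof -
  let ?Y = "X - cs (\<i> * of_real t)"
  let ?R = "fcal n e l (\<lambda>x. 1 / (of_real x - \<i> * of_real t))"
  have on: "on_fam {..<n} e" using assms(1) by (simp add: eig_def)
  have nz: "complex_of_real x - \<i> * of_real t \<noteq> 0" for x using assms(2) by (simp add: complex_eq_iff)
  have L: "?Y = fcal n e l (\<lambda>x. of_real x - \<i> * of_real t)"
    using fcal_add[of n e l "\<lambda>x. of_real x" "\<lambda>_. - (\<i> * of_real t)"] fcal_id[OF assms(1)]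
    by (simp add: fcal_cs cs_simps)
  have R: "?Y * ?R = 1" "?R * ?Y = 1"
    unfolding L fcal_mult[OF on] using nz by (simp_all add: fcal_cs cs_simps)
  then have S: "?Y * rsv t X = 1 \<and> rsv t X * ?Y = 1"
    unfolding rsv_def by (rule_tac someI[where x = ?R]) simp
  then show "?Y * rsv t X = 1" "rsv t X * ?Y = 1" by auto
  have "rsv t X = ?R * (?Y * rsv t X)" by (simp add: mult.assoc[symmetric] R)
  then show "rsv t X = ?R" using S by simp
qed

lemma rsv_inverse:
  assumes "sa X" "t \<noteq> 0"
  shows "(X - cs (\<i> * of_real t)) * rsv t X = 1" "rsv t X * (X - cs (\<i> * of_real t)) = 1"
  using eig_exists'[OF assms(1)] rsv_eq_fcal(2,3)[OF _ assms(2)] by blast+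

lemma rsv_diff:
  assumes "sa X" "sa Y" "t \<noteq> 0"
  shows "rsv t Y - rsv t X = rsv t X * (X - Y) * rsv t Y"
proof -
  have "rsv t X * (X - Y) * rsv t Y
      = (rsv t X * (X - cs (\<i> * of_real t))) * rsv t Y - rsv t X * ((Y - cs (\<i> * of_real t)) * rsv t Y)"
    by (simp add: algebra_simps)
  then show ?thesis using rsv_inverse[OF assms(1,3)] rsv_inverse[OF assms(2,3)] by simp
qed

text \<open>For self-adjoint X the cross terms cancel: |(X - \<i> t) x|^2 = |X x|^2 + t^2
  |x|^2.\<close>

lemma norm_rsv_le:
  assumes X: "sa X" and t: "t \<noteq> 0"
  shows "norm (rsv t X) \<le> 1 / \<bar>t\<bar>"
proof (rule norm_copI)
  fix y
  define x where "x = ap (rsv t X) y"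
  have y: "y = ap X x - scaleC (\<i> * of_real t) x"
    using arg_cong[OF rsv_inverse(1)[OF X t], of "\<lambda>Y. ap Y y"] by (simp add: x_def)
  have im: "Im (cinner (ap X x) x) = 0"
  proof -
    have "cinner (ap X x) x = cnj (cinner (ap X x) x)"
      using cinner_adj[of X x x] X cinner_commute[of x "ap X x"] by (simp add: sa_def)
    then show ?thesis by (metis Reals_cnj_iff complex_is_Real_iff)
  qed
  have "(norm y)\<^sup>2 = Re (cinner y y)" by (simp add: cinner_self)
  also have "cinner y y = cinner (ap X x) (ap X x) - cnj (\<i> * of_real t) * cinner (ap X x) x
      - (\<i> * of_real t) * (cinner x (ap X x) - cnj (\<i> * of_real t) * cinner x x)"
    unfolding y by (simp only: cinner_diff_left cinner_diff_right cinner_scaleC_left cinner_scaleC_right) (simp add: algebra_simps)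
  also have "cinner x (ap X x) = cinner (ap X x) x" using cinner_adj[of X x x] X by (simp add: sa_def)
  finally have "(norm y)\<^sup>2 = (norm (ap X x))\<^sup>2 + t\<^sup>2 * (norm x)\<^sup>2"
    using im by (simp add: cinner_self power2_eq_square)
  then have "(\<bar>t\<bar> * norm x)\<^sup>2 \<le> (norm y)\<^sup>2" by (simp add: power_mult_distrib)
  then have "\<bar>t\<bar> * norm x \<le> norm y" by (rule power2_le_imp_le) simp
  then show "norm (ap (rsv t X) y) \<le> 1 / \<bar>t\<bar> * norm y" using t by (simp add: x_def field_simps)
qed simp

text \<open>The divided differences of the resolvent along a line are products of resolvents.\<close>

fun rprod :: "real \<Rightarrow> 'a::complex_hilbert_space cop \<Rightarrow> nat \<Rightarrow> 'a cop \<Rightarrow> 'a cop"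
  where "rprod t V 0 X = rsv t X"
  | "rprod t V (Suc k) X = rsv t X * V * rprod t V k (X + V)"

text \<open>Both terms of the product rule for \<open>rprod\<close> give the same product of
  resolvents, so their integer weights add up and accumulate to the factorial.\<close>

lemma difn_rsv:
  assumes V: "sa V" and t: "t \<noteq> 0" and X: "sa X"
  shows "difn k V (rsv t) X = ((-1) ^ k * fact k) *\<^sub>R rprod t V k X"
proof -
  have step: "rprod t V k (X + V) - rprod t V k X = (- real (Suc k)) *\<^sub>R rprod t V (Suc k) X" if "sa X" for k X
    using that
  proof (induction k arbitrary: X)
    case 0
    show ?case using rsv_diff[OF 0 sa_add[OF 0 V] t] by simp
  next
    case (Suc k)
    define R0 R1 P2 P1 where "R0 = rsv t X" and "R1 = rsv t (X + V)" and "P2 = rprod t V k (X + V + V)" and "P1 = rprod t V k (X + V)"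
    have R: "R1 - R0 = - (R0 * V * R1)" using rsv_diff[OF Suc.prems sa_add[OF Suc.prems V] t] by (simp add: R0_def R1_def)
    have P: "P2 - P1 = (- real (Suc k)) *\<^sub>R (R1 * V * P2)"
      using Suc.IH[OF sa_add[OF Suc.prems V]] by (simp add: P2_def P1_def R1_def)
    have "rprod t V (Suc k) (X + V) - rprod t V (Suc k) X = (R1 - R0) * V * P2 + R0 * V * (P2 - P1)"
      by (simp add: R0_def R1_def P1_def P2_def algebra_simps)
    also have "... = (- real (Suc (Suc k))) *\<^sub>R (R0 * V * (R1 * V * P2))"
      unfolding R P by (simp add: scaleR_2 algebra_simps)
    finally show ?case by (simp add: R0_def R1_def P2_def)
  qed
  show ?thesis
    using X
  proof (induction k arbitrary: X)
    case (Suc k)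
    show ?case
      unfolding difn_Suc Suc.IH[OF Suc.prems] Suc.IH[OF sa_add[OF Suc.prems V]] scaleR_diff_right[symmetric] step[OF Suc.prems]
      by (simp add: algebra_simps)
  qed simp
qed

lemma fr_rprod: "fr V \<Longrightarrow> k \<ge> 1 \<Longrightarrow> fr (rprod t V k X)"
  by (cases k) auto

lemma fr_difn_rsv:
  assumes "sa V" "t \<noteq> 0" "sa X" "k \<ge> 1"
  shows "fr (difn k V (rsv t) X)"
  unfolding difn_rsv[OF assms(1-3)] using assms by (intro fr_scaleR fr_rprod) (auto simp: sa_def)

lemma sn_rprod_le:
  assumes V: "sa V" and t: "t \<noteq> 0" and X: "sa X" and k: "1 \<le> k" "k \<le> M"
  shows "sn (real M / real k) (rprod t V k X) \<le> (1 / \<bar>t\<bar>) ^ Suc k * sn (real M) V ^ k"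
  using X k
proof (induction k arbitrary: X)
  case (Suc k)
  have frV: "fr V" using V by (simp add: sa_def)
  have M: "real M \<ge> 1" using Suc.prems by simp
  have R: "norm (rsv t Y) \<le> 1 / \<bar>t\<bar>" if "sa Y" for Y using norm_rsv_le[OF that t] .
  have RV: "sn (real M) (rsv t X * V) \<le> 1 / \<bar>t\<bar> * sn (real M) V"
    using sn_ideal_left[OF frV M, of "rsv t X"] mult_right_mono[OF R[OF Suc.prems(1)], of "sn (real M) V"] by simp
  show ?case
  proof (cases "k = 0")
    case True
    have "sn (real M) (rsv t X * V * rsv t (X + V)) \<le> norm (rsv t (X + V)) * sn (real M) (rsv t X * V)"
      by (rule sn_ideal_right) (use frV M in auto)
    also have "... \<le> 1 / \<bar>t\<bar> * (1 / \<bar>t\<bar> * sn (real M) V)"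
      by (intro mult_mono R RV sa_add Suc.prems(1) V) auto
    finally show ?thesis by (simp add: True power2_eq_square)
  next
    case False
    then have k: "1 \<le> k" "k \<le> M" using Suc.prems by auto
    have "sn (real M / real (Suc k)) (rsv t X * V * rprod t V k (X + V))
        \<le> sn (real M) (rsv t X * V) * sn (real M / real k) (rprod t V k (X + V))"
    proof (rule sn_mult)
      show "1 / real M + 1 / (real M / real k) = 1 / (real M / real (Suc k))" by (simp add: add_divide_distrib)
      have "real (Suc k) \<le> real M" using Suc.prems(3) by (simp only: of_nat_le_iff)
      then show "1 \<le> real M / real (Suc k)" by (simp add: le_divide_eq)
    qed (use frV M k in \<open>auto intro: fr_rprod\<close>)
    also have "... \<le> (1 / \<bar>t\<bar> * sn (real M) V) * ((1 / \<bar>t\<bar>) ^ Suc k * sn (real M) V ^ k)"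
      by (intro mult_mono RV Suc.IH sa_add Suc.prems(1) V k) auto
    finally show ?thesis by (simp add: mult_ac)
  qed
qed simp

lemma tr_difn_rsv_le:
  assumes V: "sa V" and t: "t \<noteq> 0" and X: "sa X" and M: "1 \<le> M"
  shows "cmod (tr (difn M V (rsv t) X)) \<le> fact M * (1 / \<bar>t\<bar>) ^ Suc M * spw (real M) V"
proof -
  have frV: "fr V" using V by (simp add: sa_def)
  have "cmod (tr (difn M V (rsv t) X)) = fact M * cmod (tr (rprod t V M X))"
    unfolding difn_rsv[OF V t X] using fr_rprod[OF frV M] by (simp add: tr_scaleR norm_mult norm_power)
  also have "cmod (tr (rprod t V M X)) \<le> sn (real M / real M) (rprod t V M X)"
    using trace_le_sn1[OF fr_rprod[OF frV M]] M by simp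
  also have "... \<le> (1 / \<bar>t\<bar>) ^ Suc M * sn (real M) V ^ M" by (rule sn_rprod_le[OF V t X M order_refl])
  also have "sn (real M) V ^ M = spw (real M) V" using spw_eq_power[OF M, of V] by simp
  finally show ?thesis by (simp add: mult.assoc)
qed

text \<open>The difference of the resolvents has rank at most \<open>card J\<close> and norm at most \<open>2 / |t|\<close>.\<close>

lemma tr_rsv_rank:
  assumes X: "sa X" and Y: "sa Y" and t: "t \<noteq> 0" and J: "finite J" and XY: "X - Y = (\<Sum>j\<in>J. c j *\<^sub>R rk (f j) (f j))"
  shows "cmod (tr (rsv t Y - rsv t X)) \<le> 2 * real (card J) / \<bar>t\<bar>"
proof -
  define D where "D = rsv t Y - rsv t X"
  have D: "D = rsv t X * (X - Y) * rsv t Y" unfolding D_def by (rule rsv_diff[OF X Y t])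
  obtain B where B: "onset B" "finite B" "card B \<le> card ((\<lambda>j. ap (rsv t X) (f j)) ` J)"
    "\<And>w. w \<in> (\<lambda>j. ap (rsv t X) (f j)) ` J \<Longrightarrow> ap (proj B) w = w"
    by (rule gram_schmidt[of "(\<lambda>j. ap (rsv t X) (f j)) ` J"]) (use J in auto)
  have cB: "card B \<le> card J" using B(3) card_image_le[OF J] order_trans by blast
  have PD: "proj B * D = D"
  proof (rule cop_eqI)
    fix x
    have "ap D x = (\<Sum>j\<in>J. c j *\<^sub>R scaleC (cinner (ap (rsv t Y) x) (f j)) (ap (rsv t X) (f j)))"
      unfolding D XY by (simp add: blinfun.scaleR_right)
    then show "ap (proj B * D) x = ap D x" using B(4) by (simp add: blinfun.scaleR_right)
  qed
  have "cmod (tr (proj B * D)) \<le> real (card B) * norm D" using rank_bd_proj[OF B(1,2)] unfolding rank_bd_def by blast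
  also have "... \<le> real (card J) * (1 / \<bar>t\<bar> + 1 / \<bar>t\<bar>)"
  proof (intro mult_mono)
    show "norm D \<le> 1 / \<bar>t\<bar> + 1 / \<bar>t\<bar>"
      unfolding D_def by (rule norm_triangle_le_diff) (intro add_mono norm_rsv_le X Y t)
  qed (use cB in auto)
  finally show ?thesis unfolding PD by (simp add: D_def mult.commute)
qed

text \<open>Base points and increments may both differ, as long as they do so within the span of the
  same \<open>rk (f j) (f j)\<close>; this closes the induction, which costs a factor 2 per
  order.\<close>

lemma tr_difn_rsv_rank:
  assumes V: "sa V" and W: "sa W" and t: "t \<noteq> 0" and J: "finite J" and VW: "V - W = (\<Sum>j\<in>J. d j *\<^sub>R rk (f j) (f j))"
    and X: "sa X" and Y: "sa Y" and XY: "X - Y = (\<Sum>j\<in>J. c j *\<^sub>R rk (f j) (f j))"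
  shows "fr (difn k V (rsv t) X - difn k W (rsv t) Y) \<and>
    cmod (tr (difn k V (rsv t) X - difn k W (rsv t) Y)) \<le> 2 ^ k * (2 * real (card J) / \<bar>t\<bar>)"
  using X Y XY
proof (induction k arbitrary: X Y c)
  case 0
  have "fr (Y - X)" using 0 by (auto simp: sa_def)
  then have "fr (rsv t Y * (Y - X) * rsv t X)" by (intro fr_mult_right fr_mult_left)
  then have "fr (rsv t X - rsv t Y)" using rsv_diff[OF 0(2,1) t] by simp
  moreover have "cmod (tr (rsv t X - rsv t Y)) \<le> 2 * real (card J) / \<bar>t\<bar>"
    by (rule tr_rsv_rank[OF 0(2,1) t J, of "\<lambda>j. - c j" f]) (use 0(3) in \<open>simp add: sum_negf algebra_simps\<close>)
  ultimately show ?case by simp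
next
  case (Suc k)
  define A where "A = difn k V (rsv t) (X + V) - difn k W (rsv t) (Y + W)"
  define B where "B = difn k V (rsv t) X - difn k W (rsv t) Y"
  have "(X + V) - (Y + W) = (X - Y) + (V - W)" by simp
  also have "... = (\<Sum>j\<in>J. (c j + d j) *\<^sub>R rk (f j) (f j))" by (simp add: Suc.prems VW sum.distrib scaleR_add_left)
  finally have e: "(X + V) - (Y + W) = (\<Sum>j\<in>J. (c j + d j) *\<^sub>R rk (f j) (f j))" .
  have A: "fr A" "cmod (tr A) \<le> 2 ^ k * (2 * real (card J) / \<bar>t\<bar>)"
    unfolding A_def using Suc.IH[OF sa_add[OF Suc.prems(1) V] sa_add[OF Suc.prems(2) W] e] by auto
  have B: "fr B" "cmod (tr B) \<le> 2 ^ k * (2 * real (card J) / \<bar>t\<bar>)"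
    unfolding B_def using Suc.IH[OF Suc.prems] by auto
  have AB: "difn (Suc k) V (rsv t) X - difn (Suc k) W (rsv t) Y = A - B"
    unfolding difn_Suc A_def B_def by simp
  have "cmod (tr (A - B)) \<le> cmod (tr A) + cmod (tr B)"
    using A(1) B(1) by (simp add: tr_diff norm_triangle_ineq4)
  then show ?case unfolding AB using A B by (auto simp: fr_diff)
qed

text \<open>The bound is a sum over single eigenvalues of \<open>V\<close>, so that t can be
  integrated out for each of them. The exponent \<open>M\<close> is affordable in the second case
  because \<open>W\<close> keeps only eigenvalues of modulus at most |t|.\<close>

lemma tr_difn_rsv_split:
  assumes V: "eig n f \<kappa> V" "sa V" and t: "t \<noteq> 0" and X: "sa X" and M: "1 \<le> M"
  shows "cmod (tr (difn M V (rsv t) X)) \<le>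
    (\<Sum>j<n. if \<bar>\<kappa> j\<bar> > \<bar>t\<bar> then 2 ^ Suc M / \<bar>t\<bar> else fact M * \<bar>\<kappa> j\<bar> ^ M / \<bar>t\<bar> ^ Suc M)"
proof -
  define J where "J = {j. j < n \<and> \<bar>\<kappa> j\<bar> > \<bar>t\<bar>}"
  define W where "W = (\<Sum>j<n. (if \<bar>\<kappa> j\<bar> > \<bar>t\<bar> then 0 else \<kappa> j) *\<^sub>R rk (f j) (f j))"
  have on: "on_fam {..<n} f" and Ve: "V = (\<Sum>j<n. \<kappa> j *\<^sub>R rk (f j) (f j))" using V(1) by (auto simp: eig_def)
  have saW: "sa W" unfolding W_def sa_def by (auto simp: adj_sum adj_simps intro!: fr_sum fr_scaleR)
  have eW: "eig n f (\<lambda>j. if \<bar>\<kappa> j\<bar> > \<bar>t\<bar> then 0 else \<kappa> j) W" using on by (simp add: eig_def W_def)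
  have "V - W = (\<Sum>j<n. (if \<bar>\<kappa> j\<bar> > \<bar>t\<bar> then \<kappa> j else 0) *\<^sub>R rk (f j) (f j))"
    unfolding Ve W_def sum_subtractf[symmetric] by (intro sum.cong refl) auto
  also have "... = (\<Sum>j\<in>J. \<kappa> j *\<^sub>R rk (f j) (f j))"
    unfolding J_def by (rule sum.mono_neutral_cong_right) auto
  finally have VW: "V - W = (\<Sum>j\<in>J. \<kappa> j *\<^sub>R rk (f j) (f j))" .
  have finJ: "finite J" by (simp add: J_def)
  have 1: "fr (difn M V (rsv t) X - difn M W (rsv t) X)"
    "cmod (tr (difn M V (rsv t) X - difn M W (rsv t) X)) \<le> 2 ^ M * (2 * real (card J) / \<bar>t\<bar>)"
    using tr_difn_rsv_rank[OF V(2) saW t finJ VW X X, of "\<lambda>_. 0"] by auto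
  have "tr (difn M V (rsv t) X) = tr (difn M V (rsv t) X - difn M W (rsv t) X) + tr (difn M W (rsv t) X)"
    using tr_add[OF 1(1) fr_difn_rsv[OF saW t X M]] by simp
  then have "cmod (tr (difn M V (rsv t) X)) \<le> 2 ^ M * (2 * real (card J) / \<bar>t\<bar>) + fact M * (1 / \<bar>t\<bar>) ^ Suc M * spw (real M) W"
    using norm_triangle_mono[OF 1(2) tr_difn_rsv_le[OF saW t X M]] by simp
  also have "2 ^ M * (2 * real (card J) / \<bar>t\<bar>) = (\<Sum>j\<in>J. 2 ^ Suc M / \<bar>t\<bar>)" by simp
  also have "... = (\<Sum>j<n. if \<bar>\<kappa> j\<bar> > \<bar>t\<bar> then 2 ^ Suc M / \<bar>t\<bar> else 0)"
    unfolding J_def by (rule sum.mono_neutral_cong_left) auto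
  also have "spw (real M) W = (\<Sum>j<n. if \<bar>\<kappa> j\<bar> > \<bar>t\<bar> then 0 else \<bar>\<kappa> j\<bar> ^ M)"
    unfolding eig_spw[OF eW, of "real M", simplified of_nat_0_less_iff, OF less_le_trans[OF zero_less_one M]]
    by (intro sum.cong refl) (use M in \<open>auto simp: powr_realpow'\<close>)
  also have "fact M * (1 / \<bar>t\<bar>) ^ Suc M * ... = (\<Sum>j<n. if \<bar>\<kappa> j\<bar> > \<bar>t\<bar> then 0 else fact M * \<bar>\<kappa> j\<bar> ^ M / \<bar>t\<bar> ^ Suc M)"
    unfolding sum_distrib_left by (intro sum.cong refl) (simp add: power_one_over field_simps)
  finally show ?thesis
    unfolding sum.distrib[symmetric] by (rule order_trans) (auto intro!: sum_mono)
qed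

subsection \<open>The integral representation of the power function\<close>

text \<open>This is 1 / cosh (\<gamma> v): a majorant with exponential decay on both sides and an
  elementary primitive.\<close>

definition sch :: "real \<Rightarrow> real \<Rightarrow> real"
  where "sch \<gamma> v = 2 / (exp (\<gamma> * v) + exp (- (\<gamma> * v)))"

lemma sch_integral:
  assumes g: "\<gamma> > 0" and ab: "a \<le> b"
  shows "(\<lambda>u. sch \<gamma> (u - c)) integrable_on {a..b}" "integral {a..b} (\<lambda>u. sch \<gamma> (u - c)) \<le> pi / \<gamma>"
proof -
  let ?s = "\<lambda>u. sch \<gamma> (u - c)"
  let ?G = "\<lambda>u. 2 / \<gamma> * arctan (exp (\<gamma> * (u - c)))"
  have "(?s has_integral (?G b - ?G a)) {a..b}"
  proof (rule fundamental_theorem_of_calculus[OF ab])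
    fix x
    define y where "y = exp (\<gamma> * (x - c))"
    have y: "y > 0" "exp (- (\<gamma> * (x - c))) = 1 / y" by (simp_all add: y_def exp_minus inverse_eq_divide)
    have "(?G has_real_derivative (2 / \<gamma> * (inverse (1 + y\<^sup>2) * (y * \<gamma>)))) (at x within {a..b})"
      unfolding y_def by (auto intro!: derivative_eq_intros)
    moreover have "2 / \<gamma> * (inverse (1 + y\<^sup>2) * (y * \<gamma>)) = sch \<gamma> (x - c)"
    proof -
      have "1 + y\<^sup>2 \<noteq> 0" by (smt (verit) zero_le_power2)
      then show ?thesis
        unfolding sch_def y(2) y_def[symmetric] using y(1) g by (simp add: field_simps power2_eq_square)
    qed
    ultimately show "(?G has_vector_derivative sch \<gamma> (x - c)) (at x within {a..b})"
      by (simp add: has_real_derivative_iff_has_vector_derivative)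
  qed
  then have 1: "?s integrable_on {a..b}" "integral {a..b} ?s = ?G b - ?G a"
    by (auto simp: has_integral_iff)
  show "?s integrable_on {a..b}" by (rule 1)
  have "?G b \<le> 2 / \<gamma> * (pi / 2)" using g arctan_ubound by (intro mult_left_mono less_imp_le) auto
  moreover have "?G a \<ge> 0" using g by (simp add: zero_le_arctan_iff)
  ultimately show "integral {a..b} ?s \<le> pi / \<gamma>" using 1(2) by simp
qed

text \<open>The density t^\<alpha> / (1 + t^2) with respect to dt / t, in the variable v = ln t;
  integrable for 0 < \<alpha> < 2, which is where the condition 2 k < p < 2 k + 2 comes
  from.\<close>

definition ker :: "real \<Rightarrow> real \<Rightarrow> real"
  where "ker \<alpha> v = exp (\<alpha> * v) / (1 + exp (2 * v))"

lemma ker_pos: "0 < ker \<alpha> v"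
  by (simp add: ker_def add_pos_pos)

lemma ker_integrable: "ker \<alpha> integrable_on {a..b}"
proof -
  have "1 + exp (2 * v) \<noteq> (0::real)" for v by (smt (verit) exp_gt_zero)
  then show ?thesis unfolding ker_def by (intro integrable_continuous_real continuous_intros) auto
qed

lemma ker_le_sch:
  assumes "0 < \<alpha>" "\<alpha> < 2"
  shows "ker \<alpha> v \<le> sch (min \<alpha> (2 - \<alpha>)) v"
proof -
  define g where "g = min \<alpha> (2 - \<alpha>)"
  define d where "d = exp (- (\<alpha> * v)) + exp ((2 - \<alpha>) * v)"
  have "ker \<alpha> v = 1 / d"
  proof -
    have "exp (\<alpha> * v) * d = 1 + exp (2 * v)"
      unfolding d_def distrib_left exp_add[symmetric] by (simp add: algebra_simps)
    moreover have "d > 0" by (simp add: d_def add_pos_pos)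
    ultimately show ?thesis unfolding ker_def by (metis (no_types, lifting) exp_not_eq_zero mult.right_neutral mult_divide_mult_cancel_left)
  qed
  moreover have "exp (g * v) + exp (- (g * v)) \<le> 2 * d"
  proof (cases "v \<ge> 0")
    case True
    have 1: "exp (g * v) \<le> exp ((2 - \<alpha>) * v)" using True by (simp add: g_def mult_right_mono)
    have 2: "exp (- (g * v)) \<le> exp ((2 - \<alpha>) * v)"
      using True assms by (simp add: g_def) (smt (verit) mult_nonneg_nonneg)
    show ?thesis by (rule order_trans[OF add_mono[OF 1 2]]) (simp add: d_def)
  next
    case False
    have 1: "exp (- (g * v)) \<le> exp (- (\<alpha> * v))" using False by (simp add: g_def mult_right_mono_neg)
    have 2: "exp (g * v) \<le> exp (- (\<alpha> * v))"
      using False assms by (simp add: g_def) (smt (verit) mult_nonneg_nonpos)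
    show ?thesis by (rule order_trans[OF add_mono[OF 2 1]]) (simp add: d_def)
  qed
  moreover have "d > 0" "exp (g * v) + exp (- (g * v)) > 0" by (simp_all add: d_def add_pos_pos)
  ultimately show ?thesis
    unfolding sch_def g_def[symmetric] using divide_left_mono[of "exp (g * v) + exp (- (g * v))" "2 * d" 2] by simp
qed

text \<open>The window is translated because an eigenvalue x enters the integral only through the
  shift ln |x|, which the limit does not see. Positivity of \<open>L\<close> permits dividing by it
  in \<open>difn_spw_le\<close>.\<close>

lemma ker_limit:
  assumes "0 < \<alpha>" "\<alpha> < 2"
  obtains L where "L > 0" "\<And>c. ((\<lambda>a. integral {-a - c..a - c} (ker \<alpha>)) \<longlongrightarrow> L) at_top"
proof -
  define I where "I = (\<lambda>a. integral {-a..a} (ker \<alpha>))"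
  define g where "g = min \<alpha> (2 - \<alpha>)"
  have g: "g > 0" using assms by (simp add: g_def)
  have nn: "0 \<le> ker \<alpha> v" for v using ker_pos less_imp_le by blast
  have mono: "I a \<le> I b" if "a \<le> b" for a b
    unfolding I_def by (rule integral_subset_le) (use that nn ker_integrable in auto)
  have bd: "I a \<le> pi / g" for a
  proof (cases "0 \<le> a")
    case True
    have "I a \<le> integral {-a..a} (\<lambda>u. sch g (u - 0))"
      unfolding I_def g_def using True assms ker_le_sch[OF assms]
      by (intro integral_le ker_integrable sch_integral(1)) auto
    also have "... \<le> pi / g" using sch_integral(2)[OF g, of "-a" a 0] True by simp
    finally show ?thesis .
  qed (use g in \<open>simp add: I_def\<close>)
  define L where "L = (SUP a. I a)"
  have bdd: "bdd_above (range I)" using bd by (auto intro!: bdd_aboveI[where M = "pi / g"])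
  have IL: "(I \<longlongrightarrow> L) at_top"
  proof (rule increasing_tendsto)
    show "\<forall>\<^sub>F n in at_top. I n \<le> L" unfolding L_def using bdd by (intro always_eventually allI cSUP_upper) auto
    fix x assume "x < L"
    then obtain a where "x < I a" unfolding L_def using less_cSUP_iff[OF _ bdd] by auto
    then show "\<forall>\<^sub>F n in at_top. x < I n"
      unfolding eventually_at_top_linorder using mono by (meson less_le_trans)
  qed
  have "L > 0"
  proof -
    have "0 < integral {-1..1} (ker \<alpha>)"
    proof -
      have c: "continuous_on {-1..1} (ker \<alpha>)"
      proof -
        have "1 + exp (2 * v) \<noteq> (0::real)" for v by (smt (verit) exp_gt_zero)
        then show ?thesis unfolding ker_def by (intro continuous_intros) auto
      qed
      have "integral {-1..1} (ker \<alpha>) \<noteq> 0"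
        using integral_eq_0_iff[OF c _ nn] ker_pos[of \<alpha> 0] by (auto dest!: bspec[where x = 0])
      then show ?thesis using integral_nonneg[OF ker_integrable[of \<alpha> "-1" 1]] nn by fastforce
    qed
    then show ?thesis
      unfolding L_def using cSUP_upper[OF _ bdd, of 1] by (simp add: I_def)
  qed
  moreover have "((\<lambda>a. integral {-a - c..a - c} (ker \<alpha>)) \<longlongrightarrow> L) at_top" for c
  proof (rule tendsto_sandwich)
    show "\<forall>\<^sub>F a in at_top. I (a + - \<bar>c\<bar>) \<le> integral {-a - c..a - c} (ker \<alpha>)"
      unfolding I_def by (intro always_eventually allI integral_subset_le) (use nn ker_integrable in auto)
    show "\<forall>\<^sub>F a in at_top. integral {-a - c..a - c} (ker \<alpha>) \<le> I (a + \<bar>c\<bar>)"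
      unfolding I_def by (intro always_eventually allI integral_subset_le) (use nn ker_integrable in auto)
    have sh: "((\<lambda>a. I (a + d)) \<longlongrightarrow> L) at_top" for d
      proof (rule filterlim_compose[OF IL])
      show "filterlim (\<lambda>a. a + d) at_top at_top"
        unfolding filterlim_at_top
      proof
        fix Z show "\<forall>\<^sub>F x in at_top. Z \<le> x + d" using eventually_ge_at_top[of "Z - d"] by (rule eventually_mono) simp
      qed
    qed
    show "((\<lambda>a. I (a + - \<bar>c\<bar>)) \<longlongrightarrow> L) at_top" "((\<lambda>a. I (a + \<bar>c\<bar>)) \<longlongrightarrow> L) at_top" by (rule sh)+
  qed
  ultimately show thesis using that by blast
qed

text \<open>Scaling t by |x| extracts |x|^p and translates the window by ln |x|. At x = 0 both sides
  vanish, whatever value ln 0 has.\<close>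

lemma power_integral:
  assumes p: "2 * real k < p" "p < 2 * real k + 2"
  shows "((\<lambda>u. exp ((p - 2 * real k) * u) * (x ^ (2 * k + 2) / (x\<^sup>2 + (exp u)\<^sup>2))) has_integral
    (\<bar>x\<bar> powr p * integral {-a - ln \<bar>x\<bar>..a - ln \<bar>x\<bar>} (ker (p - 2 * real k)))) {-a..a}"
proof (cases "x = 0")
  case False
  define \<alpha> c where "\<alpha> = p - 2 * real k" and "c = ln \<bar>x\<bar>"
  have x: "\<bar>x\<bar> = exp c" using False by (simp add: c_def)
  have x2: "x\<^sup>2 = exp (2 * c)" using x by (metis exp_double power2_abs)
  have "x ^ (2 * k + 2) = (x\<^sup>2) ^ (k + 1)" unfolding power_mult[symmetric] by simp
  also have "... = exp (real (k + 1) * (2 * c))" unfolding x2 by (rule exp_of_nat_mult[symmetric])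
  finally have xk: "x ^ (2 * k + 2) = exp (real (k + 1) * (2 * c))" .
  have xp: "\<bar>x\<bar> powr p = exp (p * c)" unfolding x by (simp add: powr_def)
  have "(ker \<alpha> has_integral integral {-a - c..a - c} (ker \<alpha>)) {-a - c..a - c}"
    using ker_integrable integrable_integral by blast
  then have "((\<lambda>u. ker \<alpha> (u - c)) has_integral integral {-a - c..a - c} (ker \<alpha>)) {-a..a}"
    using has_integral_affinity'[of "ker \<alpha>" _ "-a - c" "a - c" 1 "-c"] by simp
  then have "((\<lambda>u. \<bar>x\<bar> powr p * ker \<alpha> (u - c)) has_integral \<bar>x\<bar> powr p * integral {-a - c..a - c} (ker \<alpha>)) {-a..a}"
    by (rule has_integral_mult_right)
  moreover have "\<bar>x\<bar> powr p * ker \<alpha> (u - c) = exp (\<alpha> * u) * (x ^ (2 * k + 2) / (x\<^sup>2 + (exp u)\<^sup>2))" for u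
  proof -
    have d: "x\<^sup>2 + (exp u)\<^sup>2 = exp (2 * c) * (1 + exp (2 * (u - c)))"
      unfolding x2 by (simp add: distrib_left exp_add[symmetric] exp_double[symmetric])
    have "exp (\<alpha> * u) * x ^ (2 * k + 2) = exp (2 * c) * (exp (p * c) * exp (\<alpha> * (u - c)))"
      unfolding xk exp_add[symmetric] by (simp add: \<alpha>_def algebra_simps)
    then show ?thesis unfolding ker_def xp d by (simp add: mult.assoc)
  qed
  ultimately show ?thesis by (simp add: \<alpha>_def c_def)
qed simp

text \<open>The trace of X^(2 k + 2) / (X^2 + t^2) after partial fractions; in this form its
  differences are those of resolvents.\<close>

definition kfun :: "nat \<Rightarrow> real \<Rightarrow> 'a::complex_hilbert_space cop \<Rightarrow> complex"
  where "kfun k t X = tr (cs (1 / (2 * \<i> * of_real t)) * (X ^ (2 * k + 2) * (rsv t X - rsv (- t) X)))"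

abbreviation kint :: "nat \<Rightarrow> real \<Rightarrow> real \<Rightarrow> 'a::complex_hilbert_space cop \<Rightarrow> complex"
  where "kint k p u X \<equiv> of_real (exp ((p - 2 * real k) * u)) * kfun k (exp u) X"

text \<open>The integral stays truncated, and \<open>a\<close> tends to infinity only after the
  difference has been bounded uniformly in \<open>a\<close>.\<close>

definition Kfun :: "nat \<Rightarrow> real \<Rightarrow> real \<Rightarrow> 'a::complex_hilbert_space cop \<Rightarrow> complex"
  where "Kfun k p a X = integral {-a..a} (\<lambda>u. kint k p u X)"

lemma resolvent_identity:
  assumes t: "t \<noteq> 0"
  shows "1 / (2 * \<i> * of_real t) * (1 / (complex_of_real x - \<i> * of_real t) - 1 / (of_real x - \<i> * of_real (- t)))
    = of_real (1 / (x\<^sup>2 + t\<^sup>2))"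
proof -
  have nz: "complex_of_real x - \<i> * of_real t \<noteq> 0" "complex_of_real x + \<i> * of_real t \<noteq> 0"
    using t by (simp_all add: complex_eq_iff)
  have "complex_of_real (x\<^sup>2 + t\<^sup>2) = (of_real x - \<i> * of_real t) * (of_real x + \<i> * of_real t)"
    by (simp add: algebra_simps power2_eq_square)
  then show ?thesis using nz t by (simp add: divide_simps)
qed

lemma kfun_eig:
  fixes k :: nat
  assumes X: "eig n e l X" and t: "t \<noteq> 0"
  defines "G \<equiv> cs (1 / (2 * \<i> * of_real t)) * (X ^ (2 * k + 2) * (rsv t X - rsv (- t) X))"
  shows "G = fcal n e l (\<lambda>x. of_real (x ^ (2 * k + 2) / (x\<^sup>2 + t\<^sup>2)))" "fr G"
    "kfun k t X = of_real (\<Sum>i<n. l i ^ (2 * k + 2) / ((l i)\<^sup>2 + t\<^sup>2))"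
proof -
  have on: "on_fam {..<n} e" using X by (simp add: eig_def)
  have t': "- t \<noteq> 0" using t by simp
  let ?h = "\<lambda>x. of_real (x ^ (2 * k + 2) / (x\<^sup>2 + t\<^sup>2))"
  have "G = fcal n e l (\<lambda>x. 1 / (2 * \<i> * of_real t) * (of_real x ^ (2 * k + 2)
      * (1 / (of_real x - \<i> * of_real t) + (-1) * (1 / (of_real x - \<i> * of_real (- t))))))"
    unfolding G_def fcal_cmult fcal_mult[OF on, symmetric] fcal_add[symmetric] fcal_power[OF X]
      rsv_eq_fcal(1)[OF X t, symmetric] rsv_eq_fcal(1)[OF X t', symmetric] by (simp add: cs_simps)
  also have "... = fcal n e l ?h"
  proof (rule arg_cong[of _ _ "fcal n e l"], rule ext)
    fix x
    show "1 / (2 * \<i> * of_real t) * (of_real x ^ (2 * k + 2)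
        * (1 / (of_real x - \<i> * of_real t) + (-1) * (1 / (of_real x - \<i> * of_real (- t))))) = ?h x"
      using arg_cong[OF resolvent_identity[OF t, of x], of "\<lambda>z. of_real x ^ (2 * k + 2) * z"] by (simp add: mult_ac)
  qed
  finally show G: "G = fcal n e l ?h" .
  have h0: "?h 0 = 0" by simp
  show "fr G" unfolding G by (rule tr_fcal(1)[where \<phi> = ?h, OF on h0])
  show "kfun k t X = of_real (\<Sum>i<n. l i ^ (2 * k + 2) / ((l i)\<^sup>2 + t\<^sup>2))"
    unfolding kfun_def G_def[symmetric] G by (subst tr_fcal(2)[where \<phi> = ?h, OF on h0]) (simp only: of_real_sum)
qed

lemma Kfun_has_integral:
  assumes p: "2 * real k < p" "p < 2 * real k + 2" and X: "eig n e l X"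
  shows "((\<lambda>u. kint k p u X) has_integral
    of_real (\<Sum>i<n. \<bar>l i\<bar> powr p * integral {-a - ln \<bar>l i\<bar>..a - ln \<bar>l i\<bar>} (ker (p - 2 * real k)))) {-a..a}"
proof -
  have "((\<lambda>u. \<Sum>i<n. exp ((p - 2 * real k) * u) * (l i ^ (2 * k + 2) / ((l i)\<^sup>2 + (exp u)\<^sup>2))) has_integral
    (\<Sum>i<n. \<bar>l i\<bar> powr p * integral {-a - ln \<bar>l i\<bar>..a - ln \<bar>l i\<bar>} (ker (p - 2 * real k)))) {-a..a}"
    by (intro has_integral_sum power_integral p) simp
  from has_integral_linear[OF this bounded_linear_of_real[where 'a = complex]]
  show ?thesis by (simp only: o_def sum_distrib_left[symmetric] of_real_mult kfun_eig(3)[OF X] exp_not_eq_zero not_False_eq_True)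
qed

lemma Kfun_integrable:
  assumes "2 * real k < p" "p < 2 * real k + 2" "sa X"
  shows "(\<lambda>u. kint k p u X) integrable_on {-a..a}"
  using eig_exists'[OF assms(3)] Kfun_has_integral[OF assms(1,2)] has_integral_integrable by blast

lemma Kfun_tendsto:
  assumes p: "2 * real k < p" "p < 2 * real k + 2"
  obtains L where "L > 0" "\<And>X :: 'a::complex_hilbert_space cop. sa X \<Longrightarrow>
    ((\<lambda>a. Kfun k p a X) \<longlongrightarrow> of_real (L * spw p X)) at_top"
proof -
  obtain L where L: "L > 0" "\<And>c. ((\<lambda>a. integral {-a - c..a - c} (ker (p - 2 * real k))) \<longlongrightarrow> L) at_top"
    using ker_limit[of "p - 2 * real k"] p by auto
  have "((\<lambda>a. Kfun k p a X) \<longlongrightarrow> of_real (L * spw p X)) at_top" if X: "sa X" for X :: "'a cop"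
  proof -
    obtain n e l where eig: "eig n e l X" using eig_exists'[OF X] by blast
    have "Kfun k p a X = of_real (\<Sum>i<n. \<bar>l i\<bar> powr p * integral {-a - ln \<bar>l i\<bar>..a - ln \<bar>l i\<bar>} (ker (p - 2 * real k)))" for a
      unfolding Kfun_def by (rule integral_unique) (rule Kfun_has_integral[OF p eig])
    moreover have "((\<lambda>a. \<Sum>i<n. \<bar>l i\<bar> powr p * integral {-a - ln \<bar>l i\<bar>..a - ln \<bar>l i\<bar>} (ker (p - 2 * real k)))
        \<longlongrightarrow> (\<Sum>i<n. \<bar>l i\<bar> powr p * L)) at_top"
      by (intro tendsto_sum tendsto_mult_left L(2))
    moreover have "(\<Sum>i<n. \<bar>l i\<bar> powr p * L) = L * spw p X"
      using eig_spw[OF eig] p by (simp add: sum_distrib_left mult.commute)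
    ultimately show ?thesis by (simp only: tendsto_of_real)
  qed
  then show thesis using that L(1) by blast
qed

text \<open>Differences of order \<open>M > 2 k\<close> do not see the polynomial part of \<open>x\<^sup>2\<^sup>k\<^sup>+\<^sup>2 / (x\<^sup>2 + t\<^sup>2)\<close>.\<close>

lemma difn_kfun:
  fixes V X :: "'a::complex_hilbert_space cop"
  assumes V: "sa V" and X: "sa X" and t: "t \<noteq> 0" and M: "2 * k < M"
  shows "difn M V (kfun k t) X = (- (of_real t)\<^sup>2) ^ (k + 1) / (2 * \<i> * of_real t)
    * (tr (difn M V (rsv t) X) - tr (difn M V (rsv (- t)) X))"
proof -
  define G where "G = (\<lambda>X::'a cop. cs (1 / (2 * \<i> * of_real t)) * (X ^ (2 * k + 2) * (rsv t X - rsv (- t) X)))"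
  define z where "z = (- (complex_of_real t)\<^sup>2) ^ (k + 1) / (2 * \<i> * of_real t)"
  have t': "- t \<noteq> 0" using t by simp
  have S: "Y \<in> {Y. sa Y} \<Longrightarrow> Y + V \<in> {Y. sa Y}" for Y using sa_add V by auto
  have XS: "X \<in> {Y. sa Y}" using X by simp
  have frG: "fr (G Y)" if "sa Y" for Y
    using eig_exists'[OF that] kfun_eig(2)[OF _ t] unfolding G_def by blast
  have decomp: "G Y = (\<Sum>i<k+1. cs ((- (of_real t)\<^sup>2) ^ (k - i)) * Y ^ (2 * i)) + (cs z * rsv t Y + cs (- z) * rsv (- t) Y)" if "sa Y" for Y
  proof -
    obtain n e l where Y: "eig n e l Y" using eig_exists'[OF \<open>sa Y\<close>] by blast
    have "G Y = fcal n e l (\<lambda>x. of_real (x ^ (2 * k + 2) / (x\<^sup>2 + t\<^sup>2)))"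
      unfolding G_def by (rule kfun_eig(1)[OF Y t])
    also have "... = fcal n e l (\<lambda>x. (\<Sum>i<k+1. (- (of_real t)\<^sup>2) ^ (k - i) * of_real x ^ (2 * i))
        + (z * (1 / (of_real x - \<i> * of_real t)) + (- z) * (1 / (of_real x - \<i> * of_real (- t)))))"
    proof (rule arg_cong[of _ _ "fcal n e l"], rule ext)
      fix x
      define r where "r = complex_of_real (1 / (x\<^sup>2 + t\<^sup>2))"
      have d: "x\<^sup>2 + t\<^sup>2 \<noteq> 0" using t by (simp add: sum_power2_eq_zero_iff)
      have L: "of_real (x ^ (2 * k + 2) / (x\<^sup>2 + t\<^sup>2)) = of_real x ^ (2 * k + 2) * r" by (simp add: r_def)
      have R: "z * (1 / (of_real x - \<i> * of_real t)) + (- z) * (1 / (of_real x - \<i> * of_real (- t))) = (- (of_real t)\<^sup>2) ^ (k + 1) * r"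
      proof -
        have "b / c * A + - (b / c) * B = b * (1 / c * (A - B))" for b c A B :: complex by (simp add: right_diff_distrib)
        then show ?thesis unfolding z_def r_def resolvent_identity[OF t, of x, symmetric] by blast
      qed
      \<comment> \<open>Division with remainder of x^(2 k + 2) by x^2 + t^2 = a - b: the quotient is
        the geometric sum, the remainder is b^(k + 1).\<close>
      define a b where "a = (complex_of_real x)\<^sup>2" and "b = - (complex_of_real t)\<^sup>2"
      have "(a - b) * r = 1" unfolding a_def b_def r_def using d by (simp flip: of_real_power of_real_add of_real_mult)
      moreover have "a ^ (k + 1) - b ^ (k + 1) = (a - b) * (\<Sum>i<k+1. b ^ (k - i) * a ^ i)"
        using power_diff_sumr2[of a "k + 1" b] by simp
      ultimately have "(a ^ (k + 1) - b ^ (k + 1)) * r = (\<Sum>i<k+1. b ^ (k - i) * a ^ i)"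
        by (simp only: mult.assoc mult.commute[of _ r]) (simp only: mult.assoc[symmetric] mult.commute[of r] mult_1)
      then have "a ^ (k + 1) * r = (\<Sum>i<k+1. b ^ (k - i) * a ^ i) + b ^ (k + 1) * r"
        by (simp only: left_diff_distrib diff_eq_eq)
      then show "of_real (x ^ (2 * k + 2) / (x\<^sup>2 + t\<^sup>2))
          = (\<Sum>i<k+1. (- (of_real t)\<^sup>2) ^ (k - i) * of_real x ^ (2 * i))
          + (z * (1 / (of_real x - \<i> * of_real t)) + (- z) * (1 / (of_real x - \<i> * of_real (- t))))"
        unfolding L R a_def b_def by (simp only: power_mult[symmetric]) (simp add: algebra_simps)
    qed
    also have "... = (\<Sum>i<k+1. cs ((- (of_real t)\<^sup>2) ^ (k - i)) * Y ^ (2 * i)) + (cs z * rsv t Y + cs (- z) * rsv (- t) Y)"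
      unfolding fcal_add[symmetric] fcal_sum fcal_cmult fcal_power[OF Y]
        rsv_eq_fcal(1)[OF Y t, symmetric] rsv_eq_fcal(1)[OF Y t', symmetric] ..
    finally show ?thesis .
  qed
  have cl: "difn M V (\<lambda>X. cs c * f X) X = cs c * difn M V f X" for c f
    by (rule difn_linear[where g = "\<lambda>Y. cs c * Y"]) (simp add: right_diff_distrib)
  have "difn M V G X = difn M V (\<lambda>Y. (\<Sum>i<k+1. cs ((- (of_real t)\<^sup>2) ^ (k - i)) * Y ^ (2 * i)) + (cs z * rsv t Y + cs (- z) * rsv (- t) Y)) X"
    using decomp S XS by (intro difn_cong_on[where S = "{Y. sa Y}"]) auto
  also have "... = cs z * difn M V (rsv t) X + cs (- z) * difn M V (rsv (- t)) X"
    unfolding difn_add difn_sum cl using M by (simp add: difn_power_zero)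
  finally have GD: "difn M V G X = cs z * difn M V (rsv t) X + cs (- z) * difn M V (rsv (- t)) X" .
  have frD: "fr (difn M V (rsv t) X)" "fr (difn M V (rsv (- t)) X)"
    using M t by (auto intro!: fr_difn_rsv V X)
  have "difn M V (\<lambda>X. tr (G X)) X = tr (difn M V G X)"
    by (rule conjunct2[OF difn_additive[where S = "{Y. sa Y}" and T = "{Y. fr Y}"]])
      (use S XS frG in \<open>auto simp: tr_diff fr_diff\<close>)
  moreover have "kfun k t = (\<lambda>X. tr (G X))" by (simp add: fun_eq_iff kfun_def G_def)
  ultimately show ?thesis
    unfolding GD z_def[symmetric] using frD by (simp add: tr_add tr_cs fr_mult_left fr_mult_right right_diff_distrib)
qed

text \<open>The weight exp ((p - 2 k) u) and the t^(2 k + 1) left by \<open>difn_kfun\<close>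
  combine to t^(p + 1), so that the integrand is homogeneous of degree \<open>p\<close> under a
  common scaling of \<open>X\<close>, \<open>V\<close> and t.\<close>

lemma difn_Kfun:
  assumes p: "2 * real k < p" "p < 2 * real k + 2" and V: "sa V" and X: "sa X" and M: "2 * k < M"
  shows "(\<lambda>u. difn M V (kint k p u) X) integrable_on {-a..a} \<and>
    difn M V (Kfun k p a) X = integral {-a..a} (\<lambda>u. difn M V (kint k p u) X) \<and>
    (\<forall>u. difn M V (kint k p u) X
      = (-1) ^ (k + 1) * of_real (exp u powr (p + 1)) / (2 * \<i>) * (tr (difn M V (rsv (exp u)) X) - tr (difn M V (rsv (- exp u)) X)))"
proof (intro conjI allI)
  have 1: "(\<lambda>u. difn M V (kint k p u) X) integrable_on {-a..a} \<and>
    difn M V (\<lambda>X. integral {-a..a} (\<lambda>u. kint k p u X)) X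
    = integral {-a..a} (\<lambda>u. difn M V (kint k p u) X)"
    by (rule difn_integral[where S = "{Y. sa Y}"]) (use V X sa_add Kfun_integrable[OF p] in auto)
  show "(\<lambda>u. difn M V (kint k p u) X) integrable_on {-a..a}"
    using 1 by blast
  have "Kfun k p a = (\<lambda>X. integral {-a..a} (\<lambda>u. kint k p u X))"
    by (simp add: Kfun_def fun_eq_iff)
  then have "difn M V (Kfun k p a) X = difn M V (\<lambda>X. integral {-a..a} (\<lambda>u. kint k p u X)) X"
    by (rule arg_cong[of _ _ "\<lambda>f. difn M V f X"])
  with 1 show "difn M V (Kfun k p a) X = integral {-a..a} (\<lambda>u. difn M V (kint k p u) X)"
    by (simp only:)
  fix u
  have "complex_of_real (exp u powr (p + 1)) = of_real (exp ((p - 2 * real k) * u)) * (of_real (exp u) ^ (2 * k + 1))"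
  proof -
    have "exp u powr (p + 1) = exp ((p - 2 * real k) * u) * exp u ^ (2 * k + 1)"
      by (simp add: powr_def exp_of_nat_mult[symmetric] exp_add[symmetric] algebra_simps)
    then show ?thesis by simp
  qed
  moreover have "(- (of_real (exp u))\<^sup>2) ^ (k + 1) / (2 * \<i> * complex_of_real (exp u)) = (-1) ^ (k + 1) * of_real (exp u) ^ (2 * k + 1) / (2 * \<i>)"
    unfolding power_minus[of "(of_real (exp u))\<^sup>2"] power_mult[symmetric] by (simp add: field_simps)
  moreover have "difn M V (kint k p u) X
      = of_real (exp ((p - 2 * real k) * u)) * difn M V (kfun k (exp u)) X"
    by (rule difn_linear[where g = "\<lambda>Y. of_real (exp ((p - 2 * real k) * u)) * Y"]) (simp add: right_diff_distrib)
  ultimately show "difn M V (kint k p u) X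
      = (-1) ^ (k + 1) * of_real (exp u powr (p + 1)) / (2 * \<i>) * (tr (difn M V (rsv (exp u)) X) - tr (difn M V (rsv (- exp u)) X))"
    unfolding difn_kfun[OF V X exp_not_eq_zero M] by (simp add: mult_ac)
qed

text \<open>A bound uniform in the truncation passes to the limit, where the factor \<open>L\<close>
  is divided out.\<close>

lemma difn_spw_le:
  fixes V X :: "'a::complex_hilbert_space cop"
  assumes p: "2 * real k < p" "p < 2 * real k + 2"
    and bd: "\<And>a X V :: 'a cop. a \<ge> 0 \<Longrightarrow> sa V \<Longrightarrow> sa X \<Longrightarrow> cmod (difn M V (Kfun k p a) X) \<le> C * spw p V"
  shows "\<exists>C'\<ge>0. \<forall>V X::'a cop. sa V \<longrightarrow> sa X \<longrightarrow> \<bar>difn M V (spw p) X\<bar> \<le> C' * spw p V"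
proof -
  obtain L where L: "L > 0" "\<And>X :: 'a cop. sa X \<Longrightarrow> ((\<lambda>a. Kfun k p a X) \<longlongrightarrow> of_real (L * spw p X)) at_top"
    using Kfun_tendsto[OF p] by metis
  show ?thesis
  proof (intro exI[of _ "\<bar>C\<bar> / L"] conjI allI impI)
    fix V X :: "'a cop" assume V: "sa V" and X: "sa X"
    have "((\<lambda>a. difn M V (Kfun k p a) X) \<longlongrightarrow> difn M V (\<lambda>X. of_real (L * spw p X)) X) at_top"
      by (rule difn_tendsto[where S = "{Y. sa Y}"]) (use L(2) sa_add V X in auto)
    moreover have "difn M V (\<lambda>X. complex_of_real (L * spw p X)) X = of_real (L * difn M V (spw p) X)"
      by (rule difn_linear[where g = "\<lambda>r. complex_of_real (L * r)"]) (simp add: right_diff_distrib)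
    ultimately have "((\<lambda>a. difn M V (Kfun k p a) X) \<longlongrightarrow> of_real (L * difn M V (spw p) X)) at_top" by simp
    from tendsto_norm[OF this] have "((\<lambda>a. cmod (difn M V (Kfun k p a) X)) \<longlongrightarrow> L * \<bar>difn M V (spw p) X\<bar>) at_top"
      using L(1) by (simp add: abs_mult norm_mult)
    then have "L * \<bar>difn M V (spw p) X\<bar> \<le> C * spw p V"
      by (rule tendsto_upperbound) (auto intro!: eventually_mono[OF eventually_ge_at_top[of 0]] bd V X)
    also have "... \<le> \<bar>C\<bar> * spw p V" by (intro mult_right_mono) (auto simp: spow_nonneg)
    finally show "\<bar>difn M V (spw p) X\<bar> \<le> \<bar>C\<bar> / L * spw p V" using L(1) by (simp add: field_simps)
  qed (use L(1) in simp)
qed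

text \<open>An eigenvalue \<kappa> of \<open>V\<close> contributes about t^p for t < |\<kappa>| and
  |\<kappa>|^M t^(p - M) for t above it. Since 0 < p < M, this decays exponentially in the distance
  of ln t from ln |\<kappa>|, so it is dominated by |\<kappa>|^p times a translate of
  \<open>sch\<close>, whose integral is bounded independently of \<kappa>.\<close>

lemma difn_spw_nonint:
  assumes p: "2 * real k < p" "p < 2 * real k + 2" and M: "2 * k < M" "p < real M"
  shows "\<exists>C\<ge>0. \<forall>V X::'a::complex_hilbert_space cop. sa V \<longrightarrow> sa X \<longrightarrow> \<bar>difn M V (spw p) X\<bar> \<le> C * spw p V"
proof (rule difn_spw_le[OF p])
  fix a :: real and X V :: "'a cop" assume a: "a \<ge> 0" and V: "sa V" and X: "sa X"
  obtain n f \<kappa> where eV: "eig n f \<kappa> V" using eig_exists'[OF V] by blast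
  \<comment> \<open>The smaller of the two decay rates; it would vanish for p = M, which is why that
    case is treated separately.\<close>
  define \<gamma> where "\<gamma> = min p (real M - p)"
  have \<gamma>: "\<gamma> > 0" using p M(2) by (auto simp: \<gamma>_def)
  define C1 :: real where "C1 = 2 ^ Suc M + fact M"
  let ?b = "\<lambda>u. \<Sum>j<n. C1 * (\<bar>\<kappa> j\<bar> powr p * sch \<gamma> (u - ln \<bar>\<kappa> j\<bar>))"
  let ?f = "\<lambda>u. difn M V (kint k p u) X"
  note D = difn_Kfun[OF p V X M(1), of a]
  have M1: "1 \<le> M" using M by simp
  have ab: "- a \<le> a" using a by simp
  have pt: "exp u powr (p + 1) * (if \<bar>x\<bar> > exp u then 2 ^ Suc M / exp u else fact M * \<bar>x\<bar> ^ M / exp u ^ Suc M)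
      \<le> C1 * (\<bar>x\<bar> powr p * sch \<gamma> (u - ln \<bar>x\<bar>))" for x u
  proof (cases "x = 0")
    case False
    define c where "c = ln \<bar>x\<bar>"
    have x: "\<bar>x\<bar> = exp c" using False by (simp add: c_def)
    have sc: "exp (- (\<gamma> * \<bar>v\<bar>)) \<le> sch \<gamma> v" for v
    proof -
      have "\<gamma> * v \<le> \<gamma> * \<bar>v\<bar>" "- (\<gamma> * v) \<le> \<gamma> * \<bar>v\<bar>"
        using \<gamma> by (auto simp: abs_if mult_le_0_iff)
      then have "exp (\<gamma> * v) + exp (- (\<gamma> * v)) \<le> 2 * exp (\<gamma> * \<bar>v\<bar>)"
        using exp_le_cancel_iff[of "\<gamma> * v"] exp_le_cancel_iff[of "- (\<gamma> * v)"] by (smt (verit))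
      then show ?thesis
        unfolding sch_def by (simp add: exp_minus field_simps add_pos_pos)
    qed
    have pw: "\<bar>x\<bar> powr p = exp (p * c)" "exp u powr (p + 1) = exp ((p + 1) * u)" unfolding x by (simp_all add: powr_def)
    have C1: "0 \<le> C1" "2 ^ Suc M \<le> C1" "fact M \<le> C1" by (simp_all add: C1_def)
    show ?thesis
    proof (cases "\<bar>x\<bar> > exp u")
      case True
      then have uc: "u < c" by (simp add: x)
      have "exp ((p + 1) * u) = exp (p * u) * exp u" by (simp add: exp_add[symmetric] algebra_simps)
      then have "exp u powr (p + 1) * (2 ^ Suc M / exp u) = 2 ^ Suc M * exp (p * u)"
        unfolding pw by simp
      also have "... \<le> C1 * (exp (p * c) * exp (- (\<gamma> * \<bar>u - c\<bar>)))"
      proof (intro mult_mono C1)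
        have "(p - \<gamma>) * (c - u) \<ge> 0" using uc by (simp add: \<gamma>_def)
        then show "exp (p * u) \<le> exp (p * c) * exp (- (\<gamma> * \<bar>u - c\<bar>))" using uc by (simp add: exp_add[symmetric] algebra_simps)
      qed auto
      also have "... \<le> C1 * (exp (p * c) * sch \<gamma> (u - c))" using sc C1 by (intro mult_left_mono) auto
      finally show ?thesis using True by (simp only: pw c_def[symmetric] if_True)
    next
      case False
      then have uc: "c \<le> u" by (simp add: x)
      have "exp u powr (p + 1) * (fact M * \<bar>x\<bar> ^ M / exp u ^ Suc M) = fact M * exp (real M * c + (p - real M) * u)"
        unfolding pw unfolding x by (simp add: exp_of_nat_mult[symmetric] exp_add exp_diff algebra_simps)
      also have "... \<le> C1 * (exp (p * c) * exp (- (\<gamma> * \<bar>u - c\<bar>)))"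
      proof (intro mult_mono C1)
        have "(real M - p - \<gamma>) * (u - c) \<ge> 0" using uc by (simp add: \<gamma>_def)
        then show "exp (real M * c + (p - real M) * u) \<le> exp (p * c) * exp (- (\<gamma> * \<bar>u - c\<bar>))" using uc by (simp add: exp_add[symmetric] algebra_simps)
      qed auto
      also have "... \<le> C1 * (exp (p * c) * sch \<gamma> (u - c))" using sc C1 by (intro mult_left_mono) auto
      finally show ?thesis using False by (simp only: pw c_def[symmetric] if_False)
    qed
  qed (use M1 in \<open>simp add: power_0_left\<close>)
  have fb: "norm (?f u) \<le> ?b u" for u
  proof -
    let ?s = "\<Sum>j<n. if \<bar>\<kappa> j\<bar> > \<bar>exp u\<bar> then 2 ^ Suc M / \<bar>exp u\<bar> else fact M * \<bar>\<kappa> j\<bar> ^ M / \<bar>exp u\<bar> ^ Suc M"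
    have "cmod (tr (difn M V (rsv (exp u)) X)) \<le> ?s" "cmod (tr (difn M V (rsv (- exp u)) X)) \<le> ?s"
      using tr_difn_rsv_split[OF eV V _ X M1, of "exp u"] tr_difn_rsv_split[OF eV V _ X M1, of "- exp u"] unfolding abs_minus_cancel by simp_all
    then have "cmod (tr (difn M V (rsv (exp u)) X) - tr (difn M V (rsv (- exp u)) X)) \<le> ?s + ?s"
      using norm_triangle_ineq4 by (smt (verit, best))
    then have "exp u powr (p + 1) / 2 * cmod (tr (difn M V (rsv (exp u)) X) - tr (difn M V (rsv (- exp u)) X)) \<le> exp u powr (p + 1) / 2 * (?s + ?s)"
      by (intro mult_left_mono) auto
    moreover have "norm (?f u) = exp u powr (p + 1) / 2 * cmod (tr (difn M V (rsv (exp u)) X) - tr (difn M V (rsv (- exp u)) X))"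
      unfolding spec[OF conjunct2[OF conjunct2[OF D]], of u] by (simp add: norm_mult norm_divide norm_power)
    moreover have "exp u powr (p + 1) * ?s \<le> ?b u"
      unfolding sum_distrib_left abs_exp_cancel by (intro sum_mono pt)
    moreover have "f \<le> b" if "E / 2 * c \<le> E / 2 * (s + s)" "f = E / 2 * c" "E * s \<le> b" for E c s f b :: real
      using that by (simp add: field_simps)
    ultimately show ?thesis by blast
  qed
  have bint: "?b integrable_on {-a..a}"
    by (intro integrable_sum integrable_on_mult_right) (auto intro!: sch_integral(1)[OF \<gamma> ab])
  have "norm (integral {-a..a} ?f) \<le> integral {-a..a} ?b"
    by (rule integral_norm_bound_integral) (use D bint fb in auto)
  also have "... = (\<Sum>j<n. C1 * (\<bar>\<kappa> j\<bar> powr p * integral {-a..a} (\<lambda>u. sch \<gamma> (u - ln \<bar>\<kappa> j\<bar>))))"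
    by (subst integral_sum) (auto intro!: integrable_on_mult_right sch_integral(1)[OF \<gamma> ab])
  also have "... \<le> (\<Sum>j<n. C1 * (\<bar>\<kappa> j\<bar> powr p * (pi / \<gamma>)))"
    by (intro sum_mono mult_left_mono sch_integral(2)[OF \<gamma> ab]) (auto simp: C1_def)
  also have "... = C1 * pi / \<gamma> * spw p V"
    using eig_spw[OF eV, of p] p by (simp add: sum_distrib_left mult_ac)
  finally show "cmod (difn M V (Kfun k p a) X) \<le> (2 ^ Suc M + fact M) * pi / min p (real M - p) * spw p V"
    unfolding conjunct1[OF conjunct2[OF D]] C1_def \<gamma>_def .
qed

lemma difn_spw_even:
  assumes "even M" "0 < M" "p = real M"
  shows "\<exists>C\<ge>0. \<forall>V X::'a::complex_hilbert_space cop. sa V \<longrightarrow> sa X \<longrightarrow> \<bar>difn M V (spw p) X\<bar> \<le> C * spw p V"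
proof (intro exI[of _ "fact M"] conjI allI impI)
  fix V X :: "'a cop" assume V: "sa V" and X: "sa X"
  have tp: "fr (Y ^ M)" "complex_of_real (spw p Y) = tr (Y ^ M)" if "sa Y" for Y :: "'a cop"
  proof -
    obtain n e l where Y: "eig n e l Y" using eig_exists'[OF \<open>sa Y\<close>] by blast
    have on: "on_fam {..<n} e" using Y by (simp add: eig_def)
    have 0: "complex_of_real 0 ^ M = 0" using assms(2) by simp
    show "fr (Y ^ M)" using tr_fcal(1)[of n e "\<lambda>x. of_real x ^ M" l, OF on 0] fcal_power[OF Y] by simp
    have "\<bar>x\<bar> powr p = x ^ M" for x :: real
      using assms by (simp add: powr_realpow' power_even_abs)
    then show "complex_of_real (spw p Y) = tr (Y ^ M)"
      using tr_fcal(2)[of n e "\<lambda>x. of_real x ^ M" l, OF on 0] fcal_power[OF Y] eig_spw[OF Y, of p] assms by simp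
  qed
  have S: "Y \<in> {Y. sa Y} \<Longrightarrow> Y + V \<in> {Y. sa Y}" for Y using sa_add V by auto
  have "of_real (difn M V (spw p) X) = difn M V (\<lambda>X. complex_of_real (spw p X)) X"
    by (rule difn_linear[symmetric]) simp
  also have "... = difn M V (\<lambda>X. tr (X ^ M)) X"
    by (rule difn_cong_on[where S = "{Y. sa Y}"]) (use S tp X in auto)
  also have "... = tr (difn M V (\<lambda>X. X ^ M) X)"
    by (rule conjunct2[OF difn_additive[where S = "{Y. sa Y}" and T = "{Y. fr Y}"]])
      (use S X tp in \<open>auto simp: tr_diff fr_diff\<close>)
  also have "... = of_real (fact M * spw p V)"
    unfolding difn_power_same using tp[OF V] by (simp add: tr_scaleR)
  finally show "\<bar>difn M V (spw p) X\<bar> \<le> fact M * spw p V"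
    by (simp only: of_real_eq_iff) (simp add: abs_mult spow_nonneg)
qed simp

subsection \<open>Odd exponents\<close>

lemma csg_split: "csg n e l w False + csg n e l w True = dg n e (\<lambda>i. w / (w - of_real (l i)))"
  unfolding csg_def dg_add by (rule arg_cong[of _ _ "dg n e"]) auto

lemma csg_orth: "on_fam {..<n} e \<Longrightarrow> \<sigma> \<noteq> \<sigma>' \<Longrightarrow> csg n e l w \<sigma> * csg n e l w \<sigma>' = 0"
  unfolding csg_def by (subst dg_mult_dg) (cases \<sigma>; auto simp: dg_eq cs_simps intro!: sum.neutral)+

abbreviation rcs :: "nat \<Rightarrow> (nat \<Rightarrow> 'a::complex_hilbert_space) \<Rightarrow> (nat \<Rightarrow> real) \<Rightarrow> complex \<Rightarrow> 'a cop"
  where "rcs n e l w \<equiv> dg n e (\<lambda>i. w / (w - of_real (l i)))"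

text \<open>Expanding the first \<open>p\<close> factors \<open>C\<close> yields 2^p words with
  letters of degree 1, followed by one trailing \<open>C\<close>. Under the trace this
  \<open>C\<close> meets the first letter, and by orthogonality only its compression of the same
  sign survives: this is the letter of degree 0 that \<open>wok\<close> admits.\<close>

lemma ctr_resolvent_power:
  fixes p :: nat
  assumes p: "p \<ge> 2"
  shows "\<exists>K\<ge>0. \<forall>n (e :: nat \<Rightarrow> 'a::complex_hilbert_space) l V a b. on_fam {..<n} e \<longrightarrow> fr V \<longrightarrow> a \<le> b \<longrightarrow>
    continuous_on offR (\<lambda>w. tr ((rcs n e l w * V) ^ p * rcs n e l w)) \<and>
    cmod (ctr (\<lambda>w. tr ((rcs n e l w * V) ^ p * rcs n e l w)) a b) \<le> K * spw (real p) V"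
proof -
  obtain K where K: "K \<ge> 0" and bd: "\<And>n (e :: nat \<Rightarrow> 'a) l ws a b. on_fam {..<n} e \<Longrightarrow> length ws = p + 1 \<Longrightarrow> wfr ws \<Longrightarrow>
    wdeg ws = p \<Longrightarrow> wok ws (fst (hd ws)) \<Longrightarrow> a \<le> b \<Longrightarrow> cmod (ctr (\<lambda>w. tr (wprod n e l w ws)) a b) \<le> K * wnorm p ws"
    using ctr_word_bound[OF p, of "p + 1"] by (metis le_add2)
  show ?thesis
  proof (intro exI[of _ "2 ^ p * K"] conjI[of "0 \<le> _"] allI impI)
    fix n and e :: "nat \<Rightarrow> 'a" and l and V :: "'a cop" and a b :: real
    assume e: "on_fam {..<n} e" and V: "fr V" and ab: "a \<le> b"
    define C where "C = (\<lambda>w. rcs n e l w)"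
    have Cs: "C w = csg n e l w False + csg n e l w True" for w by (simp add: C_def csg_split)
    \<comment> \<open>Partially expanded products: \<open>ws\<close> is the part already split into
      signs, \<open>k\<close> factors \<open>C w * V\<close> remain.\<close>
    define T where "T = (\<lambda>k ws w. tr (wprod n e l w ws * ((C w * V) ^ k * C w)))"
    have T_step: "T (Suc k) ws = (\<lambda>w. T k (ws @ [(False, V, 1)]) w + T k (ws @ [(True, V, 1)]) w)" for k ws
    proof
      fix w
      have "wprod n e l w ws * ((C w * V) ^ Suc k * C w)
          = wprod n e l w (ws @ [(False, V, 1)]) * ((C w * V) ^ k * C w) + wprod n e l w (ws @ [(True, V, 1)]) * ((C w * V) ^ k * C w)"
      proof -
        define Y where "Y = (C w * V) ^ k * C w"
        have "(C w * V) ^ Suc k * C w = (csg n e l w False + csg n e l w True) * V * Y"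
          by (simp add: Y_def mult.assoc Cs[symmetric])
        then show ?thesis unfolding Y_def[symmetric] by (simp add: algebra_simps)
      qed
      then show "T (Suc k) ws w = T k (ws @ [(False, V, 1)]) w + T k (ws @ [(True, V, 1)]) w"
        unfolding T_def by (simp only:) (rule tr_add; use V in \<open>simp add: fr_mult_left fr_mult_right\<close>)
    qed
    have claim: "continuous_on offR (T k ws) \<and> cmod (ctr (T k ws) a b) \<le> 2 ^ k * K * (wnorm p ws * sn (real p) V ^ k)"
      if "ws \<noteq> []" "\<And>\<sigma> A j. (\<sigma>, A, j) \<in> set ws \<Longrightarrow> j \<noteq> 0" "wfr ws" "wdeg ws + k = p" "length ws + k = p" for k ws
      using that
    proof (induction k arbitrary: ws)
      case 0
      obtain s A j r where ws: "ws = (s, A, j) # r" using 0(1) by (metis list.exhaust prod.exhaust)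
      \<comment> \<open>Letters need finite-rank operators; the projection onto the span of the
        \<open>e i\<close> acts as the identity next to \<open>csg\<close>.\<close>
      define us where "us = ws @ [(s, dg n e (\<lambda>_. 1), 0)]"
      have "T 0 ws w = tr (wprod n e l w us)" for w
      proof -
        have frw: "fr (wprod n e l w ws)" by (rule fr_wprod[OF 0(3,1)])
        have "tr (wprod n e l w ws * csg n e l w (\<not> s)) = tr (csg n e l w (\<not> s) * wprod n e l w ws)"
          by (rule tr_commute[OF frw])
        also have "csg n e l w (\<not> s) * wprod n e l w ws = 0"
          unfolding ws using csg_orth[OF e, of "\<not> s" s] by (simp add: mult.assoc[symmetric])
        finally have z: "tr (wprod n e l w ws * csg n e l w (\<not> s)) = 0" by simp
        have "csg n e l w s * dg n e (\<lambda>_. 1) = csg n e l w s" unfolding csg_def dg_mult_dg[OF e] by simp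
        moreover have "C w = csg n e l w s + csg n e l w (\<not> s)" unfolding Cs by (cases s) auto
        ultimately show ?thesis
          unfolding T_def us_def using z frw by (simp add: distrib_left tr_add fr_mult_left fr_mult_right)
      qed
      then have T0: "T 0 ws = (\<lambda>w. tr (wprod n e l w us))" by auto
      have frP: "fr (dg n e (\<lambda>_. 1))" by simp
      have pos: "(\<And>\<sigma> A j. (\<sigma>, A, j) \<in> set vs \<Longrightarrow> j \<noteq> 0) \<Longrightarrow> wok vs s'" for vs :: "'a letter list" and s'
      proof (induction vs)
        case (Cons x vs)
        obtain \<sigma> A j where x: "x = (\<sigma>, A, j)" by (cases x)
        have "j \<noteq> 0" by (rule Cons.prems[of \<sigma> A]) (simp add: x)
        moreover have "wok vs s'" using Cons.IH Cons.prems by (meson list.set_intros(2))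
        ultimately show ?case by (simp add: x)
      qed simp
      have us: "wfr us" "us \<noteq> []" "length us = p + 1" "wdeg us = p" "fst (hd us) = s" "wok us s"
      proof -
        show "fst (hd us) = s" by (simp add: us_def ws)
        show "wok us s" unfolding us_def by (subst wok_append) (use pos 0(2) in auto)
        show "wfr us" "us \<noteq> []" using 0(3) frP by (simp_all add: us_def)
        show "length us = p + 1" "wdeg us = p" using 0(4,5) by (simp_all add: us_def)
      qed
      have "(\<lambda>w. tr (wprod n e l w us)) holomorphic_on offR"
        by (rule holomorphic_trace_word[OF e us(1,2)]) auto
      then have "continuous_on offR (T 0 ws)" unfolding T0 by (rule holomorphic_on_imp_continuous_on)
      moreover have "cmod (ctr (T 0 ws) a b) \<le> K * wnorm p us"
        unfolding T0 by (rule bd[OF e us(3,1,4) _ ab]) (simp only: us)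
      moreover have "wnorm p us \<le> wnorm p ws"
      proof -
        have "norm (dg n e (\<lambda>_. 1)) \<le> 1" by (rule norm_dg_le[OF e]) auto
        then show ?thesis unfolding us_def by (simp add: nj_def mult_left_le)
      qed
      ultimately show ?case using mult_left_mono[OF _ K] by fastforce
    next
      case (Suc k)
      have IH: "continuous_on offR (T k (ws @ [(\<sigma>, V, 1)]))"
        "cmod (ctr (T k (ws @ [(\<sigma>, V, 1)])) a b) \<le> 2 ^ k * K * (wnorm p ws * sn (real p) V ^ Suc k)" for \<sigma>
      proof -
        have "continuous_on offR (T k (ws @ [(\<sigma>, V, 1)])) \<and>
          cmod (ctr (T k (ws @ [(\<sigma>, V, 1)])) a b) \<le> 2 ^ k * K * (wnorm p (ws @ [(\<sigma>, V, 1)]) * sn (real p) V ^ k)"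
          by (rule Suc.IH) (use Suc.prems V in auto)
        moreover have "wnorm p (ws @ [(\<sigma>, V, 1)]) * sn (real p) V ^ k = wnorm p ws * sn (real p) V ^ Suc k" by (simp add: nj_def)
        ultimately show "continuous_on offR (T k (ws @ [(\<sigma>, V, 1)]))"
          "cmod (ctr (T k (ws @ [(\<sigma>, V, 1)])) a b) \<le> 2 ^ k * K * (wnorm p ws * sn (real p) V ^ Suc k)"
          by (simp_all only:)
      qed
      have "cmod (ctr (T (Suc k) ws) a b) \<le> cmod (ctr (T k (ws @ [(False, V, 1)])) a b) + cmod (ctr (T k (ws @ [(True, V, 1)])) a b)"
        unfolding T_step ctr_add[OF IH(1) IH(1)] by (rule norm_triangle_ineq)
      then have "cmod (ctr (T (Suc k) ws) a b) \<le> 2 ^ Suc k * K * (wnorm p ws * sn (real p) V ^ Suc k)"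
        using IH(2)[of False] IH(2)[of True] by simp
      moreover have "continuous_on offR (T (Suc k) ws)"
        unfolding T_step by (intro continuous_on_add IH(1))
      ultimately show ?case by blast
    qed
    obtain q where q: "p = Suc q" using p by (cases p) auto
    have c: "continuous_on offR (T q [(\<sigma>, V, 1)])" "cmod (ctr (T q [(\<sigma>, V, 1)]) a b) \<le> 2 ^ q * K * spw (real p) V" for \<sigma>
    proof -
      have "continuous_on offR (T q [(\<sigma>, V, 1)]) \<and> cmod (ctr (T q [(\<sigma>, V, 1)]) a b) \<le> 2 ^ q * K * (wnorm p [(\<sigma>, V, 1)] * sn (real p) V ^ q)"
        by (rule claim) (use q V in auto)
      moreover have "wnorm p [(\<sigma>, V, 1)] * sn (real p) V ^ q = spw (real p) V"
        using spw_eq_power[of p V] q by (simp add: nj_def)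
      ultimately show "continuous_on offR (T q [(\<sigma>, V, 1)])" "cmod (ctr (T q [(\<sigma>, V, 1)]) a b) \<le> 2 ^ q * K * spw (real p) V"
        by auto
    qed
    have Tp: "(\<lambda>w. tr ((C w * V) ^ p * C w)) = (\<lambda>w. T q [(False, V, 1)] w + T q [(True, V, 1)] w)"
      using T_step[of q "[]"] q by (simp add: T_def)
    have "cmod (ctr (\<lambda>w. tr ((C w * V) ^ p * C w)) a b) \<le> cmod (ctr (T q [(False, V, 1)]) a b) + cmod (ctr (T q [(True, V, 1)]) a b)"
      unfolding Tp ctr_add[OF c(1) c(1)] by (rule norm_triangle_ineq)
    also have "... \<le> 2 ^ p * K * spw (real p) V" using c(2)[of False] c(2)[of True] q by simp
    finally show "continuous_on offR (\<lambda>w. tr ((rcs n e l w * V) ^ p * rcs n e l w)) \<and>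
      cmod (ctr (\<lambda>w. tr ((rcs n e l w * V) ^ p * rcs n e l w)) a b) \<le> 2 ^ p * K * spw (real p) V"
      using continuous_on_add[OF c(1) c(1), of False True] unfolding Tp[symmetric] C_def by blast
  qed (use K in simp)
qed

section \<open>Moving all resolvents to one point\<close>

lemma common_range_proj:
  assumes "fr X" "fr Y"
  obtains B where "onset B" "finite B" "proj B * X = X" "proj B * Y = Y"
proof -
  obtain n u v where X: "X = (\<Sum>i<n::nat. rk (u i) (v i))" using assms by (auto simp: fr_def)
  obtain m a b where Y: "Y = (\<Sum>i<m::nat. rk (a i) (b i))" using assms by (auto simp: fr_def)
  obtain B where B: "onset B" "finite B" "\<And>w. w \<in> u ` {..<n} \<union> a ` {..<m} \<Longrightarrow> ap (proj B) w = w"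
    using gram_schmidt[of "u ` {..<n} \<union> a ` {..<m}"] by (metis finite_Un finite_imageI finite_lessThan)
  have "proj B * X = X" "proj B * Y = Y"
    unfolding X Y sum_distrib_left using B(3) by (auto intro!: sum.cong simp: rk_mult)
  then show thesis using that B(1,2) by blast
qed

lemma cs_mult_power: "(cs z * A) ^ k = cs (z ^ k) * A ^ k"
proof (induction k)
  case (Suc k)
  have "(cs z * A) ^ Suc k = cs z * (A * cs (z ^ k)) * A ^ k" by (simp add: Suc mult.assoc)
  also have "A * cs (z ^ k) = cs (z ^ k) * A" by (rule cs_commute[symmetric])
  finally show ?case by (simp add: cs_simps mult.assoc[symmetric])
qed (simp add: cs_simps)

text \<open>On the span of the \<open>e i\<close> the resolvent at w is -1 / w times w / (w - X),
  and there are p + 1 of them. The conditions on \<open>V\<close> keep the whole product within that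
  span.\<close>

lemma resolvent_power_dg:
  assumes X: "eig n e l X" and V: "dg n e (\<lambda>_. 1) * V = V" "V * dg n e (\<lambda>_. 1) = V" and t: "t \<noteq> 0" and p: "p \<ge> 1"
    and w: "w = \<i> * of_real t"
  shows "(rsv t X * V) ^ p * rsv t X
    = cs ((- 1 / w) ^ (p + 1)) * ((rcs n e l w * V) ^ p * rcs n e l w)"
proof -
  define R P C z where "R = rsv t X" and "P = dg n e (\<lambda>_. 1)" and "C = rcs n e l w" and "z = - 1 / w"
  have on: "on_fam {..<n} e" using X by (simp add: eig_def)
  have w0: "w \<noteq> 0" "complex_of_real x - w \<noteq> 0" "w - complex_of_real x \<noteq> 0" for x
    using t by (simp_all add: w complex_eq_iff)
  have zC: "cs z * C = dg n e (\<lambda>i. 1 / (of_real (l i) - w))"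
    unfolding C_def cs_mult_dg z_def
    by (rule arg_cong[of _ _ "dg n e"]) (use w0 in \<open>auto simp: fun_eq_iff divide_simps\<close>)
  have RP: "R * P = cs z * C" "P * R = cs z * C"
    unfolding zC R_def P_def rsv_eq_fcal(1)[OF X t] fcal_def distrib_left distrib_right cs_commute[of _ "dg n e (\<lambda>_. 1)", symmetric] cs_mult_dg dg_mult_dg[OF on] dg_add
    by (simp_all add: w)
  have RV: "R * V = cs z * (C * V)" using V(1) RP(1) by (metis P_def mult.assoc)
  have VR: "V * R = cs z * (V * C)"
  proof -
    have "V * R = V * (cs z * C)" using V(2) RP(2) by (metis P_def mult.assoc)
    then show ?thesis by (metis cs_commute mult.assoc)
  qed
  obtain q where q: "p = Suc q" using p by (cases p) auto
  have "(R * V) ^ p * R = (R * V) ^ q * R * (V * R)" unfolding q power_Suc2 by (simp add: mult.assoc)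
  also have "... = cs z * ((R * V) ^ q * R * V * C)" unfolding VR by (metis cs_commute mult.assoc)
  also have "... = cs z * ((R * V) ^ p * C)" unfolding q power_Suc2 by (simp add: mult.assoc)
  also have "... = cs (z ^ (p + 1)) * ((C * V) ^ p * C)"
    unfolding RV cs_mult_power by (simp add: mult.assoc[symmetric] cs_simps)
  finally show ?thesis by (simp add: R_def C_def z_def)
qed

lemma norm_rprod_le:
  assumes V: "sa V" and t: "t \<noteq> 0" and X: "sa X"
  shows "norm (rprod t V k X) \<le> (1 / \<bar>t\<bar>) ^ Suc k * norm V ^ k"
  using X
proof (induction k arbitrary: X)
  case (Suc k)
  have "norm (rprod t V (Suc k) X) \<le> norm (rsv t X) * norm V * norm (rprod t V k (X + V))"
    unfolding rprod.simps by (rule order_trans[OF norm_mult_ineq]) (intro mult_right_mono norm_mult_ineq norm_ge_zero)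
  also have "... \<le> 1 / \<bar>t\<bar> * norm V * ((1 / \<bar>t\<bar>) ^ Suc k * norm V ^ k)"
    by (intro mult_mono Suc.IH sa_add Suc.prems V norm_rsv_le t) auto
  finally show ?case by (simp add: mult_ac)
qed (simp add: norm_rsv_le[OF _ t])

text \<open>The \<open>j + 1\<close> resolvents of \<open>rprod\<close> are moved to the point
  \<open>X\<close>, each over at most \<open>i + j\<close> steps of length \<open>norm V\<close>;
  this accounts for the factor (i + j) (j + 1).\<close>

lemma norm_rprod_diff:
  assumes V: "sa V" and t: "t \<noteq> 0" and X: "sa X" and Y: "sa Y" "Y = X + real i *\<^sub>R V"
  shows "norm (rprod t V j Y - (rsv t X * V) ^ j * rsv t X) \<le> real ((i + j) * (j + 1)) * ((1 / \<bar>t\<bar>) ^ (j + 2) * norm V ^ (j + 1))"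
  using Y
proof (induction j arbitrary: Y i)
  have RY: "norm (rsv t Y - rsv t X) \<le> real i * ((1 / \<bar>t\<bar>)\<^sup>2 * norm V)" if "sa Y" "Y = X + real i *\<^sub>R V" for Y i
  proof -
    have "norm (rsv t Y - rsv t X) \<le> norm (rsv t X) * norm (X - Y) * norm (rsv t Y)"
      unfolding rsv_diff[OF X that(1) t] by (rule order_trans[OF norm_mult_ineq]) (intro mult_right_mono norm_mult_ineq norm_ge_zero)
    also have "... \<le> 1 / \<bar>t\<bar> * (real i * norm V) * (1 / \<bar>t\<bar>)"
      by (intro mult_mono norm_rsv_le t X that(1)) (auto simp: that(2))
    finally show ?thesis by (simp add: power2_eq_square mult_ac)
  qed
  {
    case 0
    then show ?case using RY[OF 0] by (simp add: power2_eq_square)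
  next
    case (Suc j)
    define r v where "r = 1 / \<bar>t\<bar>" and "v = norm V"
    have rv: "0 \<le> r" "0 \<le> v" by (simp_all add: r_def v_def)
    define A B where "A = rprod t V j (Y + V)" and "B = (rsv t X * V) ^ j * rsv t X"
    have YV: "sa (Y + V)" "Y + V = X + real (Suc i) *\<^sub>R V" using Suc.prems V by (auto intro: sa_add simp: algebra_simps)
    have "rprod t V (Suc j) Y - (rsv t X * V) ^ Suc j * rsv t X = (rsv t Y - rsv t X) * V * A + rsv t X * V * (A - B)"
      by (simp add: A_def B_def algebra_simps)
    also have "norm ... \<le> norm (rsv t Y - rsv t X) * norm V * norm A + norm (rsv t X) * norm V * norm (A - B)"
      by (rule norm_triangle_le, rule add_mono) (rule order_trans[OF norm_mult_ineq], intro mult_right_mono norm_mult_ineq norm_ge_zero)+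
    also have "... \<le> (real i * (r\<^sup>2 * v)) * v * (r ^ Suc j * v ^ j)
        + r * v * (real ((Suc i + j) * (j + 1)) * (r ^ (j + 2) * v ^ (j + 1)))"
      unfolding r_def v_def A_def B_def
      by (intro add_mono mult_mono RY Suc.prems norm_rprod_le V t YV norm_rsv_le X Suc.IH) auto
    also have "... = real (i + (Suc i + j) * (j + 1)) * (r ^ (Suc j + 2) * v ^ (Suc j + 1))"
      by (simp add: algebra_simps power2_eq_square)
    also have "... \<le> real ((i + Suc j) * (Suc j + 1)) * (r ^ (Suc j + 2) * v ^ (Suc j + 1))"
      by (intro mult_right_mono of_nat_mono) (use rv in \<open>auto simp: algebra_simps\<close>)
    finally show ?case by (simp only: r_def v_def)
  }
qed

text \<open>The error has degree p + 1 in \<open>V\<close>: \<open>p\<close> operator norms and one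
  trace norm. Neither is compared with the p-norm; the surplus degree alone makes the error vanish
  when \<open>V\<close> is divided into ever smaller steps.\<close>

lemma tr_rprod_diff:
  assumes V: "sa V" and t: "t \<noteq> 0" and X: "sa X" and p: "p \<ge> 1"
  shows "cmod (tr (rprod t V p X) - tr ((rsv t X * V) ^ p * rsv t X)) \<le> (real p)\<^sup>2 * (1 / \<bar>t\<bar>) ^ (p + 2) * norm V ^ p * sn 1 V"
proof -
  obtain q where q: "p = Suc q" using p by (cases p) auto
  have frV: "fr V" using V by (simp add: sa_def)
  define Y where "Y = rprod t V q (X + V) - (rsv t X * V) ^ q * rsv t X"
  have "tr (rprod t V p X) - tr ((rsv t X * V) ^ p * rsv t X) = tr (rprod t V p X - (rsv t X * V) ^ p * rsv t X)"
    by (rule tr_diff[symmetric]) (use frV in \<open>simp_all add: q fr_mult_left fr_mult_right\<close>)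
  also have "rprod t V p X - (rsv t X * V) ^ p * rsv t X = rsv t X * V * Y"
    by (simp add: q Y_def algebra_simps)
  finally have "cmod (tr (rprod t V p X) - tr ((rsv t X * V) ^ p * rsv t X)) = cmod (tr (rsv t X * V * Y))" by simp
  also have "... \<le> sn 1 (rsv t X * V * Y)" by (rule trace_le_sn1) (use frV in \<open>simp add: fr_mult_left fr_mult_right\<close>)
  also have "... \<le> norm (rsv t X) * norm Y * sn 1 V" by (rule sn_ideal[OF frV]) simp
  also have "... \<le> 1 / \<bar>t\<bar> * (real ((1 + q) * (q + 1)) * ((1 / \<bar>t\<bar>) ^ (q + 2) * norm V ^ (q + 1))) * sn 1 V"
    unfolding Y_def
    by (intro mult_right_mono mult_mono norm_rsv_le t X norm_rprod_diff V sa_add) (auto simp: schatten_norm_spow)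
  also have "... = (real p)\<^sup>2 * (1 / \<bar>t\<bar>) ^ (p + 2) * norm V ^ p * sn 1 V"
  proof -
    have "(real p)\<^sup>2 = real ((1 + q) * (q + 1))" by (simp add: q power2_eq_square algebra_simps)
    then show ?thesis by (simp only: q power_Suc add_Suc mult_ac) simp
  qed
  finally show ?thesis .
qed

lemma difn_shift: "difn k V (\<lambda>X. f (X + W)) X = difn k V f (X + W)"
  by (induction k arbitrary: X) (simp_all add: dif_def add_ac)

text \<open>A step by 2 U is two steps by U, so a first difference is a sum of two translates;
  iterating gives 2^k terms.\<close>

lemma difn_double:
  fixes f :: "'v::ab_group_add \<Rightarrow> 'w::real_normed_vector"
  assumes S: "\<And>X. X \<in> S \<Longrightarrow> X + U \<in> S" and bd: "\<And>X. X \<in> S \<Longrightarrow> norm (difn k U f X) \<le> B" and X: "X \<in> S"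
  shows "norm (difn k (U + U) f X) \<le> 2 ^ k * B"
  using bd X
proof (induction k arbitrary: f X)
  case (Suc k)
  define g where "g = dif U f"
  have g: "norm (difn k U g Y) \<le> B" if "Y \<in> S" for Y using Suc.prems(1)[OF that] by (simp add: g_def funpow_swap1)
  have "difn (Suc k) (U + U) f X = difn k (U + U) (dif (U + U) f) X" by (simp add: funpow_swap1)
  also have "dif (U + U) f = (\<lambda>X. g (X + U) + g X)" by (simp add: g_def dif_def add.assoc fun_eq_iff)
  also have "difn k (U + U) ... X = difn k (U + U) g (X + U) + difn k (U + U) g X" by (simp add: difn_add difn_shift)
  also have "norm ... \<le> 2 ^ k * B + 2 ^ k * B"
    by (rule norm_triangle_le, rule add_mono) (intro Suc.IH g S Suc.prems(2); assumption)+
  also have "... = 2 ^ Suc k * B" by simp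
  finally show ?case .
qed simp

text \<open>To first order in \<open>U\<close>, all the resolvents in the difference may be taken at the same point.\<close>

lemma difn_Kfun_odd:
  fixes p k :: nat
  assumes p: "p = 2 * k + 1" "k \<ge> 1"
  obtains C where "C \<ge> 0" "\<And>(a::real) (U :: 'a::complex_hilbert_space cop) X. a \<ge> 0 \<Longrightarrow> sa U \<Longrightarrow> sa X \<Longrightarrow>
    cmod (difn p U (Kfun k (real p) a) X) \<le> C * spw (real p) U
      + 2 * a * (exp a ^ (2 * p + 3) * fact p * (real p)\<^sup>2 * norm U ^ p * sn 1 U)"
proof -
  have p2: "p \<ge> 2" and p1: "p \<ge> 1" using p by auto
  obtain K where K: "K \<ge> 0" and KB: "\<forall>n (e :: nat \<Rightarrow> 'a) l V a b. on_fam {..<n} e \<longrightarrow> fr V \<longrightarrow> a \<le> b \<longrightarrow>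
    continuous_on offR (\<lambda>w. tr ((rcs n e l w * V) ^ p * rcs n e l w)) \<and>
    cmod (ctr (\<lambda>w. tr ((rcs n e l w * V) ^ p * rcs n e l w)) a b) \<le> K * spw (real p) V"
    using ctr_resolvent_power[OF p2, where ?'a = 'a] by (elim exE conjE) (rule that)
  show thesis
  proof (rule that[of "fact p * K"])
    fix a :: real and U X :: "'a cop" assume a: "a \<ge> 0" and U: "sa U" and X: "sa X"
    have frU: "fr U" using U by (simp add: sa_def)
    obtain B where B: "onset B" "finite B" "proj B * X = X" "proj B * U = U"
      using common_range_proj[of X U] X U by (auto simp: sa_def)
    obtain n e l where eig: "eig n e l X" and P: "dg n e (\<lambda>_. 1) = proj B"
      by (rule eig_exists[OF X B(1-3)])
    have on: "on_fam {..<n} e" using eig by (simp add: eig_def)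
    have UP: "U * proj B = U" using arg_cong[OF B(4), of adj] U by (simp add: adj_simps sa_def)
    define g where "g = (\<lambda>w. tr ((rcs n e l w * U) ^ p * rcs n e l w))"
    have g: "continuous_on offR g" "cmod (ctr g (-a) a) \<le> K * spw (real p) U"
      using KB[rule_format, OF on frU, of "-a" a l] a unfolding g_def by auto
    define \<epsilon> where "\<epsilon> = (\<lambda>t. tr (rprod t U p X) - tr ((rsv t X * U) ^ p * rsv t X))"
    \<comment> \<open>Because p + 1 is even, (-1 / w)^(p + 1) is the same at \<i> t and -\<i> t. The
      two resolvent traces then combine to the integrand of \<open>ctr\<close>, and |t|^(p + 1)
      cancels the weight of the integral.\<close>
    have pk: "p + 1 = 2 * (k + 1)" using p by simp
    have main: "tr ((rsv t X * U) ^ p * rsv t X) = (-1) ^ (k + 1) / of_real \<bar>t\<bar> ^ (p + 1) * g (\<i> * of_real t)" if t: "t \<noteq> 0" for t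
    proof -
      have "(- 1 / (\<i> * complex_of_real t)) ^ (p + 1) = ((- 1 / (\<i> * complex_of_real t))\<^sup>2) ^ (k + 1)"
        by (simp only: pk power_mult)
      also have "(- 1 / (\<i> * complex_of_real t))\<^sup>2 = - 1 / (of_real t)\<^sup>2" by (simp add: power_divide power_mult_distrib)
      also have "(of_real t)\<^sup>2 = (complex_of_real \<bar>t\<bar>)\<^sup>2" by (simp flip: of_real_power)
      also have "(- 1 / (complex_of_real \<bar>t\<bar>)\<^sup>2) ^ (k + 1) = (-1) ^ (k + 1) / of_real \<bar>t\<bar> ^ (p + 1)"
        by (simp only: power_divide power_mult[symmetric] pk)
      finally have z: "(- 1 / (\<i> * complex_of_real t)) ^ (p + 1) = (-1) ^ (k + 1) / of_real \<bar>t\<bar> ^ (p + 1)" .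
      have "fr ((dg n e d * U) ^ p * dg n e d)" for d by (rule fr_mult_left) (rule fr_dg)
      then show ?thesis
        unfolding resolvent_power_dg[OF eig _ _ t p1 refl, unfolded P, OF B(4) UP] z g_def by (simp only: tr_cs)
    qed
    have q: "2 * real k < real p" "real p < 2 * real k + 2" "2 * k < p" using p by auto
    let ?f = "\<lambda>u. difn p U (kint k (real p) u) X"
    note D = difn_Kfun[OF q(1,2) U X q(3), of a]
    have f: "?f u = - fact p / (2 * \<i>) * (g (\<i> * of_real (exp u)) - g (- \<i> * of_real (exp u)))
        + - fact p * (-1) ^ (k + 1) / (2 * \<i>) * of_real (exp u ^ (p + 1)) * (\<epsilon> (exp u) - \<epsilon> (- exp u))" for u
    proof -
      have trD: "tr (difn p U (rsv t) X) = - fact p * ((-1) ^ (k + 1) / of_real \<bar>t\<bar> ^ (p + 1) * g (\<i> * of_real t) + \<epsilon> t)" if t: "t \<noteq> 0" for t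
      proof -
        have "(-1::real) ^ p = -1" using p by simp
        then have "tr (difn p U (rsv t) X) = - fact p * tr (rprod t U p X)"
          unfolding difn_rsv[OF U t X] using tr_scaleR[OF fr_rprod[OF frU p1], of "(-1) ^ p * fact p" t X] by simp
        then show ?thesis unfolding main[OF t, symmetric] \<epsilon>_def by simp
      qed
      have "exp u powr (real p + 1) = exp u ^ (p + 1)" using powr_realpow[of "exp u" "p + 1"] by (simp add: add.commute)
      then have "?f u = (-1) ^ (k + 1) * of_real (exp u ^ (p + 1)) / (2 * \<i>) *
        (- fact p * ((-1) ^ (k + 1) / of_real (exp u) ^ (p + 1) * g (\<i> * of_real (exp u)) + \<epsilon> (exp u))
         - - fact p * ((-1) ^ (k + 1) / of_real (exp u) ^ (p + 1) * g (- \<i> * of_real (exp u)) + \<epsilon> (- exp u)))"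
        using spec[OF conjunct2[OF conjunct2[OF D]], of u] trD[of "exp u"] trD[of "- exp u"] by simp
      also have "... = ((-1) ^ (k + 1) * (-1) ^ (k + 1)) * (of_real (exp u) ^ (p + 1) / of_real (exp u) ^ (p + 1)) *
          (- fact p / (2 * \<i>) * (g (\<i> * of_real (exp u)) - g (- \<i> * of_real (exp u))))
        + - fact p * (-1) ^ (k + 1) / (2 * \<i>) * of_real (exp u ^ (p + 1)) * (\<epsilon> (exp u) - \<epsilon> (- exp u))"
        unfolding of_real_power by (simp add: field_simps)
      also have "(-1) ^ (k + 1) * (-1) ^ (k + 1) = (1::complex)" by (simp flip: power_mult_distrib)
      finally show ?thesis by simp
    qed
    \<comment> \<open>A crude bound for the error on -a \<le> u \<le> a: the power p + 1 of exp a
      comes from the weight, the power p + 2 from those of 1 / |t|.\<close>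
    define E where "E = exp a ^ (2 * p + 3) * fact p * (real p)\<^sup>2 * norm U ^ p * sn 1 U"
    define h where "h = (\<lambda>u. - fact p / (2 * \<i>) * (g (\<i> * of_real (exp u)) - g (- \<i> * of_real (exp u))))"
    have hi: "h integrable_on {-a..a}"
      unfolding h_def by (intro integrable_on_mult_right integrable_diff ctr_integrable g)
    have fi: "?f integrable_on {-a..a}" using D by blast
    have "norm (integral {-a..a} (\<lambda>u. ?f u - h u)) \<le> integral {-a..a} (\<lambda>u. E)"
    proof (rule integral_norm_bound_integral)
      show "(\<lambda>u. ?f u - h u) integrable_on {-a..a}" by (intro integrable_diff fi hi)
      fix u assume u: "u \<in> {-a..a}"
      define G where "G = (real p)\<^sup>2 * exp a ^ (p + 2) * norm U ^ p * sn 1 U"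
      have e: "cmod (\<epsilon> t) \<le> G" if "\<bar>t\<bar> = exp u" for t
      proof -
        have t: "t \<noteq> 0" using that by auto
        have "1 / \<bar>t\<bar> \<le> exp a" unfolding that using u by (simp add: exp_minus[symmetric] inverse_eq_divide[symmetric])
        then have "(real p)\<^sup>2 * (1 / \<bar>t\<bar>) ^ (p + 2) * norm U ^ p * sn 1 U \<le> G"
          unfolding G_def by (intro mult_right_mono mult_left_mono power_mono) auto
        then show ?thesis unfolding \<epsilon>_def using tr_rprod_diff[OF U t X p1] by simp
      qed
      have G0: "0 \<le> G" by (simp add: G_def)
      have "norm (?f u - h u) = fact p / 2 * exp u ^ (p + 1) * cmod (\<epsilon> (exp u) - \<epsilon> (- exp u))"
        unfolding f h_def by (simp add: norm_mult norm_divide norm_power)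
      also have "... \<le> fact p / 2 * exp a ^ (p + 1) * (G + G)"
      proof (intro mult_mono power_mono)
        show "cmod (\<epsilon> (exp u) - \<epsilon> (- exp u)) \<le> G + G" by (rule norm_triangle_le_diff) (intro add_mono e; simp)
      qed (use u G0 in auto)
      also have "... = E"
      proof -
        have "2 * p + 3 = (p + 1) + (p + 2)" by simp
        then have "exp a ^ (2 * p + 3) = exp a ^ (p + 1) * exp a ^ (p + 2)" by (simp only: power_add)
        then show ?thesis by (simp add: E_def G_def)
      qed
      finally show "norm (?f u - h u) \<le> E" .
    qed (rule integrable_const_ivl)
    also have "... = 2 * a * E" using a by simp
    finally have 1: "cmod (integral {-a..a} ?f - integral {-a..a} h) \<le> 2 * a * E"
      by (simp only: integral_diff[OF fi hi])
    have "integral {-a..a} h = - fact p / (2 * \<i>) * ctr g (-a) a"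
      unfolding h_def ctr_def by (rule integral_mult_right)
    then have "cmod (integral {-a..a} h) = cmod (- fact p / (2 * \<i>) * ctr g (-a) a)" by (rule arg_cong)
    also have "... = fact p / 2 * cmod (ctr g (-a) a)" by (simp add: norm_mult norm_divide)
    also have "... \<le> fact p * (K * spw (real p) U)" using g(2) by (intro mult_mono) (auto simp: order_trans[OF norm_ge_zero])
    finally have 2: "cmod (integral {-a..a} h) \<le> fact p * K * spw (real p) U" by simp
    have "cmod (integral {-a..a} ?f) \<le> fact p * K * spw (real p) U + 2 * a * E"
      using norm_triangle_sub[of "integral {-a..a} ?f" "integral {-a..a} h"] 1 2 by linarith
    then show "cmod (difn p U (Kfun k (real p) a) X) \<le> fact p * K * spw (real p) U
        + 2 * a * (exp a ^ (2 * p + 3) * fact p * (real p)\<^sup>2 * norm U ^ p * sn 1 U)"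
      unfolding conjunct1[OF conjunct2[OF D]] E_def .
  qed (use K in simp)
qed

text \<open>With \<open>a\<close> fixed, \<open>V\<close> is divided into 2^m equal steps. Doubling
  m times costs 2^(m p), which the degree \<open>p\<close> of the main term compensates exactly; the
  error, of degree p + 1, retains a factor 2^(-m). Only then may \<open>a\<close> tend to
  infinity.\<close>

lemma difn_spw_odd:
  fixes p k :: nat
  assumes p: "p = 2 * k + 1" "k \<ge> 1"
  shows "\<exists>C\<ge>0. \<forall>V X::'a::complex_hilbert_space cop. sa V \<longrightarrow> sa X \<longrightarrow> \<bar>difn p V (spw (real p)) X\<bar> \<le> C * spw (real p) V"
proof -
  obtain C where C: "C \<ge> 0" "\<And>(a::real) (U :: 'a cop) X. a \<ge> 0 \<Longrightarrow> sa U \<Longrightarrow> sa X \<Longrightarrow>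
    cmod (difn p U (Kfun k (real p) a) X) \<le> C * spw (real p) U
      + 2 * a * (exp a ^ (2 * p + 3) * fact p * (real p)\<^sup>2 * norm U ^ p * sn 1 U)"
    using difn_Kfun_odd[OF p] by metis
  have q: "2 * real k < real p" "real p < 2 * real k + 2" using p by auto
  show ?thesis
  proof (rule difn_spw_le[OF q])
    fix a :: real and X V :: "'a cop" assume a: "a \<ge> 0" and V: "sa V" and X: "sa X"
    have frV: "fr V" using V by (simp add: sa_def)
    define c where "c = 2 * a * (exp a ^ (2 * p + 3) * fact p * (real p)\<^sup>2 * norm V ^ p * sn 1 V)"
    have dbl: "cmod (difn p (2 ^ m *\<^sub>R U) (Kfun k (real p) a) X) \<le> (2 ^ m) ^ p * b"
      if "sa U" "sa X" "\<And>Y. sa Y \<Longrightarrow> cmod (difn p U (Kfun k (real p) a) Y) \<le> b" for m b and U X :: "'a cop"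
      using that(2)
    proof (induction m arbitrary: X)
      case 0
      then show ?case using that(3) by simp
    next
      case (Suc m)
      have "cmod (difn p (2 ^ m *\<^sub>R U + 2 ^ m *\<^sub>R U) (Kfun k (real p) a) X) \<le> 2 ^ p * ((2 ^ m) ^ p * b)"
        by (rule difn_double[where S = "{Y. sa Y}"]) (use Suc that(1) in \<open>auto intro: sa_add sa_scaleR\<close>)
      then show ?case by (simp add: scaleR_2[symmetric] power_mult_distrib mult.assoc)
    qed
    have "cmod (difn p V (Kfun k (real p) a) X) \<le> C * spw (real p) V + c * (1 / 2) ^ m" for m
    proof -
      define U where "U = (1 / 2 ^ m) *\<^sub>R V"
      have U: "sa U" using V by (simp add: U_def sa_scaleR)
      have "cmod (difn p (2 ^ m *\<^sub>R U) (Kfun k (real p) a) X) \<le> (2 ^ m) ^ p * (C * spw (real p) U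
          + 2 * a * (exp a ^ (2 * p + 3) * fact p * (real p)\<^sup>2 * norm U ^ p * sn 1 U))"
        by (rule dbl[OF U X]) (rule C(2)[OF a U])
      also have "spw (real p) U = (1 / 2 ^ m) ^ p * spw (real p) V"
        unfolding U_def using p by (subst spw_scaleR[OF frV]) (auto simp: powr_realpow simp del: of_nat_Suc of_nat_add)
      also have "sn 1 U = (1 / 2 ^ m) * sn 1 V"
        unfolding U_def by (subst sn_scaleR[OF frV]) auto
      also have "norm U ^ p = (1 / 2 ^ m) ^ p * norm V ^ p" by (simp add: U_def power_divide)
      also have "(2 ^ m) ^ p * (C * ((1 / 2 ^ m) ^ p * spw (real p) V)
          + 2 * a * (exp a ^ (2 * p + 3) * fact p * (real p)\<^sup>2 * ((1 / 2 ^ m) ^ p * norm V ^ p) * (1 / 2 ^ m * sn 1 V)))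
          = C * spw (real p) V + c * (1 / 2) ^ m"
        by (simp add: c_def distrib_left power_one_over)
      finally show ?thesis by (simp add: U_def)
    qed
    moreover have "(\<lambda>m. C * spw (real p) V + c * (1 / 2) ^ m) \<longlonglongrightarrow> C * spw (real p) V + c * 0"
      by (intro tendsto_intros LIMSEQ_realpow_zero) auto
    ultimately show "cmod (difn p V (Kfun k (real p) a) X) \<le> C * spw (real p) V"
      using LIMSEQ_le_const[of "\<lambda>m. C * spw (real p) V + c * (1 / 2) ^ m"] by auto
  qed
qed

theorem difn_spw_bound:
  assumes p: "1 < p" "real m < p" "p \<le> real m + 1"
  shows "\<exists>C\<ge>0. \<forall>V X::'a::complex_hilbert_space cop. sa V \<longrightarrow> sa X \<longrightarrow> \<bar>difn (m + 1) V (spw p) X\<bar> \<le> C * spw p V"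
proof (cases "p = real (m + 1)")
  case True
  show ?thesis
  proof (cases "even (m + 1)")
    case True
    then show ?thesis using difn_spw_even[of "m + 1" p] \<open>p = real (m + 1)\<close> by simp
  next
    case False
    then obtain k where k: "m + 1 = 2 * k + 1" by (metis oddE)
    then show ?thesis using difn_spw_odd[of "m + 1" k] p(1) \<open>p = real (m + 1)\<close> by auto
  qed
next
  case False
  \<comment> \<open>With k = m div 2 one has 2 k \<le> m < p < m + 1 \<le> 2 k + 2, so the integral
    representation applies.\<close>
  have m: "2 * (m div 2) \<le> m" "m + 1 \<le> 2 * (m div 2) + 2" by presburger+
  then have "real (2 * (m div 2)) \<le> real m" "real (m + 1) \<le> real (2 * (m div 2) + 2)" by (simp_all only: of_nat_le_iff)
  then show ?thesis using difn_spw_nonint[of "m div 2" p "m + 1"] p False m by simp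
qed

subsection \<open>Mixed differences\<close>

interpretation dif: comp_fun_commute dif
  by standard (auto simp: dif_def fun_eq_iff algebra_simps)

text \<open>Differences commute, so the increments form a multiset; the forms built from them are
  symmetric from the outset.\<close>

definition md :: "'v::ab_group_add multiset \<Rightarrow> ('v \<Rightarrow> 'w::ab_group_add) \<Rightarrow> 'v \<Rightarrow> 'w"
  where "md A G = fold_mset dif G A"

lemma md_empty [simp]: "md {#} G = G"
  by (simp add: md_def)

lemma md_add_mset: "md (add_mset V A) G = md A (dif V G)"
  unfolding md_def by (simp add: dif.fold_mset_fun_left_comm)

lemma md_add_mset': "md (add_mset V A) G X = md A G (X + V) - md A G X"
  unfolding md_def by (simp add: dif_def)

lemma md_cong_on:
  assumes "\<And>X. X \<in> S \<Longrightarrow> f X = g X" "\<And>X V. X \<in> S \<Longrightarrow> V \<in># A \<Longrightarrow> X + V \<in> S" "X \<in> S"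
  shows "md A f X = md A g X"
  using assms(2,3) by (induction A arbitrary: X) (simp_all add: assms(1) md_add_mset')

lemma md_diff: "md A (\<lambda>X. f X - g X) X = md A f X - md A g X"
  by (induction A arbitrary: X) (simp_all add: md_add_mset')

lemma md_const: "md A (\<lambda>_. c) X = (if A = {#} then c else 0)"
  by (induction A arbitrary: X) (simp_all add: md_add_mset')

lemma md_sum: "md A (\<lambda>X. \<Sum>i\<in>I. f i X) X = (\<Sum>i\<in>I. md A (f i) X)"
  by (induction A arbitrary: X) (simp_all add: md_add_mset' sum_subtractf)

lemma md_cmult: "md A (\<lambda>X. c * f X) X = c * (md A f X :: real)"
  by (induction A arbitrary: X) (simp_all add: md_add_mset' right_diff_distrib)

lemma md_shift: "md A (\<lambda>X. f (X - H)) X = md A f (X - H)"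
  by (induction A arbitrary: X) (simp_all add: md_add_mset' algebra_simps)

text \<open>The defect of additivity in one increment is a mixed difference of the next order, hence
  negligible when that order is controlled.\<close>

lemma md_polarize:
  "md (add_mset (U + W) A) G X = md (add_mset U (add_mset W A)) G X + md (add_mset U A) G X + md (add_mset W A) G X"
  by (simp add: md_add_mset' algebra_simps)

lemma md_subsets:
  fixes f :: "'v::ab_group_add \<Rightarrow> real"
  assumes "finite I"
  shows "md (image_mset h (mset_set I)) f x = (\<Sum>E\<in>Pow I. (-1) ^ card I * (-1) ^ card E * f (x + sum h E))"
  using assms
proof (induction I arbitrary: x rule: finite_induct)
  case (insert i I)
  have inj: "inj_on (insert i) (Pow I)" using insert(2) by (auto simp: inj_on_def)
  have c: "(\<Sum>E\<in>insert i ` Pow I. (-1) ^ card (insert i I) * (-1) ^ card E * f (x + sum h E))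
      = (\<Sum>E\<in>Pow I. (-1) ^ card I * (-1) ^ card E * f (x + h i + sum h E))"
    unfolding sum.reindex[OF inj] o_def
  proof (intro sum.cong refl)
    fix E assume "E \<in> Pow I"
    then have "finite E" "i \<notin> E" using insert(1,2) finite_subset by auto
    then show "(-1) ^ card (insert i I) * (-1) ^ card (insert i E) * f (x + sum h (insert i E))
        = (-1) ^ card I * (-1) ^ card E * f (x + h i + sum h E)"
      using insert(1,2) by (simp add: add.assoc)
  qed
  have "(\<Sum>E\<in>Pow (insert i I). (-1) ^ card (insert i I) * (-1) ^ card E * f (x + sum h E))
      = (\<Sum>E\<in>Pow I. (-1) ^ card (insert i I) * (-1) ^ card E * f (x + sum h E))
      + (\<Sum>E\<in>insert i ` Pow I. (-1) ^ card (insert i I) * (-1) ^ card E * f (x + sum h E))"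
    unfolding Pow_insert using insert(1,2) by (intro sum.union_disjoint) auto
  also have "... = md (image_mset h (mset_set I)) f (x + h i) - md (image_mset h (mset_set I)) f x"
    unfolding c insert.IH using insert(1,2) by (simp add: sum_negf)
  finally show ?case using insert(1,2) by (simp add: md_add_mset')
qed simp

lemma difn_binomial:
  fixes f :: "'v::real_vector \<Rightarrow> real"
  shows "difn n a f y = (\<Sum>i\<le>n. (-1) ^ n * (-1) ^ i * real (n choose i) * f (y + real i *\<^sub>R a))"
proof (induction n arbitrary: y)
  case (Suc n)
  define g where "g = (\<lambda>i. (-1) ^ i * f (y + real i *\<^sub>R a))"
  have 1: "difn n a f y = (-1) ^ n * (\<Sum>i\<le>Suc n. real (n choose i) * g i)"
    unfolding Suc g_def by (simp add: sum_distrib_left mult_ac binomial_eq_0)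
  have 2: "difn n a f (y + a) = (-1) ^ Suc n * (\<Sum>i\<le>n. real (n choose i) * g (Suc i))"
    unfolding Suc g_def sum_distrib_left by (intro sum.cong refl) (simp add: algebra_simps)
  have "difn (Suc n) a f y = (-1) ^ Suc n * (\<Sum>i\<le>Suc n. real (Suc n choose i) * g i)"
    unfolding difn_Suc 1 2 sum.atMost_Suc_shift by (simp add: algebra_simps sum.distrib)
  then show ?case by (simp only: g_def sum_distrib_left mult_ac)
qed simp

text \<open>In the \<open>i\<close>-th term of the binomial expansion of the right-hand side, \<open>i > 0\<close>, the increment with
  index \<open>i\<close> becomes zero, so only \<open>i = 0\<close> contributes.\<close>

lemma md_eq_difn:
  fixes f :: "'v::real_vector \<Rightarrow> real"
  shows "md (image_mset h (mset_set {1..n})) f x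
    = (\<Sum>E\<in>Pow {1..n}. (-1) ^ card E * difn n (\<Sum>j\<in>E. (- 1 / real j) *\<^sub>R h j) f (x + sum h E))"
proof -
  let ?h = "\<lambda>i j. (1 - real i / real j) *\<^sub>R h j"
  have e: "x + sum h E + real i *\<^sub>R (\<Sum>j\<in>E. (- 1 / real j) *\<^sub>R h j) = x + sum (?h i) E" for E i
    by (simp add: scaleR_sum_right sum.distrib[symmetric] scaleR_diff_left sum_subtractf sum_negf)
  have "(\<Sum>E\<in>Pow {1..n}. (-1) ^ card E * difn n (\<Sum>j\<in>E. (- 1 / real j) *\<^sub>R h j) f (x + sum h E))
      = (\<Sum>E\<in>Pow {1..n}. \<Sum>i\<le>n. (-1) ^ i * real (n choose i) * ((-1) ^ n * (-1) ^ card E * f (x + sum (?h i) E)))"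
    unfolding difn_binomial e sum_distrib_left by (intro sum.cong refl) simp
  also have "... = (\<Sum>i\<le>n. (-1) ^ i * real (n choose i) * md (image_mset (?h i) (mset_set {1..n})) f x)"
    by (subst sum.swap) (simp add: md_subsets sum_distrib_left)
  also have "... = (\<Sum>i\<in>{0}. (-1) ^ i * real (n choose i) * md (image_mset (?h i) (mset_set {1..n})) f x)"
  proof (rule sum.mono_neutral_right)
    show "\<forall>i\<in>{..n} - {0}. (-1) ^ i * real (n choose i) * md (image_mset (?h i) (mset_set {1..n})) f x = 0"
    proof
      fix i assume i: "i \<in> {..n} - {0}"
      then have "?h i i \<in># image_mset (?h i) (mset_set {1..n})" by (intro imageI[of _ "set_mset _", simplified set_image_mset[symmetric]]) simp
      then obtain A where A: "image_mset (?h i) (mset_set {1..n}) = add_mset (?h i i) A" by (metis multi_member_split)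
      have "?h i i = 0" using i by simp
      then have "md (add_mset (?h i i) A) f x = 0" by (simp only: md_add_mset') simp
      then show "(-1) ^ i * real (n choose i) * md (image_mset (?h i) (mset_set {1..n})) f x = 0"
        unfolding A by simp
    qed
  qed auto
  finally show ?thesis by simp
qed

subsection \<open>Symmetric forms and the abstract Taylor theorem\<close>

text \<open>A symmetric form of degree \<open>k\<close> is a function of multisets of size \<open>k\<close>.\<close>

locale power_functional =
  fixes S :: "'v::real_vector set" and F :: "'v \<Rightarrow> real" and p :: real
  assumes S: "subspace S" and p: "p > 0"
    and F_nonneg: "\<And>V. 0 \<le> F V"
    and F_scale: "\<And>c V. V \<in> S \<Longrightarrow> F (c *\<^sub>R V) = \<bar>c\<bar> powr p * F V"
    and F_add: "\<And>V W. V \<in> S \<Longrightarrow> W \<in> S \<Longrightarrow> F (V + W) \<le> 2 powr p * (F V + F W)"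
begin

definition FS :: "'v multiset \<Rightarrow> real"
  where "FS A = (\<Sum>V\<in>#A. F V)"

abbreviation tup :: "nat \<Rightarrow> 'v multiset set"
  where "tup k \<equiv> {A. size A = k \<and> set_mset A \<subseteq> S}"

text \<open>The hypothesis of the descent: beyond degree \<open>k\<close> the differences of
  \<open>G\<close> at \<open>H\<close> are of order F. Subtracting a form of degree \<open>k\<close>
  lowers \<open>k\<close> by one.\<close>

definition small :: "nat \<Rightarrow> ('v \<Rightarrow> real) \<Rightarrow> 'v \<Rightarrow> bool"
  where "small k G H \<longleftrightarrow> (\<forall>j>k. \<exists>C\<ge>0. \<forall>A\<in>tup j. \<bar>md A G H\<bar> \<le> C * FS A)"

text \<open>Local boundedness is what turns additive limits into real-linear and bounded
  forms.\<close>

definition lbd :: "('v \<Rightarrow> real) \<Rightarrow> 'v \<Rightarrow> bool"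
  where "lbd G H \<longleftrightarrow> (\<forall>r. \<exists>B. \<forall>V\<in>S. F V \<le> r \<longrightarrow> \<bar>G (H + V)\<bar> \<le> B)"

definition form :: "nat \<Rightarrow> ('v multiset \<Rightarrow> real) \<Rightarrow> bool"
  where "form k D \<longleftrightarrow> (\<forall>A U W c. size A + 1 = k \<longrightarrow> set_mset A \<subseteq> S \<longrightarrow> U \<in> S \<longrightarrow> W \<in> S \<longrightarrow>
    D (add_mset (U + W) A) = D (add_mset U A) + D (add_mset W A) \<and> D (add_mset (c *\<^sub>R U) A) = c * D (add_mset U A)) \<and>
    (\<exists>C\<ge>0. \<forall>A\<in>tup k. \<bar>D A\<bar> \<le> C * (\<Prod>V\<in>#A. F V powr (1 / p)))"

lemma FS_simps [simp]: "FS {#} = 0" "FS (add_mset V A) = F V + FS A" "FS (A + B) = FS A + FS B"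
  by (simp_all add: FS_def)

lemma FS_nonneg [simp]: "0 \<le> FS A"
  by (induction A) (simp_all add: F_nonneg)

lemma FS_scale: "set_mset A \<subseteq> S \<Longrightarrow> FS (image_mset ((*\<^sub>R) c) A) = \<bar>c\<bar> powr p * FS A"
  by (induction A) (simp_all add: F_scale distrib_left)

lemma S_scale: "V \<in> S \<Longrightarrow> c *\<^sub>R V \<in> S" and S_add: "V \<in> S \<Longrightarrow> W \<in> S \<Longrightarrow> V + W \<in> S"
  using S by (auto simp: subspace_def)

lemma tup_scale: "A \<in> tup k \<Longrightarrow> image_mset ((*\<^sub>R) c) A \<in> tup k"
  using S_scale by auto

lemma lbd_md:
  assumes "lbd G H"
  shows "\<exists>B. \<forall>A\<in>tup j. \<forall>Y\<in>S. (\<forall>V\<in>#A. F V \<le> r) \<longrightarrow> F Y \<le> r \<longrightarrow> \<bar>md A G (H + Y)\<bar> \<le> B"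
proof (induction j arbitrary: r)
  case 0
  then show ?case using assms by (auto simp: lbd_def)
next
  case (Suc j)
  define r' where "r' = max r (2 powr p * (r + r))"
  obtain B where B: "\<And>A Y. A \<in> tup j \<Longrightarrow> Y \<in> S \<Longrightarrow> (\<forall>V\<in>#A. F V \<le> r') \<Longrightarrow> F Y \<le> r' \<Longrightarrow> \<bar>md A G (H + Y)\<bar> \<le> B"
    using Suc[of r'] by blast
  show ?case
  proof (intro exI[of _ "B + B"] ballI impI)
    fix A Y assume A: "A \<in> tup (Suc j)" and Y: "Y \<in> S" "F Y \<le> r" and F: "\<forall>V\<in>#A. F V \<le> r"
    obtain V A' where A': "A = add_mset V A'" using A by (metis (mono_tags, lifting) mem_Collect_eq size_eq_Suc_imp_eq_union)
    have V: "V \<in> S" "A' \<in> tup j" using A by (auto simp: A')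
    have "F (Y + V) \<le> 2 powr p * (F Y + F V)" by (rule F_add[OF Y(1) V(1)])
    also have "... \<le> 2 powr p * (r + r)" using Y(2) F by (intro mult_left_mono add_mono) (auto simp: A')
    finally have "F (Y + V) \<le> r'" by (simp add: r'_def)
    moreover have "F Y \<le> r'" "\<forall>V\<in>#A'. F V \<le> r'" using Y(2) F by (auto simp: r'_def A')
    ultimately have "\<bar>md A' G (H + (Y + V))\<bar> \<le> B" "\<bar>md A' G (H + Y)\<bar> \<le> B"
      using B V Y(1) S_add by auto
    then show "\<bar>md A G (H + Y)\<bar> \<le> B + B" unfolding A' md_add_mset' by (simp add: add.assoc)
  qed
qed

lemma form_powr_bound:
  assumes D: "form k D"
  obtains C where "C \<ge> 0" "\<And>V. V \<in> S \<Longrightarrow> \<bar>D (replicate_mset k V)\<bar> \<le> C * (F V powr (1 / p)) ^ k"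
proof -
  obtain C where C: "C \<ge> 0" "\<And>A. A \<in> tup k \<Longrightarrow> \<bar>D A\<bar> \<le> C * (\<Prod>V\<in>#A. F V powr (1 / p))"
    using D unfolding form_def by blast
  show thesis
  proof (rule that[OF C(1)])
    fix V assume "V \<in> S"
    then have "replicate_mset k V \<in> tup k" by (auto simp: set_mset_replicate_mset_subset)
    from C(2)[OF this] show "\<bar>D (replicate_mset k V)\<bar> \<le> C * (F V powr (1 / p)) ^ k" by simp
  qed
qed

lemma form_add:
  "form k D \<Longrightarrow> size A + 1 = k \<Longrightarrow> set_mset A \<subseteq> S \<Longrightarrow> U \<in> S \<Longrightarrow> W \<in> S \<Longrightarrow>
    D (add_mset (U + W) A) = D (add_mset U A) + D (add_mset W A)"
  unfolding form_def by blast

lemma form_binomial: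
  assumes D: "form k D" and X: "X \<in> S" and V: "V \<in> S"
  shows "i + size W = k \<Longrightarrow> set_mset W \<subseteq> S \<Longrightarrow> D (replicate_mset i (X + V) + W)
    = (\<Sum>l\<le>i. real (i choose l) * D (replicate_mset l X + (replicate_mset (i - l) V + W)))"
proof (induction i arbitrary: W)
  case (Suc i)
  define g where "g = (\<lambda>l. D (replicate_mset l X + (replicate_mset (Suc i - l) V + W)))"
  have XV: "X + V \<in> S" by (rule S_add[OF X V])
  have "D (replicate_mset (Suc i) (X + V) + W) = D (add_mset (X + V) (replicate_mset i (X + V) + W))" by simp
  also have "... = D (add_mset X (replicate_mset i (X + V) + W)) + D (add_mset V (replicate_mset i (X + V) + W))"
    by (rule form_add[OF D]) (use Suc.prems X V XV in \<open>auto dest: in_replicate_mset[THEN iffD1]\<close>)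
  also have "D (add_mset X (replicate_mset i (X + V) + W)) = D (replicate_mset i (X + V) + add_mset X W)" by simp
  also have "... = (\<Sum>l\<le>i. real (i choose l) * D (replicate_mset l X + (replicate_mset (i - l) V + add_mset X W)))"
    by (rule Suc.IH) (use Suc.prems X in auto)
  also have "... = (\<Sum>l\<le>i. real (i choose l) * g (Suc l))" by (simp add: g_def)
  also have "D (add_mset V (replicate_mset i (X + V) + W)) = D (replicate_mset i (X + V) + add_mset V W)" by simp
  also have "... = (\<Sum>l\<le>i. real (i choose l) * D (replicate_mset l X + (replicate_mset (i - l) V + add_mset V W)))"
    by (rule Suc.IH) (use Suc.prems V in auto)
  also have "... = (\<Sum>l\<le>i. real (i choose l) * g l)" by (intro sum.cong refl) (simp add: g_def Suc_diff_le)
  also have "... = (\<Sum>l\<le>Suc i. real (i choose l) * g l)" by (simp add: binomial_eq_0)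
  also have "(\<Sum>l\<le>i. real (i choose l) * g (Suc l)) + ... = (\<Sum>l\<le>Suc i. real (Suc i choose l) * g l)"
    unfolding sum.atMost_Suc_shift by (simp add: sum.distrib algebra_simps)
  finally show ?case by (simp only: g_def)
qed simp

text \<open>Discrete version of the fact that the i-th derivative of a homogeneous polynomial of
  degree i is i! times its polar form. \<open>W\<close> holds arguments that stay fixed; they arise
  from the binomial expansion in the induction.\<close>

lemma md_form:
  assumes D: "form k D"
  shows "i + size W = k \<Longrightarrow> set_mset W \<subseteq> S \<Longrightarrow> set_mset A \<subseteq> S \<Longrightarrow> i \<le> size A \<Longrightarrow> X \<in> S \<Longrightarrow>
    md A (\<lambda>X. D (replicate_mset i X + W)) X = (if size A = i then fact i * D (A + W) else 0)"
proof (induction i arbitrary: A W X rule: less_induct)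
  case (less i)
  show ?case
  proof (cases "A = {#}")
    case False
    then obtain V A' where A: "A = add_mset V A'" by (metis multiset_cases)
    have V: "V \<in> S" "set_mset A' \<subseteq> S" using less.prems by (auto simp: A)
    show ?thesis
    proof (cases i)
      case 0
      then show ?thesis using False by (simp add: md_const)
    next
      case (Suc i')
      let ?f = "\<lambda>l X. D (replicate_mset l X + (replicate_mset (i - l) V + W))"
      have "md A (\<lambda>X. D (replicate_mset i X + W)) X = md A' (\<lambda>X. \<Sum>l<i. real (i choose l) * ?f l X) X"
        unfolding A md_add_mset
      proof (rule md_cong_on[where S = S])
        fix X assume X: "X \<in> S"
        show "dif V (\<lambda>X. D (replicate_mset i X + W)) X = (\<Sum>l<i. real (i choose l) * ?f l X)"
          unfolding dif_def form_binomial[OF D X V(1) less.prems(1,2)] by (simp add: lessThan_Suc_atMost[symmetric])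
      qed (use V S_add less.prems in auto)
      also have "... = (\<Sum>l<i. real (i choose l) * (if size A' = l then fact l * D (A' + (replicate_mset (i - l) V + W)) else 0))"
        unfolding md_sum md_cmult
      proof (intro sum.cong refl arg_cong2[of _ _ _ _ "(*)"])
        fix l assume l: "l \<in> {..<i}"
        show "md A' (?f l) X = (if size A' = l then fact l * D (A' + (replicate_mset (i - l) V + W)) else 0)"
          by (rule less.IH) (use l less.prems V A in \<open>auto dest: in_replicate_mset[THEN iffD1]\<close>)
      qed
      also have "... = (if size A = i then fact i * D (A + W) else 0)"
      proof (cases "size A = i")
        case True
        then have "size A' = i'" using A Suc by simp
        then show ?thesis using True Suc by (simp add: A)
      next
        case False
        then have "size A' \<ge> i" using less.prems(4) by (simp add: A)
        then show ?thesis using False by (auto intro!: sum.neutral)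
      qed
      finally show ?thesis .
    qed
  qed (use less.prems in auto)
qed

text \<open>Subtracting the linear function with the same value at 1 leaves an additive function
  that vanishes on the integers, hence is bounded by its values on [0, 1); a bounded additive
  function is 0.\<close>

lemma additive_bounded_linear:
  fixes g :: "real \<Rightarrow> real"
  assumes add: "\<And>x y. g (x + y) = g x + g y" and bd: "\<And>x. \<bar>x\<bar> \<le> 1 \<Longrightarrow> \<bar>g x\<bar> \<le> B"
  shows "g c = c * g 1"
proof -
  define h where "h = (\<lambda>x. g x - x * g 1)"
  have h: "h (x + y) = h x + h y" for x y by (simp add: h_def add algebra_simps)
  have h0: "h 0 = 0" using h[of 0 0] by simp
  have hm: "h (- x) = - h x" for x using h[of x "- x"] h0 by simp
  have hn: "h (real n * x) = real n * h x" for n x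
    by (induction n) (simp_all add: h0 h distrib_right)
  have h1: "h 1 = 0" by (simp add: h_def)
  have hi: "h (real_of_int z) = 0" for z
  proof (cases z)
    case (nonneg n)
    then show ?thesis using hn[of n 1] h1 by simp
  next
    case (neg n)
    then show ?thesis using hm[of "real (Suc n)"] hn[of "Suc n" 1] h1 by simp
  qed
  have hb: "\<bar>h x\<bar> \<le> B + \<bar>g 1\<bar>" for x
  proof -
    have f: "\<bar>frac x\<bar> \<le> 1" using frac_ge_0[of x] frac_lt_1[of x] by linarith
    have "h x = h (of_int \<lfloor>x\<rfloor> + frac x)" by (simp add: frac_def)
    also have "... = h (frac x)" unfolding h hi by simp
    finally have "h x = g (frac x) - frac x * g 1" by (simp add: h_def)
    moreover have "\<bar>frac x * g 1\<bar> \<le> 1 * \<bar>g 1\<bar>" unfolding abs_mult using f by (intro mult_right_mono) auto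
    ultimately show ?thesis using bd[OF f] by linarith
  qed
  have "h c = 0"
  proof (rule ccontr)
    assume "h c \<noteq> 0"
    then obtain n where "B + \<bar>g 1\<bar> < real n * \<bar>h c\<bar>" using reals_Archimedean3[of "\<bar>h c\<bar>"] by auto
    also have "... = \<bar>h (real n * c)\<bar>" by (simp add: hn abs_mult)
    finally show False using hb[of "real n * c"] by simp
  qed
  then show ?thesis by (simp add: h_def)
qed

text \<open>Doubling one increment doubles the mixed difference up to one of the next order, by
  polarization with two equal increments. The increments in \<open>B\<close> are doubled one at a
  time, those in \<open>A\<close> are left alone.\<close>

lemma md_double:
  assumes k: "k \<ge> 1" and C: "C \<ge> 0" "\<And>A. A \<in> tup (k + 1) \<Longrightarrow> \<bar>md A G H\<bar> \<le> C * FS A"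
  shows "\<exists>C'\<ge>0. \<forall>B A. size B = b \<longrightarrow> B + A \<in> tup k \<longrightarrow>
    \<bar>md (image_mset ((*\<^sub>R) 2) B + A) G H - 2 ^ b * md (B + A) G H\<bar> \<le> C' * FS (B + A)"
proof (induction b)
  case (Suc b)
  obtain C' where C': "C' \<ge> 0" "\<And>B A. size B = b \<Longrightarrow> B + A \<in> tup k \<Longrightarrow>
    \<bar>md (image_mset ((*\<^sub>R) 2) B + A) G H - 2 ^ b * md (B + A) G H\<bar> \<le> C' * FS (B + A)"
    using Suc by blast
  show ?case
  proof (intro exI[of _ "C' * 2 powr p + 2 ^ b * (C * 2)"] conjI allI impI)
    fix B A assume B: "size B = Suc b" and BA: "B + A \<in> tup k"
    obtain U B' where B': "B = add_mset U B'" using B by (metis size_eq_Suc_imp_eq_union)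
    have U: "U \<in> S" using BA by (simp add: B')
    define A' where "A' = add_mset (2 *\<^sub>R U) A"
    have "\<bar>md (image_mset ((*\<^sub>R) 2) B' + A') G H - 2 ^ b * md (B' + A') G H\<bar> \<le> C' * FS (B' + A')"
      by (rule C'(2)) (use B BA S_scale[OF U] in \<open>auto simp: B' A'_def\<close>)
    also have "... \<le> C' * (2 powr p * FS (B + A))"
    proof (rule mult_left_mono[OF _ C'(1)])
      have "1 \<le> 2 powr p" using p by (simp add: ge_one_powr_ge_zero)
      then have "1 * FS (B' + A) \<le> 2 powr p * FS (B' + A)" by (intro mult_right_mono) auto
      then show "FS (B' + A') \<le> 2 powr p * FS (B + A)" by (simp add: A'_def B' F_scale[OF U] distrib_left)
    qed
    finally have 1: "\<bar>md (image_mset ((*\<^sub>R) 2) B + A) G H - 2 ^ b * md (B' + A') G H\<bar> \<le> C' * 2 powr p * FS (B + A)"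
      by (simp add: B' A'_def mult.assoc)
    have "md (B' + A') G H = md (add_mset U (add_mset U (B' + A))) G H + 2 * md (B + A) G H"
      using md_polarize[of U U "B' + A" G H] by (simp add: A'_def B' scaleR_2)
    moreover have "\<bar>md (add_mset U (add_mset U (B' + A))) G H\<bar> \<le> C * FS (add_mset U (add_mset U (B' + A)))"
      by (rule C(2)) (use BA in \<open>auto simp: B'\<close>)
    moreover have "C * FS (add_mset U (add_mset U (B' + A))) \<le> C * (2 * FS (B + A))"
      by (rule mult_left_mono[OF _ C(1)]) (simp add: B')
    ultimately have "\<bar>md (B' + A') G H - 2 * md (B + A) G H\<bar> \<le> C * (2 * FS (B + A))" by linarith
    then have "\<bar>2 ^ b * (md (B' + A') G H - 2 * md (B + A) G H)\<bar> \<le> 2 ^ b * (C * (2 * FS (B + A)))"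
      unfolding abs_mult by simp
    then have 2: "\<bar>2 ^ b * md (B' + A') G H - 2 ^ Suc b * md (B + A) G H\<bar> \<le> 2 ^ b * (C * 2) * FS (B + A)"
      by (simp add: right_diff_distrib mult.assoc)
    show "\<bar>md (image_mset ((*\<^sub>R) 2) B + A) G H - 2 ^ Suc b * md (B + A) G H\<bar> \<le> (C' * 2 powr p + 2 ^ b * (C * 2)) * FS (B + A)"
      unfolding distrib_right using 1 2 by linarith
  qed (use C' C in auto)
qed auto

lemma scale_scale: "image_mset ((*\<^sub>R) a) (image_mset ((*\<^sub>R) b) A) = image_mset ((*\<^sub>R) (a * b)) (A :: 'v multiset)"
  by (simp add: image_mset.compositionality o_def)

text \<open>Successive approximations differ by O(q^n) with q = 2^(k - p), and k < p makes this
  geometric. The same factor q^n kills the defect of additivity. Local boundedness gives homogeneity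
  over the reals and, by rescaling, boundedness as a form.\<close>

lemma top_form:
  assumes k: "k \<ge> 1" "real k < p" and H: "H \<in> S" and G: "small k G H" "lbd G H"
  shows "\<exists>D C. C \<ge> 0 \<and> form k D \<and> (\<forall>A\<in>tup k. \<bar>md A G H - D A\<bar> \<le> C * FS A)"
proof -
  obtain C where C: "C \<ge> 0" "\<And>A. A \<in> tup (k + 1) \<Longrightarrow> \<bar>md A G H\<bar> \<le> C * FS A"
    using G(1)[unfolded small_def, rule_format, of "k + 1"] by auto
  obtain C' where C': "C' \<ge> 0" "\<And>B A. size B = k \<Longrightarrow> B + A \<in> tup k \<Longrightarrow>
    \<bar>md (image_mset ((*\<^sub>R) 2) B + A) G H - 2 ^ k * md (B + A) G H\<bar> \<le> C' * FS (B + A)"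
    using md_double[OF k(1) C, of k] by blast
  define s where "s = (\<lambda>n. (1 / 2 :: real) ^ n)"
  define a where "a = (\<lambda>n A. (2 ^ n) ^ k * md (image_mset ((*\<^sub>R) (s n)) A) G H)"
  define q where "q = 2 ^ k / (2 powr p :: real)"
  have "2 powr real k < 2 powr p" using k(2) by simp
  then have q: "0 < q" "q < 1" by (simp_all add: q_def powr_realpow)
  have sp: "s n powr p = (1 / 2 powr p) ^ n" for n
    by (simp add: s_def power_one_over powr_divide powr_powr flip: powr_realpow) (simp add: mult.commute)
  have qn: "(2 ^ n) ^ k * s n powr p = q ^ n" for n
    unfolding sp q_def by (simp add: power_divide power_mult[symmetric] mult.commute)
  have step: "\<bar>a (Suc n) A - a n A\<bar> \<le> C' * FS A * q ^ n" if A: "A \<in> tup k" for n A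
  proof -
    define A' where "A' = image_mset ((*\<^sub>R) (s (Suc n))) A"
    have A': "size A' = k" "A' + {#} \<in> tup k" using tup_scale[OF A] by (simp_all add: A'_def)
    have e: "image_mset ((*\<^sub>R) 2) A' = image_mset ((*\<^sub>R) (s n)) A" by (simp only: A'_def scale_scale) (simp add: s_def)
    have "a n A - a (Suc n) A = (2 ^ n) ^ k * (md (image_mset ((*\<^sub>R) 2) A') G H - 2 ^ k * md A' G H)"
      unfolding a_def e A'_def[symmetric] by (simp add: right_diff_distrib power_mult_distrib)
    then have "\<bar>a (Suc n) A - a n A\<bar> = (2 ^ n) ^ k * \<bar>md (image_mset ((*\<^sub>R) 2) A') G H - 2 ^ k * md A' G H\<bar>"
      by (simp add: abs_minus_commute abs_mult)
    also have "... \<le> (2 ^ n) ^ k * (C' * FS A')"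
      using C'(2)[OF A'] by (intro mult_left_mono) auto
    also have "... \<le> (2 ^ n) ^ k * (C' * (s n powr p * FS A))"
    proof (intro mult_left_mono C'(1))
      have "FS A' = s (Suc n) powr p * FS A"
        unfolding A'_def by (subst FS_scale) (use A in \<open>auto simp: s_def\<close>)
      also have "... \<le> s n powr p * FS A"
        by (intro mult_right_mono powr_mono2) (use p in \<open>auto simp: s_def\<close>)
      finally show "FS A' \<le> s n powr p * FS A" .
    qed simp
    finally show ?thesis using qn[of n] by (simp add: mult_ac)
  qed
  define D where "D = (\<lambda>A. lim (\<lambda>n. a n A))"
  have a0: "a 0 A = md A G H" for A by (simp add: a_def s_def image_mset_cong[of A "(*\<^sub>R) 1" "\<lambda>x. x"])
  have conv: "(\<lambda>n. a n A) \<longlonglongrightarrow> D A" and approx: "\<bar>md A G H - D A\<bar> \<le> C' / (1 - q) * FS A" if A: "A \<in> tup k" for A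
  proof -
    let ?d = "\<lambda>n. a (Suc n) A - a n A"
    have sg: "summable (\<lambda>n. C' * FS A * q ^ n)" using q by (intro summable_mult summable_geometric) auto
    have sd: "summable (\<lambda>n. norm (?d n))" by (rule summable_comparison_test'[OF sg, of 0]) (use step[OF A] in simp)
    have eq: "(\<lambda>n. a 0 A + sum ?d {..<n}) = (\<lambda>n. a n A)"
      by (rule ext, subst sum_lessThan_telescope[of "\<lambda>n. a n A"]) simp
    have "(\<lambda>n. a 0 A + sum ?d {..<n}) \<longlonglongrightarrow> a 0 A + suminf ?d"
      by (intro tendsto_add tendsto_const summable_LIMSEQ summable_norm_cancel[OF sd])
    then have lim: "(\<lambda>n. a n A) \<longlonglongrightarrow> a 0 A + suminf ?d" unfolding eq .
    then have DA: "D A = a 0 A + suminf ?d" unfolding D_def by (rule limI)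
    show "(\<lambda>n. a n A) \<longlonglongrightarrow> D A" unfolding DA by (rule lim)
    have "\<bar>suminf ?d\<bar> \<le> (\<Sum>n. norm (?d n))" using summable_norm[OF sd] by simp
    also have "... \<le> (\<Sum>n. C' * FS A * q ^ n)" by (rule suminf_le[OF _ sd sg]) (use step[OF A] in simp)
    also have "... = C' / (1 - q) * FS A" using q by (simp add: suminf_mult suminf_geometric)
    finally show "\<bar>md A G H - D A\<bar> \<le> C' / (1 - q) * FS A" by (simp add: DA a0)
  qed
  have add: "D (add_mset (U + W) A) = D (add_mset U A) + D (add_mset W A)"
    if A: "size A + 1 = k" "set_mset A \<subseteq> S" and UW: "U \<in> S" "W \<in> S" for A U W
  proof -
    let ?A = "add_mset U (add_mset W A)"
    have t: "add_mset (U + W) A \<in> tup k" "add_mset U A \<in> tup k" "add_mset W A \<in> tup k" "?A \<in> tup (k + 1)"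
      using A UW S_add by auto
    have lim: "(\<lambda>n. a n (add_mset (U + W) A) - a n (add_mset U A) - a n (add_mset W A)) \<longlonglongrightarrow>
        D (add_mset (U + W) A) - D (add_mset U A) - D (add_mset W A)"
      by (intro tendsto_diff conv t)
    have bd: "\<bar>a n (add_mset (U + W) A) - a n (add_mset U A) - a n (add_mset W A)\<bar> \<le> C * FS ?A * q ^ n" for n
    proof -
      have "a n (add_mset (U + W) A) - a n (add_mset U A) - a n (add_mset W A) = (2 ^ n) ^ k * md (image_mset ((*\<^sub>R) (s n)) ?A) G H"
        unfolding a_def using md_polarize[of "s n *\<^sub>R U" "s n *\<^sub>R W" "image_mset ((*\<^sub>R) (s n)) A" G H]
        by (simp add: scaleR_add_right algebra_simps)
      also have "\<bar>...\<bar> \<le> (2 ^ n) ^ k * (C * FS (image_mset ((*\<^sub>R) (s n)) ?A))"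
        unfolding abs_mult using C(2)[OF tup_scale[OF t(4)], of "s n"] by simp
      also have "FS (image_mset ((*\<^sub>R) (s n)) ?A) = s n powr p * FS ?A"
        by (subst FS_scale) (use t(4) in \<open>auto simp: s_def\<close>)
      finally show ?thesis unfolding qn[of n, symmetric] by (simp add: mult_ac)
    qed
    have qlim: "(\<lambda>n. C * FS ?A * q ^ n) \<longlonglongrightarrow> 0"
      using q tendsto_mult_left[OF LIMSEQ_realpow_zero[of q], of "C * FS ?A"] by simp
    have "(\<lambda>n. a n (add_mset (U + W) A) - a n (add_mset U A) - a n (add_mset W A)) \<longlonglongrightarrow> 0"
      by (rule Lim_null_comparison[OF always_eventually qlim]) (simp only: real_norm_def bd simp_thms)
    from LIMSEQ_unique[OF lim this] show ?thesis by simp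
  qed
  have bdd: "\<exists>B\<ge>0. \<forall>A\<in>tup k. (\<forall>V\<in>#A. F V \<le> r) \<longrightarrow> \<bar>D A\<bar> \<le> B" if r: "r \<ge> 0" for r
  proof -
    obtain B where B: "\<And>A Y. A \<in> tup k \<Longrightarrow> Y \<in> S \<Longrightarrow> (\<forall>V\<in>#A. F V \<le> r) \<Longrightarrow> F Y \<le> r \<Longrightarrow> \<bar>md A G (H + Y)\<bar> \<le> B"
      using lbd_md[OF G(2), of k r] by blast
    have z: "0 \<in> S" "F 0 = 0" using S F_scale[of 0 0] p by (auto simp: subspace_def)
    have FSA: "FS A \<le> real (size A) * r" if "\<forall>V\<in>#A. F V \<le> r" for A
      using that by (induction A) (auto simp: distrib_right)
    show ?thesis
    proof (intro exI[of _ "\<bar>B\<bar> + C' / (1 - q) * (real k * r)"] conjI ballI impI)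
      fix A assume A: "A \<in> tup k" "\<forall>V\<in>#A. F V \<le> r"
      have "\<bar>md A G H\<bar> \<le> B" using B[OF A(1) z(1) A(2)] z(2) r by simp
      moreover have "C' / (1 - q) * FS A \<le> C' / (1 - q) * (real k * r)"
        using C'(1) q FSA[OF A(2)] A(1) by (intro mult_left_mono) auto
      ultimately show "\<bar>D A\<bar> \<le> \<bar>B\<bar> + C' / (1 - q) * (real k * r)" using approx[OF A(1)] by linarith
    qed (use C'(1) q r in auto)
  qed
  have scale: "D (add_mset (c *\<^sub>R U) A) = c * D (add_mset U A)" if A: "size A + 1 = k" "set_mset A \<subseteq> S" and U: "U \<in> S" for A U c
  proof -
    define r where "r = FS (add_mset U A)"
    have r0: "r \<ge> 0" unfolding r_def by (rule FS_nonneg)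
    obtain B where B: "\<And>A. A \<in> tup k \<Longrightarrow> (\<forall>V\<in>#A. F V \<le> r) \<Longrightarrow> \<bar>D A\<bar> \<le> B" using bdd[OF r0] by blast
    have le: "F V \<le> FS A" if "V \<in># A" for V A
    proof -
      obtain A' where "A = add_mset V A'" using \<open>V \<in># A\<close> by (metis multi_member_split)
      then show ?thesis by simp
    qed
    have "D (add_mset (c *\<^sub>R U) A) = c * D (add_mset (1 *\<^sub>R U) A)"
    proof (rule additive_bounded_linear[where g = "\<lambda>c. D (add_mset (c *\<^sub>R U) A)" and B = B])
      show "D (add_mset ((x + y) *\<^sub>R U) A) = D (add_mset (x *\<^sub>R U) A) + D (add_mset (y *\<^sub>R U) A)" for x y
        unfolding scaleR_add_left by (rule add) (use A S_scale[OF U] in auto)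
      fix x :: real assume x: "\<bar>x\<bar> \<le> 1"
      have "\<bar>x\<bar> powr p \<le> 1 powr p" using x p by (intro powr_mono2) auto
      then have "F (x *\<^sub>R U) \<le> F U" using F_nonneg[of U] unfolding F_scale[OF U] by (intro mult_left_le_one_le) auto
      also have "... \<le> r" by (simp add: r_def)
      finally have "F (x *\<^sub>R U) \<le> r" .
      moreover have "F V \<le> r" if "V \<in># A" for V using le[OF that] F_nonneg[of U] by (simp add: r_def)
      ultimately show "\<bar>D (add_mset (x *\<^sub>R U) A)\<bar> \<le> B"
        using A S_scale[OF U] by (intro B) auto
    qed
    then show ?thesis by simp
  qed
  obtain B where B: "B \<ge> 0" "\<And>A. A \<in> tup k \<Longrightarrow> (\<forall>V\<in>#A. F V \<le> 1) \<Longrightarrow> \<bar>D A\<bar> \<le> B" using bdd[of 1] by auto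
  \<comment> \<open>The bound on the unit ball becomes a product bound by normalizing one argument
    after the other: \<open>A\<close> holds the arguments yet to be normalized, \<open>A'\<close>
    those with F at most 1.\<close>
  have prodbd: "\<bar>D (A + A')\<bar> \<le> B * (\<Prod>V\<in>#A. F V powr (1 / p))" if "A + A' \<in> tup k" "\<forall>V\<in>#A'. F V \<le> 1" for A A'
    using that
  proof (induction A arbitrary: A')
    case empty
    then show ?case using B(2)[of A'] by simp
  next
    case (add U A)
    have U: "U \<in> S" and sz: "size (A + A') + 1 = k" "set_mset (A + A') \<subseteq> S" using add.prems by auto
    define P where "P = (\<Prod>V\<in>#A. F V powr (1 / p))"
    have le: "\<bar>c\<bar> * \<bar>D (add_mset U (A + A'))\<bar> \<le> B * P" if c: "F (c *\<^sub>R U) \<le> 1" for c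
    proof -
      have "\<bar>D (A + add_mset (c *\<^sub>R U) A')\<bar> \<le> B * P"
        unfolding P_def by (rule add.IH) (use add.prems c S_scale[OF U] in auto)
      then show ?thesis using scale[OF sz U, of c] by (simp add: abs_mult)
    qed
    have "\<bar>D (add_mset U (A + A'))\<bar> \<le> F U powr (1 / p) * (B * P)"
    proof (cases "F U = 0")
      case True
      have "D (add_mset U (A + A')) = 0"
      proof (rule ccontr)
        assume nz: "D (add_mset U (A + A')) \<noteq> 0"
        \<comment> \<open>All multiples of \<open>U\<close> have F = 0, so a multiple large enough
          to violate the bound is admissible.\<close>
        have "\<bar>(\<bar>B * P\<bar> + 1) / D (add_mset U (A + A'))\<bar> * \<bar>D (add_mset U (A + A'))\<bar> \<le> B * P"
          by (rule le) (simp add: F_scale[OF U] True)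
        then show False using nz by (simp flip: abs_mult)
      qed
      then show ?thesis by (simp add: True)
    next
      case False
      then have FU: "F U > 0" using F_nonneg[of U] by simp
      define c where "c = 1 / F U powr (1 / p)"
      have "F (c *\<^sub>R U) = 1" using FU p by (simp add: F_scale[OF U] c_def powr_divide powr_powr)
      from le[of c] this have "\<bar>c\<bar> * \<bar>D (add_mset U (A + A'))\<bar> \<le> B * P" by simp
      then show ?thesis using FU by (simp add: c_def field_simps)
    qed
    then show ?case by (simp add: P_def mult_ac)
  qed
  have "form k D"
    unfolding form_def
  proof (intro conjI allI impI exI[of _ B] ballI)
    fix A assume "A \<in> tup k"
    then show "\<bar>D A\<bar> \<le> B * (\<Prod>V\<in>#A. F V powr (1 / p))" using prodbd[of A "{#}"] by simp
  qed (use add scale B in auto)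
  moreover have "C' / (1 - q) \<ge> 0" using C'(1) q by simp
  ultimately show ?thesis using approx by blast
qed

text \<open>By \<open>md_form\<close> the subtracted polynomial contributes exactly \<open>D\<close>
  to the mixed difference of order k and nothing to higher orders; the factor 1 / k! is that of
  Taylor's formula.\<close>

lemma small_reduce:
  assumes k: "k \<ge> 1" and H: "H \<in> S" and G: "small k G H" "lbd G H" and D: "form k D"
    and C: "C \<ge> 0" "\<And>A. A \<in> tup k \<Longrightarrow> \<bar>md A G H - D A\<bar> \<le> C * FS A"
  defines "G' \<equiv> \<lambda>X. G X - 1 / fact k * D (replicate_mset k (X - H))"
  shows "small (k - 1) G' H" "lbd G' H"
proof -
  have z: "0 \<in> S" using S by (simp add: subspace_def)
  have md': "md A G' H = md A G H - (if size A = k then D A else 0)" if "set_mset A \<subseteq> S" "k \<le> size A" for A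
    unfolding G'_def md_diff md_cmult md_shift[of A "\<lambda>X. D (replicate_mset k X)"]
    using md_form[OF D, of k "{#}" A 0] that z by simp
  show "small (k - 1) G' H"
    unfolding small_def
  proof (intro allI impI)
    fix j assume j: "j > k - 1"
    show "\<exists>C\<ge>0. \<forall>A\<in>tup j. \<bar>md A G' H\<bar> \<le> C * FS A"
    proof (cases "j = k")
      case True
      then show ?thesis using C md' by (intro exI[of _ C]) auto
    next
      case False
      then have "j > k" using j k by auto
      then obtain C2 where "C2 \<ge> 0" "\<forall>A\<in>tup j. \<bar>md A G H\<bar> \<le> C2 * FS A" using G(1) unfolding small_def by blast
      then show ?thesis using md' False \<open>j > k\<close> by (intro exI[of _ C2]) auto
    qed
  qed
  obtain C3 where C3: "C3 \<ge> 0" "\<And>V. V \<in> S \<Longrightarrow> \<bar>D (replicate_mset k V)\<bar> \<le> C3 * (F V powr (1 / p)) ^ k"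
    using form_powr_bound[OF D] by blast
  show "lbd G' H"
    unfolding lbd_def
  proof
    fix r
    obtain B where B: "\<And>V. V \<in> S \<Longrightarrow> F V \<le> r \<Longrightarrow> \<bar>G (H + V)\<bar> \<le> B" using G(2) unfolding lbd_def by blast
    show "\<exists>B. \<forall>V\<in>S. F V \<le> r \<longrightarrow> \<bar>G' (H + V)\<bar> \<le> B"
    proof (intro exI[of _ "B + 1 / fact k * (C3 * (r powr (1 / p)) ^ k)"] ballI impI)
      fix V assume V: "V \<in> S" "F V \<le> r"
      have "\<bar>D (replicate_mset k V)\<bar> \<le> C3 * (F V powr (1 / p)) ^ k" by (rule C3(2)[OF V(1)])
      also have "... \<le> C3 * (r powr (1 / p)) ^ k"
        by (intro mult_left_mono power_mono powr_mono2) (use V p F_nonneg C3 in auto)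
      finally have "\<bar>1 / fact k * D (replicate_mset k V)\<bar> \<le> 1 / fact k * (C3 * (r powr (1 / p)) ^ k)"
        unfolding abs_mult by (intro mult_mono) auto
      then show "\<bar>G' (H + V)\<bar> \<le> B + 1 / fact k * (C3 * (r powr (1 / p)) ^ k)"
        using B[OF V] unfolding G'_def add_diff_cancel_left' by linarith
    qed
  qed
qed

lemma form_cmult:
  assumes "form k D"
  shows "form k (\<lambda>A. c * D A)"
proof -
  obtain C where "C \<ge> 0" "\<And>A. A \<in> tup k \<Longrightarrow> \<bar>D A\<bar> \<le> C * (\<Prod>V\<in>#A. F V powr (1 / p))"
    using assms unfolding form_def by blast
  then have "\<exists>C\<ge>0. \<forall>A\<in>tup k. \<bar>c * D A\<bar> \<le> C * (\<Prod>V\<in>#A. F V powr (1 / p))"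
    by (intro exI[of _ "\<bar>c\<bar> * C"]) (auto simp: abs_mult mult.assoc intro!: mult_left_mono)
  then show ?thesis using assms unfolding form_def by (auto simp: distrib_left)
qed

lemma taylor_forms:
  assumes H: "H \<in> S" and k: "real k < p" and G: "small k G H" "lbd G H"
  shows "\<exists>D C. (\<forall>i\<in>{1..k}. form i (D i)) \<and>
    (\<forall>V\<in>S. \<bar>G (H + V) - G H - (\<Sum>i=1..k. D i (replicate_mset i V))\<bar> \<le> C * F V)"
  using k G
proof (induction k arbitrary: G)
  case 0
  obtain C where C: "\<forall>A\<in>tup 1. \<bar>md A G H\<bar> \<le> C * FS A" using 0(2)[unfolded small_def, rule_format, of 1] by auto
  have "\<bar>G (H + V) - G H\<bar> \<le> C * F V" if "V \<in> S" for V
    using bspec[OF C, of "{#V#}"] that by (simp add: md_add_mset')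
  then show ?case by auto
next
  case (Suc k)
  have "1 \<le> Suc k" by simp
  from top_form[OF this Suc.prems(1) H Suc.prems(2,3)] obtain D C where D: "form (Suc k) D"
    and C: "C \<ge> 0" "\<And>A. A \<in> tup (Suc k) \<Longrightarrow> \<bar>md A G H - D A\<bar> \<le> C * FS A"
    by blast
  define G' where "G' = (\<lambda>X. G X - 1 / fact (Suc k) * D (replicate_mset (Suc k) (X - H)))"
  have G': "small k G' H" "lbd G' H"
    using small_reduce[OF _ H Suc.prems(2,3) D C] by (auto simp: G'_def)
  have "real k < p" using Suc.prems(1) by simp
  from Suc.IH[OF this G'] obtain E C2 where E: "\<And>i. i \<in> {1..k} \<Longrightarrow> form i (E i)"
    "\<And>V. V \<in> S \<Longrightarrow> \<bar>G' (H + V) - G' H - (\<Sum>i=1..k. E i (replicate_mset i V))\<bar> \<le> C2 * F V"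
    by blast
  define D' where "D' = E(Suc k := (\<lambda>A. 1 / fact (Suc k) * D A))"
  obtain C3 where C3: "\<And>V. V \<in> S \<Longrightarrow> \<bar>D (replicate_mset (Suc k) V)\<bar> \<le> C3 * (F V powr (1 / p)) ^ Suc k"
    using form_powr_bound[OF D] by blast
  have z: "0 \<in> S" "F 0 = 0" using S F_scale[of 0 0] p by (auto simp: subspace_def)
  then have D0: "D (replicate_mset (Suc k) 0) = 0" using C3[of 0] by simp
  show ?case
  proof (intro exI[of _ D'] exI[of _ C2] conjI ballI)
    fix i assume "i \<in> {1..Suc k}"
    then show "form i (D' i)"
      using E(1)[of i] form_cmult[OF D, of "1 / fact (Suc k)"] by (auto simp: D'_def le_Suc_eq simp del: fact_Suc)
  next
    fix V assume V: "V \<in> S"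
    have "(\<Sum>i=1..Suc k. D' i (replicate_mset i V)) = (\<Sum>i=1..k. E i (replicate_mset i V)) + 1 / fact (Suc k) * D (replicate_mset (Suc k) V)"
      by (simp add: D'_def)
    then show "\<bar>G (H + V) - G H - (\<Sum>i=1..Suc k. D' i (replicate_mset i V))\<bar> \<le> C2 * F V"
      using E(2)[OF V] unfolding G'_def by (simp add: D0 del: replicate_mset_Suc fact_Suc)
  qed
qed

text \<open>\<open>md_eq_difn\<close> expresses a mixed difference by ordinary ones with combined
  increments at shifted base points, which is where uniformity in \<open>X\<close> is used. Orders
  above \<open>M\<close> are differences of those already bounded.\<close>

lemma small_of_difn:
  assumes M: "M \<ge> 1" and C: "C \<ge> 0" "\<And>X V. X \<in> S \<Longrightarrow> V \<in> S \<Longrightarrow> \<bar>difn M V F X\<bar> \<le> C * F V" and H: "H \<in> S"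
  shows "small (M - 1) F H"
proof -
  let ?a = "\<lambda>h E. \<Sum>j\<in>E. (- 1 / real j) *\<^sub>R h j"
  have M_case: "\<exists>C'\<ge>0. \<forall>A\<in>tup M. \<forall>X\<in>S. \<bar>md A F X\<bar> \<le> C' * FS A"
  proof -
    have FE: "\<exists>c\<ge>0. \<forall>h. (\<forall>j\<in>E. h j \<in> S) \<longrightarrow> F (?a h E) \<le> c * (\<Sum>j\<in>E. F (h j))" if "finite E" "0 \<notin> E" for E :: "nat set"
      using that
    proof (induction E rule: finite_induct)
      case empty
      have "F 0 = 0" using S F_scale[of 0 0] p by (auto simp: subspace_def)
      then show ?case by auto
    next
      case (insert i E)
      then obtain c where c: "c \<ge> 0" "\<And>h. (\<forall>j\<in>E. h j \<in> S) \<Longrightarrow> F (?a h E) \<le> c * (\<Sum>j\<in>E. F (h j))"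
        by auto
      show ?case
      proof (intro exI[of _ "2 powr p * (1 + c)"] conjI allI impI)
        fix h assume h: "\<forall>j\<in>insert i E. h j \<in> S"
        have i1: "1 \<le> real i" using insert.prems by (cases i) auto
        have "F ((- 1 / real i) *\<^sub>R h i + (?a h E))
            \<le> 2 powr p * (F ((- 1 / real i) *\<^sub>R h i) + F (?a h E))"
          by (intro F_add S_scale subspace_sum[OF S]) (use h in auto)
        also have "... \<le> 2 powr p * (F (h i) + c * (\<Sum>j\<in>E. F (h j)))"
        proof (intro mult_left_mono add_mono)
          have "\<bar>- 1 / real i\<bar> powr p \<le> 1 powr p" using i1 p by (intro powr_mono2) auto
          then show "F ((- 1 / real i) *\<^sub>R h i) \<le> F (h i)"
            using F_nonneg[of "h i"] h by (subst F_scale) (auto intro!: mult_left_le_one_le)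
          show "F (?a h E) \<le> c * (\<Sum>j\<in>E. F (h j))" using c(2) h by auto
        qed auto
        also have "... \<le> 2 powr p * ((1 + c) * (F (h i) + (\<Sum>j\<in>E. F (h j))))"
          using c(1) F_nonneg[of "h i"] sum_nonneg[of E "\<lambda>j. F (h j)"] F_nonneg
          by (intro mult_left_mono) (auto simp: algebra_simps)
        finally show "F (\<Sum>j\<in>insert i E. (- 1 / real j) *\<^sub>R h j) \<le> 2 powr p * (1 + c) * (\<Sum>j\<in>insert i E. F (h j))"
          using insert.hyps by (simp add: mult.assoc)
      qed (use c(1) in auto)
    qed
    define c where "c = (\<lambda>E::nat set. SOME c. 0 \<le> c \<and> (\<forall>h. (\<forall>j\<in>E. h j \<in> S) \<longrightarrow> F (?a h E) \<le> c * (\<Sum>j\<in>E. F (h j))))"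
    have c: "0 \<le> c E" "\<And>h. (\<forall>j\<in>E. h j \<in> S) \<Longrightarrow> F (?a h E) \<le> c E * (\<Sum>j\<in>E. F (h j))" if "E \<subseteq> {1..M}" for E
    proof -
      have "finite E" "0 \<notin> E" using that finite_subset by auto
      from someI_ex[OF FE[OF this]] show "0 \<le> c E"
        "\<And>h. (\<forall>j\<in>E. h j \<in> S) \<Longrightarrow> F (?a h E) \<le> c E * (\<Sum>j\<in>E. F (h j))"
        unfolding c_def by blast+
    qed
    show ?thesis
    proof (intro exI[of _ "\<Sum>E\<in>Pow {1..M}. C * c E"] conjI ballI)
      show "0 \<le> (\<Sum>E\<in>Pow {1..M}. C * c E)" using C(1) c(1) by (intro sum_nonneg) auto
      fix A X assume A: "A \<in> tup M" and X: "X \<in> S"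
      obtain xs where xs: "mset xs = A" using ex_mset by blast
      have len: "length xs = M" using A xs by auto
      define h where "h = (\<lambda>j. xs ! (j - 1))"
      have Ah: "A = image_mset h (mset_set {1..M})"
      proof -
        have "A = mset (map ((!) xs) [0..<M])" unfolding len[symmetric] map_nth by (rule xs[symmetric])
        also have "... = image_mset (\<lambda>j. xs ! j) (mset_set {0..<M})" by (simp only: mset_map mset_upt)
        also have "... = image_mset h (image_mset Suc (mset_set {0..<M}))"
          by (simp add: image_mset.compositionality o_def h_def)
        also have "image_mset Suc (mset_set {0..<M}) = mset_set {1..M}"
          by (subst image_mset_mset_set) (simp_all add: image_Suc_atLeastLessThan atLeastLessThanSuc_atLeastAtMost)
        finally show ?thesis by simp
      qed
      have hS: "h j \<in> S" if "j \<in> {1..M}" for j using A that unfolding Ah by auto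
      have FSA: "FS A = (\<Sum>j\<in>{1..M}. F (h j))" unfolding Ah FS_def by (simp add: image_mset.compositionality o_def sum_unfold_sum_mset)
      have "\<bar>md A F X\<bar> \<le> (\<Sum>E\<in>Pow {1..M}. \<bar>(-1) ^ card E * difn M (?a h E) F (X + sum h E)\<bar>)"
        unfolding Ah md_eq_difn by (rule sum_abs)
      also have "... \<le> (\<Sum>E\<in>Pow {1..M}. C * c E * FS A)"
      proof (rule sum_mono)
        fix E assume "E \<in> Pow {1..M}"
        then have E: "E \<subseteq> {1..M}" by simp
        have hE: "\<forall>j\<in>E. h j \<in> S" using hS E by auto
        have "\<bar>(-1) ^ card E * difn M (?a h E) F (X + sum h E)\<bar>
            = \<bar>difn M (?a h E) F (X + sum h E)\<bar>" by (simp add: abs_mult)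
        also have "... \<le> C * F (?a h E)"
          by (intro C(2) S_add X subspace_sum[OF S] S_scale) (use hE in auto)
        also have "... \<le> C * (c E * (\<Sum>j\<in>E. F (h j)))" by (intro mult_left_mono c(2)[OF E hE] C(1))
        also have "... \<le> C * (c E * FS A)"
          unfolding FSA by (intro mult_left_mono sum_mono2 E F_nonneg C(1) c(1)) auto
        finally show "\<bar>(-1) ^ card E * difn M (?a h E) F (X + sum h E)\<bar> \<le> C * c E * FS A"
          by (simp add: mult.assoc)
      qed
      also have "... = (\<Sum>E\<in>Pow {1..M}. C * c E) * FS A" by (rule sum_distrib_right[symmetric])
      finally show "\<bar>md A F X\<bar> \<le> (\<Sum>E\<in>Pow {1..M}. C * c E) * FS A" .
    qed
  qed
  have all: "\<exists>C'\<ge>0. \<forall>A\<in>tup (M + i). \<forall>X\<in>S. \<bar>md A F X\<bar> \<le> C' * FS A" for i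
  proof (induction i)
    case (Suc i)
    then obtain C' where C': "C' \<ge> 0" "\<And>A X. A \<in> tup (M + i) \<Longrightarrow> X \<in> S \<Longrightarrow> \<bar>md A F X\<bar> \<le> C' * FS A" by blast
    show ?case
    proof (intro exI[of _ "2 * C'"] conjI ballI)
      fix A X assume A: "A \<in> tup (M + Suc i)" and X: "X \<in> S"
      obtain V A' where A': "A = add_mset V A'" using A by (metis (mono_tags, lifting) add_Suc_right mem_Collect_eq size_eq_Suc_imp_eq_union)
      have V: "V \<in> S" "A' \<in> tup (M + i)" using A by (auto simp: A')
      have "C' * FS A' \<le> C' * FS A" using C'(1) F_nonneg by (intro mult_left_mono) (auto simp: A')
      then show "\<bar>md A F X\<bar> \<le> 2 * C' * FS A"
        using C'(2)[OF V(2) X] C'(2)[OF V(2) S_add[OF X V(1)]] unfolding A' md_add_mset' by (simp add: abs_le_iff)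
    qed (use C'(1) in simp)
  qed (use M_case in simp)
  show ?thesis
    unfolding small_def
  proof (intro allI impI)
    fix j assume "M - 1 < j"
    then obtain i where "j = M + i" using M le_Suc_ex[of M j] by (metis One_nat_def Suc_pred less_eq_Suc_le)
    with all[of i] H show "\<exists>C\<ge>0. \<forall>A\<in>tup j. \<bar>md A F H\<bar> \<le> C * FS A" by blast
  qed
qed

lemma lbd_F: "H \<in> S \<Longrightarrow> lbd F H"
  unfolding lbd_def
proof
  fix r assume H: "H \<in> S"
  show "\<exists>B. \<forall>V\<in>S. F V \<le> r \<longrightarrow> \<bar>F (H + V)\<bar> \<le> B"
  proof (intro exI[of _ "2 powr p * (F H + r)"] ballI impI)
    fix V assume V: "V \<in> S" "F V \<le> r"
    have "F (H + V) \<le> 2 powr p * (F H + F V)" by (rule F_add[OF H V(1)])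
    also have "... \<le> 2 powr p * (F H + r)" using V by simp
    finally show "\<bar>F (H + V)\<bar> \<le> 2 powr p * (F H + r)" using F_nonneg by simp
  qed
qed

theorem taylor:
  assumes "real m < p" and "C \<ge> 0" "\<And>X V. X \<in> S \<Longrightarrow> V \<in> S \<Longrightarrow> \<bar>difn (m + 1) V F X\<bar> \<le> C * F V" and "H \<in> S"
  shows "\<exists>D C. (\<forall>i\<in>{1..m}. form i (D i)) \<and>
    (\<forall>V\<in>S. \<bar>F (H + V) - F H - (\<Sum>i=1..m. D i (replicate_mset i V))\<bar> \<le> C * F V)"
  using taylor_forms[OF assms(4,1) _ lbd_F[OF assms(4)]] small_of_difn[of "m + 1" C H] assms by simp

end

subsection \<open>Reduction to self-adjoint operators of finite rank\<close>

instantiation prod :: (complex_hilbert_space, complex_hilbert_space) complex_hilbert_space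
begin

definition scaleC_prod :: "complex \<Rightarrow> 'a \<times> 'b \<Rightarrow> 'a \<times> 'b"
  where "scaleC_prod c z = (scaleC c (fst z), scaleC c (snd z))"

definition cinner_prod :: "'a \<times> 'b \<Rightarrow> 'a \<times> 'b \<Rightarrow> complex"
  where "cinner_prod z w = cinner (fst z) (fst w) + cinner (snd z) (snd w)"

instance
proof
  fix x y :: "'a \<times> 'b"
  show "cinner x y = cnj (cinner y x)"
    by (simp add: cinner_prod_def flip: cinner_commute)
qed (auto simp: scaleC_prod_def cinner_prod_def scaleC_add_right scaleC_add_left scaleC_scaleC scaleC_of_real
    cinner_add_left cinner_scaleC_left Re_cinner inner_prod_def distrib_left prod_eq_iff)

end

text \<open>The block operator with \<open>X\<close> and \<open>adj X\<close> off the diagonal. It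
  is self-adjoint for every finite-rank \<open>X\<close> and additive in \<open>X\<close>, which is
  all that differences require.\<close>

definition dil :: "'a::complex_hilbert_space cop \<Rightarrow> ('a \<times> 'a) cop"
  where "dil X = Cop (Blinfun (\<lambda>z. (ap X (snd z), ap (adj X) (fst z))))"

lemma ap_dil: "ap (dil X) z = (ap X (snd z), ap (adj X) (fst z))"
proof -
  have bl: "bounded_linear (\<lambda>z. (ap X (snd z), ap (adj X) (fst z)))"
    by (intro bounded_linear_Pair bounded_linear_compose[OF blinfun.bounded_linear_right] bounded_linear_fst bounded_linear_snd)
  have "clinear_op (Blinfun (\<lambda>z. (ap X (snd z), ap (adj X) (fst z))))"
    using clinear_bl unfolding clinear_op_def bounded_linear_Blinfun_apply[OF bl] by (simp add: scaleC_prod_def clinear_op_def)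
  then show ?thesis unfolding dil_def by (simp add: Cop_inverse bounded_linear_Blinfun_apply[OF bl])
qed

lemma dil_add: "dil (X + Y) = dil X + dil Y" and dil_scaleR: "dil (r *\<^sub>R X) = r *\<^sub>R dil X" and dil_zero: "dil 0 = 0"
  by (rule cop_eqI; simp add: ap_dil adj_simps zero_prod_def)+

lemma dil_sum: "dil (\<Sum>i\<in>I. X i) = (\<Sum>i\<in>I. dil (X i))"
  by (induction I rule: infinite_finite_induct) (simp_all add: dil_add dil_zero)

lemma dil_rk: "dil (rk u v) = rk (u, 0) (0, v) + rk (0, v) (u, 0)"
  by (rule cop_eqI) (simp add: ap_dil adj_simps scaleC_prod_def cinner_prod_def zero_prod_def)

lemma sa_dil: "fr X \<Longrightarrow> sa (dil X)"
  unfolding sa_def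
proof
  assume "fr X"
  then obtain n u v where X: "X = (\<Sum>i<n::nat. rk (u i) (v i))" by (auto simp: fr_def)
  show "fr (dil X)" unfolding X dil_sum dil_rk by (intro fr_sum fr_add fr_rk)
  show "adj (dil X) = dil X"
    by (rule adj_eqI) (simp add: ap_dil cinner_prod_def cinner_adj cinner_adj_left)
qed

text \<open>Every singular value occurs twice. The factor 2 appears on both sides of the estimate
  for differences and cancels.\<close>

lemma spw_dil:
  assumes "fr X" "p > 0"
  shows "spw p (dil X) = 2 * spw p X"
proof -
  obtain n s u v where svd: "svd n s u v X" by (rule svd_exists[OF assms(1)])
  then have on: "on_fam {..<n} u" "on_fam {..<n} v" and s: "\<And>i. 0 \<le> s i" and X: "X = (\<Sum>i<n. s i *\<^sub>R rk (u i) (v i))"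
    by (auto simp: svd_def)
  let ?I = "{..<n} \<times> (UNIV :: bool set)"
  let ?u = "\<lambda>(i, b). if b then (u i, 0) else (0, v i)" and ?v = "\<lambda>(i, b). if b then (0, v i) else (u i, 0)"
  have "spw p (dil X) = (\<Sum>i\<in>?I. s (fst i) powr p)"
  proof (rule spw_on_fam(2))
    show "on_fam ?I ?u" "on_fam ?I ?v" using on by (auto simp: on_fam_def cinner_prod_def)
    show "dil X = (\<Sum>i\<in>?I. s (fst i) *\<^sub>R rk (?u i) (?v i))"
      unfolding X dil_sum dil_scaleR dil_rk by (simp add: sum.cartesian_product' UNIV_bool scaleR_add_right add.commute)
  qed (use s assms in auto)
  also have "... = 2 * (\<Sum>i<n. s i powr p)"
    by (simp add: sum.cartesian_product' UNIV_bool sum_distrib_left)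
  also have "(\<Sum>i<n. s i powr p) = spw p X"
    using spw_on_fam(2)[OF on _ _ X assms(2)] s by simp
  finally show ?thesis .
qed

lemma difn_compose_additive:
  assumes "\<And>X Y. g (X + Y) = g X + g Y"
  shows "difn k V (\<lambda>X. f (g X)) X = difn k (g V) f (g X)"
  by (induction k arbitrary: X) (simp_all add: dif_def assms)

lemma difn_spw_fr:
  assumes p: "1 < p" "real m < p" "p \<le> real m + 1"
  shows "\<exists>C\<ge>0. \<forall>V X::'a::complex_hilbert_space cop. fr V \<longrightarrow> fr X \<longrightarrow> \<bar>difn (m + 1) V (spw p) X\<bar> \<le> C * spw p V"
proof -
  obtain C where C: "C \<ge> 0" "\<And>V X :: ('a \<times> 'a) cop. sa V \<Longrightarrow> sa X \<Longrightarrow> \<bar>difn (m + 1) V (spw p) X\<bar> \<le> C * spw p V"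
    using difn_spw_bound[OF p, where ?'a = "'a \<times> 'a"] by blast
  show ?thesis
  proof (intro exI[of _ C] conjI allI impI C(1))
    fix V X :: "'a cop" assume V: "fr V" and X: "fr X"
    have "difn (m + 1) (dil V) (spw p) (dil X) = difn (m + 1) V (\<lambda>X. spw p (dil X)) X"
      by (rule difn_compose_additive[symmetric]) (rule dil_add)
    also have "... = difn (m + 1) V (\<lambda>X. 2 * spw p X) X"
      by (rule difn_cong_on[where S = "{X. fr X}"]) (use V X spw_dil[OF _ less_trans[OF zero_less_one p(1)]] in auto)
    also have "... = 2 * difn (m + 1) V (spw p) X"
      by (rule difn_linear[where g = "\<lambda>r. 2 * r"]) simp
    finally show "\<bar>difn (m + 1) V (spw p) X\<bar> \<le> C * spw p V"
      using C(2)[OF sa_dil[OF V] sa_dil[OF X]] p by (simp add: spw_dil[OF V])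
  qed
qed

text \<open>Finitely many vectors of a singular basis and their images suffice as \<open>W\<close>:
  every projection fixing them recovers the value up to \<epsilon>. Stated in this way, several
  operators can be served by a single projection.\<close>

lemma spow_compress_ge:
  fixes Y :: "'a::complex_hilbert_space \<Rightarrow>\<^sub>L 'a"
  assumes Y: "Y \<in> schatten p" and p: "p \<ge> 1" and \<epsilon>: "\<epsilon> > 0"
  obtains W where "finite W" "\<And>B. onset B \<Longrightarrow> finite B \<Longrightarrow> (\<And>w. w \<in> W \<Longrightarrow> ap (proj B) w = w) \<Longrightarrow>
    spow p Y - \<epsilon> \<le> spow p (bl (proj B) o\<^sub>L Y o\<^sub>L bl (proj B))"
proof -
  note wit = that
  have Yc: "compact_op Y" using Y by (simp add: schatten_def)
  have Yl: "clinear_op Y" using Yc by (simp add: compact_op_def)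
  obtain E where E: "sing_basis Y E" using sing_basis_exists[OF Yc] by blast
  have on: "onset E" using E orthonormal_basis_onset by (auto simp: sing_basis_def)
  have "(\<Sum>e\<in>F. norm (Y e) powr p) > spow p Y - \<epsilon> \<Longrightarrow> thesis" if F: "finite F" "F \<subseteq> E" for F
  proof -
    assume big: "(\<Sum>e\<in>F. norm (Y e) powr p) > spow p Y - \<epsilon>"
    define F' where "F' = {e \<in> F. Y e \<noteq> 0}"
    have F': "finite F'" "F' \<subseteq> E" using F by (auto simp: F'_def)
    define u where "u = (\<lambda>e. (1 / norm (Y e)) *\<^sub>R Y e)"
    have onF: "on_fam F' (\<lambda>e. e)" unfolding on_fam_def by (intro ballI onset_cinner[OF on] subsetD[OF F'(2)])
    have onu: "on_fam F' u"
      unfolding on_fam_def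
    proof (intro ballI)
      fix e f assume ef: "e \<in> F'" "f \<in> F'"
      then show "cinner (u e) (u f) = (if e = f then 1 else 0)"
        using sing_basis_orthogonal[OF Yl E subsetD[OF F'(2) ef(1)] subsetD[OF F'(2) ef(2)]] unfolding u_def
        by (auto simp: cinner_scaleR_left cinner_scaleR_right F'_def power2_eq_square)
    qed
    show thesis
    proof (rule wit[of "F \<union> Y ` F"])
      fix B assume B: "onset B" "finite B" "\<And>w. w \<in> F \<union> Y ` F \<Longrightarrow> ap (proj B) w = w"
      let ?Z = "bl (proj B) o\<^sub>L Y o\<^sub>L bl (proj B)"
      have c: "cmod (cinner (?Z e) (u e)) = norm (Y e)" if e: "e \<in> F'" for e
      proof -
        have Pe: "ap (proj B) e = e" "ap (proj B) (Y e) = Y e" using B(3) e by (auto simp: F'_def)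
        have "cinner (Y e) (Y e) = of_real ((norm (Y e))\<^sup>2)" by (rule cinner_self)
        then show ?thesis
          using e by (simp add: Pe u_def cinner_scaleR_right F'_def norm_mult norm_power power2_eq_square)
      qed
      have "(\<Sum>e\<in>F. norm (Y e) powr p) = (\<Sum>e\<in>F'. norm (Y e) powr p)"
        unfolding F'_def by (rule sum.mono_neutral_right) (use F in auto)
      also have "... = (\<Sum>e\<in>F'. cmod (cinner (?Z e) (u e)) powr p)" by (intro sum.cong refl) (simp only: c)
      also have "... \<le> spow p ?Z"
        by (rule spow_bessel[OF schatten_ideal(1)[OF Y p clinear_bl clinear_bl] p])
          (intro on_fam_bessel onF onu F')+
      finally show "spow p Y - \<epsilon> \<le> spow p ?Z" using big by simp
    qed (use F in auto)
  qed
  moreover have "\<exists>F. finite F \<and> F \<subseteq> E \<and> (\<Sum>e\<in>F. norm (Y e) powr p) > spow p Y - \<epsilon>"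
  proof -
    have "((\<lambda>e. norm (Y e) powr p) has_sum spow p Y) E" using spow_has_sum[OF Y E] p by simp
    then have "\<forall>\<^sub>F F in finite_subsets_at_top E. (\<Sum>e\<in>F. norm (Y e) powr p) > spow p Y - \<epsilon>"
      unfolding has_sum_def using \<epsilon> by (intro order_tendstoD(1)) auto
    then show ?thesis unfolding eventually_finite_subsets_at_top by blast
  qed
  ultimately show thesis by blast
qed

theorem difn_spow_bound:
  assumes p: "1 < p" "real m < p" "p \<le> real m + 1"
  shows "\<exists>C\<ge>0. \<forall>V\<in>schatten p. \<forall>X\<in>schatten p. \<bar>difn (m + 1) V (spow p) (X :: 'a::complex_hilbert_space \<Rightarrow>\<^sub>L 'a)\<bar> \<le> C * spow p V"
proof -
  obtain C where C: "C \<ge> 0" "\<And>V X :: 'a cop. fr V \<Longrightarrow> fr X \<Longrightarrow> \<bar>difn (m + 1) V (spw p) X\<bar> \<le> C * spw p V"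
    using difn_spw_fr[OF p, where ?'a = 'a] by blast
  define M where "M = m + 1"
  show ?thesis
  proof (intro exI[of _ C] conjI ballI C(1))
    fix V X :: "'a \<Rightarrow>\<^sub>L 'a" assume V: "V \<in> schatten p" and X: "X \<in> schatten p"
    have p1: "p \<ge> 1" and p0: "p > 0" using p by auto
    have cl: "clinear_op Y" if "Y \<in> schatten p" for Y :: "'a \<Rightarrow>\<^sub>L 'a" using that by (simp add: schatten_def compact_op_def)
    \<comment> \<open>A difference of order m + 1 involves only finitely many of these operators, so
      one projection approximates all of them at once.\<close>
    define Y where "Y = (\<lambda>i. X + real i *\<^sub>R V)"
    have Y: "Y i \<in> schatten p" for i unfolding Y_def by (intro schatten_add(1) schatten_scaleR(1) X V p1 p0)
    show "\<bar>difn (m + 1) V (spow p) X\<bar> \<le> C * spow p V"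
    proof (rule field_le_epsilon)
      fix \<epsilon> :: real assume \<epsilon>: "\<epsilon> > 0"
      \<comment> \<open>The binomial coefficients that weight the errors add up to 2^M.\<close>
      define \<eta> where "\<eta> = \<epsilon> / 2 ^ M"
      have \<eta>: "\<eta> > 0" using \<epsilon> by (simp add: \<eta>_def)
      have "\<exists>W. finite W \<and> (\<forall>B. onset B \<longrightarrow> finite B \<longrightarrow> (\<forall>w\<in>W. ap (proj B) w = w) \<longrightarrow>
          spow p (Y i) - \<eta> \<le> spow p (bl (proj B) o\<^sub>L Y i o\<^sub>L bl (proj B)))" for i
        by (rule spow_compress_ge[OF Y[of i] p1 \<eta>]) blast
      then obtain W where W: "\<And>i. finite (W i)" "\<And>i B. onset B \<Longrightarrow> finite B \<Longrightarrow> (\<forall>w\<in>W i. ap (proj B) w = w) \<Longrightarrow>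
          spow p (Y i) - \<eta> \<le> spow p (bl (proj B) o\<^sub>L Y i o\<^sub>L bl (proj B))"
        by metis
      have "finite (\<Union>i\<le>M. W i)" using W(1) by simp
      then obtain B where B: "onset B" "finite B" "\<And>w. w \<in> (\<Union>i\<le>M. W i) \<Longrightarrow> ap (proj B) w = w"
        by (rule gram_schmidt) blast
      define P where "P = proj B"
      have nP: "norm (bl P) \<le> 1" using norm_proj_le[OF B(1,2)] unfolding P_def norm_cop.rep_eq .
      have le: "spow p (bl P o\<^sub>L Z o\<^sub>L bl P) \<le> spow p Z" if Z: "Z \<in> schatten p" for Z
      proof -
        have "spow p (bl P o\<^sub>L Z o\<^sub>L bl P) \<le> (norm (bl P) * norm (bl P)) powr p * spow p Z"
          by (rule schatten_ideal(2)[OF Z p1]) simp_all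
        also have "... \<le> 1 powr p * spow p Z"
          by (intro mult_right_mono powr_mono2 spow_nonneg mult_le_one nP) (use p0 in auto)
        finally show ?thesis by simp
      qed
      define X' V' where "X' = P * Cop X * P" and "V' = P * Cop V * P"
      have fr: "fr X'" "fr V'" by (simp_all add: X'_def V'_def P_def fr_mult_left)
      have bc: "bl (Cop Z) = Z" if "Z \<in> schatten p" for Z :: "'a \<Rightarrow>\<^sub>L 'a" using cl[OF that] by (simp add: Cop_inverse)
      have XV: "bl (X' + real i *\<^sub>R V') = bl P o\<^sub>L Y i o\<^sub>L bl P" for i
      proof -
        have "Cop (Y i) = Cop X + real i *\<^sub>R Cop V"
          by (metis bl_add bl_inverse bl_scaleR bc X V Y_def)
        then have "X' + real i *\<^sub>R V' = P * Cop (Y i) * P"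
          by (simp add: X'_def V'_def distrib_left distrib_right)
        then show ?thesis by (simp add: bl_mult bc[OF Y])
      qed
      have "difn M V (spow p) X - difn M V' (spw p) X'
          = (\<Sum>i\<le>M. (-1) ^ M * (-1) ^ i * real (M choose i) * (spow p (Y i) - spow p (bl P o\<^sub>L Y i o\<^sub>L bl P)))"
        unfolding difn_binomial XV by (simp add: Y_def sum_subtractf right_diff_distrib)
      also have "\<bar>...\<bar> \<le> (\<Sum>i\<le>M. real (M choose i) * \<eta>)"
      proof (rule order_trans[OF sum_abs], rule sum_mono)
        fix i assume "i \<in> {..M}"
        then have "spow p (Y i) - \<eta> \<le> spow p (bl P o\<^sub>L Y i o\<^sub>L bl P)" unfolding P_def using B by (intro W(2)) auto
        then have "\<bar>spow p (Y i) - spow p (bl P o\<^sub>L Y i o\<^sub>L bl P)\<bar> \<le> \<eta>" using le[OF Y[of i]] by linarith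
        then show "\<bar>(-1) ^ M * (-1) ^ i * real (M choose i) * (spow p (Y i) - spow p (bl P o\<^sub>L Y i o\<^sub>L bl P))\<bar> \<le> real (M choose i) * \<eta>"
          unfolding abs_mult power_abs by (simp add: mult_left_mono)
      qed
      also have "... = \<epsilon>"
      proof -
        have "(\<Sum>i\<le>M. real (M choose i)) = 2 ^ M" by (simp only: of_nat_sum[symmetric] choose_row_sum) simp
        then show ?thesis by (simp only: sum_distrib_right[symmetric]) (simp add: \<eta>_def)
      qed
      finally have 1: "\<bar>difn M V (spow p) X - difn M V' (spw p) X'\<bar> \<le> \<epsilon>" .
      have "\<bar>difn M V' (spw p) X'\<bar> \<le> C * spw p V'" unfolding M_def by (rule C(2)[OF fr(2,1)])
      also have "... \<le> C * spow p V"
        using le[OF V] C(1) by (intro mult_left_mono) (simp_all add: V'_def bl_mult bc[OF V])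
      finally show "\<bar>difn (m + 1) V (spow p) X\<bar> \<le> C * spow p V + \<epsilon>" using 1 unfolding M_def by linarith
    qed
  qed
qed

theorem theorem15:
  fixes p :: real and m :: nat and H :: "'a::complex_hilbert_space \<Rightarrow>\<^sub>L 'a"
  assumes "1 < p" and "real m < p" and "p \<le> real m + 1"
    and "H \<in> schatten p" and "schatten_norm p H \<le> 1"
  shows "\<exists>\<delta> :: nat \<Rightarrow> ('a \<Rightarrow>\<^sub>L 'a) list \<Rightarrow> real.
    (\<forall>k\<in>{1..m}. polylinear_form p k (\<delta> k) \<and> symmetric_form p k (\<delta> k) \<and> bounded_form p k (\<delta> k)) \<and>
    (\<lambda>V. schatten_norm p (H + V) powr p - schatten_norm p H powr p
        - (\<Sum>k=1..m. \<delta> k (replicate k V)))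
      \<in> O[schatten_at_0 p](\<lambda>V. schatten_norm p V powr p)"
proof -
  have p: "p \<ge> 1" "p > 0" using assms(1) by auto
  have sub: "subspace (schatten p :: ('a \<Rightarrow>\<^sub>L 'a) set)"
    using schatten_scaleR(1)[OF assms(4) p(2), of 0] schatten_add(1)[OF _ _ p(1)] schatten_scaleR(1)[OF _ p(2)]
    by (auto simp: subspace_def)
  interpret power_functional "schatten p :: ('a \<Rightarrow>\<^sub>L 'a) set" "spow p" p
    by standard (use sub p schatten_scaleR(2)[OF _ p(2)] schatten_add(2)[OF _ _ p(1)] spow_nonneg in auto)
  obtain C where "C \<ge> 0" "\<forall>V\<in>schatten p. \<forall>X\<in>schatten p. \<bar>difn (m + 1) V (spow p) (X :: 'a \<Rightarrow>\<^sub>L 'a)\<bar> \<le> C * spow p V"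
    using difn_spow_bound[OF assms(1-3), where ?'a = 'a] by blast
  then obtain D C where D: "\<And>i. i \<in> {1..m} \<Longrightarrow> form i (D i)"
    and C: "\<And>V. V \<in> schatten p \<Longrightarrow> \<bar>spow p (H + V) - spow p H - (\<Sum>i=1..m. D i (replicate_mset i V))\<bar> \<le> C * spow p V"
    using taylor[OF assms(2) _ _ assms(4), of C] by blast
  \<comment> \<open>Forgetting the order of the list makes symmetry automatic; replacing an entry
    then amounts to adding it to the multiset of the others.\<close>
  define \<delta> where "\<delta> = (\<lambda>k Xs. D k (mset Xs))"
  have "polylinear_form p k (\<delta> k) \<and> symmetric_form p k (\<delta> k) \<and> bounded_form p k (\<delta> k)" if k: "k \<in> {1..m}" for k
  proof (intro conjI)
    note form = D[OF k, unfolded form_def]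
    show "polylinear_form p k (\<delta> k)"
      unfolding polylinear_form_def schatten_tuples_def
    proof (intro ballI allI impI)
      fix Xs :: "('a \<Rightarrow>\<^sub>L 'a) list" and i and X Y :: "'a \<Rightarrow>\<^sub>L 'a" and c :: real
      assume Xs: "Xs \<in> {Xs. length Xs = k \<and> set Xs \<subseteq> schatten p}" and i: "i < k" and XY: "X \<in> schatten p" "Y \<in> schatten p"
      define A where "A = mset Xs - {#Xs ! i#}"
      have u: "\<delta> k (Xs[i := Z]) = D k (add_mset Z A)" for Z using mset_update[of i Xs Z] Xs i by (simp add: \<delta>_def A_def)
      have "size A + 1 = k" using Xs i by (simp add: A_def size_Diff_singleton)
      moreover have "set_mset A \<subseteq> set Xs" unfolding A_def by (metis diff_subset_eq_self set_mset_mono set_mset_mset)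
      then have "set_mset A \<subseteq> schatten p" using Xs by blast
      ultimately show "\<delta> k (Xs[i := X + Y]) = \<delta> k (Xs[i := X]) + \<delta> k (Xs[i := Y]) \<and> \<delta> k (Xs[i := c *\<^sub>R X]) = c * \<delta> k (Xs[i := X])"
        unfolding u using form XY by blast
    qed
    show "symmetric_form p k (\<delta> k)"
      unfolding symmetric_form_def schatten_tuples_def by (auto simp: \<delta>_def)
    obtain B where B: "\<And>A. A \<in> tup k \<Longrightarrow> \<bar>D k A\<bar> \<le> B * (\<Prod>V\<in>#A. spow p V powr (1 / p))" using form by blast
    show "bounded_form p k (\<delta> k)"
      unfolding bounded_form_def
    proof (intro exI[of _ B] ballI)
      fix Xs :: "('a \<Rightarrow>\<^sub>L 'a) list" assume Xs: "Xs \<in> schatten_tuples p k"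
      then have "(\<Prod>V\<in>#mset Xs. spow p V powr (1 / p)) = (\<Prod>i<k. schatten_norm p (Xs ! i))"
        by (auto simp: schatten_tuples_def schatten_norm_spow prod_mset_prod_list prod.list_conv_set_nth atLeast0LessThan simp flip: mset_map)
      then show "\<bar>\<delta> k Xs\<bar> \<le> B * (\<Prod>i<k. schatten_norm p (Xs ! i))"
        using B[of "mset Xs"] Xs by (simp add: \<delta>_def schatten_tuples_def)
    qed
  qed
  moreover have "(\<lambda>V. schatten_norm p (H + V) powr p - schatten_norm p H powr p - (\<Sum>k=1..m. \<delta> k (replicate k V)))
      \<in> O[schatten_at_0 p](\<lambda>V. schatten_norm p V powr p)"
  proof (rule bigoI[where c = C])
    have "\<forall>\<^sub>F V in schatten_at_0 p. V \<in> schatten p"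
      unfolding schatten_at_0_def by (simp add: inf_commute[of "principal _"] eventually_inf_principal)
    then show "\<forall>\<^sub>F V in schatten_at_0 p. norm (schatten_norm p (H + V) powr p - schatten_norm p H powr p - (\<Sum>k=1..m. \<delta> k (replicate k V)))
        \<le> C * norm (schatten_norm p V powr p)"
      by (rule eventually_mono) (use C in \<open>simp add: schatten_norm_powr[OF p] \<delta>_def spow_nonneg\<close>)
  qed
  ultimately show ?thesis by blast
qed

end
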